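(* Let $\Omega\subset\mathbb{R}^n$ be a bounded open set with $C^2$ boundary and let $m_0\in\mathcal{P}(\overline\Omega)$. Let $L:\overline\Omega\times\mathbb{R}^n\to\mathbb{R}$ satisfy: (L1) $L\in C^1(\overline\Omega\times\mathbb{R}^n)$ and there is $C>0$ with $|D_xL(x,v)|\le C(1+|v|^2)$ and $|D_vL(x,v)|\le C(1+|v|)$ for all $(x,v)$; (L2) there are $c_1,c_0>0$ with $L(x,v)\ge c_1|v|^2-c_0$ for all $(x,v)$; (L3) $v\mapsto L(x,v)$ is convex for every $x\in\overline\Omega$. Let $F,G:\overline\Omega\times\mathcal{P}(\overline\Omega)\to\mathbb{R}$ be continuous. Then there exists at least one constrained MFG equilibrium for $m_0$.
   Context: $\mathcal{P}(\overline\Omega)$ is the set of Borel probability measures on $\overline\Omega$ with the Kantorovich–Rubinstein distance $d_1$. $\Gamma=\{\gamma\in AC(0,T;\mathbb{R}^n):\gamma(t)\in\overline\Omega\ \forall t\in[0,T]\}$ with the uniform metric; $\Gamma[x]=\{\gamma\in\Gamma:\gamma(0)=x\}$. $e_t(\gamma)=\gamma(t)$; $\mathcal{P}_{m_0}(\Gamma)$ is the set of Borel probability measures $\eta$ on $\Gamma$ with $e_0\sharp\eta=m_0$; $m^\eta(t)=e_t\sharp\eta$. For $\eta\in\mathcal{P}_{m_0}(\Gamma)$, $J_\eta[\gamma]=\int_0^T[L(\gamma(t),\dot\gamma(t))+F(\gamma(t),m^\eta(t))]dt+G(\gamma(T),m^\eta(T))$, and $\Gamma^\eta[x]=\{\gamma\in\Gamma[x]: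 J_\eta[\gamma]=\min_{\Gamma[x]}J_\eta\}$. A constrained MFG equilibrium for $m_0$ is $\eta\in\mathcal{P}_{m_0}(\Gamma)$ with $\mathrm{supp}(\eta)\subseteq\bigcup_{x\in\overline\Omega}\Gamma^\eta[x]$. *)

theory Defs
  imports "HOL-Probability.Probability"
begin

definition C2_boundary :: "(real^'n) set \<Rightarrow> bool" where
  "C2_boundary \<Omega> \<longleftrightarrow> (\<forall>x0\<in>frontier \<Omega>. \<exists>U psi. \<exists>g :: real^'n \<Rightarrow> real^'n. \<exists>H :: real^'n \<Rightarrow> real^'n^'n.
      open U \<and> x0 \<in> U \<and>
      (\<forall>x\<in>U. (psi has_derivative (\<lambda>h. g x \<bullet> h)) (at x)) \<and>
      (\<forall>x\<in>U. (g has_derivative (\<lambda>h. H x *v h)) (at x)) \<and>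
      continuous_on U H \<and>
      g x0 \<noteq> 0 \<and>
      \<Omega> \<inter> U = {x\<in>U. psi x < (0::real)})"

definition Pmeas :: "(real^'n) set \<Rightarrow> (real^'n) measure set" where
  "Pmeas \<Omega> = {M. sets M = sets (restrict_space borel (closure \<Omega>)) \<and> prob_space M}"

definition d1 :: "(real^'n) measure \<Rightarrow> (real^'n) measure \<Rightarrow> real" where
  "d1 M N = Sup {(\<integral>x. f x \<partial>M) - (\<integral>x. f x \<partial>N) | f :: real^'n \<Rightarrow> real. 1-lipschitz_on UNIV f}"

definition cont_xP :: "(real^'n) set \<Rightarrow> (real^'n \<Rightarrow> (real^'n) measure \<Rightarrow> real) \<Rightarrow> bool" where
  "cont_xP \<Omega> F \<longleftrightarrow> (\<forall>x\<in>closure \<Omega>. \<forall>m\<in>Pmeas \<Omega>. \<forall>\<epsilon>>0. \<exists>\<delta>>0.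
      \<forall>y\<in>closure \<Omega>. \<forall>m'\<in>Pmeas \<Omega>. dist y x < \<delta> \<and> d1 m' m < \<delta> \<longrightarrow> \<bar>F y m' - F x m\<bar> < \<epsilon>)"

definition abs_cont_on :: "real \<Rightarrow> real \<Rightarrow> (real \<Rightarrow> 'a::real_normed_vector) \<Rightarrow> bool" where
  "abs_cont_on a b g \<longleftrightarrow> (\<forall>\<epsilon>>0. \<exists>\<delta>>0. \<forall>(k::nat) (s::nat \<Rightarrow> real) (e::nat \<Rightarrow> real).
      (\<forall>i<k. a \<le> s i \<and> s i \<le> e i \<and> e i \<le> b) \<and>
      (\<forall>i<k. \<forall>j<k. i \<noteq> j \<longrightarrow> e i \<le> s j \<or> e j \<le> s i) \<and>
      (\<Sum>i<k. e i - s i) < \<delta> \<longrightarrow> (\<Sum>i<k. norm (g (e i) - g (s i))) < \<epsilon>)"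

text \<open>The space Gamma. A curve on [0,T] is represented by its constant extension
  t |-> gamma(max 0 (min T t)), a bounded continuous function on the reals; the
  sup-metric of bcontfun is then exactly the uniform metric on [0,T].\<close>
definition Gamma :: "(real^'n) set \<Rightarrow> real \<Rightarrow> (real, real^'n) bcontfun set" where
  "Gamma \<Omega> T = {\<gamma>. (\<forall>t. apply_bcontfun \<gamma> t = apply_bcontfun \<gamma> (max 0 (min T t))) \<and>
      abs_cont_on 0 T (apply_bcontfun \<gamma>) \<and> (\<forall>t\<in>{0..T}. apply_bcontfun \<gamma> t \<in> closure \<Omega>)}"

definition Gamma_at :: "(real^'n) set \<Rightarrow> real \<Rightarrow> real^'n \<Rightarrow> (real, real^'n) bcontfun set" where
  "Gamma_at \<Omega> T x = {\<gamma>\<in>Gamma \<Omega> T. apply_bcontfun \<gamma> 0 = x}"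

definition PGamma :: "(real^'n) set \<Rightarrow> real \<Rightarrow> (real, real^'n) bcontfun measure set" where
  "PGamma \<Omega> T = {\<eta>. sets \<eta> = sets (restrict_space borel (Gamma \<Omega> T)) \<and> prob_space \<eta>}"

definition push_e :: "(real^'n) set \<Rightarrow> real \<Rightarrow> (real, real^'n) bcontfun measure \<Rightarrow> (real^'n) measure" where
  "push_e \<Omega> t \<eta> = distr \<eta> (restrict_space borel (closure \<Omega>)) (\<lambda>\<gamma>. apply_bcontfun \<gamma> t)"

definition PGamma_m0 :: "(real^'n) set \<Rightarrow> real \<Rightarrow> (real^'n) measure \<Rightarrow> (real, real^'n) bcontfun measure set" where
  "PGamma_m0 \<Omega> T m0 = {\<eta>\<in>PGamma \<Omega> T. push_e \<Omega> 0 \<eta> = m0}"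

text \<open>J_eta[gamma] with values in (-infinity, +infinity]: the time integral is +infinity
  when the (bounded below) integrand is not Lebesgue integrable on [0,T].\<close>
definition Jcost :: "(real^'n) set \<Rightarrow> real \<Rightarrow> (real^'n \<Rightarrow> real^'n \<Rightarrow> real)
    \<Rightarrow> (real^'n \<Rightarrow> (real^'n) measure \<Rightarrow> real) \<Rightarrow> (real^'n \<Rightarrow> (real^'n) measure \<Rightarrow> real)
    \<Rightarrow> (real, real^'n) bcontfun measure \<Rightarrow> (real, real^'n) bcontfun \<Rightarrow> ereal" where
  "Jcost \<Omega> T L F G \<eta> \<gamma> =
     (let h = (\<lambda>t. L (apply_bcontfun \<gamma> t) (vector_derivative (apply_bcontfun \<gamma>) (at t))
                  + F (apply_bcontfun \<gamma> t) (push_e \<Omega> t \<eta>))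
      in (if set_integrable lborel {0..T} h then ereal (set_lebesgue_integral lborel {0..T} h) else \<infinity>))
     + ereal (G (apply_bcontfun \<gamma> T) (push_e \<Omega> T \<eta>))"

definition Gamma_opt :: "(real^'n) set \<Rightarrow> real \<Rightarrow> (real^'n \<Rightarrow> real^'n \<Rightarrow> real)
    \<Rightarrow> (real^'n \<Rightarrow> (real^'n) measure \<Rightarrow> real) \<Rightarrow> (real^'n \<Rightarrow> (real^'n) measure \<Rightarrow> real)
    \<Rightarrow> (real, real^'n) bcontfun measure \<Rightarrow> real^'n \<Rightarrow> (real, real^'n) bcontfun set" where
  "Gamma_opt \<Omega> T L F G \<eta> x = {\<gamma>\<in>Gamma_at \<Omega> T x.
      \<forall>\<gamma>'\<in>Gamma_at \<Omega> T x. Jcost \<Omega> T L F G \<eta> \<gamma> \<le> Jcost \<Omega> T L F G \<eta> \<gamma>'}"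

definition msupp :: "'a::topological_space measure \<Rightarrow> 'a set" where
  "msupp \<mu> = {x\<in>space \<mu>. \<forall>U. open U \<and> x \<in> U \<longrightarrow> emeasure \<mu> (U \<inter> space \<mu>) > 0}"

definition constrained_MFG_equilibrium :: "(real^'n) set \<Rightarrow> real \<Rightarrow> (real^'n \<Rightarrow> real^'n \<Rightarrow> real)
    \<Rightarrow> (real^'n \<Rightarrow> (real^'n) measure \<Rightarrow> real) \<Rightarrow> (real^'n \<Rightarrow> (real^'n) measure \<Rightarrow> real)
    \<Rightarrow> (real^'n) measure \<Rightarrow> (real, real^'n) bcontfun measure \<Rightarrow> bool" where
  "constrained_MFG_equilibrium \<Omega> T L F G m0 \<eta> \<longleftrightarrow>
     \<eta> \<in> PGamma_m0 \<Omega> T m0 \<and> msupp \<eta> \<subseteq> (\<Union>x\<in>closure \<Omega>. Gamma_opt \<Omega> T L F G \<eta> x)"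

end

theory Submission imports Defs "HOL-Complex_Analysis.Great_Picard" begin

text \<open>Since \<open>L\<close> is convex and coercive, the action (the integral of \<open>L + c0\<close> along a curve) has compact
  sublevel sets in the uniform metric, and all optimal curves lie in one such set. Restricting to
  finitely many starting points and finitely many curves gives a finite population game, which has an
  approximate equilibrium by Brouwer's theorem. The laws of these equilibria subconverge in the
  Kantorovich--Rubinstein distance to some \<open>\<eta>\<close>.

  Every curve in the support of \<open>\<eta>\<close> is a limit of approximately optimal curves. It is optimal because
  the action is lower semicontinuous and because a competitor can be transferred to nearby starting
  points at little cost: the \<open>C2\<close> boundary allows points of the closed domain to be joined by curves of
  length comparable to their distance, and such a bridge is prepended to the competitor.\<close>

section \<open>Absolutely continuous curves\<close>

text \<open>The natural route is a fixed point of the best-reply correspondence on a set of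
  measures, with set-valued maps on an infinite-dimensional space. Finite games replace it by a
  single-valued continuous map on a cube, at the price of errors that must survive a limit. Two
  obstacles shape that limit. First, the cost is finite only on curves of finite action and the
  action is merely lower semicontinuous, so every strategy set is cut at an action bound
  \<open>M2\<close>, large enough that no competitor above the cut could win, and finite nets must
  control the action as well as the distance. Second, the approximating curves near a curve of the
  support in general start at other points, and the state constraint forbids translating a
  competitor. Since \<open>Jcost\<close> is built from pointwise derivatives of curves that are
  absolutely continuous in the \<epsilon>-\<delta> sense, differentiability almost everywhere, the
  integral formula for increments and measurability of the derivative are settled beforehand. Lower
  semicontinuity is obtained from difference quotients on uniform grids and Fatou's lemma, without
  weak convergence of velocities.\<close>

lemma abs_cont_on_finite_family:
  fixes g :: "real \<Rightarrow> 'a::real_normed_vector"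
  assumes "abs_cont_on a b g" "\<epsilon> > 0"
  shows "\<exists>\<delta>>0. \<forall>(P::'i set) s e. finite P \<longrightarrow> (\<forall>i\<in>P. a \<le> s i \<and> s i \<le> e i \<and> e i \<le> b) \<longrightarrow>
       (\<forall>i\<in>P. \<forall>j\<in>P. i \<noteq> j \<longrightarrow> e i \<le> s j \<or> e j \<le> s i) \<longrightarrow>
       (\<Sum>i\<in>P. e i - s i) < \<delta> \<longrightarrow> (\<Sum>i\<in>P. norm (g (e i) - g (s i))) < \<epsilon>"
proof -
  obtain \<delta> where \<delta>: "\<delta> > 0" and D: "\<forall>(k::nat) (s::nat \<Rightarrow> real) (e::nat \<Rightarrow> real).
      (\<forall>i<k. a \<le> s i \<and> s i \<le> e i \<and> e i \<le> b) \<and>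
      (\<forall>i<k. \<forall>j<k. i \<noteq> j \<longrightarrow> e i \<le> s j \<or> e j \<le> s i) \<and>
      (\<Sum>i<k. e i - s i) < \<delta> \<longrightarrow> (\<Sum>i<k. norm (g (e i) - g (s i))) < \<epsilon>"
    using assms unfolding abs_cont_on_def by blast
  have main: "(\<Sum>i\<in>P. norm (g (e i) - g (s i))) < \<epsilon>"
    if P: "finite P" "\<forall>i\<in>P. a \<le> s i \<and> s i \<le> e i \<and> e i \<le> b"
      "\<forall>i\<in>P. \<forall>j\<in>P. i \<noteq> j \<longrightarrow> e i \<le> s j \<or> e j \<le> s i"
      "(\<Sum>i\<in>P. e i - s i) < \<delta>" for P :: "'i set" and s e
  proof -
    obtain h where h: "bij_betw h {..<card P} P"
      using ex_bij_betw_nat_finite[OF P(1)] by (auto simp: lessThan_atLeast0)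
    have hP: "h i \<in> P" if "i < card P" for i
      using h that by (auto simp: bij_betw_def)
    have hi: "h i \<noteq> h j" if "i < card P" "j < card P" "i \<noteq> j" for i j
      using h that by (auto simp: bij_betw_def inj_on_def)
    have "(\<Sum>i<card P. norm (g (e (h i)) - g (s (h i)))) < \<epsilon>"
      by (rule D[rule_format]) (use P hP hi sum.reindex_bij_betw[OF h, of "\<lambda>i. e i - s i"] in auto)
    then show ?thesis
      using sum.reindex_bij_betw[OF h, of "\<lambda>i. norm (g (e i) - g (s i))"] by simp
  qed
  show ?thesis
    by (intro exI[of _ \<delta>] conjI allI impI \<delta>) (rule main; assumption)
qed

lemma abs_cont_on_imp_continuous_on:
  assumes "abs_cont_on a b (g :: real \<Rightarrow> 'a::real_normed_vector)"
  shows "continuous_on {a..b} g"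
  unfolding continuous_on_iff
proof safe
  fix x e :: real assume x: "x \<in> {a..b}" and e: "e > 0"
  obtain \<delta> where \<delta>: "\<delta> > 0" and D: "\<forall>(P::unit set) s t. finite P \<longrightarrow> (\<forall>i\<in>P. a \<le> s i \<and> s i \<le> t i \<and> t i \<le> b) \<longrightarrow>
       (\<forall>i\<in>P. \<forall>j\<in>P. i \<noteq> j \<longrightarrow> t i \<le> s j \<or> t j \<le> s i) \<longrightarrow>
       (\<Sum>i\<in>P. t i - s i) < \<delta> \<longrightarrow> (\<Sum>i\<in>P. norm (g (t i) - g (s i))) < e"
    using abs_cont_on_finite_family[OF assms e] by blast
  have "dist (g y) (g x) < e" if "y \<in> {a..b}" "dist y x < \<delta>" for y
    using D[rule_format, of UNIV "\<lambda>_. min x y" "\<lambda>_. max x y"] that x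
    by (cases "x \<le> y") (auto simp: dist_norm UNIV_unit norm_minus_commute)
  then show "\<exists>d>0. \<forall>y\<in>{a..b}. dist y x < d \<longrightarrow> dist (g y) (g x) < e"
    using \<delta>(1) by blast
qed

section \<open>Differentiability almost everywhere by Vitali coverings\<close>

lemma sum_disjoint_intervals_le_measure:
  assumes "finite P" and U: "U \<in> lmeasurable"
    and "\<And>i. i \<in> P \<Longrightarrow> u i \<le> v i \<and> {u i<..<v i} \<subseteq> U"
    and "\<And>i j. i \<in> P \<Longrightarrow> j \<in> P \<Longrightarrow> i \<noteq> j \<Longrightarrow> {u i<..<v i::real} \<inter> {u j<..<v j} = {}"
  shows "(\<Sum>i\<in>P. v i - u i) \<le> measure lebesgue U"
proof -
  have "(\<Sum>i\<in>P. v i - u i) = (\<Sum>i\<in>P. measure lebesgue {u i<..<v i})"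
    using assms(3) by (intro sum.cong) auto
  also have "\<dots> = measure lebesgue (\<Union>i\<in>P. {u i<..<v i})"
    by (rule measure_UNION'[symmetric]) (use assms in \<open>auto simp: pairwise_def disjnt_def\<close>)
  also have "\<dots> \<le> measure lebesgue U"
    by (rule measure_mono_fmeasurable) (use assms in auto)
  finally show ?thesis .
qed

text \<open>All endpoints are merged into one grid, on whose cells the two families are compared.\<close>
lemma abs_cont_on_compare_families:
  fixes f :: "real \<Rightarrow> real"
  assumes AC: "abs_cont_on a b f" and \<epsilon>: "\<epsilon> > 0"
  shows "\<exists>\<delta>>0. \<forall>P Q U. finite P \<longrightarrow> finite Q \<longrightarrow> U \<in> lmeasurable \<longrightarrow>
      (\<forall>(u,v)\<in>P \<union> Q. a \<le> u \<and> u < v \<and> v \<le> b \<and> {u<..<v} \<subseteq> U) \<longrightarrow>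
      pairwise (\<lambda>p q. {fst p<..<snd p} \<inter> {fst q<..<snd q} = {}) P \<longrightarrow>
      pairwise (\<lambda>p q. {fst p<..<snd p} \<inter> {fst q<..<snd q} = {}) Q \<longrightarrow>
      2 * measure lebesgue U - (\<Sum>p\<in>P. snd p - fst p) - (\<Sum>p\<in>Q. snd p - fst p) < \<delta> \<longrightarrow>
      \<bar>(\<Sum>p\<in>P. f (snd p) - f (fst p)) - (\<Sum>p\<in>Q. f (snd p) - f (fst p))\<bar> < \<epsilon>"
proof -
  obtain \<delta> where \<delta>: "\<delta> > 0" and D: "\<forall>(P::nat set) s e. finite P \<longrightarrow> (\<forall>i\<in>P. a \<le> s i \<and> s i \<le> e i \<and> e i \<le> b) \<longrightarrow>
       (\<forall>i\<in>P. \<forall>j\<in>P. i \<noteq> j \<longrightarrow> e i \<le> s j \<or> e j \<le> s i) \<longrightarrow>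
       (\<Sum>i\<in>P. e i - s i) < \<delta> \<longrightarrow> (\<Sum>i\<in>P. norm (f (e i) - f (s i))) < \<epsilon>"
    using abs_cont_on_finite_family[OF AC \<epsilon>] by blast
  have main: "\<bar>(\<Sum>p\<in>P. f (snd p) - f (fst p)) - (\<Sum>p\<in>Q. f (snd p) - f (fst p))\<bar> < \<epsilon>"
    if fin: "finite P" "finite Q" and U: "U \<in> lmeasurable"
      and PQ0: "\<forall>(u,v)\<in>P \<union> Q. a \<le> u \<and> u < v \<and> v \<le> b \<and> {u<..<v} \<subseteq> U"
      and dP: "pairwise (\<lambda>p q. {fst p<..<snd p} \<inter> {fst q<..<snd q} = {}) P"
      and dQ: "pairwise (\<lambda>p q. {fst p<..<snd p} \<inter> {fst q<..<snd q} = {}) Q"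
      and small: "2 * measure lebesgue U - (\<Sum>p\<in>P. snd p - fst p) - (\<Sum>p\<in>Q. snd p - fst p) < \<delta>"
    for P Q U
  proof -
    have PQ: "a \<le> u \<and> u < v \<and> v \<le> b \<and> {u<..<v} \<subseteq> U" if "(u,v) \<in> P \<union> Q" for u v
      using bspec[OF PQ0 that] by simp
    define E where "E = fst ` (P \<union> Q) \<union> snd ` (P \<union> Q)"
    have finE: "finite E" using fin by (auto simp: E_def)
    define xs where "xs = sorted_list_of_set E"
    have xs: "set xs = E" "sorted_wrt (<) xs"
      using finE by (auto simp: xs_def)
    have Eab: "a \<le> x \<and> x \<le> b" if x: "x \<in> E" for x
    proof -
      obtain p where "p \<in> P \<union> Q" "x = fst p \<or> x = snd p" using x unfolding E_def by blast
      then show ?thesis using PQ[of "fst p" "snd p"] by auto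
    qed
    \<comment> \<open>The number of grid cells. An empty grid also gives \<open>m = 0\<close> by
      truncated subtraction, hence the side condition \<open>0 < m\<close> in the facts about grid
      points.\<close>
    define m where "m = length xs - 1"
    define x where "x = (\<lambda>i. xs ! i)"
    have xless: "x i < x j" if "i < j" "j \<le> m" "0 < m" for i j
      using sorted_wrt_nth_less[OF xs(2), of i j] that by (auto simp: x_def m_def)
    have xless': "x i < x (Suc i)" if "i < m" for i
      using xless[of i "Suc i"] that by auto
    have xle: "i \<le> j" if "x i \<le> x j" "i \<le> m" "0 < m" for i j
      using xless[of j i] that by (meson leD le_less_linear)
    have xE: "x i \<in> E" if "i \<le> m" "0 < m" for i
      using that xs(1) nth_mem[of i xs] by (auto simp: x_def m_def)
    define c where "c = (\<lambda>(p::real\<times>real) i. if fst p \<le> x i \<and> x (Suc i) \<le> snd p then 1 else 0::real)"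
    \<comment> \<open>Stated for every \<open>\<phi>\<close>: with \<open>f\<close> it expands the
      increments, with the identity the lengths, so that both are compared on the same
      cells.\<close>
    have tele: "\<phi> (snd p) - \<phi> (fst p) = (\<Sum>i<m. c p i * (\<phi> (x (Suc i)) - \<phi> (x i)))"
      if p: "p \<in> P \<union> Q" for \<phi> :: "real \<Rightarrow> real" and p
    proof -
      obtain u v where uv: "p = (u,v)" by force
      have "u < v" using PQ p uv by auto
      have "u \<in> set xs" "v \<in> set xs" using imageI[OF p, of fst] imageI[OF p, of snd] uv xs(1) unfolding E_def by auto
      then obtain i j where ij: "i < length xs" "u = x i" "j < length xs" "v = x j"
        by (auto simp: in_set_conv_nth x_def)
      have "i \<noteq> j" using ij \<open>u < v\<close> by auto
      have m0: "0 < m" using ij \<open>i \<noteq> j\<close> unfolding m_def by linarith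
      have ijm: "i \<le> m" "j \<le> m" using ij by (auto simp: m_def)
      have "\<not> j < i" using xless[of j i] ij \<open>u < v\<close> ijm m0 by auto
      then have "i < j" using \<open>i \<noteq> j\<close> by auto
      have xle': "x k \<le> x l" if "k \<le> l" "l \<le> m" for k l
        using xless[of k l] that m0 by (cases "k = l") auto
      have eq: "{k. k < m \<and> u \<le> x k \<and> x (Suc k) \<le> v} = {i..<j}"
      proof safe
        fix k assume "k < m" "u \<le> x k" "x (Suc k) \<le> v"
        then show "k \<in> {i..<j}" using xle[of i k] xle[of "Suc k" j] ij ijm m0 by auto
      next
        fix k assume "k \<in> {i..<j}"
        then show "k < m" "u \<le> x k" "x (Suc k) \<le> v"
          using xle'[of i k] xle'[of "Suc k" j] ij ijm by auto
      qed
      have "(\<Sum>k<m. c p k * (\<phi> (x (Suc k)) - \<phi> (x k)))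
          = (\<Sum>k\<in>{k. k < m \<and> u \<le> x k \<and> x (Suc k) \<le> v}. (\<phi> (x (Suc k)) - \<phi> (x k)))"
        by (rule sum.mono_neutral_cong_right) (auto simp: c_def uv)
      also have "\<dots> = \<phi> v - \<phi> u"
        unfolding eq using \<open>i < j\<close> ij sum_Suc_diff'[of i j "\<lambda>k. \<phi> (x k)"] by auto
      finally show ?thesis by (simp add: uv)
    qed
    define C where "C = (\<lambda>R i. \<Sum>p\<in>R. c p i)"
    have tot: "(\<Sum>p\<in>R. \<phi> (snd p) - \<phi> (fst p)) = (\<Sum>i<m. C R i * (\<phi> (x (Suc i)) - \<phi> (x i)))"
      if "R = P \<or> R = Q" for \<phi> :: "real \<Rightarrow> real" and R
    proof -
      have "(\<Sum>p\<in>R. \<phi> (snd p) - \<phi> (fst p)) = (\<Sum>p\<in>R. \<Sum>i<m. c p i * (\<phi> (x (Suc i)) - \<phi> (x i)))"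
        by (intro sum.cong tele) (use that in auto)
      also have "\<dots> = (\<Sum>i<m. \<Sum>p\<in>R. c p i * (\<phi> (x (Suc i)) - \<phi> (x i)))"
        by (rule sum.swap)
      finally show ?thesis by (simp add: C_def sum_distrib_right)
    qed
    have C01: "C R i = 0 \<or> (C R i = 1 \<and> (\<exists>p\<in>R. fst p \<le> x i \<and> x (Suc i) \<le> snd p))"
      if R: "R = P \<or> R = Q" and i: "i < m" for R i
    proof (cases "\<exists>p\<in>R. fst p \<le> x i \<and> x (Suc i) \<le> snd p")
      case True
      then obtain p where p: "p \<in> R" "fst p \<le> x i" "x (Suc i) \<le> snd p" by blast
      have "c q i = 0" if "q \<in> R" "q \<noteq> p" for q
      proof (rule ccontr)
        assume "c q i \<noteq> 0"
        then have "fst q \<le> x i" "x (Suc i) \<le> snd q" by (auto simp: c_def split: if_splits)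
        then have "(x i + x (Suc i)) / 2 \<in> {fst p<..<snd p} \<inter> {fst q<..<snd q}"
          using p xless'[OF i] by auto
        then show False using dP dQ R p that unfolding pairwise_def by blast
      qed
      then have "C R i = (\<Sum>q\<in>R. if q = p then 1 else 0)"
        unfolding C_def using p by (intro sum.cong) (auto simp: c_def)
      also have "\<dots> = 1" using p R fin by auto
      finally show ?thesis using p by blast
    next
      case False
      have "C R i = 0" unfolding C_def by (rule sum.neutral) (use False in \<open>auto simp: c_def\<close>)
      then show ?thesis by simp
    qed
    have C01': "C R i = 0 \<or> C R i = 1" if "R = P \<or> R = Q" "i < m" for R i
      using C01[OF that] by auto
    let ?N = "{i. i < m \<and> C P i \<noteq> C Q i}"
    let ?M = "{i. i < m \<and> (C P i = 1 \<or> C Q i = 1)}"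
    have MU: "(\<Sum>i\<in>?M. x (Suc i) - x i) \<le> measure lebesgue U"
    proof (rule sum_disjoint_intervals_le_measure[OF _ U])
      fix i assume i: "i \<in> ?M"
      then obtain p where p: "p \<in> P \<union> Q" "fst p \<le> x i" "x (Suc i) \<le> snd p"
        using C01[of P i] C01[of Q i] by fastforce
      have "{fst p<..<snd p} \<subseteq> U" using PQ p(1) by (cases p) auto
      with p have "{x i<..<x (Suc i)} \<subseteq> U" by force
      then show "x i \<le> x (Suc i) \<and> {x i<..<x (Suc i)} \<subseteq> U"
        using i xless'[of i] by auto
    next
      fix i j assume ij: "i \<in> ?M" "j \<in> ?M" "i \<noteq> j"
      have *: "{x i<..<x (Suc i)} \<inter> {x j<..<x (Suc j)} = {}" if "i < j" "j < m" for i j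
        using xless[of "Suc i" j] that by (cases "Suc i = j") auto
      show "{x i<..<x (Suc i)} \<inter> {x j<..<x (Suc j)} = {}"
        using ij *[of i j] *[of j i] by (cases "i < j") auto
    qed auto
    \<comment> \<open>For multiplicities 0 or 1, twice the indicator of "at least one" minus both
      multiplicities is the indicator of "exactly one". Cells covered by both families cancel in the
      difference of the sums of increments, so absolute continuity is needed only on
      \<open>?N\<close>, whose length the hypothesis makes small.\<close>
    have "(\<Sum>i\<in>?N. x (Suc i) - x i) = (\<Sum>i<m. (if C P i \<noteq> C Q i then 1 else 0) * (x (Suc i) - x i))"
      by (rule sum.mono_neutral_cong_left) auto
    also have "\<dots> = (\<Sum>i<m. 2 * ((if C P i = 1 \<or> C Q i = 1 then 1 else 0) * (x (Suc i) - x i))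
         - C P i * (x (Suc i) - x i) - C Q i * (x (Suc i) - x i))"
      by (intro sum.cong refl) (use C01'[of P] C01'[of Q] in \<open>force simp: algebra_simps\<close>)
    also have "\<dots> = 2 * (\<Sum>i<m. (if C P i = 1 \<or> C Q i = 1 then 1 else 0) * (x (Suc i) - x i))
         - (\<Sum>p\<in>P. snd p - fst p) - (\<Sum>p\<in>Q. snd p - fst p)"
      using tot[of P "\<lambda>x. x"] tot[of Q "\<lambda>x. x"] by (simp add: sum_subtractf sum_distrib_left)
    also have "(\<Sum>i<m. (if C P i = 1 \<or> C Q i = 1 then 1 else 0) * (x (Suc i) - x i)) = (\<Sum>i\<in>?M. x (Suc i) - x i)"
      by (rule sum.mono_neutral_cong_right) auto
    finally have len: "(\<Sum>i\<in>?N. x (Suc i) - x i) < \<delta>"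
      using MU small by linarith
    have "(\<Sum>i\<in>?N. norm (f (x (Suc i)) - f (x i))) < \<epsilon>"
    proof (rule D[rule_format])
      fix i assume "i \<in> ?N"
      then show "a \<le> x i \<and> x i \<le> x (Suc i) \<and> x (Suc i) \<le> b"
        using xless'[of i] xE[of i] xE[of "Suc i"] Eab by force
    next
      fix i j assume ij: "i \<in> ?N" "j \<in> ?N" "i \<noteq> j"
      have *: "x (Suc i) \<le> x j" if "i < j" "j < m" for i j
        using xless[of "Suc i" j] that by (cases "Suc i = j") auto
      show "x (Suc i) \<le> x j \<or> x (Suc j) \<le> x i"
        using ij *[of i j] *[of j i] by (cases "i < j") auto
    qed (use len in auto)
    moreover have "\<bar>(\<Sum>p\<in>P. f (snd p) - f (fst p)) - (\<Sum>p\<in>Q. f (snd p) - f (fst p))\<bar>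
        \<le> (\<Sum>i<m. \<bar>C P i - C Q i\<bar> * \<bar>f (x (Suc i)) - f (x i)\<bar>)"
      unfolding tot[of P f, simplified] tot[of Q f, simplified] sum_subtractf[symmetric]
      by (rule order_trans[OF sum_abs]) (simp add: left_diff_distrib[symmetric] abs_mult)
    moreover have "(\<Sum>i<m. \<bar>C P i - C Q i\<bar> * \<bar>f (x (Suc i)) - f (x i)\<bar>)
        = (\<Sum>i\<in>?N. norm (f (x (Suc i)) - f (x i)))"
    proof (rule sum.mono_neutral_cong_right)
      show "\<bar>C P i - C Q i\<bar> * \<bar>f (x (Suc i)) - f (x i)\<bar> = norm (f (x (Suc i)) - f (x i))" if "i \<in> ?N" for i
        using that C01'[of P i] C01'[of Q i] by auto
    qed auto
    ultimately show ?thesis by linarith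
  qed
  show ?thesis
    by (intro exI[of _ \<delta>] conjI allI impI \<delta>) (rule main; assumption)
qed

text \<open>The intervals satisfying \<open>R\<close> form a Vitali cover of this set. Conditions on
  difference quotients are put on intervals strictly around \<open>t\<close> rather than with an
  endpoint at \<open>t\<close>; the set is then Borel for every \<open>R\<close>.\<close>

definition vitali_points :: "(real \<Rightarrow> real \<Rightarrow> bool) \<Rightarrow> real set" where
  "vitali_points R = {t. \<forall>d>0. \<exists>u v. u < t \<and> t < v \<and> v - u < d \<and> R u v}"

lemma vitali_pointsE:
  assumes "t \<in> vitali_points R" "d > 0"
  obtains u v where "u < t" "t < v" "v - u < d" "R u v"
  using assms unfolding vitali_points_def by blast

text \<open>A point strictly inside an interval can be moved while the interval stays, so the points
  served by intervals shorter than \<open>1 / Suc n\<close> form an open set, and the Vitali points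
  are a countable intersection of such sets.\<close>

lemma vitali_points_borel [measurable]: "vitali_points R \<in> sets borel"
proof -
  have "vitali_points R = (\<Inter>n. \<Union>{{u<..<v} | u v. v - u < 1 / Suc n \<and> R u v})"
    (is "_ = (\<Inter>n. ?O n)")
  proof (intro equalityI subsetI)
    fix t assume t: "t \<in> vitali_points R"
    show "t \<in> (\<Inter>n. ?O n)"
    proof
      fix n
      obtain u v where "u < t" "t < v" "v - u < 1 / Suc n" "R u v"
        using vitali_pointsE[OF t, of "1 / Suc n"] by auto
      then have "t \<in> {u<..<v}" "{u<..<v} \<in> {{u<..<v} | u v. v - u < 1 / Suc n \<and> R u v}" by auto
      then show "t \<in> ?O n" by (rule UnionI[rotated])
    qed
  next
    fix t assume t: "t \<in> (\<Inter>n. ?O n)"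
    show "t \<in> vitali_points R"
      unfolding vitali_points_def
    proof safe
      fix d :: real assume "d > 0"
      then obtain n where n: "1 / Suc n < d" by (metis nat_approx_posE)
      from t have "t \<in> ?O n" by blast
      then obtain u v where "u < t" "t < v" "v - u < 1 / Suc n" "R u v" by auto
      with n show "\<exists>u v. u < t \<and> t < v \<and> v - u < d \<and> R u v"
        by (meson less_trans)
    qed
  qed
  moreover have "open (?O n)" for n by (intro open_Union) auto
  ultimately show ?thesis by simp
qed

text \<open>The Vitali covering theorem yields countably many disjoint closed intervals in
  \<open>U\<close> that exhaust \<open>A\<close> up to a null set. By continuity from below finitely
  many of them already contain a part of \<open>A\<close> of measure above \<open>r\<close>, so
  their total length exceeds \<open>r\<close>.\<close>

lemma vitali_finite_intervals:
  assumes U: "open U" "U \<in> lmeasurable" and A: "A \<in> sets borel" "A \<subseteq> U" "A \<subseteq> vitali_points R"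
    and r: "r < measure lebesgue A"
  shows "\<exists>P. finite P \<and> (\<forall>(u,v)\<in>P. u < v \<and> {u<..<v} \<subseteq> U \<and> R u v) \<and>
     pairwise (\<lambda>p q. {fst p<..<snd p} \<inter> {fst q<..<snd q} = {}) P \<and>
     r < (\<Sum>p\<in>P. snd p - fst p)"
proof (cases "A = {}")
  case True
  then show ?thesis using r by (intro exI[of _ "{}"]) auto
next
  case False
  define K where "K = {(u,v). u < v \<and> {u..v} \<subseteq> U \<and> R u v}"
  define m where "m = (\<lambda>p::real\<times>real. (fst p + snd p) / 2)"
  define \<rho> where "\<rho> = (\<lambda>p::real\<times>real. (snd p - fst p) / 2)"
  have cb: "cball (m p) (\<rho> p) = {fst p..snd p}" for p
    unfolding m_def \<rho>_def cball_eq_atLeastAtMost by (simp add: field_simps)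
  obtain C where C: "countable C" "C \<subseteq> K"
    "pairwise (\<lambda>i j. disjnt (cball (m i) (\<rho> i)) (cball (m j) (\<rho> j))) C"
    "negligible (A - (\<Union>i\<in>C. cball (m i) (\<rho> i)))"
  proof (rule Vitali_covering_theorem_cballs[of K \<rho> A m])
    show "0 < \<rho> i" if "i \<in> K" for i using that by (auto simp: K_def \<rho>_def)
  next
    fix t d :: real assume t: "t \<in> A" and d: "0 < d"
    obtain e where e: "e > 0" "ball t e \<subseteq> U"
      using U A t open_contains_ball by blast
    from t A have "t \<in> vitali_points R" by auto
    then obtain u v where uv: "u < t" "t < v" "v - u < min d e" "R u v"
      by (rule vitali_pointsE[of _ _ "min d e"]) (use d e in auto)
    have "{u..v} \<subseteq> ball t e" using uv by (auto simp: dist_real_def)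
    then have "(u,v) \<in> K" using uv e by (auto simp: K_def)
    then show "\<exists>i. i \<in> K \<and> t \<in> cball (m i) (\<rho> i) \<and> \<rho> i < d"
      using uv unfolding cb by (intro exI[of _ "(u,v)"]) (auto simp: \<rho>_def)
  qed
  have Amea: "A \<in> lmeasurable"
    by (rule fmeasurableI2[OF U(2) A(2)]) (use A in auto)
  have CK: "fst p < snd p" "{fst p..snd p} \<subseteq> U" "R (fst p) (snd p)" if "p \<in> C" for p
    using subsetD[OF C(2) that] unfolding K_def by (simp_all add: case_prod_beta)
  show ?thesis
  proof (cases "C = {}")
    case True
    then have "negligible A" using C by simp
    then have "measure lebesgue A = 0" using negligible_imp_measure0 by blast
    then show ?thesis using r by (intro exI[of _ "{}"]) auto
  next
    case False
    define D where "D = (\<lambda>n. A \<inter> (\<Union>k\<le>n. {fst (from_nat_into C k)..snd (from_nat_into C k)}))"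
    have UD: "(\<Union>n. D n) = A \<inter> (\<Union>i\<in>C. cball (m i) (\<rho> i))"
    proof -
      have "(\<Union>i\<in>C. cball (m i) (\<rho> i)) = (\<Union>i\<in>range (from_nat_into C). {fst i..snd i})"
        using range_from_nat_into[OF False C(1)] by (simp add: cb)
      then show ?thesis by (auto simp: D_def)
    qed
    have "(\<lambda>n. measure lebesgue (D n)) \<longlonglongrightarrow> measure lebesgue (\<Union>n. D n)"
    proof (rule Lim_measure_incseq)
      show "range D \<subseteq> sets lebesgue" using A by (auto simp: D_def)
      show "incseq D" by (force simp: D_def incseq_def)
      show "emeasure lebesgue (\<Union>n. D n) \<noteq> \<infinity>"
        using Amea emeasure_mono[of "\<Union>n. D n" A lebesgue] unfolding UD
        by (metis Int_lower1 fmeasurableD fmeasurable_def infinity_ennreal_def mem_Collect_eq neq_top_trans top.not_eq_extremum)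
    qed
    moreover have "measure lebesgue (\<Union>n. D n) = measure lebesgue A"
    proof -
      have "negligible ((A - (\<Union>n. D n)) \<union> ((\<Union>n. D n) - A))"
        using C(4) unfolding UD by (simp add: Diff_Int_distrib2 Diff_triv Int_Diff Diff_Int)
      moreover have "(A - (\<Union>n. D n)) \<union> ((\<Union>n. D n) - A) = ((\<Union>n. D n) - A) \<union> (A - (\<Union>n. D n))" by auto
      ultimately show ?thesis
        using measure_negligible_symdiff[OF Amea] by metis
    qed
    ultimately obtain n where n: "r < measure lebesgue (D n)"
      using order_tendstoD(1)[of _ "measure lebesgue A" sequentially r] r
      by (metis (no_types, lifting) eventually_sequentially order_refl)
    define P where "P = from_nat_into C ` {..n}"
    have PC: "P \<subseteq> C" unfolding P_def using from_nat_into[OF False] by auto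
    have "measure lebesgue (D n) \<le> measure lebesgue (\<Union>p\<in>P. {fst p..snd p})"
    proof (rule measure_mono_fmeasurable)
      show "D n \<subseteq> (\<Union>p\<in>P. {fst p..snd p})" by (auto simp: D_def P_def)
      show "D n \<in> sets lebesgue" using A by (auto simp: D_def)
      show "(\<Union>p\<in>P. {fst p..snd p}) \<in> lmeasurable" unfolding P_def by (intro fmeasurable.finite_UN) auto
    qed
    also have "\<dots> \<le> (\<Sum>p\<in>P. measure lebesgue {fst p..snd p})"
      by (rule measure_UNION_le) (auto simp: P_def)
    also have "\<dots> = (\<Sum>p\<in>P. snd p - fst p)"
      using CK PC by (intro sum.cong) (auto simp: less_imp_le subset_iff)
    finally have "r < (\<Sum>p\<in>P. snd p - fst p)" using n by simp
    moreover have "\<forall>(u,v)\<in>P. u < v \<and> {u<..<v} \<subseteq> U \<and> R u v"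
    proof safe
      fix u v assume "(u,v) \<in> P"
      then have "(u,v) \<in> C" using PC by auto
      then show "u < v" "R u v" "\<And>x. x \<in> {u<..<v} \<Longrightarrow> x \<in> U" using CK[of "(u,v)"] by auto
    qed
    moreover have "finite P" by (simp add: P_def)
    moreover have "pairwise (\<lambda>p q. {fst p<..<snd p} \<inter> {fst q<..<snd q} = {}) P"
    proof (rule pairwiseI)
      fix p q assume "p \<in> P" "q \<in> P" "p \<noteq> q"
      then have "disjnt {fst p..snd p} {fst q..snd q}"
        using C(3) PC unfolding pairwise_def cb by blast
      then show "{fst p<..<snd p} \<inter> {fst q<..<snd q} = {}"
        using Int_mono[of "{fst p<..<snd p}" "{fst p..snd p}" "{fst q<..<snd q}" "{fst q..snd q}"]
        unfolding disjnt_def by auto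
    qed
    ultimately show ?thesis
      by blast
  qed
qed

text \<open>If the set had positive measure, both kinds of intervals would nearly fill it inside a
  slightly larger open set. The increments of \<open>f\<close> over one family sum to at most
  \<open>p\<close> times its length, over the other to at least \<open>q\<close> times its length,
  although \<open>abs_cont_on_compare_families\<close> forces the two sums to be close.\<close>

lemma abs_cont_on_null_oscillation:
  fixes f :: "real \<Rightarrow> real"
  assumes AC: "abs_cont_on a b f" and pq: "p < q"
  shows "vitali_points (\<lambda>u v. a \<le> u \<and> v \<le> b \<and> f v - f u < p * (v - u))
       \<inter> vitali_points (\<lambda>u v. a \<le> u \<and> v \<le> b \<and> f v - f u > q * (v - u)) \<in> null_sets lborel"
    (is "vitali_points ?R \<inter> vitali_points ?S \<in> _")
proof (rule ccontr)
  define A where "A = vitali_points ?R \<inter> vitali_points ?S"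
  assume "\<not> ?thesis"
  then have nn: "A \<notin> null_sets lborel" by (simp add: A_def)
  have Ab: "A \<in> sets borel" by (auto simp: A_def)
  have "A \<subseteq> {a..b}"
  proof
    fix t assume "t \<in> A"
    then have "t \<in> vitali_points ?R" by (simp add: A_def)
    then obtain u v where "u < t" "t < v" "v - u < 1" "?R u v"
      by (rule vitali_pointsE[of _ _ 1]) auto
    then show "t \<in> {a..b}" by auto
  qed
  then have Am: "A \<in> lmeasurable"
    using fmeasurableI2[of "{a..b}" lebesgue A] Ab by auto
  define l where "l = measure lebesgue A"
  have "l > 0"
  proof (rule ccontr)
    assume "\<not> l > 0"
    then have "measure lebesgue A = 0" unfolding l_def by (simp add: measure_le_0_iff not_less)
    then have "negligible A" using Am negligible_iff_measure by blast
    then have "A \<in> null_sets lebesgue" by (simp add: negligible_iff_null_sets)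
    then show False using nn Ab null_sets_completion_iff[of A lborel] by auto
  qed
  define \<epsilon> where "\<epsilon> = (q - p) * l / 2"
  have "\<epsilon> > 0" using pq \<open>l > 0\<close> by (simp add: \<epsilon>_def)
  obtain \<delta> where \<delta>: "\<delta> > 0" and D: "\<forall>P Q U. finite P \<longrightarrow> finite Q \<longrightarrow> U \<in> lmeasurable \<longrightarrow>
      (\<forall>(u,v)\<in>P \<union> Q. a \<le> u \<and> u < v \<and> v \<le> b \<and> {u<..<v} \<subseteq> U) \<longrightarrow>
      pairwise (\<lambda>p q. {fst p<..<snd p} \<inter> {fst q<..<snd q} = {}) P \<longrightarrow>
      pairwise (\<lambda>p q. {fst p<..<snd p} \<inter> {fst q<..<snd q} = {}) Q \<longrightarrow>
      2 * measure lebesgue U - (\<Sum>p\<in>P. snd p - fst p) - (\<Sum>p\<in>Q. snd p - fst p) < \<delta> \<longrightarrow>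
      \<bar>(\<Sum>p\<in>P. f (snd p) - f (fst p)) - (\<Sum>p\<in>Q. f (snd p) - f (fst p))\<bar> < \<epsilon>"
    using abs_cont_on_compare_families[OF AC \<open>\<epsilon> > 0\<close>] by blast
  \<comment> \<open>Both total lengths exceed \<open>l - \<eta>\<close> and \<open>U\<close> has
    measure below \<open>l + \<eta>\<close>, so the defect in the comparison lemma is below
    \<open>4 * \<eta>\<close>, hence below \<open>\<delta>\<close>. The second bound makes the error
    from replacing both lengths by \<open>l\<close> smaller than \<open>\<epsilon>\<close>, which is
    half of the gap between the slopes times \<open>l\<close>.\<close>
  define \<eta> where "\<eta> = min (\<delta> / 4) (\<epsilon> / (\<bar>p\<bar> + \<bar>q\<bar> + 1))"
  have \<eta>: "\<eta> > 0" "4 * \<eta> \<le> \<delta>" using \<delta> \<open>\<epsilon> > 0\<close> by (auto simp: \<eta>_def)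
  have "\<eta> \<le> \<epsilon> / (\<bar>p\<bar> + \<bar>q\<bar> + 1)" by (simp add: \<eta>_def)
  then have \<eta>2: "\<eta> * (\<bar>p\<bar> + \<bar>q\<bar> + 1) \<le> \<epsilon>" by (subst (asm) pos_le_divide_eq) auto
  obtain U where U: "open U" "A \<subseteq> U" "U - A \<in> lmeasurable" "emeasure lebesgue (U - A) < ennreal \<eta>"
    using sets_lebesgue_outer_open[of A \<eta>] Ab \<eta> by (metis sets_completionI_sets sets_lborel)
  have Um: "U \<in> lmeasurable" using Am U by (metis Un_Diff_cancel2 fmeasurable.Un sup.absorb_iff1)
  have "measure lebesgue (U - A) < \<eta>"
    using U(3,4) \<eta> by (simp add: emeasure_eq_measure2 ennreal_less_iff)
  then have mU: "measure lebesgue U < l + \<eta>"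
    using measurable_measure_Diff[OF Um fmeasurableD[OF Am] U(2)] by (simp add: l_def)
  have ex: "\<exists>P. finite P \<and> (\<forall>(u,v)\<in>P. u < v \<and> {u<..<v} \<subseteq> U \<and> R u v) \<and>
     pairwise (\<lambda>p q. {fst p<..<snd p} \<inter> {fst q<..<snd q} = {}) P \<and>
     l - \<eta> < (\<Sum>p\<in>P. snd p - fst p)" if "A \<subseteq> vitali_points R" for R
    by (rule vitali_finite_intervals[OF U(1) Um Ab U(2) that]) (use \<eta> in \<open>auto simp: l_def\<close>)
  from ex[of ?R] obtain P where P: "finite P" "\<forall>(u,v)\<in>P. u < v \<and> {u<..<v} \<subseteq> U \<and> ?R u v"
    "pairwise (\<lambda>p q. {fst p<..<snd p} \<inter> {fst q<..<snd q} = {}) P"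
    "l - \<eta> < (\<Sum>p\<in>P. snd p - fst p)" by (auto simp: A_def)
  from ex[of ?S] obtain Q where Q: "finite Q" "\<forall>(u,v)\<in>Q. u < v \<and> {u<..<v} \<subseteq> U \<and> ?S u v"
    "pairwise (\<lambda>p q. {fst p<..<snd p} \<inter> {fst q<..<snd q} = {}) Q"
    "l - \<eta> < (\<Sum>p\<in>Q. snd p - fst p)" by (auto simp: A_def)
  define SP where "SP = (\<Sum>p\<in>P. snd p - fst p)"
  define SQ where "SQ = (\<Sum>p\<in>Q. snd p - fst p)"
  have Pi: "fst i < snd i" "{fst i<..<snd i} \<subseteq> U" "?R (fst i) (snd i)" if "i \<in> P" for i
    using bspec[OF P(2) that] by (auto simp: case_prod_beta)
  have Qi: "fst i < snd i" "{fst i<..<snd i} \<subseteq> U" "?S (fst i) (snd i)" if "i \<in> Q" for i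
    using bspec[OF Q(2) that] by (auto simp: case_prod_beta)
  have "SP \<le> measure lebesgue U" unfolding SP_def
    by (rule sum_disjoint_intervals_le_measure[OF P(1) Um])
       (use Pi P(3) in \<open>auto simp: less_imp_le pairwise_def\<close>)
  then have SP: "\<bar>SP - l\<bar> \<le> \<eta>" using P(4) mU by (simp add: SP_def)
  have "SQ \<le> measure lebesgue U" unfolding SQ_def
    by (rule sum_disjoint_intervals_le_measure[OF Q(1) Um])
       (use Qi Q(3) in \<open>auto simp: less_imp_le pairwise_def\<close>)
  then have SQ: "\<bar>SQ - l\<bar> \<le> \<eta>" using Q(4) mU by (simp add: SQ_def)
  have "\<bar>(\<Sum>p\<in>P. f (snd p) - f (fst p)) - (\<Sum>p\<in>Q. f (snd p) - f (fst p))\<bar> < \<epsilon>"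
  proof (rule D[rule_format])
    show "finite P" "finite Q" "U \<in> lmeasurable" by fact+
    show "case x of (u, v) \<Rightarrow> a \<le> u \<and> u < v \<and> v \<le> b \<and> {u<..<v} \<subseteq> U" if "x \<in> P \<union> Q" for x
      using that Pi[of x] Qi[of x] by (auto simp: case_prod_beta)
    show "2 * measure lebesgue U - (\<Sum>p\<in>P. snd p - fst p) - (\<Sum>p\<in>Q. snd p - fst p) < \<delta>"
      using P(4) Q(4) mU \<eta> by linarith
  qed (use P Q in auto)
  moreover have "(\<Sum>p\<in>P. f (snd p) - f (fst p)) \<le> p * SP"
    unfolding SP_def sum_distrib_left by (rule sum_mono) (use Pi in force)
  moreover have "(\<Sum>p\<in>Q. f (snd p) - f (fst p)) \<ge> q * SQ"
    unfolding SQ_def sum_distrib_left by (rule sum_mono) (use Qi in force)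
  ultimately have "q * SQ - p * SP < \<epsilon>" by linarith
  moreover have "q * SQ - p * SP \<ge> (q - p) * l - (\<bar>p\<bar> + \<bar>q\<bar>) * \<eta>"
  proof -
    have "\<bar>q * (SQ - l)\<bar> \<le> \<bar>q\<bar> * \<eta>" "\<bar>p * (SP - l)\<bar> \<le> \<bar>p\<bar> * \<eta>"
      using SP SQ by (auto simp: abs_mult intro: mult_left_mono)
    then show ?thesis by (auto simp: algebra_simps abs_le_iff)
  qed
  moreover have "(\<bar>p\<bar> + \<bar>q\<bar>) * \<eta> < \<epsilon>" using \<eta>2 \<eta>(1) by (simp add: algebra_simps)
  ultimately show False by (simp add: \<epsilon>_def field_simps)
qed

text \<open>In a ball of length \<open>2 * \<delta> / 3\<close> absolute continuity bounds the
  variation over any finite disjoint family by 1. If the bad set had measure \<open>l > 0\<close>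
  there, disjoint intervals of total length above \<open>l / 2\<close> with slopes above
  \<open>M > 2 / l\<close> would have variation above 1. Balls with rational centres cover the
  line.\<close>

lemma abs_cont_on_null_unbounded:
  fixes f :: "real \<Rightarrow> real"
  assumes AC: "abs_cont_on a b f"
  shows "(\<Inter>M::nat. vitali_points (\<lambda>u v. a \<le> u \<and> v \<le> b \<and> \<bar>f v - f u\<bar> > real M * (v - u))) \<in> null_sets lborel"
    (is "?B \<in> _")
proof -
  obtain \<delta> where \<delta>: "\<delta> > 0" and D: "\<forall>(P::(real\<times>real) set) s e. finite P \<longrightarrow> (\<forall>i\<in>P. a \<le> s i \<and> s i \<le> e i \<and> e i \<le> b) \<longrightarrow>
       (\<forall>i\<in>P. \<forall>j\<in>P. i \<noteq> j \<longrightarrow> e i \<le> s j \<or> e j \<le> s i) \<longrightarrow>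
       (\<Sum>i\<in>P. e i - s i) < \<delta> \<longrightarrow> (\<Sum>i\<in>P. norm (f (e i) - f (s i))) < 1"
    using abs_cont_on_finite_family[OF AC zero_less_one] by blast
  have Bb: "?B \<in> sets borel" by measurable
  have null: "?B \<inter> ball c (\<delta>/3) \<in> null_sets lborel" for c
  proof (rule ccontr)
    define A where "A = ?B \<inter> ball c (\<delta>/3)"
    assume "\<not> ?thesis"
    then have nn: "A \<notin> null_sets lborel" by (simp add: A_def)
    have Ab: "A \<in> sets borel" using Bb by (auto simp: A_def)
    then have Am: "A \<in> lmeasurable"
      using fmeasurableI2[of "ball c (\<delta>/3)" lebesgue A] by (auto simp: A_def)
    define l where "l = measure lebesgue A"
    have "l > 0"
    proof (rule ccontr)
      assume "\<not> l > 0"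
      then have "measure lebesgue A = 0" unfolding l_def by (simp add: measure_le_0_iff not_less)
      then have "negligible A" using Am negligible_iff_measure by blast
      then have "A \<in> null_sets lebesgue" by (simp add: negligible_iff_null_sets)
      then show False using nn Ab null_sets_completion_iff[of A lborel] by auto
    qed
    obtain M :: nat where M: "2 / l < M" using reals_Archimedean2 by blast
    let ?R = "\<lambda>u v. a \<le> u \<and> v \<le> b \<and> \<bar>f v - f u\<bar> > real M * (v - u)"
    have "\<exists>P::(real\<times>real) set. finite P \<and> (\<forall>(u,v)\<in>P. u < v \<and> {u<..<v} \<subseteq> ball c (\<delta>/3) \<and> ?R u v) \<and>
       pairwise (\<lambda>p q. {fst p<..<snd p} \<inter> {fst q<..<snd q} = {}) P \<and>
       l/2 < (\<Sum>p\<in>P. snd p - fst p)"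
      by (rule vitali_finite_intervals[OF _ _ Ab]) (use \<open>l > 0\<close> in \<open>auto simp: A_def l_def\<close>)
    then obtain P where P: "finite P" "\<forall>(u,v)\<in>P. u < v \<and> {u<..<v} \<subseteq> ball c (\<delta>/3) \<and> ?R u v"
       "pairwise (\<lambda>p q. {fst p<..<snd p} \<inter> {fst q<..<snd q} = {}) P"
       "l/2 < (\<Sum>p\<in>P. snd p - fst p)" by blast
    have Pi: "fst i < snd i" "{fst i<..<snd i} \<subseteq> ball c (\<delta>/3)" "?R (fst i) (snd i)" if "i \<in> P" for i
      using bspec[OF P(2) that] by (auto simp: case_prod_beta)
    have "(\<Sum>p\<in>P. snd p - fst p) \<le> measure lebesgue (ball c (\<delta>/3))"
      by (rule sum_disjoint_intervals_le_measure[OF P(1)])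
         (use Pi P(3) in \<open>auto simp: less_imp_le pairwise_def\<close>)
    also have "\<dots> = 2 * \<delta> / 3" using \<delta> by (simp add: ball_eq_greaterThanLessThan)
    finally have len: "(\<Sum>p\<in>P. snd p - fst p) < \<delta>" using \<delta> by simp
    have "(\<Sum>p\<in>P. norm (f (snd p) - f (fst p))) < 1"
    proof (rule D[rule_format, OF P(1) _ _ len])
      fix i j assume ij: "i \<in> P" "j \<in> P" "i \<noteq> j"
      then have dis: "{fst i<..<snd i} \<inter> {fst j<..<snd j} = {}" using P(3) by (auto simp: pairwise_def)
      show "snd i \<le> fst j \<or> snd j \<le> fst i"
      proof (rule ccontr)
        assume "\<not> ?thesis"
        then have "(max (fst i) (fst j) + min (snd i) (snd j)) / 2 \<in> {fst i<..<snd i} \<inter> {fst j<..<snd j}"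
          using Pi(1)[OF ij(1)] Pi(1)[OF ij(2)] by (auto simp: max_def min_def)
        with dis show False by blast
      qed
    qed (use Pi in \<open>auto simp: less_imp_le\<close>)
    moreover have "real M * (\<Sum>p\<in>P. snd p - fst p) \<le> (\<Sum>p\<in>P. norm (f (snd p) - f (fst p)))"
      unfolding sum_distrib_left by (rule sum_mono) (use Pi in force)
    moreover have "real M * (\<Sum>p\<in>P. snd p - fst p) \<ge> real M * (l/2)"
      using P(4) by (intro mult_left_mono) auto
    moreover have "real M * (l/2) > 1" using M \<open>l > 0\<close> by (simp add: field_simps)
    ultimately show False by linarith
  qed
  have "?B \<subseteq> (\<Union>c\<in>\<rat>. ?B \<inter> ball c (\<delta>/3))"
  proof
    fix t assume t: "t \<in> ?B"
    obtain c where "c \<in> \<rat>" "t - \<delta>/3 < c" "c < t" using Rats_dense_in_real[of "t - \<delta>/3" t] \<delta> by auto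
    then have "t \<in> ball c (\<delta>/3)" by (auto simp: dist_real_def)
    with t \<open>c \<in> \<rat>\<close> show "t \<in> (\<Union>c\<in>\<rat>. ?B \<inter> ball c (\<delta>/3))" by blast
  qed
  moreover have "(\<Union>c\<in>\<rat>. ?B \<inter> ball c (\<delta>/3)) \<in> null_sets lborel"
    using null countable_rat by (intro null_sets_UN') auto
  ultimately show ?thesis using null_sets_subset[of "\<Union>c\<in>\<rat>. ?B \<inter> ball c (\<delta>/3)" lborel ?B] Bb by simp
qed

text \<open>The slopes over intervals around \<open>t\<close> have a finite lower limit
  \<open>l\<close>, finite by \<open>bd\<close>, and by \<open>osc\<close> their upper limit is
  \<open>l\<close> too. Continuity of \<open>f\<close> at \<open>t\<close> transfers this from
  intervals around \<open>t\<close> to difference quotients with one end at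
  \<open>t\<close>.\<close>

lemma real_differentiable_if_not_vitali:
  fixes f :: "real \<Rightarrow> real"
  assumes cont: "continuous_on {a..b} f" and t: "t \<in> {a<..<b}"
    and osc: "\<And>p q. p \<in> \<rat> \<Longrightarrow> q \<in> \<rat> \<Longrightarrow> p < q \<Longrightarrow>
      t \<notin> vitali_points (\<lambda>u v. a \<le> u \<and> v \<le> b \<and> f v - f u < p * (v - u))
       \<inter> vitali_points (\<lambda>u v. a \<le> u \<and> v \<le> b \<and> f v - f u > q * (v - u))"
    and bd: "t \<notin> (\<Inter>M::nat. vitali_points (\<lambda>u v. a \<le> u \<and> v \<le> b \<and> \<bar>f v - f u\<bar> > real M * (v - u)))"
  shows "f differentiable (at t)"
proof -
  \<comment> \<open>These properties form a proper filter, by \<open>Hconj\<close> and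
    \<open>Hex\<close>, so an upper and a lower slope bound always meet on a common
    interval.\<close>
  define H where "H = (\<lambda>P. \<exists>d>0. \<forall>u v. u < t \<and> t < v \<and> v - u < d \<and> a \<le> u \<and> v \<le> b \<longrightarrow> P u v)"
  have notV: "t \<notin> vitali_points (\<lambda>u v. a \<le> u \<and> v \<le> b \<and> R u v) \<longleftrightarrow> H (\<lambda>u v. \<not> R u v)" for R
    unfolding vitali_points_def H_def by blast
  have Hconj: "H (\<lambda>u v. P u v \<and> Q u v)" if "H P" "H Q" for P Q
  proof -
    from that obtain d e where de: "d > 0" "\<forall>u v. u < t \<and> t < v \<and> v - u < d \<and> a \<le> u \<and> v \<le> b \<longrightarrow> P u v"
        "e > 0" "\<forall>u v. u < t \<and> t < v \<and> v - u < e \<and> a \<le> u \<and> v \<le> b \<longrightarrow> Q u v"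
      unfolding H_def by blast
    then show ?thesis unfolding H_def by (intro exI[of _ "min d e"]) auto
  qed
  have Hex: "\<exists>u v. u < t \<and> t < v \<and> P u v" if HP: "H P" for P
  proof -
    obtain d where d: "d > 0" "\<forall>u v. u < t \<and> t < v \<and> v - u < d \<and> a \<le> u \<and> v \<le> b \<longrightarrow> P u v"
      using HP unfolding H_def by blast
    have "P (max a (t - d/3)) (min b (t + d/3))"
      using d(1) t by (intro d(2)[rule_format]) auto
    moreover have "max a (t - d/3) < t" "t < min b (t + d/3)" using d(1) t by auto
    ultimately show ?thesis by blast
  qed
  obtain M :: nat where "t \<notin> vitali_points (\<lambda>u v. a \<le> u \<and> v \<le> b \<and> \<bar>f v - f u\<bar> > real M * (v - u))"
    using bd by blast
  then have HM: "H (\<lambda>u v. \<not> \<bar>f v - f u\<bar> > real M * (v - u))" unfolding notV .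
  define Low where "Low = {p. H (\<lambda>u v. \<not> f v - f u < p * (v - u))}"
  have "- real M \<in> Low"
  proof -
    obtain d where d: "d > 0" "\<forall>u v. u < t \<and> t < v \<and> v - u < d \<and> a \<le> u \<and> v \<le> b \<longrightarrow> \<not> \<bar>f v - f u\<bar> > real M * (v - u)"
      using HM unfolding H_def by blast
    then show ?thesis unfolding Low_def H_def
      by (simp, intro exI[of _ d]) (force simp: abs_less_iff not_less abs_le_iff)
  qed
  have bdd: "p \<le> real M" if p: "p \<in> Low" for p
  proof (rule ccontr)
    assume "\<not> p \<le> real M"
    obtain u v where uv: "u < t" "t < v" "\<not> \<bar>f v - f u\<bar> > real M * (v - u)" "\<not> f v - f u < p * (v - u)"
      using Hex[OF Hconj[OF HM p[unfolded Low_def mem_Collect_eq]]] by blast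
    then have "p * (v - u) \<le> real M * (v - u)" by linarith
    then show False using uv \<open>\<not> p \<le> real M\<close> by (simp add: mult_le_cancel_right)
  qed
  define l where "l = Sup Low"
  have bddL: "bdd_above Low" unfolding bdd_above_def using bdd by blast
  have key: "H (\<lambda>u v. \<bar>f v - f u - l * (v - u)\<bar> \<le> e * (v - u))" if e: "e > 0" for e
  proof -
    obtain p where p: "p \<in> Low" "l - e < p"
      using less_cSup_iff[OF _ bddL, of "l - e"] \<open>- real M \<in> Low\<close> e unfolding l_def by force
    \<comment> \<open>Since \<open>p'\<close> exceeds the supremum \<open>l\<close>, slopes below
      \<open>p'\<close> occur over arbitrarily short intervals; \<open>osc\<close> for the rational
      pair \<open>p' < q\<close> then bounds the slopes over all sufficiently short intervals by
      \<open>q\<close>.\<close>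
    obtain p' where p': "p' \<in> \<rat>" "l < p'" "p' < l + e" using Rats_dense_in_real[of l "l + e"] e by auto
    obtain q where q: "q \<in> \<rat>" "p' < q" "q < l + e" using Rats_dense_in_real[of p' "l + e"] p' by auto
    have "p' \<notin> Low" using p' cSup_upper[OF _ bddL] unfolding l_def by fastforce
    then have "t \<in> vitali_points (\<lambda>u v. a \<le> u \<and> v \<le> b \<and> f v - f u < p' * (v - u))"
      using notV[of "\<lambda>u v. f v - f u < p' * (v - u)"] unfolding Low_def by simp
    then have "t \<notin> vitali_points (\<lambda>u v. a \<le> u \<and> v \<le> b \<and> f v - f u > q * (v - u))"
      using osc[OF p'(1) q(1,2)] by blast
    then have "H (\<lambda>u v. \<not> f v - f u > q * (v - u))" unfolding notV .
    from Hconj[OF this p(1)[unfolded Low_def mem_Collect_eq]]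
    obtain d where d: "d > 0" "\<And>u v. u < t \<and> t < v \<and> v - u < d \<and> a \<le> u \<and> v \<le> b \<Longrightarrow>
        \<not> f v - f u > q * (v - u) \<and> \<not> f v - f u < p * (v - u)"
      unfolding H_def by blast
    have "\<bar>f v - f u - l * (v - u)\<bar> \<le> e * (v - u)" if uv: "u < t \<and> t < v \<and> v - u < d \<and> a \<le> u \<and> v \<le> b" for u v
    proof -
      have "f v - f u \<le> q * (v - u)" "p * (v - u) \<le> f v - f u" using d(2)[OF uv] by auto
      moreover have "q * (v - u) \<le> (l + e) * (v - u)" "(l - e) * (v - u) \<le> p * (v - u)"
        using uv p q by (auto intro!: mult_right_mono)
      ultimately show ?thesis by (simp add: abs_le_iff algebra_simps)
    qed
    then show ?thesis unfolding H_def using d(1) by blast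
  qed
  have ct: "isCont f t" using cont t continuous_on_interior[of "{a..b}" f t] by auto
  have "(f has_derivative (\<lambda>h. l * h)) (at t)"
    unfolding has_derivative_at_alt
  proof (intro conjI allI impI bounded_linear_mult_right)
    fix e :: real assume e: "e > 0"
    obtain d where d: "d > 0" and dd: "\<And>u v. u < t \<and> t < v \<and> v - u < d \<and> a \<le> u \<and> v \<le> b \<Longrightarrow>
        \<bar>f v - f u - l * (v - u)\<bar> \<le> e * (v - u)"
      using key[OF e] unfolding H_def by blast
    define d' where "d' = min (d/2) (min (t - a) (b - t))"
    have d': "d' > 0" "d' \<le> d/2" "d' \<le> t - a" "d' \<le> b - t" using d t unfolding d'_def by auto (simp_all add: min_def)
    have "norm (f y - f t - l * (y - t)) \<le> e * norm (y - t)" if y: "norm (y - t) < d'" for y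
    proof (cases "y = t")
      case False
      have cl: "(f \<longlongrightarrow> f t) (at_left t)" and cr: "(f \<longlongrightarrow> f t) (at_right t)"
        using ct by (auto simp: isCont_def intro: tendsto_mono[OF at_le])
      show ?thesis
      proof (cases "y > t")
        case True
        \<comment> \<open>The estimate is known only for intervals strictly around \<open>t\<close>.
          With the end \<open>y\<close> fixed, the other end tends to \<open>t\<close>.\<close>
        have "((\<lambda>u. e * (y - u) - \<bar>f y - f u - l * (y - u)\<bar>) \<longlongrightarrow> e * (y - t) - \<bar>f y - f t - l * (y - t)\<bar>) (at_left t)"
          by (intro tendsto_intros cl)
        moreover have "eventually (\<lambda>u. e * (y - u) - \<bar>f y - f u - l * (y - u)\<bar> \<ge> 0) (at_left t)"
        proof (rule eventually_mono)
          show "eventually (\<lambda>u. u \<in> {t - d'<..<t}) (at_left t)"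
            using eventually_at_left_real[of "t - d'" t] d'(1) by simp
          fix u assume "u \<in> {t - d'<..<t}"
          then have "u < t \<and> t < y \<and> y - u < d \<and> a \<le> u \<and> y \<le> b"
            using y True d' by (auto simp: abs_less_iff)
          then show "e * (y - u) - \<bar>f y - f u - l * (y - u)\<bar> \<ge> 0" using dd[of u y] by simp
        qed
        ultimately have "e * (y - t) - \<bar>f y - f t - l * (y - t)\<bar> \<ge> 0"
          by (rule tendsto_lowerbound) simp
        then show ?thesis using True by simp
      next
        case F: False
        have "((\<lambda>v. e * (v - y) - \<bar>f v - f y - l * (v - y)\<bar>) \<longlongrightarrow> e * (t - y) - \<bar>f t - f y - l * (t - y)\<bar>) (at_right t)"
          by (intro tendsto_intros cr)
        moreover have "eventually (\<lambda>v. e * (v - y) - \<bar>f v - f y - l * (v - y)\<bar> \<ge> 0) (at_right t)"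
        proof (rule eventually_mono)
          show "eventually (\<lambda>v. v \<in> {t<..<t + d'}) (at_right t)"
            using eventually_at_right_real[of t "t + d'"] d'(1) by simp
          fix v assume "v \<in> {t<..<t + d'}"
          then have "y < t \<and> t < v \<and> v - y < d \<and> a \<le> y \<and> v \<le> b"
            using y F False d' by (auto simp: abs_less_iff)
          then show "e * (v - y) - \<bar>f v - f y - l * (v - y)\<bar> \<ge> 0" using dd[of y v] by simp
        qed
        ultimately have "e * (t - y) - \<bar>f t - f y - l * (t - y)\<bar> \<ge> 0"
          by (rule tendsto_lowerbound) simp
        then show ?thesis using F False by (simp add: abs_if algebra_simps split: if_splits)
      qed
    qed auto
    then show "\<exists>d>0. \<forall>y. norm (y - t) < d \<longrightarrow> norm (f y - f t - l * (y - t)) \<le> e * norm (y - t)"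
      using d'(1) by blast
  qed
  then show ?thesis by (auto simp: differentiable_def)
qed

lemma abs_cont_on_AE_real_differentiable:
  fixes f :: "real \<Rightarrow> real"
  assumes AC: "abs_cont_on a b f"
  shows "AE t in lborel. t \<in> {a<..<b} \<longrightarrow> f differentiable (at t)"
proof -
  let ?O = "\<lambda>p q. vitali_points (\<lambda>u v. a \<le> u \<and> v \<le> b \<and> f v - f u < p * (v - u))
       \<inter> vitali_points (\<lambda>u v. a \<le> u \<and> v \<le> b \<and> f v - f u > q * (v - u))"
  let ?B = "\<Inter>M::nat. vitali_points (\<lambda>u v. a \<le> u \<and> v \<le> b \<and> \<bar>f v - f u\<bar> > real M * (v - u))"
  let ?N = "?B \<union> (\<Union>(p,q)\<in>{(p,q). p \<in> \<rat> \<and> q \<in> \<rat> \<and> p < q}. ?O p q)"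
  have "countable {(p,q). p \<in> \<rat> \<and> q \<in> \<rat> \<and> p < (q::real)}"
    by (rule countable_subset[of _ "\<rat> \<times> \<rat>"]) (auto simp: countable_rat)
  then have "?N \<in> null_sets lborel"
    by (intro null_sets.Un abs_cont_on_null_unbounded[OF AC] null_sets_UN')
       (auto intro!: abs_cont_on_null_oscillation[OF AC])
  then show ?thesis
  proof (rule AE_I')
    show "{t \<in> space lborel. \<not> (t \<in> {a<..<b} \<longrightarrow> f differentiable at t)} \<subseteq> ?N"
    proof
      fix t assume t: "t \<in> {t \<in> space lborel. \<not> (t \<in> {a<..<b} \<longrightarrow> f differentiable at t)}"
      show "t \<in> ?N"
      proof (rule ccontr)
        assume n: "t \<notin> ?N"
        have "f differentiable (at t)"
          by (rule real_differentiable_if_not_vitali[OF abs_cont_on_imp_continuous_on[OF AC]])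
             (use t n in blast)+
        then show False using t by auto
      qed
    qed
  qed
qed

section \<open>Vector-valued curves: differentiability and increments as integrals of the
  derivative\<close>

lemma abs_cont_on_AE_differentiable:
  fixes f :: "real \<Rightarrow> 'a::euclidean_space"
  assumes AC: "abs_cont_on a b f"
  shows "AE t in lborel. t \<in> {a<..<b} \<longrightarrow> f differentiable (at t)"
proof -
  have "abs_cont_on a b (\<lambda>t. f t \<bullet> i)" if i: "i \<in> Basis" for i
    unfolding abs_cont_on_def
  proof (intro allI impI)
    fix \<epsilon> :: real assume "\<epsilon> > 0"
    then obtain \<delta> where \<delta>: "\<delta> > 0" and D: "\<forall>(k::nat) (s::nat \<Rightarrow> real) (e::nat \<Rightarrow> real).
      (\<forall>i<k. a \<le> s i \<and> s i \<le> e i \<and> e i \<le> b) \<and>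
      (\<forall>i<k. \<forall>j<k. i \<noteq> j \<longrightarrow> e i \<le> s j \<or> e j \<le> s i) \<and>
      (\<Sum>i<k. e i - s i) < \<delta> \<longrightarrow> (\<Sum>i<k. norm (f (e i) - f (s i))) < \<epsilon>"
      using AC unfolding abs_cont_on_def by blast
    show "\<exists>\<delta>>0. \<forall>(k::nat) (s::nat \<Rightarrow> real) (e::nat \<Rightarrow> real).
      (\<forall>i<k. a \<le> s i \<and> s i \<le> e i \<and> e i \<le> b) \<and>
      (\<forall>i<k. \<forall>j<k. i \<noteq> j \<longrightarrow> e i \<le> s j \<or> e j \<le> s i) \<and>
      (\<Sum>i<k. e i - s i) < \<delta> \<longrightarrow> (\<Sum>j<k. norm (f (e j) \<bullet> i - f (s j) \<bullet> i)) < \<epsilon>"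
    proof (intro exI[of _ \<delta>] conjI \<delta> allI impI)
      fix k :: nat and s e :: "nat \<Rightarrow> real"
      assume *: "(\<forall>i<k. a \<le> s i \<and> s i \<le> e i \<and> e i \<le> b) \<and>
        (\<forall>i<k. \<forall>j<k. i \<noteq> j \<longrightarrow> e i \<le> s j \<or> e j \<le> s i) \<and> (\<Sum>i<k. e i - s i) < \<delta>"
      have "(\<Sum>j<k. norm (f (e j) \<bullet> i - f (s j) \<bullet> i)) \<le> (\<Sum>j<k. norm (f (e j) - f (s j)))"
        using Basis_le_norm[OF i] by (intro sum_mono) (simp add: inner_diff_left[symmetric])
      also have "\<dots> < \<epsilon>" using D * by blast
      finally show "(\<Sum>j<k. norm (f (e j) \<bullet> i - f (s j) \<bullet> i)) < \<epsilon>" .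
    qed
  qed
  then have "AE t in lborel. \<forall>i\<in>Basis. t \<in> {a<..<b} \<longrightarrow> (\<lambda>t. f t \<bullet> i) differentiable (at t)"
    by (intro AE_finite_allI finite_Basis abs_cont_on_AE_real_differentiable)
  then show ?thesis
    by eventually_elim (use differentiable_componentwise_within[of f _ UNIV] in auto)
qed

text \<open>At tags outside the null set of non-differentiability the Henstock estimate is the
  definition of the derivative; the remaining tags are confined to an open set of small measure, where
  absolute continuity controls the increments.\<close>
lemma abs_cont_on_has_integral_vector_derivative:
  fixes f :: "real \<Rightarrow> 'a::euclidean_space"
  assumes AC: "abs_cont_on a b f" and ab: "a \<le> b"
  shows "((\<lambda>t. vector_derivative f (at t)) has_integral (f b - f a)) {a..b}"
proof (cases "a = b")
  case True
  then show ?thesis by (simp add: has_integral_refl)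
next
  case False
  with ab have ab: "a < b" by simp
  define N where "N = {t\<in>{a..b}. \<not> (t \<in> {a<..<b} \<and> f differentiable (at t))}"
  \<comment> \<open>The value on the null set \<open>N\<close> is free. With 0, a tag in
    \<open>N\<close> contributes nothing to the Riemann sum and its error is just the increment of
    \<open>f\<close>.\<close>
  define g where "g = (\<lambda>t. if t \<in> N then 0 else vector_derivative f (at t))"
  have negl: "negligible N"
  proof -
    obtain Z where Z: "Z \<in> null_sets lborel" "{t \<in> space lborel. \<not> (t \<in> {a<..<b} \<longrightarrow> f differentiable (at t))} \<subseteq> Z"
      using abs_cont_on_AE_differentiable[OF AC] by (auto simp: eventually_ae_filter)
    have "negligible Z" using Z by (simp add: negligible_iff_null_sets null_sets_completionI)
    then have "negligible (Z \<union> {a,b})" by (simp add: negligible_Un)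
    moreover have "N \<subseteq> Z \<union> {a,b}" using Z(2) by (force simp: N_def)
    ultimately show ?thesis by (rule negligible_subset)
  qed
  have "(g has_integral (f b - f a)) {a..b}"
    unfolding has_integral_real
  proof (intro allI impI)
    fix e :: real assume e: "e > 0"
    \<comment> \<open>Half of \<open>e\<close> is spent on the tags outside \<open>N\<close>, at
      rate \<open>e1\<close> per unit length; the other half bounds the increments over the cells
      tagged in \<open>N\<close>.\<close>
    define e1 where "e1 = e / (2 * (b - a))"
    have e1: "e1 > 0" "e1 * (b - a) = e / 2" using e ab by (simp_all add: e1_def field_simps)
    obtain \<delta> where \<delta>: "\<delta> > 0" and D: "\<forall>(P::(real \<times> real set) set) s t. finite P \<longrightarrow> (\<forall>i\<in>P. a \<le> s i \<and> s i \<le> t i \<and> t i \<le> b) \<longrightarrow>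
       (\<forall>i\<in>P. \<forall>j\<in>P. i \<noteq> j \<longrightarrow> t i \<le> s j \<or> t j \<le> s i) \<longrightarrow>
       (\<Sum>i\<in>P. t i - s i) < \<delta> \<longrightarrow> (\<Sum>i\<in>P. norm (f (t i) - f (s i))) < e/2"
      using abs_cont_on_finite_family[OF AC half_gt_zero[OF e]] by blast
    obtain U where U: "open U" "N \<subseteq> U" "U \<in> lmeasurable" "measure lebesgue U < \<delta>"
    proof -
      have N0: "N \<in> lmeasurable" "measure lebesgue N = 0" using negl by (auto simp: negligible_iff_measure)
      obtain V where V: "open V" "N \<subseteq> V" "V - N \<in> lmeasurable" "emeasure lebesgue (V - N) < ennreal \<delta>"
        using sets_lebesgue_outer_open[OF fmeasurableD[OF N0(1)] \<delta>] by metis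
      have "V \<in> lmeasurable" using N0 V by (metis Un_Diff_cancel2 fmeasurable.Un sup.absorb_iff1)
      moreover have "measure lebesgue V = measure lebesgue (V - N)"
        using measurable_measure_Diff[OF \<open>V \<in> lmeasurable\<close> fmeasurableD[OF N0(1)] V(2)] N0 by simp
      ultimately show ?thesis using that V \<delta> by (simp add: emeasure_eq_measure2 ennreal_less_iff)
    qed
    have "\<exists>d>0. if x \<in> N then ball x d \<subseteq> U else
        x \<in> {a..b} \<longrightarrow> (\<forall>y. norm (y - x) < d \<longrightarrow> norm (f y - f x - (y - x) *\<^sub>R g x) \<le> e1 * norm (y - x))" for x
    proof -
      consider "x \<in> N" | "x \<notin> N" "x \<notin> {a..b}" | "x \<notin> N" "x \<in> {a..b}" by blast
      then show ?thesis
      proof cases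
        case 1
        then show ?thesis using U(1,2) open_contains_ball[of U] by (simp add: subset_iff)
      next
        case 2
        then show ?thesis by (intro exI[of _ 1]) auto
      next
        case 3
      then have "f differentiable (at x)" "x \<notin> N" by (auto simp: N_def)
      then have "(f has_vector_derivative g x) (at x)"
        by (simp add: g_def vector_derivative_works)
      then show ?thesis using \<open>x \<notin> N\<close> e1(1)
        unfolding has_vector_derivative_def has_derivative_at_alt by auto
      qed
    qed
    then obtain d where d0: "\<And>x. d x > 0" and dN: "\<And>x. x \<in> N \<Longrightarrow> ball x (d x) \<subseteq> U"
      and dg: "\<And>x y. x \<notin> N \<Longrightarrow> x \<in> {a..b} \<Longrightarrow> norm (y - x) < d x \<Longrightarrow> norm (f y - f x - (y - x) *\<^sub>R g x) \<le> e1 * norm (y - x)"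
      by metis
    show "\<exists>\<gamma>. gauge \<gamma> \<and> (\<forall>\<D>. \<D> tagged_division_of {a..b} \<and> \<gamma> fine \<D> \<longrightarrow>
        norm ((\<Sum>(x,k)\<in>\<D>. measure lborel k *\<^sub>R g x) - (f b - f a)) < e)"
    proof (intro exI[of _ "\<lambda>x. ball x (d x)"] conjI allI impI)
      show "gauge (\<lambda>x. ball x (d x))" using d0 gauge_ball_dependent by blast
      fix p assume "p tagged_division_of {a..b} \<and> (\<lambda>x. ball x (d x)) fine p"
      then have p: "p tagged_division_of {a..b}" and fine: "(\<lambda>x. ball x (d x)) fine p" by auto
      have finp: "finite p" using p by auto
      have el: "\<exists>u v. k = {u..v} \<and> u \<le> x \<and> x \<le> v \<and> a \<le> u \<and> v \<le> b \<and> {u..v} \<subseteq> ball x (d x)"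
        if xk: "(x,k) \<in> p" for x k
      proof -
        have "x \<in> k" "k \<subseteq> {a..b}" "\<exists>u v. k = cbox u v" using p xk by blast+
        moreover have "k \<subseteq> ball x (d x)" using fine xk by (auto simp: fine_def)
        ultimately show ?thesis by (auto simp: cbox_interval)
      qed
      define \<Delta> where "\<Delta> = (\<lambda>(x::real,k::real set). f (Sup k) - f (Inf k))"
      have sumD: "f b - f a = (\<Sum>i\<in>p. \<Delta> i)"
        using additive_tagged_division_1[of a b p f] ab p by (simp add: \<Delta>_def)
      have sumL: "b - a = (\<Sum>(x,k)\<in>p. Sup k - Inf k)"
        using additive_tagged_division_1[of a b p "\<lambda>x. x"] ab p by simp
      \<comment> \<open>Degenerate cells are excluded: disjointness of interiors does not order them
        relative to other cells, and their increment vanishes anyway.\<close>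
      define Q where "Q = {i\<in>p. fst i \<in> N \<and> Inf (snd i) < Sup (snd i)}"
      have IS: "k = {Inf k..Sup k} \<and> Inf k \<le> x \<and> x \<le> Sup k \<and> a \<le> Inf k \<and> Sup k \<le> b \<and> k \<subseteq> ball x (d x)"
        if "(x,k) \<in> p" for x k
        using el[OF that] by force
      have "(\<Sum>i\<in>Q. norm (f (Sup (snd i)) - f (Inf (snd i)))) < e/2"
      proof (rule D[rule_format])
        show "finite Q" using finp by (simp add: Q_def)
        fix i assume "i \<in> Q"
        then show "a \<le> Inf (snd i) \<and> Inf (snd i) \<le> Sup (snd i) \<and> Sup (snd i) \<le> b"
          using IS[of "fst i" "snd i"] by (auto simp: Q_def)
      next
        fix i j assume ij: "i \<in> Q" "j \<in> Q" "i \<noteq> j"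
        have "interior (snd i) \<inter> interior (snd j) = {}"
          using tagged_division_ofD(5)[OF p, of "fst i" "snd i" "fst j" "snd j"] ij by (auto simp: Q_def prod_eq_iff)
        moreover have "interior (snd i) = {Inf (snd i)<..<Sup (snd i)}" if "i \<in> Q" for i
          using IS[of "fst i" "snd i"] that interior_atLeastAtMost_real by (metis (no_types, lifting) Q_def mem_Collect_eq prod.collapse)
        ultimately have dis: "{Inf (snd i)<..<Sup (snd i)} \<inter> {Inf (snd j)<..<Sup (snd j)} = {}"
          using ij by auto
        show "Sup (snd i) \<le> Inf (snd j) \<or> Sup (snd j) \<le> Inf (snd i)"
        proof (rule ccontr)
          assume "\<not> ?thesis"
          then have "(max (Inf (snd i)) (Inf (snd j)) + min (Sup (snd i)) (Sup (snd j))) / 2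
              \<in> {Inf (snd i)<..<Sup (snd i)} \<inter> {Inf (snd j)<..<Sup (snd j)}"
            using ij by (auto simp: Q_def max_def min_def)
          with dis show False by blast
        qed
      next
        have "(\<Sum>i\<in>Q. Sup (snd i) - Inf (snd i)) \<le> measure lebesgue U"
        proof (rule sum_disjoint_intervals_le_measure[OF _ U(3)])
          show "finite Q" using finp by (simp add: Q_def)
          fix i assume i: "i \<in> Q"
          then have "snd i = {Inf (snd i)..Sup (snd i)}" "snd i \<subseteq> U"
            using IS[of "fst i" "snd i"] dN[of "fst i"] by (auto simp: Q_def)
          moreover have "{Inf (snd i)<..<Sup (snd i)} \<subseteq> {Inf (snd i)..Sup (snd i)}" by auto
          ultimately show "Inf (snd i) \<le> Sup (snd i) \<and> {Inf (snd i)<..<Sup (snd i)} \<subseteq> U"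
            using i by (metis (no_types, lifting) Q_def less_imp_le mem_Collect_eq subset_trans)
        next
          fix i j assume ij: "i \<in> Q" "j \<in> Q" "i \<noteq> j"
          have "interior (snd i) \<inter> interior (snd j) = {}"
            using tagged_division_ofD(5)[OF p, of "fst i" "snd i" "fst j" "snd j"] ij by (auto simp: Q_def prod_eq_iff)
          moreover have "interior (snd i) = {Inf (snd i)<..<Sup (snd i)}" if "i \<in> Q" for i
            using IS[of "fst i" "snd i"] that interior_atLeastAtMost_real by (metis (no_types, lifting) Q_def mem_Collect_eq prod.collapse)
          ultimately show "{Inf (snd i)<..<Sup (snd i)} \<inter> {Inf (snd j)<..<Sup (snd j)} = {}"
            using ij by auto
        qed
        then show "(\<Sum>i\<in>Q. Sup (snd i) - Inf (snd i)) < \<delta>" using U(4) by linarith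
      qed
      then have bQ: "(\<Sum>i\<in>Q. norm (\<Delta> i)) < e/2" by (simp add: \<Delta>_def case_prod_beta)
      have pt: "norm ((case i of (x,k) \<Rightarrow> measure lborel k *\<^sub>R g x) - \<Delta> i)
          \<le> (case i of (x,k) \<Rightarrow> e1 * (Sup k - Inf k)) + (if i \<in> Q then norm (\<Delta> i) else 0)" if i: "i \<in> p" for i
      proof -
        obtain x k where xk: "i = (x,k)" by force
        define u v where "u = Inf k" and "v = Sup k"
        have k: "k = {u..v}" "u \<le> x" "x \<le> v" "a \<le> u" "v \<le> b" "k \<subseteq> ball x (d x)"
          using IS[of x k] i xk by (auto simp: u_def v_def)
        have con: "measure lborel k = v - u" using k by auto
        show ?thesis
        proof (cases "x \<in> N")
          case True
          have "g x = 0" using True by (simp add: g_def)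
          then have "norm ((case i of (x,k) \<Rightarrow> measure lborel k *\<^sub>R g x) - \<Delta> i) = norm (\<Delta> i)"
            by (simp add: xk)
          moreover have "i \<in> Q \<or> \<Delta> i = 0"
          proof (cases "u < v")
            case True
            then show ?thesis using i xk \<open>x \<in> N\<close> by (simp add: Q_def u_def v_def)
          next
            case False
            then have "u = v" using k by simp
            then show ?thesis by (simp add: xk \<Delta>_def u_def v_def)
          qed
          moreover have "e1 * (v - u) \<ge> 0" using e1 k by simp
          ultimately show ?thesis by (auto simp: xk u_def v_def)
        next
          case False
          have "u \<in> ball x (d x)" "v \<in> ball x (d x)" using k by (metis atLeastAtMost_iff order_refl order_trans subsetD)+
          then have "norm (f u - f x - (u - x) *\<^sub>R g x) \<le> e1 * norm (u - x)"
              "norm (f v - f x - (v - x) *\<^sub>R g x) \<le> e1 * norm (v - x)"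
            using dg[OF False, of u] dg[OF False, of v] k by (auto simp: dist_real_def)
          moreover have "norm ((v - u) *\<^sub>R g x - (f v - f u)) \<le> norm (f u - f x - (u - x) *\<^sub>R g x) + norm (f v - f x - (v - x) *\<^sub>R g x)"
          proof -
            have "(v - u) *\<^sub>R g x - (f v - f u) = (f u - f x - (u - x) *\<^sub>R g x) - (f v - f x - (v - x) *\<^sub>R g x)"
              by (simp add: algebra_simps)
            then show ?thesis by (metis norm_triangle_ineq4)
          qed
          moreover have "e1 * norm (u - x) + e1 * norm (v - x) = e1 * (v - u)"
            using k by (simp add: algebra_simps)
          ultimately have "norm ((v - u) *\<^sub>R g x - (f v - f u)) \<le> e1 * (v - u)" by linarith
          moreover have "i \<notin> Q" using False xk by (auto simp: Q_def)
          ultimately show ?thesis by (simp add: xk con \<Delta>_def u_def[symmetric] v_def[symmetric])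
        qed
      qed
      have "norm ((\<Sum>(x,k)\<in>p. measure lborel k *\<^sub>R g x) - (f b - f a))
          = norm (\<Sum>i\<in>p. (case i of (x,k) \<Rightarrow> measure lborel k *\<^sub>R g x) - \<Delta> i)"
        unfolding sumD by (simp add: sum_subtractf)
      also have "\<dots> \<le> (\<Sum>i\<in>p. (case i of (x,k) \<Rightarrow> e1 * (Sup k - Inf k)) + (if i \<in> Q then norm (\<Delta> i) else 0))"
        by (rule sum_norm_le) (rule pt)
      also have "\<dots> = e1 * (\<Sum>(x,k)\<in>p. Sup k - Inf k) + (\<Sum>i\<in>Q. norm (\<Delta> i))"
      proof -
        have "(\<Sum>i\<in>p. if i \<in> Q then norm (\<Delta> i) else 0) = (\<Sum>i\<in>Q. norm (\<Delta> i))"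
          using finp by (intro sum.mono_neutral_cong_right) (auto simp: Q_def)
        then show ?thesis by (simp add: sum.distrib sum_distrib_left case_prod_beta)
      qed
      also have "\<dots> < e" using bQ e1 sumL by simp
      finally show "norm ((\<Sum>(x,k)\<in>p. measure lborel k *\<^sub>R g x) - (f b - f a)) < e" .
    qed
  qed
  then show ?thesis
    by (rule has_integral_spike[OF negl, rotated]) (auto simp: g_def)
qed

text \<open>The Cauchy criterion for the difference quotient, with all quantifiers over countable
  sets. Continuity of \<open>f\<close> allows the increments to be restricted to rationals. This is
  the form from which the set of differentiability is seen to be Borel.\<close>

lemma differentiable_real_iff_rational_Cauchy:
  fixes f :: "real \<Rightarrow> 'a::euclidean_space"
  assumes cont: "continuous_on UNIV f"
  shows "f differentiable (at t) \<longleftrightarrow> (\<forall>k::nat. \<exists>n::nat. \<forall>h\<in>\<rat>. \<forall>h'\<in>\<rat>. h \<noteq> 0 \<longrightarrow> h' \<noteq> 0 \<longrightarrow>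
     \<bar>h\<bar> < 1 / Suc n \<longrightarrow> \<bar>h'\<bar> < 1 / Suc n \<longrightarrow>
     norm ((f (t + h) - f t) /\<^sub>R h - (f (t + h') - f t) /\<^sub>R h') \<le> 1 / Suc k)" (is "_ \<longleftrightarrow> ?R")
proof
  define q where "q = (\<lambda>h. (f (t + h) - f t) /\<^sub>R h)"
  assume "f differentiable (at t)"
  then obtain D where "(f has_vector_derivative D) (at t)"
    using vector_derivative_works by blast
  then have fd: "\<And>e. e > 0 \<Longrightarrow> \<exists>d>0. \<forall>y. norm (y - t) < d \<longrightarrow> norm (f y - f t - (y - t) *\<^sub>R D) \<le> e * norm (y - t)"
    unfolding has_vector_derivative_def has_derivative_at_alt by blast
  show ?R
  proof
    fix k :: nat
    obtain d where d: "d > 0" "\<forall>y. norm (y - t) < d \<longrightarrow> norm (f y - f t - (y - t) *\<^sub>R D) \<le> (1 / (2 * Suc k)) * norm (y - t)"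
      using fd[of "1 / (2 * Suc k)"] by auto
    have dq: "dist (q h) D \<le> 1 / (2 * Suc k)" if h: "h \<noteq> 0" "\<bar>h\<bar> < d" for h
    proof -
      have "f (t + h) - f t - h *\<^sub>R D = h *\<^sub>R (q h - D)" using h by (simp add: q_def scaleR_diff_right)
      moreover have "norm (f (t + h) - f t - h *\<^sub>R D) \<le> (1 / (2 * Suc k)) * \<bar>h\<bar>"
        using d(2)[rule_format, of "t + h"] h by simp
      ultimately have "\<bar>h\<bar> * norm (q h - D) \<le> \<bar>h\<bar> * (1 / (2 * Suc k))" by (simp add: mult.commute)
      then show ?thesis using h by (subst (asm) mult_le_cancel_left_pos) (auto simp: dist_norm)
    qed
    obtain n :: nat where n: "1 / Suc n < d" using d(1) nat_approx_posE by blast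
    have "norm (q h - q h') \<le> 1 / Suc k" if "h \<noteq> 0" "h' \<noteq> 0" "\<bar>h\<bar> < 1 / Suc n" "\<bar>h'\<bar> < 1 / Suc n" for h h'
    proof -
      have "dist (q h) (q h') \<le> dist (q h) D + dist (q h') D" by (rule dist_triangle2)
      also have "\<dots> \<le> 1 / (2 * Suc k) + 1 / (2 * Suc k)"
        using that n by (intro add_mono dq) auto
      also have "\<dots> = 1 / Suc k" by (simp add: field_simps)
      finally show ?thesis by (simp add: dist_norm)
    qed
    then show "\<exists>n. \<forall>h\<in>\<rat>. \<forall>h'\<in>\<rat>. h \<noteq> 0 \<longrightarrow> h' \<noteq> 0 \<longrightarrow> \<bar>h\<bar> < 1 / Suc n \<longrightarrow> \<bar>h'\<bar> < 1 / Suc n \<longrightarrow>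
       norm ((f (t + h) - f t) /\<^sub>R h - (f (t + h') - f t) /\<^sub>R h') \<le> 1 / Suc k"
      unfolding q_def by blast
  qed
next
  define q where "q = (\<lambda>h. (f (t + h) - f t) /\<^sub>R h)"
  assume R: ?R
  have qR: "\<exists>n::nat. \<forall>h\<in>\<rat>. \<forall>h'\<in>\<rat>. h \<noteq> 0 \<longrightarrow> h' \<noteq> 0 \<longrightarrow> \<bar>h\<bar> < 1 / Suc n \<longrightarrow> \<bar>h'\<bar> < 1 / Suc n \<longrightarrow>
       norm (q h - q h') \<le> 1 / Suc k" for k :: nat
    using R unfolding q_def by blast
  define x where "x = (\<lambda>m::nat. q (1 / (real m + 1)))"
  have small: "\<exists>M. \<forall>m\<ge>M. \<bar>1 / (real m + 1)\<bar> < 1 / Suc n" for n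
    by (rule exI[of _ "Suc n"]) (auto simp: field_simps)
  have "Cauchy x"
  proof (rule metric_CauchyI)
    fix e :: real assume "e > 0"
    then obtain k :: nat where k: "1 / Suc k < e" using nat_approx_posE by blast
    obtain n where n: "\<forall>h\<in>\<rat>. \<forall>h'\<in>\<rat>. h \<noteq> 0 \<longrightarrow> h' \<noteq> 0 \<longrightarrow> \<bar>h\<bar> < 1 / Suc n \<longrightarrow> \<bar>h'\<bar> < 1 / Suc n \<longrightarrow>
       norm (q h - q h') \<le> 1 / Suc k" using qR by blast
    obtain M where M: "\<forall>m\<ge>M. \<bar>1 / (real m + 1)\<bar> < 1 / Suc n" using small by blast
    have "dist (x m) (x m') < e" if "m \<ge> M" "m' \<ge> M" for m m'
    proof -
      have "norm (q (1 / (real m + 1)) - q (1 / (real m' + 1))) \<le> 1 / Suc k"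
        using that M by (intro n[rule_format]) auto
      then show ?thesis using k by (simp add: x_def dist_norm)
    qed
    then show "\<exists>M. \<forall>m\<ge>M. \<forall>n\<ge>M. dist (x m) (x n) < e" by blast
  qed
  then obtain D where D: "x \<longlonglongrightarrow> D" using Cauchy_convergent convergent_def by blast
  have "(q \<longlongrightarrow> D) (at 0)"
  proof (rule tendstoI)
    fix e :: real assume "e > 0"
    then obtain k :: nat where k: "1 / Suc k < e" using nat_approx_posE by blast
    obtain n where n: "\<forall>h\<in>\<rat>. \<forall>h'\<in>\<rat>. h \<noteq> 0 \<longrightarrow> h' \<noteq> 0 \<longrightarrow> \<bar>h\<bar> < 1 / Suc n \<longrightarrow> \<bar>h'\<bar> < 1 / Suc n \<longrightarrow>
       norm (q h - q h') \<le> 1 / Suc k" using qR by blast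
    obtain M where M: "\<forall>m\<ge>M. \<bar>1 / (real m + 1)\<bar> < 1 / Suc n" using small by blast
    have rat: "norm (q h - D) \<le> 1 / Suc k" if h: "h \<in> \<rat>" "h \<noteq> 0" "\<bar>h\<bar> < 1 / Suc n" for h
    proof (rule tendsto_upperbound)
      show "(\<lambda>m. norm (q h - x m)) \<longlonglongrightarrow> norm (q h - D)" by (intro tendsto_intros D)
      show "\<forall>\<^sub>F m in sequentially. norm (q h - x m) \<le> 1 / Suc k"
        using eventually_ge_at_top[of M]
      proof eventually_elim
        case (elim m)
        then show ?case unfolding x_def using M h by (intro n[rule_format]) auto
      qed
    qed simp
    \<comment> \<open>Rational increments tending to \<open>h\<close> can be kept nonzero and inside
      the window, so the bound \<open>rat\<close> passes to \<open>h\<close>.\<close>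
    have "norm (q h - D) \<le> 1 / Suc k" if h: "h \<noteq> 0" "\<bar>h\<bar> < 1 / Suc n" for h
    proof -
      have "h \<in> closure (\<rat> \<inter> ({-1 / Suc n<..<1 / Suc n} - {0}))"
      proof -
        have "open ({-1 / Suc n<..<1 / Suc n} - {0::real})" by (intro open_Diff) auto
        moreover have "closure (\<rat>::real set) = UNIV"
          by (simp add: Rats_closure_real)
        ultimately show ?thesis using open_Int_closure_subset[of "{-1 / Suc n<..<1 / Suc n} - {0::real}" \<rat>] h
          by (auto simp: Int_commute abs_less_iff)
      qed
      then obtain y where y: "\<And>m. y m \<in> \<rat> \<inter> ({-1 / Suc n<..<1 / Suc n} - {0})" "y \<longlonglongrightarrow> h"
        unfolding closure_sequential by blast
      have "isCont f (t + h)" using cont by (simp add: continuous_on_eq_continuous_at)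
      then have "(\<lambda>m. f (t + y m)) \<longlonglongrightarrow> f (t + h)"
        using y(2) by (intro isCont_tendsto_compose[of _ f]) (auto intro: tendsto_intros)
      then have "(\<lambda>m. norm (q (y m) - D)) \<longlonglongrightarrow> norm (q h - D)"
        unfolding q_def using y(2) h by (intro tendsto_intros) auto
      then show ?thesis
      proof (rule tendsto_upperbound)
        have "norm (q (y m) - D) \<le> 1 / Suc k" for m
          using y(1)[of m] by (intro rat) (auto simp: abs_less_iff)
        then show "\<forall>\<^sub>F m in sequentially. norm (q (y m) - D) \<le> 1 / Suc k" by simp
      qed simp
    qed
    then have "dist (q h) D < e" if "h \<noteq> 0" "\<bar>h\<bar> < 1 / Suc n" for h
      using that k by (force simp: dist_norm)
    then show "\<forall>\<^sub>F h in at 0. dist (q h) D < e"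
      unfolding eventually_at by (intro exI[of _ "1 / Suc n"]) (auto simp: dist_real_def)
  qed
  note qD = this
  have "(f has_derivative (\<lambda>h. h *\<^sub>R D)) (at t)"
    unfolding has_derivative_at_alt
  proof (intro conjI allI impI bounded_linear_scaleR_left)
    fix e :: real assume "e > 0"
    then obtain d where d: "d > 0" "\<forall>h. h \<noteq> 0 \<and> \<bar>h\<bar> < d \<longrightarrow> dist (q h) D < e"
      using tendstoD[OF qD, of e] unfolding eventually_at by (auto simp: dist_real_def)
    have "norm (f y - f t - (y - t) *\<^sub>R D) \<le> e * norm (y - t)" if y: "norm (y - t) < d" for y
    proof (cases "y = t")
      case False
      define h where "h = y - t"
      have h: "h \<noteq> 0" "\<bar>h\<bar> < d" "y = t + h" using False y by (auto simp: h_def)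
      have "f y - f t - h *\<^sub>R D = h *\<^sub>R (q h - D)" using h by (simp add: q_def scaleR_diff_right)
      then have "norm (f y - f t - h *\<^sub>R D) = \<bar>h\<bar> * norm (q h - D)" by simp
      also have "\<dots> \<le> \<bar>h\<bar> * e" using d(2) h(1,2) by (intro mult_left_mono) (auto simp: dist_norm)
      finally show ?thesis by (simp add: h_def mult.commute)
    qed simp
    then show "\<exists>d>0. \<forall>y. norm (y - t) < d \<longrightarrow> norm (f y - f t - (y - t) *\<^sub>R D) \<le> e * norm (y - t)"
      using d(1) by blast
  qed
  then show "f differentiable (at t)" by (auto simp: differentiable_def)
qed

text \<open>On the Borel set of differentiability the derivative is a limit of difference quotients.
  Off it, \<open>vector_derivative\<close> chooses from an empty predicate, which gives the same
  value \<open>SOME y. False\<close> at every point.\<close>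

lemma borel_measurable_vector_derivative:
  fixes f :: "real \<Rightarrow> 'a::euclidean_space"
  assumes cont: "continuous_on UNIV f"
  shows "(\<lambda>t. vector_derivative f (at t)) \<in> borel_measurable borel"
proof -
  have f[measurable]: "f \<in> borel_measurable borel" using cont by (rule borel_measurable_continuous_onI)
  have [measurable]: "{t. f differentiable (at t)} \<in> sets borel"
    unfolding differentiable_real_iff_rational_Cauchy[OF cont]
  proof -
    have "{t. \<forall>k::nat. \<exists>n::nat. \<forall>h\<in>\<rat>. \<forall>h'\<in>\<rat>. h \<noteq> 0 \<longrightarrow> h' \<noteq> 0 \<longrightarrow>
       \<bar>h\<bar> < 1 / Suc n \<longrightarrow> \<bar>h'\<bar> < 1 / Suc n \<longrightarrow>
       norm ((f (t + h) - f t) /\<^sub>R h - (f (t + h') - f t) /\<^sub>R h') \<le> 1 / Suc k}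
     = (\<Inter>k::nat. \<Union>n::nat. \<Inter>h\<in>\<rat>. \<Inter>h'\<in>\<rat>. {t. h \<noteq> 0 \<longrightarrow> h' \<noteq> 0 \<longrightarrow>
       \<bar>h\<bar> < 1 / Suc n \<longrightarrow> \<bar>h'\<bar> < 1 / Suc n \<longrightarrow>
       norm ((f (t + h) - f t) /\<^sub>R h - (f (t + h') - f t) /\<^sub>R h') \<le> 1 / Suc k})" (is "?A = _")
      by auto
    also have "\<dots> \<in> sets borel"
    proof (intro sets.countable_INT'' sets.countable_UN sets.countable_INT' countable_rat image_subsetI)
    qed (auto intro: Rats_0)
    finally show "?A \<in> sets borel" .
  qed
  define q where "q = (\<lambda>(m::nat) t. (f (t + 1 / Suc m) - f t) /\<^sub>R (1 / Suc m))"
  have [measurable]: "q m \<in> borel_measurable borel" for m unfolding q_def by measurable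
  have "vector_derivative f (at t) = (if f differentiable (at t) then lim (\<lambda>m. q m t) else (SOME y. False))" for t
  proof (cases "f differentiable (at t)")
    case True
    then have d: "(f has_vector_derivative vector_derivative f (at t)) (at t)"
      using vector_derivative_works by blast
    have "(\<lambda>m. q m t) \<longlonglongrightarrow> vector_derivative f (at t)"
    proof (rule LIMSEQ_I)
      fix e :: real assume "e > 0"
      then obtain d where d: "d > 0" "\<And>y. norm (y - t) < d \<Longrightarrow> norm (f y - f t - (y - t) *\<^sub>R vector_derivative f (at t)) \<le> (e/2) * norm (y - t)"
        using d unfolding has_vector_derivative_def has_derivative_at_alt by (meson half_gt_zero)
      obtain M :: nat where M: "1 / Suc M < d" using d(1) nat_approx_posE by blast
      have "norm (q m t - vector_derivative f (at t)) < e" if "m \<ge> M" for m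
      proof -
        have "1 / Suc m \<le> 1 / Suc M" using that by (simp add: field_simps)
        then have "norm (f (t + 1 / Suc m) - f t - (1 / Suc m) *\<^sub>R vector_derivative f (at t)) \<le> (e/2) * (1 / Suc m)"
          using d(2)[of "t + 1 / Suc m"] M by simp
        moreover have "f (t + c) - f t - c *\<^sub>R D = c *\<^sub>R ((f (t + c) - f t) /\<^sub>R c - D)" if "c \<noteq> 0" for c D
          using that by (simp add: scaleR_diff_right)
        then have "f (t + 1 / Suc m) - f t - (1 / Suc m) *\<^sub>R vector_derivative f (at t) = (1 / Suc m) *\<^sub>R (q m t - vector_derivative f (at t))"
          unfolding q_def by simp
        ultimately have "(1 / Suc m) * norm (q m t - vector_derivative f (at t)) \<le> (1 / Suc m) * (e/2)"
          by (simp add: mult.commute)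
        then have "norm (q m t - vector_derivative f (at t)) \<le> e/2"
          by (subst (asm) mult_le_cancel_left_pos) auto
        then show ?thesis using \<open>e > 0\<close> by simp
      qed
      then show "\<exists>M. \<forall>m\<ge>M. norm (q m t - vector_derivative f (at t)) < e" by blast
    qed
    then show ?thesis using True by (simp add: limI)
  next
    case False
    then have "(\<lambda>D. (f has_vector_derivative D) (at t)) = (\<lambda>D. False)"
      using differentiableI_vector by blast
    then show ?thesis using False unfolding vector_derivative_def by simp
  qed
  moreover have "(\<lambda>t. if t \<in> {t. f differentiable (at t)} then lim (\<lambda>m. q m t) else (SOME y. False)) \<in> borel_measurable borel"
    by (intro measurable_If_set borel_measurable_lim_metric) (auto simp: q_def)
  ultimately show ?thesis by simp
qed

text \<open>Tychonoff's theorem makes the cube compact, and a countable index type makes the product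
  first countable, so compactness is sequential.\<close>

lemma bounded_functions_subsequence:
  fixes g :: "nat \<Rightarrow> 'i::countable \<Rightarrow> real"
  assumes "\<And>n i. a \<le> g n i \<and> g n i \<le> b"
  obtains r p where "strict_mono (r::nat \<Rightarrow> nat)" "\<And>i. (\<lambda>n. g (r n) i) \<longlonglongrightarrow> p i"
proof -
  have "compactin (product_topology (\<lambda>i. euclidean) UNIV) (PiE UNIV (\<lambda>i::'i. {a..b}))"
    by (subst compactin_PiE) auto
  then have "compact (PiE UNIV (\<lambda>i::'i. {a..b}))"
    by (simp add: euclidean_product_topology compactin_euclidean_iff)
  then have "seq_compact (PiE UNIV (\<lambda>i::'i. {a..b}))" using compact_imp_seq_compact by blast
  moreover have "\<forall>n. g n \<in> PiE UNIV (\<lambda>i. {a..b})" using assms by auto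
  ultimately obtain p r where r: "strict_mono (r::nat\<Rightarrow>nat)" "(g \<circ> r) \<longlonglongrightarrow> p"
    unfolding seq_compact_def by blast
  have "(\<lambda>n. g (r n) i) \<longlonglongrightarrow> p i" for i
  proof -
    have "isCont (\<lambda>x::'i \<Rightarrow> real. x i) p"
      by (metis UNIV_I continuous_on_eq_continuous_at continuous_on_product_coordinates open_UNIV)
    from isCont_tendsto_compose[OF this r(2)] show ?thesis by (simp add: o_def)
  qed
  with r(1) that show ?thesis by blast
qed

section \<open>Sequential compactness of laws\<close>

text \<open>The unit interval is subdivided into consecutive intervals of lengths \<open>p w\<close>, refined letter by
  letter. The words produced here are reversed: the letter added at step \<open>k\<close> is the head.\<close>

context
  fixes Z :: "nat \<Rightarrow> nat" and p :: "nat list \<Rightarrow> real"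
begin

text \<open>The left endpoint of the interval belonging to a word. Words are built with the newest
  letter at the head, whereas \<open>p\<close> reads them in natural order, hence
  \<open>rev\<close>.\<close>

primrec subdivision_start :: "nat list \<Rightarrow> real" where
  "subdivision_start [] = 0"
| "subdivision_start (i # v) = subdivision_start v + (\<Sum>j<i. p (rev v @ [j]))"

primrec subdivision_word :: "nat \<Rightarrow> real \<Rightarrow> nat list" where
  "subdivision_word 0 u = []"
| "subdivision_word (Suc k) u = (let v = subdivision_word k u
     in (LEAST i. u < subdivision_start v + (\<Sum>j\<le>i. p (rev v @ [j]))) # v)"

context
  assumes p_nonneg: "\<And>w. 0 \<le> p w" and p_Nil: "p [] = 1"
    and p_add: "\<And>w. p w = (\<Sum>i<Z (length w). p (w @ [i]))"
begin

lemma subdivision_word_length [simp]: "length (subdivision_word k u) = k"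
  by (induction k) (auto simp: Let_def)

text \<open>By \<open>p_add\<close> the intervals of the children fill that of the parent, so the
  \<open>LEAST\<close> letter exists; its defining property gives the upper bound and its minimality
  the lower one.\<close>

lemma subdivision_word_bounds:
  assumes "0 \<le> u" "u < 1"
  shows "subdivision_start (subdivision_word k u) \<le> u
    \<and> u < subdivision_start (subdivision_word k u) + p (rev (subdivision_word k u))"
proof (induction k)
  case 0
  then show ?case using assms p_Nil by simp
next
  case (Suc k)
  define v where "v = subdivision_word k u"
  define P where "P = (\<lambda>i. u < subdivision_start v + (\<Sum>j\<le>i. p (rev v @ [j])))"
  define i where "i = (LEAST i. P i)"
  have W: "subdivision_word (Suc k) u = i # v" by (simp add: Let_def v_def i_def P_def)
  have lv: "length v = k" by (simp add: v_def)
  have sum: "p (rev v) = (\<Sum>i<Z k. p (rev v @ [i]))" using p_add[of "rev v"] lv by simp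
  have IH: "subdivision_start v \<le> u" "u < subdivision_start v + p (rev v)" using Suc by (auto simp: v_def)
  then have "Z k \<noteq> 0" using sum by (intro notI) simp
  then obtain n where n: "Z k = Suc n" using not0_implies_Suc by blast
  have "P n" unfolding P_def using IH(2) sum n by (simp add: lessThan_Suc_atMost)
  then have Pi: "P i" unfolding i_def by (rule LeastI)
  have "subdivision_start v + (\<Sum>j<i. p (rev v @ [j])) \<le> u"
  proof (cases i)
    case 0
    then show ?thesis using IH by simp
  next
    case (Suc i')
    then have "\<not> P i'" unfolding i_def using not_less_Least[of i' P] by simp
    then show ?thesis unfolding P_def Suc by (simp add: lessThan_Suc_atMost)
  qed
  moreover have "u < subdivision_start v + (\<Sum>j<i. p (rev v @ [j])) + p (rev v @ [i])"
    using Pi unfolding P_def by (simp add: lessThan_Suc_atMost[symmetric])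
  ultimately show ?case unfolding W by simp
qed

text \<open>Converse of \<open>subdivision_word_bounds\<close>. Together they identify the set of
  \<open>u\<close> with a given admissible word as one half-open interval of length
  \<open>p\<close>, from which measurability and the measure of these sets are read off.\<close>

lemma subdivision_wordI:
  assumes "\<And>j. j < length v \<Longrightarrow> rev v ! j < Z j"
    "subdivision_start v \<le> u" "u < subdivision_start v + p (rev v)"
  shows "0 \<le> u \<and> u < 1 \<and> subdivision_word (length v) u = v"
  using assms
proof (induction v)
  case Nil
  then show ?case by (simp add: p_Nil)
next
  case (Cons i v)
  have i: "i < Z (length v)" using Cons.prems(1)[of "length v"] by (simp add: nth_append)
  have u1: "subdivision_start v + (\<Sum>j<i. p (rev v @ [j])) \<le> u" using Cons.prems(2) by simp
  have u2: "u < subdivision_start v + (\<Sum>j\<le>i. p (rev v @ [j]))"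
    using Cons.prems(3) by (simp add: lessThan_Suc_atMost[symmetric])
  have v: "0 \<le> u \<and> u < 1 \<and> subdivision_word (length v) u = v"
  proof (rule Cons.IH)
    show "rev v ! j < Z j" if "j < length v" for j
      using Cons.prems(1)[of j] that by (simp add: nth_append)
    show "subdivision_start v \<le> u"
      using u1 sum_nonneg[of "{..<i}" "\<lambda>j. p (rev v @ [j])"] p_nonneg by force
    have "(\<Sum>j\<le>i. p (rev v @ [j])) \<le> (\<Sum>j<Z (length v). p (rev v @ [j]))"
      using i p_nonneg by (intro sum_mono2) auto
    then show "u < subdivision_start v + p (rev v)" using u2 p_add[of "rev v"] by simp
  qed
  have "(LEAST i. u < subdivision_start v + (\<Sum>j\<le>i. p (rev v @ [j]))) = i"
  proof (rule Least_equality)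
    show "u < subdivision_start v + (\<Sum>j\<le>i. p (rev v @ [j]))" by (rule u2)
    fix l assume l: "u < subdivision_start v + (\<Sum>j\<le>l. p (rev v @ [j]))"
    show "i \<le> l"
    proof (rule ccontr)
      assume "\<not> i \<le> l"
      then have "(\<Sum>j\<le>l. p (rev v @ [j])) \<le> (\<Sum>j<i. p (rev v @ [j]))"
        using p_nonneg by (intro sum_mono2) auto
      then show False using l u1 by linarith
    qed
  qed
  then show ?case using v by (simp add: Let_def)
qed

end
end

text \<open>Serves on both sides of the limit, for the laws with their cells and for the unit
  interval with the intervals of the words. With the same values \<open>b w\<close> the two
  integrals then differ essentially through the masses only.\<close>

lemma prob_space_abs_integral_minus_simple:
  assumes "prob_space M" "finite V" and h: "integrable M h"
    and E: "\<And>w. w \<in> V \<Longrightarrow> E w \<in> sets M" "\<And>x. x \<in> space M \<Longrightarrow> \<exists>w\<in>V. x \<in> E w"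
      "\<And>w w'. w \<in> V \<Longrightarrow> w' \<in> V \<Longrightarrow> w \<noteq> w' \<Longrightarrow> E w \<inter> E w' = {}"
    and close: "\<And>w x. w \<in> V \<Longrightarrow> x \<in> E w \<Longrightarrow> \<bar>h x - b w\<bar> \<le> (\<epsilon>::real)"
  shows "\<bar>(\<integral>x. h x \<partial>M) - (\<Sum>w\<in>V. b w * measure M (E w))\<bar> \<le> \<epsilon>"
proof -
  interpret prob_space M by fact
  have int: "integrable M (\<lambda>x. \<Sum>w\<in>V. b w * indicator (E w) x)"
    using E(1) by (intro Bochner_Integration.integrable_sum integrable_mult_right integrable_real_indicator)
      (auto simp: emeasure_eq_measure)
  have "(\<Sum>w\<in>V. b w * measure M (E w)) = (\<integral>x. (\<Sum>w\<in>V. b w * indicator (E w) x) \<partial>M)"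
    using E(1) by (subst Bochner_Integration.integral_sum)
      (auto simp: emeasure_eq_measure sets.sets_into_space Int_absorb2 intro!: integrable_mult_right integrable_real_indicator)
  then have "\<bar>(\<integral>x. h x \<partial>M) - (\<Sum>w\<in>V. b w * measure M (E w))\<bar> = \<bar>\<integral>x. h x - (\<Sum>w\<in>V. b w * indicator (E w) x) \<partial>M\<bar>"
    using h int by simp
  also have "\<dots> \<le> (\<integral>x. \<bar>h x - (\<Sum>w\<in>V. b w * indicator (E w) x)\<bar> \<partial>M)"
    by (rule integral_abs_bound)
  also have "\<dots> \<le> (\<integral>x. \<epsilon> \<partial>M)"
  proof (rule integral_mono)
    show "integrable M (\<lambda>x. \<bar>h x - (\<Sum>w\<in>V. b w * indicator (E w) x)\<bar>)" using h int by auto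
    fix x assume "x \<in> space M"
    then obtain w where w: "w \<in> V" "x \<in> E w" using E(2) by blast
    have "(\<Sum>w\<in>V. b w * indicator (E w) x) = (\<Sum>w'\<in>V. if w' = w then b w else 0)"
      using w E(3) by (intro sum.cong) (auto simp: indicator_def)
    also have "\<dots> = b w" using w assms(2) by simp
    finally show "\<bar>h x - (\<Sum>w\<in>V. b w * indicator (E w) x)\<bar> \<le> \<epsilon>" using close[OF w] by simp
  qed simp
  also have "\<dots> = \<epsilon>" by (simp add: prob_space)
  finally show ?thesis .
qed

lemma prob_space_unit_interval: "prob_space (restrict_space lborel {0..<1::real})"
  by (rule prob_spaceI) (simp add: emeasure_restrict_space space_restrict_space)

text \<open>Along a subsequence the masses of the cells of successively refined finite partitions of \<open>K\<close>
  converge; a subdivision of the unit interval with the limiting masses as lengths carries the limit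
  variable \<open>Y\<close>.\<close>
lemma compact_laws_subsequence:
  fixes K :: "'a::metric_space set" and M :: "nat \<Rightarrow> 'b measure" and X :: "nat \<Rightarrow> 'b \<Rightarrow> 'a"
  assumes K: "compact K" and M: "\<And>n. prob_space (M n)"
    and X: "\<And>n. X n \<in> borel_measurable (M n)" and XK: "\<And>n x. x \<in> space (M n) \<Longrightarrow> X n x \<in> K"
  shows "\<exists>r Y. strict_mono (r::nat \<Rightarrow> nat) \<and> Y \<in> borel_measurable borel \<and> (\<forall>u. Y u \<in> K) \<and>
    (\<forall>e>0. \<exists>N. \<forall>n\<ge>N. \<forall>f::'a \<Rightarrow> real. 1-lipschitz_on UNIV f \<longrightarrow>
      \<bar>(\<integral>x. f (X (r n) x) \<partial>M (r n)) - (\<integral>u. f (Y u) \<partial>restrict_space lborel {0..<1::real})\<bar> \<le> e)"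
proof -
  have Kne: "K \<noteq> {}" using XK[of _ 0] prob_space.not_empty[OF M[of 0]] by blast
  then obtain y0 where y0: "y0 \<in> K" by blast
  have "\<exists>T. finite T \<and> T \<subseteq> K \<and> K \<subseteq> (\<Union>x\<in>T. ball x ((1/2)^k))" for k :: nat
    using seq_compact_imp_totally_bounded[OF compact_imp_seq_compact[OF K]] by simp
  then obtain T where T: "\<And>k::nat. finite (T k)" "\<And>k. K \<subseteq> (\<Union>x\<in>T k. ball x ((1/2)^k))" by metis
  have "\<exists>xs. set xs = T k" for k using T(1) finite_list by blast
  then obtain xs where xs: "\<And>k. set (xs k) = T k" by metis
  define Z where "Z = (\<lambda>k. length (xs k))"
  define b where "b = (\<lambda>k i. ball (xs k ! i) ((1/2)^k))"
  define D where "D = (\<lambda>k i. b k i - (\<Union>j<i. b k j))"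
  have Dex: "\<exists>i<Z k. y \<in> D k i" if y: "y \<in> K" for y k
  proof -
    obtain x where "x \<in> set (xs k)" "y \<in> ball x ((1/2)^k)" using T(2)[of k] y xs[of k] by blast
    then obtain i where i: "i < Z k" "y \<in> b k i" by (auto simp: in_set_conv_nth Z_def b_def)
    define l where "l = (LEAST i. y \<in> b k i)"
    have "y \<in> b k l" unfolding l_def using i(2) by (rule LeastI)
    moreover have "l \<le> i" unfolding l_def using i(2) by (rule Least_le)
    moreover have "y \<notin> b k j" if "j < l" for j using not_less_Least[of j "\<lambda>i. y \<in> b k i"] that by (simp add: l_def)
    ultimately show ?thesis using i by (auto simp: D_def intro!: exI[of _ l])
  qed
  have Duniq: "i = j" if "y \<in> D k i" "y \<in> D k j" for y k i j
    using that by (auto simp: D_def) (metis lessThan_iff linorder_neqE_nat)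
  \<comment> \<open>Cells of the common refinement of the first \<open>length w\<close> partitions.
    A cell whose word has length \<open>Suc k\<close> lies in one ball of radius
    \<open>(1/2)^k\<close>, whence the diameter bound \<open>Cdist\<close>.\<close>
  define C where "C = (\<lambda>w. {y\<in>K. \<forall>j<length w. y \<in> D j (w ! j)})"
  have CK: "C w \<subseteq> K" for w by (auto simp: C_def)
  have CNil: "C [] = K" by (simp add: C_def)
  have Cborel: "C w \<in> sets borel" for w
  proof -
    have "C w = K - (\<Union>j<length w. UNIV - D j (w ! j))" by (auto simp: C_def)
    moreover have D: "D k i \<in> sets borel" for k i unfolding D_def b_def by (intro sets.Diff sets.finite_UN) auto
    have "K - (\<Union>j<length w. UNIV - D j (w ! j)) \<in> sets borel"
      using compact_imp_closed[OF K] by (intro sets.Diff[OF _ sets.finite_UN] sets.Diff[OF _ D]) auto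
    ultimately show ?thesis by simp
  qed
  have Cmono: "C (w @ v) \<subseteq> C w" for w v
    unfolding C_def by (auto simp: nth_append)
  have Csplit: "C w = (\<Union>i<Z (length w). C (w @ [i]))" for w
  proof
    show "C w \<subseteq> (\<Union>i<Z (length w). C (w @ [i]))"
    proof
      fix y assume y: "y \<in> C w"
      then obtain i where i: "i < Z (length w)" "y \<in> D (length w) i" using Dex[of y "length w"] CK by blast
      have "y \<in> C (w @ [i])" using y i by (auto simp: C_def nth_append less_Suc_eq)
      then show "y \<in> (\<Union>i<Z (length w). C (w @ [i]))" using i by blast
    qed
    show "(\<Union>i<Z (length w). C (w @ [i])) \<subseteq> C w" using Cmono by blast
  qed
  have Cdist: "dist y y' \<le> 2 * (1/2)^k" if y: "y \<in> C w" "y' \<in> C w" and w: "length w = Suc k" for y y' w k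
  proof -
    have "y \<in> D k (w ! k)" "y' \<in> D k (w ! k)" using y w by (auto simp: C_def)
    then have "dist (xs k ! (w ! k)) y < (1/2)^k" "dist (xs k ! (w ! k)) y' < (1/2)^k"
      by (auto simp: D_def b_def)
    then show ?thesis using dist_triangle3[of y y' "xs k ! (w ! k)"] by linarith
  qed
  define V where "V = (\<lambda>k. {w. length w = k \<and> (\<forall>j<k. w ! j < Z j)})"
  have finV: "finite (V k)" for k
  proof (induction k)
    case 0
    then show ?case by (simp add: V_def)
  next
    case (Suc k)
    have "V (Suc k) \<subseteq> (\<lambda>(w,i). w @ [i]) ` (V k \<times> {..<Z k})"
    proof
      fix w assume w: "w \<in> V (Suc k)"
      then have w': "w \<noteq> []" "length w = Suc k" "\<forall>j<Suc k. w ! j < Z j" by (auto simp: V_def)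
      then have "butlast w \<in> V k" "last w < Z k" using last_conv_nth[OF w'(1)]
        by (auto simp: V_def nth_butlast)
      then show "w \<in> (\<lambda>(w,i). w @ [i]) ` (V k \<times> {..<Z k})"
        using w'(1) by (intro image_eqI[of _ _ "(butlast w, last w)"]) auto
    qed
    then show ?case using Suc finite_subset by fastforce
  qed
  have Vcov: "\<exists>w\<in>V k. y \<in> C w" if "y \<in> K" for y k
  proof (induction k)
    case 0
    then show ?case using that by (auto simp: V_def CNil)
  next
    case (Suc k)
    then obtain w where w: "w \<in> V k" "y \<in> C w" by blast
    then obtain i where "i < Z (length w)" "y \<in> C (w @ [i])" using Csplit[of w] by blast
    then show ?case using w by (intro bexI[of _ "w @ [i]"]) (auto simp: V_def nth_append less_Suc_eq)
  qed
  have Vdis: "C w \<inter> C w' = {}" if "w \<in> V k" "w' \<in> V k" "w \<noteq> w'" for w w' k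
  proof -
    have "w = w'" if "\<forall>j<k. w ! j = w' ! j"
      using that \<open>w \<in> V k\<close> \<open>w' \<in> V k\<close> by (intro nth_equalityI) (auto simp: V_def)
    then obtain j where j: "j < k" "w ! j \<noteq> w' ! j" using \<open>w \<noteq> w'\<close> by blast
    show ?thesis
    proof (rule equals0I)
      fix y assume "y \<in> C w \<inter> C w'"
      then have "y \<in> D j (w ! j)" "y \<in> D j (w' ! j)" using j that by (auto simp: C_def V_def)
      then show False using Duniq j by blast
    qed
  qed
  define E where "E = (\<lambda>n w. X n -` C w \<inter> space (M n))"
  have Emeas: "E n w \<in> sets (M n)" for n w unfolding E_def using X Cborel by (rule measurable_sets)
  define pn where "pn = (\<lambda>n w. measure (M n) (E n w))"
  have pn01: "0 \<le> pn n w \<and> pn n w \<le> 1" for n w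
    unfolding pn_def using prob_space.prob_le_1[OF M] by simp
  have pnNil: "pn n [] = 1" for n
  proof -
    have "E n [] = space (M n)" using XK by (auto simp: E_def CNil)
    then show ?thesis using prob_space.prob_space[OF M] by (simp add: pn_def)
  qed
  have pnadd: "pn n w = (\<Sum>i<Z (length w). pn n (w @ [i]))" for n w
  proof -
    interpret prob_space "M n" by (rule M)
    have "E n w = (\<Union>i\<in>{..<Z (length w)}. E n (w @ [i]))" unfolding E_def by (subst Csplit) auto
    moreover have "disjoint_family_on (\<lambda>i. E n (w @ [i])) {..<Z (length w)}"
    proof (unfold disjoint_family_on_def, intro ballI impI)
      fix i j :: nat assume "i \<noteq> j"
      have "C (w @ [i]) \<inter> C (w @ [j]) = {}"
      proof (rule equals0I)
        fix y assume "y \<in> C (w @ [i]) \<inter> C (w @ [j])"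
        then have "y \<in> D (length w) i" "y \<in> D (length w) j" by (auto simp: C_def nth_append)
        then show False using Duniq \<open>i \<noteq> j\<close> by blast
      qed
      then show "E n (w @ [i]) \<inter> E n (w @ [j]) = {}" by (auto simp: E_def)
    qed
    ultimately show ?thesis unfolding pn_def using Emeas
      by (simp add: finite_measure_finite_Union image_subset_iff)
  qed
  \<comment> \<open>Words are countable, so one subsequence serves the masses of all cells at all
    depths. Additivity survives the limit because each cell has finitely many children.\<close>
  obtain r p where r: "strict_mono (r::nat\<Rightarrow>nat)" and lim: "\<And>w. (\<lambda>n. pn (r n) w) \<longlonglongrightarrow> p w"
    using bounded_functions_subsequence[of 0 pn 1] pn01 by blast
  have p0: "0 \<le> p w" for w using LIMSEQ_le_const[OF lim[of w], of 0] pn01 by auto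
  have pNil: "p [] = 1" using lim[of "[]"] pnNil by (simp add: LIMSEQ_const_iff)
  have padd: "p w = (\<Sum>i<Z (length w). p (w @ [i]))" for w
  proof (rule LIMSEQ_unique[OF lim])
    show "(\<lambda>n. pn (r n) w) \<longlonglongrightarrow> (\<Sum>i<Z (length w). p (w @ [i]))"
      by (subst pnadd) (intro tendsto_intros lim)
  qed
  define W where "W = (\<lambda>k u. rev (subdivision_word p k u))"
  define I where "I = (\<lambda>w. {subdivision_start p (rev w)..<subdivision_start p (rev w) + p w})"
  note bounds = subdivision_word_bounds[of p Z, OF p0 pNil padd]
  note wordI = subdivision_wordI[of p Z, OF p0 pNil padd]
  have Wlen: "length (W k u) = k" for k u
    by (simp add: W_def subdivision_word_length[of p Z, OF p0 pNil padd])
  have WI: "u \<in> I (W k u)" if "u \<in> {0..<1}" for k u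
    using bounds[of u k] that by (simp add: W_def I_def)
  have IW: "u \<in> {0..<1} \<and> W k u = w" if w: "w \<in> V k" "u \<in> I w" for w k u
    using wordI[of "rev w" u] w by (auto simp: W_def I_def V_def)
  have Wpre: "W (k + l) u = W k u @ drop k (W (k + l) u)" for k l u
  proof (induction l)
    case (Suc l)
    obtain i where i: "W (k + Suc l) u = W (k + l) u @ [i]" by (simp add: W_def Let_def)
    then show ?case using Suc Wlen[of "k + l" u] by simp
  qed (use Wlen[of k u] in simp)
  have Wpos: "p (W k u) > 0" if "u \<in> {0..<1}" for k u
    using WI[OF that, of k] by (auto simp: I_def)
  \<comment> \<open>Cells may be empty or lose all their mass in the limit. Such words get an empty
    interval and are never the address of a point, because the interval of an address contains that
    point and so has positive length.\<close>
  have Cne: "C w \<noteq> {}" if "p w > 0" for w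
  proof
    assume "C w = {}"
    then have "pn n w = 0" for n by (simp add: pn_def E_def)
    then show False using lim[of w] that by (simp add: LIMSEQ_const_iff)
  qed
  define c where "c = (\<lambda>w. if C w = {} then y0 else SOME y. y \<in> C w)"
  have cC: "c w \<in> C w" if "C w \<noteq> {}" for w using that by (auto simp: c_def some_in_eq)
  have cK: "c w \<in> K" for w using cC[of w] y0 CK[of w] by (cases "C w = {}") (auto simp: c_def)
  have WV: "W k u \<in> V k" if u: "u \<in> {0..<1}" for k u
  proof -
    obtain y where y: "y \<in> C (W k u)" using Cne[OF Wpos[OF u]] by blast
    then obtain w where w: "w \<in> V k" "y \<in> C w" using Vcov CK by blast
    have "W k u ! j = w ! j" if "j < k" for j
      using y w that Wlen[of k u] Duniq[of y j] by (auto simp: C_def V_def)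
    then show ?thesis using w Wlen[of k u] by (auto simp: V_def)
  qed
  \<comment> \<open>A chosen point of the depth \<open>k\<close> cell addressed by \<open>u\<close>.
    For growing \<open>k\<close> these cells are nested with diameters tending to 0, and
    \<open>K\<close> is complete, so a limit in \<open>K\<close> exists at every
    \<open>u\<close>.\<close>
  define Yk where "Yk = (\<lambda>k u. if u \<in> {0..<1} then c (W k u) else y0)"
  have Yd: "dist (Yk k u) (Yk l u) \<le> 2 * (1/2)^m" if u: "u \<in> {0..<1}" and "k \<ge> Suc m" "l \<ge> Suc m" for k l m u
  proof -
    have *: "c (W k u) \<in> C (W (Suc m) u)" if "k \<ge> Suc m" for k
    proof -
      have "W k u = W (Suc m) u @ drop (Suc m) (W k u)" using Wpre[of "Suc m" "k - Suc m" u] that by simp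
      then show ?thesis using cC[OF Cne[OF Wpos[OF u, of k]]] Cmono by (metis subsetD)
    qed
    show ?thesis using Cdist[OF *[OF that(2)] *[OF that(3)] Wlen] u by (simp add: Yk_def)
  qed
  have small: "\<exists>m. 2 * (1/2)^m < e" if "e > 0" for e :: real
  proof -
    have "(\<lambda>m. 2 * (1/2::real)^m) \<longlonglongrightarrow> 0" by (intro tendsto_mult_right_zero LIMSEQ_power_zero) auto
    then have "\<forall>\<^sub>F m in sequentially. 2 * (1/2::real)^m < e" using that by (rule order_tendstoD)
    then show ?thesis by (auto simp: eventually_sequentially)
  qed
  have "\<exists>l\<in>K. (\<lambda>k. Yk k u) \<longlonglongrightarrow> l" for u
  proof (cases "u \<in> {0..<1}")
    case True
    have "Cauchy (\<lambda>k. Yk k u)"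
    proof (rule metric_CauchyI)
      fix e :: real assume "e > 0"
      then obtain m where m: "2 * (1/2)^m < e" using small by blast
      show "\<exists>M. \<forall>k\<ge>M. \<forall>l\<ge>M. dist (Yk k u) (Yk l u) < e"
        using Yd[OF True, of m] m by (intro exI[of _ "Suc m"]) (meson le_less_trans)
    qed
    moreover have "Yk k u \<in> K" for k using cK by (simp add: Yk_def y0)
    ultimately show ?thesis using completeE[OF compact_imp_complete[OF K], of "\<lambda>k. Yk k u"] by blast
  next
    case False
    then have "(\<lambda>k. Yk k u) = (\<lambda>k. y0)" by (auto simp: Yk_def)
    then show ?thesis using y0 by (intro bexI[of _ y0]) auto
  qed
  then obtain Y where Y: "\<And>u. Y u \<in> K" "\<And>u. (\<lambda>k. Yk k u) \<longlonglongrightarrow> Y u" by metis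
  have Sset: "{u. u \<in> {0..<1} \<and> W k u = w} = (if w \<in> V k then I w else {})" for k w
    using WI[of _ k] IW WV[of _ k] by auto
  have Ykm: "Yk k \<in> borel_measurable borel" for k
  proof -
    have "(\<lambda>u. if u \<in> {0..<1} then W k u else []) \<in> measurable borel (count_space UNIV)"
    proof (subst measurable_count_space_eq2_countable)
      show "(\<lambda>u. if u \<in> {0..<1::real} then W k u else []) \<in> space borel \<rightarrow> UNIV \<and>
        (\<forall>a\<in>UNIV. (\<lambda>u. if u \<in> {0..<1} then W k u else []) -` {a} \<inter> space borel \<in> sets borel)"
      proof (intro conjI ballI)
        fix w :: "nat list"
        have "(\<lambda>u. if u \<in> {0..<1} then W k u else []) -` {w} \<inter> space borel
          = {u. u \<in> {0..<1} \<and> W k u = w} \<union> (if w = [] then - {0..<1} else {})"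
          by (auto split: if_splits)
        also have "\<dots> \<in> sets borel" unfolding Sset by (auto simp: I_def)
        finally show "(\<lambda>u. if u \<in> {0..<1} then W k u else []) -` {w} \<inter> space borel \<in> sets borel" .
      qed auto
    qed
    then have "(\<lambda>u. c (if u \<in> {0..<1} then W k u else [])) \<in> borel_measurable borel"
      by (rule measurable_compose) simp
    then have "(\<lambda>u. if u \<in> {0..<1} then c (if u \<in> {0..<1} then W k u else []) else y0) \<in> borel_measurable borel"
      by (rule measurable_If_set) auto
    moreover have "(\<lambda>u. if u \<in> {0..<1} then c (if u \<in> {0..<1} then W k u else []) else y0) = Yk k"
      by (auto simp: Yk_def)
    ultimately show ?thesis by simp
  qed
  have Ym: "Y \<in> borel_measurable borel"
    by (rule borel_measurable_LIMSEQ_metric[OF Ykm]) (rule Y(2))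
  have YC: "dist (Y u) (c w) \<le> 2 * (1/2)^m" if u: "u \<in> {0..<1}" and w: "w = W (Suc m) u" for u w m
  proof -
    have cw: "c w = Yk (Suc m) u" using u w by (simp add: Yk_def)
    have "(\<lambda>k. dist (Yk k u) (Yk (Suc m) u)) \<longlonglongrightarrow> dist (Y u) (Yk (Suc m) u)"
      by (intro tendsto_intros Y(2))
    then show ?thesis unfolding cw
    proof (rule tendsto_upperbound)
      show "\<forall>\<^sub>F k in sequentially. dist (Yk k u) (Yk (Suc m) u) \<le> 2 * (1/2)^m"
        using eventually_ge_at_top[of "Suc m"] by eventually_elim (rule Yd[OF u], auto)
    qed simp
  qed
  let ?U = "restrict_space lborel {0..<1::real}"
  interpret U: prob_space ?U by (rule prob_space_unit_interval)
  obtain R where R: "\<And>y. y \<in> K \<Longrightarrow> dist y y0 \<le> R" "R \<ge> 0"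
    using compact_imp_bounded[OF K] unfolding bounded_any_center[where a=y0] 
    by (metis dist_commute dist_self y0)
  have flip: "\<bar>f y - f z\<bar> \<le> dist y z" if "1-lipschitz_on UNIV f" for f :: "'a \<Rightarrow> real" and y z
    using lipschitz_onD[OF that, of y z] by (simp add: dist_real_def)
  have "\<exists>N. \<forall>n\<ge>N. \<forall>f::'a \<Rightarrow> real. 1-lipschitz_on UNIV f \<longrightarrow>
      \<bar>(\<integral>x. f (X (r n) x) \<partial>M (r n)) - (\<integral>u. f (Y u) \<partial>?U)\<bar> \<le> e" if e: "e > 0" for e
  proof -
    obtain m where m: "2 * (1/2)^m < e/4" using small[of "e/4"] e by auto
    have "(\<lambda>n. R * (\<Sum>w\<in>V (Suc m). \<bar>pn (r n) w - p w\<bar>)) \<longlonglongrightarrow> R * (\<Sum>w\<in>V (Suc m). \<bar>p w - p w\<bar>)"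
      by (intro tendsto_intros lim)
    then have "\<forall>\<^sub>F n in sequentially. R * (\<Sum>w\<in>V (Suc m). \<bar>pn (r n) w - p w\<bar>) < e/4"
      using e by (intro order_tendstoD(2)) auto
    then obtain N where N: "\<And>n. n \<ge> N \<Longrightarrow> R * (\<Sum>w\<in>V (Suc m). \<bar>pn (r n) w - p w\<bar>) < e/4"
      by (auto simp: eventually_sequentially)
    have "\<bar>(\<integral>x. f (X (r n) x) \<partial>M (r n)) - (\<integral>u. f (Y u) \<partial>?U)\<bar> \<le> e"
      if n: "n \<ge> N" and f: "1-lipschitz_on UNIV f" for n and f :: "'a \<Rightarrow> real"
    proof -
      have fm: "f \<in> borel_measurable borel"
        using lipschitz_on_continuous_on[OF f] by (rule borel_measurable_continuous_onI)
      interpret Mn: prob_space "M (r n)" by (rule M)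
      have fb: "\<bar>f y\<bar> \<le> \<bar>f y0\<bar> + R" if "y \<in> K" for y using flip[OF f, of y y0] R(1)[OF that] by linarith
      have i1: "integrable (M (r n)) (\<lambda>x. f (X (r n) x))"
        using XK fb by (intro Mn.integrable_const_bound[where B = "\<bar>f y0\<bar> + R"] measurable_compose[OF X fm]) auto
      have Um: "(\<lambda>u. f (Y u)) \<in> borel_measurable ?U"
        using measurable_compose[OF Ym fm] by (intro measurable_restrict_space1) (simp add: measurable_lborel1)
      have i2: "integrable ?U (\<lambda>u. f (Y u))"
        using fb Y(1) by (intro U.integrable_const_bound[where B = "\<bar>f y0\<bar> + R"] Um) auto
      have e1: "\<bar>(\<integral>x. f (X (r n) x) \<partial>M (r n)) - (\<Sum>w\<in>V (Suc m). f (c w) * measure (M (r n)) (E (r n) w))\<bar> \<le> 2 * (1/2)^m"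
      proof (rule prob_space_abs_integral_minus_simple[OF M finV i1])
        show "\<exists>w\<in>V (Suc m). x \<in> E (r n) w" if "x \<in> space (M (r n))" for x
          using Vcov[OF XK[OF that]] that by (auto simp: E_def)
        show "E (r n) w \<inter> E (r n) w' = {}" if "w \<in> V (Suc m)" "w' \<in> V (Suc m)" "w \<noteq> w'" for w w'
          using Vdis[OF that] by (auto simp: E_def)
        fix w x assume w: "w \<in> V (Suc m)" and x: "x \<in> E (r n) w"
        then have "X (r n) x \<in> C w" by (simp add: E_def)
        then have "dist (X (r n) x) (c w) \<le> 2 * (1/2)^m" using cC[of w] w by (intro Cdist[of _ w]) (auto simp: V_def)
        then show "\<bar>f (X (r n) x) - f (c w)\<bar> \<le> 2 * (1/2)^m" using flip[OF f] order_trans by blast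
      qed (rule Emeas)
      have Ims: "I w \<inter> {0..<1} \<in> sets ?U" for w by (auto simp: sets_restrict_space I_def)
      have e2: "\<bar>(\<integral>u. f (Y u) \<partial>?U) - (\<Sum>w\<in>V (Suc m). f (c w) * measure ?U (I w \<inter> {0..<1}))\<bar> \<le> 2 * (1/2)^m"
      proof (rule prob_space_abs_integral_minus_simple[OF prob_space_unit_interval finV i2])
        show "\<exists>w\<in>V (Suc m). u \<in> I w \<inter> {0..<1}" if "u \<in> space ?U" for u
          using that WI[of u "Suc m"] WV[of u "Suc m"] by (auto simp: space_restrict_space)
        show "I w \<inter> {0..<1} \<inter> (I w' \<inter> {0..<1}) = {}" if "w \<in> V (Suc m)" "w' \<in> V (Suc m)" "w \<noteq> w'" for w w'
          using IW that by blast
        fix w u assume w: "w \<in> V (Suc m)" and u: "u \<in> I w \<inter> {0..<1}"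
        then have "w = W (Suc m) u" using IW by blast
        then have "dist (Y u) (c w) \<le> 2 * (1/2)^m" using u by (intro YC) auto
        then show "\<bar>f (Y u) - f (c w)\<bar> \<le> 2 * (1/2)^m" using flip[OF f] order_trans by blast
      qed (rule Ims)
      have Ip: "measure ?U (I w \<inter> {0..<1}) = p w" if "w \<in> V (Suc m)" for w
      proof -
        have "I w \<subseteq> {0..<1}" using IW[OF that] by blast
        then have "measure ?U (I w \<inter> {0..<1}) = measure lborel (I w)"
          by (subst measure_restrict_space) (auto simp: Int_absorb2)
        also have "\<dots> = p w" using p0[of w] by (simp add: I_def)
        finally show ?thesis .
      qed
      have tot1: "(\<Sum>w\<in>V k. pn (r n) w) = 1" for k
      proof -
        have "(\<Sum>w\<in>V k. pn (r n) w) = measure (M (r n)) (\<Union>w\<in>V k. E (r n) w)"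
          unfolding pn_def using Vdis Emeas finV
          by (subst Mn.finite_measure_finite_Union) (auto simp: disjoint_family_on_def E_def)
        also have "(\<Union>w\<in>V k. E (r n) w) = space (M (r n))" using Vcov XK by (fastforce simp: E_def)
        finally show ?thesis by (simp add: Mn.prob_space)
      qed
      have tot2: "(\<Sum>w\<in>V (Suc m). p w) = 1"
      proof -
        have "(\<Sum>w\<in>V (Suc m). p w) = (\<Sum>w\<in>V (Suc m). measure ?U (I w \<inter> {0..<1}))" using Ip by simp
        also have "\<dots> = measure ?U (\<Union>w\<in>V (Suc m). I w \<inter> {0..<1})"
          using finV Ims IW by (subst U.finite_measure_finite_Union) (auto simp: disjoint_family_on_def, blast)
        also have "(\<Union>w\<in>V (Suc m). I w \<inter> {0..<1}) = space ?U"
        proof (intro equalityI subsetI)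
          fix u assume "u \<in> space ?U"
          then have u: "u \<in> {0..<1}" by (simp add: space_restrict_space)
          then show "u \<in> (\<Union>w\<in>V (Suc m). I w \<inter> {0..<1})" using WI[OF u] WV[OF u] by blast
        qed (simp add: space_restrict_space)
        finally show ?thesis unfolding U.prob_space .
      qed
      \<comment> \<open>Lipschitz functions are uniformly bounded on \<open>K\<close> only up to
        constants. Both families of masses sum to 1, so \<open>f\<close> may be replaced by its
        difference to \<open>f y0\<close>, which is at most \<open>R\<close> on \<open>K\<close>;
        this keeps \<open>N\<close> independent of \<open>f\<close>.\<close>
      have "(\<Sum>w\<in>V (Suc m). f (c w) * pn (r n) w) - (\<Sum>w\<in>V (Suc m). f (c w) * p w)
          = (\<Sum>w\<in>V (Suc m). (f (c w) - f y0) * (pn (r n) w - p w)) + f y0 * ((\<Sum>w\<in>V (Suc m). pn (r n) w) - (\<Sum>w\<in>V (Suc m). p w))"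
        by (simp add: algebra_simps sum.distrib sum_subtractf sum_distrib_left)
      also have "\<dots> = (\<Sum>w\<in>V (Suc m). (f (c w) - f y0) * (pn (r n) w - p w))"
        using tot1 tot2 by simp
      finally have "\<bar>(\<Sum>w\<in>V (Suc m). f (c w) * pn (r n) w) - (\<Sum>w\<in>V (Suc m). f (c w) * p w)\<bar>
          \<le> (\<Sum>w\<in>V (Suc m). R * \<bar>pn (r n) w - p w\<bar>)"
        using order_trans[OF flip[OF f] R(1)[OF cK]]
        by (auto simp: abs_mult intro!: order_trans[OF sum_abs] sum_mono mult_right_mono)
      also have "\<dots> < e/4" using N[OF n] by (simp add: sum_distrib_left)
      finally have "\<bar>(\<Sum>w\<in>V (Suc m). f (c w) * measure (M (r n)) (E (r n) w)) - (\<Sum>w\<in>V (Suc m). f (c w) * p w)\<bar> < e/4"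
        unfolding pn_def .
      moreover have "\<bar>(\<integral>u. f (Y u) \<partial>?U) - (\<Sum>w\<in>V (Suc m). f (c w) * p w)\<bar> \<le> 2 * (1/2)^m"
        using e2 Ip by simp
      ultimately show ?thesis using e1 m by linarith
    qed
    then show ?thesis by blast
  qed
  then show ?thesis using r Ym Y(1) by blast
qed

section \<open>Approximate equilibria of finite population games\<close>

text \<open>The dimension is a number and not a type; the fixed point is read off from Kuhn's combinatorial
  lemma by compactness.\<close>
lemma brouwer_nat_cube:
  fixes f :: "(nat \<Rightarrow> real) \<Rightarrow> (nat \<Rightarrow> real)" and B :: real
  assumes B: "B > 0"
    and cont: "\<And>y x i. (\<And>n. y n \<in> {x. (\<forall>j<m. 0 \<le> x j \<and> x j \<le> B) \<and> (\<forall>j\<ge>m. x j = 0)}) \<Longrightarrow>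
        (\<forall>j. (\<lambda>n. y n j) \<longlonglongrightarrow> x j) \<Longrightarrow> i < m \<Longrightarrow> (\<lambda>n. f (y n) i) \<longlonglongrightarrow> f x i"
    and maps: "\<And>x i. (\<forall>j<m. 0 \<le> x j \<and> x j \<le> B) \<Longrightarrow> (\<forall>j\<ge>m. x j = 0) \<Longrightarrow> i < m \<Longrightarrow> 0 \<le> f x i \<and> f x i \<le> B"
  shows "\<exists>x. (\<forall>j<m. 0 \<le> x j \<and> x j \<le> B) \<and> (\<forall>j\<ge>m. x j = 0) \<and> (\<forall>i<m. f x i = x i)"
proof -
  define emb where "emb = (\<lambda>p::nat. \<lambda>z::nat\<Rightarrow>nat. \<lambda>j. if j < m then B * real (z j) / real p else 0)"
  have embin: "emb p z \<in> {x. (\<forall>j<m. 0 \<le> x j \<and> x j \<le> B) \<and> (\<forall>j\<ge>m. x j = 0)}"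
    if "p > 0" "\<forall>j<m. z j \<le> p" for p z
    using that B by (auto simp: emb_def field_simps)
  \<comment> \<open>Kuhn labels: 0 where \<open>f\<close> does not decrease coordinate
    \<open>i\<close>, 1 where it does. The cases \<open>z i = 0\<close> and \<open>z i = p\<close>
    impose the boundary labels that \<open>kuhn_lemma\<close> demands; there \<open>maps\<close>
    supplies the inequality that the label stands for.\<close>
  define label where "label = (\<lambda>p z i. if (z i \<noteq> p \<and> (z i = 0 \<or> f (emb p z) i \<ge> emb p z i)) then 0 else 1::nat)"
  have ex: "\<exists>q. (\<forall>i<m. q i < p) \<and> (\<forall>i<m. \<exists>r s. (\<forall>j<m. q j \<le> r j \<and> r j \<le> q j + 1) \<and>
      (\<forall>j<m. q j \<le> s j \<and> s j \<le> q j + 1) \<and> label p r i \<noteq> label p s i)" if "p > 0" for p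
  proof -
    have l: "\<forall>x. (\<forall>i<m. x i \<le> p) \<longrightarrow> (\<forall>i<m. label p x i = 0 \<or> label p x i = 1)"
      "\<forall>x. (\<forall>i<m. x i \<le> p) \<longrightarrow> (\<forall>i<m. x i = 0 \<longrightarrow> label p x i = 0)"
      "\<forall>x. (\<forall>i<m. x i \<le> p) \<longrightarrow> (\<forall>i<m. x i = p \<longrightarrow> label p x i = 1)"
      using that by (auto simp: label_def)
    show ?thesis by (rule kuhn_lemma[OF that l]) blast
  qed
  have ex2: "\<exists>q r s. (\<forall>i<m. q i < Suc p) \<and> (\<forall>i<m. (\<forall>j<m. q j \<le> r i j \<and> r i j \<le> q j + 1) \<and>
      (\<forall>j<m. q j \<le> s i j \<and> s i j \<le> q j + 1) \<and> label (Suc p) (r i) i = 0 \<and> label (Suc p) (s i) i = 1)" for p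
  proof -
    obtain q where q: "\<forall>i<m. q i < Suc p" "\<forall>i<m. \<exists>r s. (\<forall>j<m. q j \<le> r j \<and> r j \<le> q j + 1) \<and>
      (\<forall>j<m. q j \<le> s j \<and> s j \<le> q j + 1) \<and> label (Suc p) r i \<noteq> label (Suc p) s i"
      using ex[of "Suc p"] by auto
    have "\<forall>i. \<exists>r s. i < m \<longrightarrow> ((\<forall>j<m. q j \<le> r j \<and> r j \<le> q j + 1) \<and>
      (\<forall>j<m. q j \<le> s j \<and> s j \<le> q j + 1) \<and> label (Suc p) r i = 0 \<and> label (Suc p) s i = 1)"
    proof
      fix i
      show "\<exists>r s. i < m \<longrightarrow> ((\<forall>j<m. q j \<le> r j \<and> r j \<le> q j + 1) \<and>
      (\<forall>j<m. q j \<le> s j \<and> s j \<le> q j + 1) \<and> label (Suc p) r i = 0 \<and> label (Suc p) s i = 1)"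
      proof (cases "i < m")
        case True
        then obtain r s where rs: "\<forall>j<m. q j \<le> r j \<and> r j \<le> q j + 1"
          "\<forall>j<m. q j \<le> s j \<and> s j \<le> q j + 1" "label (Suc p) r i \<noteq> label (Suc p) s i"
          using q(2) by blast
        have "label (Suc p) r i = 0 \<and> label (Suc p) s i = 1 \<or> label (Suc p) s i = 0 \<and> label (Suc p) r i = 1"
          using rs(3) by (auto simp: label_def split: if_splits)
        then show ?thesis using rs by blast
      qed blast
    qed
    then obtain r s where "\<forall>i. i < m \<longrightarrow> ((\<forall>j<m. q j \<le> r i j \<and> r i j \<le> q j + 1) \<and>
      (\<forall>j<m. q j \<le> s i j \<and> s i j \<le> q j + 1) \<and> label (Suc p) (r i) i = 0 \<and> label (Suc p) (s i) i = 1)"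
      by metis
    with q(1) show ?thesis by blast
  qed
  define T where "T = (\<lambda>p (t :: (nat \<Rightarrow> nat) \<times> (nat \<Rightarrow> nat \<Rightarrow> nat) \<times> (nat \<Rightarrow> nat \<Rightarrow> nat)).
      (\<forall>i<m. fst t i < Suc p) \<and> (\<forall>i<m. (\<forall>j<m. fst t j \<le> fst (snd t) i j \<and> fst (snd t) i j \<le> fst t j + 1) \<and>
      (\<forall>j<m. fst t j \<le> snd (snd t) i j \<and> snd (snd t) i j \<le> fst t j + 1) \<and>
      label (Suc p) (fst (snd t) i) i = 0 \<and> label (Suc p) (snd (snd t) i) i = 1))"
  have "\<exists>t. T p t" for p
  proof -
    obtain q r s where "(\<forall>i<m. q i < Suc p) \<and> (\<forall>i<m. (\<forall>j<m. q j \<le> r i j \<and> r i j \<le> q j + 1) \<and>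
      (\<forall>j<m. q j \<le> s i j \<and> s i j \<le> q j + 1) \<and> label (Suc p) (r i) i = 0 \<and> label (Suc p) (s i) i = 1)"
      using ex2[of p] by blast
    then have "T p (q, r, s)" by (simp add: T_def)
    then show ?thesis ..
  qed
  then obtain t where t: "\<And>p. T p (t p)" using choice[of T] by blast
  define q where "q = (\<lambda>p. fst (t p))"
  define r where "r = (\<lambda>p. fst (snd (t p)))"
  define s where "s = (\<lambda>p. snd (snd (t p)))"
  have q: "q p i < Suc p" and lr: "label (Suc p) (r p i) i = 0" and ls: "label (Suc p) (s p i) i = 1" if "i < m" for p i
    using t[of p] that by (auto simp: T_def q_def r_def s_def)
  have r: "q p j \<le> r p i j \<and> r p i j \<le> q p j + 1" and s: "q p j \<le> s p i j \<and> s p i j \<le> q p j + 1" if "i < m" "j < m" for p i j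
    using t[of p] that by (auto simp: T_def q_def r_def s_def)
  define x where "x = (\<lambda>p. emb (Suc p) (q p))"
  have x01: "0 \<le> x p j \<and> x p j \<le> B" for p j
    using embin[of "Suc p" "q p"] q[of _ p] B unfolding x_def by (cases "j < m") (auto simp: less_imp_le)
  obtain \<phi> l where l: "strict_mono (\<phi>::nat\<Rightarrow>nat)" and xl: "\<And>j. (\<lambda>p. x (\<phi> p) j) \<longlonglongrightarrow> l j"
    using bounded_functions_subsequence[of 0 x B] x01 by blast
  have xin: "x p \<in> {x.  (\<forall>j<m. 0 \<le> x j \<and> x j \<le> B) \<and> (\<forall>j\<ge>m. x j = 0)}" for p
    unfolding x_def by (rule embin) (use q in \<open>auto intro: less_imp_le\<close>)
  have lin: "0 \<le> l j \<and> l j \<le> B" if "j < m" for j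
    using LIMSEQ_le_const[OF xl[of j], of 0] LIMSEQ_le_const2[OF xl[of j], of B] xin that by auto
  have l0: "l j = 0" if "j \<ge> m" for j
    using xl[of j] xin that by (simp add: LIMSEQ_const_iff)
  have near: "(\<lambda>p. emb (Suc (\<phi> p)) (w (\<phi> p)) j) \<longlonglongrightarrow> l j"
    if w: "\<And>p j. j < m \<Longrightarrow> q p j \<le> w p j \<and> w p j \<le> q p j + 1" for w j
  proof (cases "j < m")
    case True
    have "(\<lambda>p. emb (Suc (\<phi> p)) (w (\<phi> p)) j - x (\<phi> p) j) \<longlonglongrightarrow> 0"
    proof (rule Lim_null_comparison)
      show "\<forall>\<^sub>F p in sequentially. norm (emb (Suc (\<phi> p)) (w (\<phi> p)) j - x (\<phi> p) j) \<le> B * inverse (real (Suc p))"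
      proof (intro always_eventually allI)
        fix p
        have "norm (emb (Suc (\<phi> p)) (w (\<phi> p)) j - x (\<phi> p) j) = B * (real (w (\<phi> p) j) - real (q (\<phi> p) j)) / real (Suc (\<phi> p))"
          using True w[OF True, of "\<phi> p"] B by (simp add: emb_def x_def diff_divide_distrib[symmetric] right_diff_distrib[symmetric] abs_mult)
        also have "\<dots> \<le> B * 1 / real (Suc (\<phi> p))"
          using w[OF True, of "\<phi> p"] B by (intro divide_right_mono mult_left_mono) auto
        also have "\<dots> \<le> B * 1 / real (Suc p)"
          using B seq_suble[OF l, of p] by (intro divide_left_mono) auto
        finally show "norm (emb (Suc (\<phi> p)) (w (\<phi> p)) j - x (\<phi> p) j) \<le> B * inverse (real (Suc p))"
          by (simp add: field_simps)
      qed
      show "(\<lambda>p. B * inverse (real (Suc p))) \<longlonglongrightarrow> 0"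
        using tendsto_mult_right_zero[OF LIMSEQ_inverse_real_of_nat] by blast
    qed
    from tendsto_add[OF this xl[of j]] show ?thesis by simp
  next
    case False
    then show ?thesis using l0 by (simp add: emb_def)
  qed
  \<comment> \<open>For each coordinate the Kuhn cell has a vertex labelled 0, where
    \<open>f\<close> lies above the identity, and one labelled 1, where it lies below. The cells
    shrink to \<open>l\<close>, so both inequalities hold at \<open>l\<close>.\<close>
  have "f l i = l i" if i: "i < m" for i
  proof (rule antisym)
    have rin: "emb (Suc (\<phi> p)) (r (\<phi> p) i) \<in> {x. (\<forall>j<m. 0 \<le> x j \<and> x j \<le> B) \<and> (\<forall>j\<ge>m. x j = 0)}" for p
    proof (rule embin)
      show "\<forall>j<m. r (\<phi> p) i j \<le> Suc (\<phi> p)"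
        using r[OF i, of _ "\<phi> p"] q[of _ "\<phi> p"] by (metis Suc_eq_plus1 Suc_leI order_trans)
    qed simp
    have sin: "emb (Suc (\<phi> p)) (s (\<phi> p) i) \<in> {x. (\<forall>j<m. 0 \<le> x j \<and> x j \<le> B) \<and> (\<forall>j\<ge>m. x j = 0)}" for p
    proof (rule embin)
      show "\<forall>j<m. s (\<phi> p) i j \<le> Suc (\<phi> p)"
        using s[OF i, of _ "\<phi> p"] q[of _ "\<phi> p"] by (metis Suc_eq_plus1 Suc_leI order_trans)
    qed simp
    have nr: "\<forall>j. (\<lambda>p. emb (Suc (\<phi> p)) (r (\<phi> p) i) j) \<longlonglongrightarrow> l j" using near[of "\<lambda>p. r p i"] r[OF i] by blast
    have ns: "\<forall>j. (\<lambda>p. emb (Suc (\<phi> p)) (s (\<phi> p) i) j) \<longlonglongrightarrow> l j" using near[of "\<lambda>p. s p i"] s[OF i] by blast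
    show "l i \<le> f l i"
    proof (rule LIMSEQ_le[OF nr[rule_format, of i] cont[OF rin nr i]])
      have "emb (Suc (\<phi> p)) (r (\<phi> p) i) i \<le> f (emb (Suc (\<phi> p)) (r (\<phi> p) i)) i" for p
      proof -
        have "r (\<phi> p) i i \<noteq> Suc (\<phi> p) \<and> (r (\<phi> p) i i = 0 \<or> f (emb (Suc (\<phi> p)) (r (\<phi> p) i)) i \<ge> emb (Suc (\<phi> p)) (r (\<phi> p) i) i)"
          using lr[OF i, of "\<phi> p"] by (simp add: label_def split: if_splits)
        moreover have "0 \<le> f (emb (Suc (\<phi> p)) (r (\<phi> p) i)) i" using maps[of "emb (Suc (\<phi> p)) (r (\<phi> p) i)" i] rin i by auto
        ultimately show ?thesis using i by (auto simp: emb_def)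
      qed
      then show "\<exists>N. \<forall>n\<ge>N. emb (Suc (\<phi> n)) (r (\<phi> n) i) i \<le> f (emb (Suc (\<phi> n)) (r (\<phi> n) i)) i" by blast
    qed
    show "f l i \<le> l i"
    proof (rule LIMSEQ_le[OF cont[OF sin ns i] ns[rule_format, of i]])
      have "f (emb (Suc (\<phi> p)) (s (\<phi> p) i)) i \<le> emb (Suc (\<phi> p)) (s (\<phi> p) i) i" for p
      proof -
        have "s (\<phi> p) i i = Suc (\<phi> p) \<or> f (emb (Suc (\<phi> p)) (s (\<phi> p) i)) i < emb (Suc (\<phi> p)) (s (\<phi> p) i) i"
          using ls[OF i, of "\<phi> p"] by (auto simp: label_def split: if_splits)
        moreover have "f (emb (Suc (\<phi> p)) (s (\<phi> p) i)) i \<le> B" using maps[of "emb (Suc (\<phi> p)) (s (\<phi> p) i)" i] sin i by auto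
        ultimately show ?thesis using i by (auto simp: emb_def)
      qed
      then show "\<exists>N. \<forall>n\<ge>N. f (emb (Suc (\<phi> n)) (s (\<phi> n) i)) i \<le> emb (Suc (\<phi> n)) (s (\<phi> n) i) i" by blast
    qed
  qed
  then show ?thesis using lin l0 by blast
qed

text \<open>The fixed point is sought among the cost vectors \<open>y\<close>, each group spreading its mass over its strategies with weights
  \<open>max 0 (min y + \<delta> - y i)\<close>; these vanish off the \<open>\<delta>\<close>-optimal strategies.\<close>
lemma finite_game_approx_equilibrium:
  fixes m :: nat and grp :: "nat \<Rightarrow> 'b" and W :: "'b \<Rightarrow> real" and c :: "(nat \<Rightarrow> real) \<Rightarrow> nat \<Rightarrow> real"
  defines "S \<equiv> {\<pi>. (\<forall>i<m. 0 \<le> \<pi> i) \<and> (\<forall>i<m. (\<Sum>j\<in>{j. j < m \<and> grp j = grp i}. \<pi> j) = W (grp i))}"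
  assumes B: "B > 0" and \<delta>: "\<delta> > 0" and W: "\<And>b. W b \<ge> 0"
    and bd: "\<And>\<pi> i. \<pi> \<in> S \<Longrightarrow> i < m \<Longrightarrow> 0 \<le> c \<pi> i \<and> c \<pi> i \<le> B"
    and cont: "\<And>\<pi> \<rho> i. (\<And>n. \<pi> n \<in> S) \<Longrightarrow> \<rho> \<in> S \<Longrightarrow> (\<And>j. j < m \<Longrightarrow> (\<lambda>n. \<pi> n j) \<longlonglongrightarrow> \<rho> j) \<Longrightarrow> i < m \<Longrightarrow>
        (\<lambda>n. c (\<pi> n) i) \<longlonglongrightarrow> c \<rho> i"
  shows "\<exists>\<pi>\<in>S. \<forall>i<m. \<forall>j<m. grp i = grp j \<longrightarrow> \<pi> i > 0 \<longrightarrow> c \<pi> i \<le> c \<pi> j + \<delta>"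
proof -
  define A where "A = (\<lambda>i. {j. j < m \<and> grp j = grp i})"
  have A: "finite (A i)" for i by (simp add: A_def)
  have Aself: "i \<in> A i" if "i < m" for i using that by (simp add: A_def)
  have Aeq: "A j = A i" if "grp j = grp i" for i j using that by (simp add: A_def)
  define w where "w = (\<lambda>y i. max 0 (Min (y ` A i) + \<delta> - y i))"
  define \<pi> where "\<pi> = (\<lambda>y i. if i < m then W (grp i) * w y i / (\<Sum>j\<in>A i. w y j) else 0)"
  \<comment> \<open>A strategy of minimal entry in its group has weight exactly \<delta>, so the
    normalisation is well defined.\<close>
  have wpos: "(\<Sum>j\<in>A i. w y j) > 0" if i: "i < m" for y i
  proof -
    have "Min (y ` A i) \<in> y ` A i" using A Aself[OF i] by (intro Min_in) auto
    then obtain k where k: "k \<in> A i" "y k = Min (y ` A i)" by auto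
    have "A k = A i" using k Aeq by (simp add: A_def)
    then have "w y k > 0" using k \<delta> by (simp add: w_def)
    then show ?thesis using k A by (intro sum_pos2[of _ k]) (auto simp: w_def)
  qed
  have piS: "\<pi> y \<in> S" for y
  proof -
    have "(\<Sum>j\<in>A i. \<pi> y j) = W (grp i)" if i: "i < m" for i
    proof -
      have "(\<Sum>j\<in>A i. \<pi> y j) = (\<Sum>j\<in>A i. W (grp i) * w y j / (\<Sum>j\<in>A i. w y j))"
      proof (rule sum.cong[OF refl])
        fix j assume j: "j \<in> A i"
        then have "grp j = grp i" "j < m" by (auto simp: A_def)
        then show "\<pi> y j = W (grp i) * w y j / (\<Sum>j\<in>A i. w y j)" using Aeq[of j i] by (simp add: \<pi>_def)
      qed
      also have "\<dots> = W (grp i) * (\<Sum>j\<in>A i. w y j) / (\<Sum>j\<in>A i. w y j)"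
        by (simp add: sum_distrib_left sum_divide_distrib)
      finally show ?thesis using wpos[OF i, of y] by simp
    qed
    moreover have "0 \<le> \<pi> y i" for i using W wpos[of i y] by (simp add: \<pi>_def w_def less_imp_le)
    ultimately show ?thesis unfolding S_def A_def by blast
  qed
  \<comment> \<open>Cost vectors range over a cube, whereas the set \<open>S\<close> of mixed
    profiles is a product of simplices; composing \<open>\<pi>\<close> with \<open>c\<close> makes
    the cube version of the fixed point theorem applicable.\<close>
  have "\<exists>x. (\<forall>j<m. 0 \<le> x j \<and> x j \<le> B) \<and> (\<forall>j\<ge>m. x j = 0) \<and> (\<forall>i<m. c (\<pi> x) i = x i)"
  proof (rule brouwer_nat_cube[OF B, of m "\<lambda>y. c (\<pi> y)"])
    fix y :: "nat \<Rightarrow> nat \<Rightarrow> real" and x i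
    assume y: "\<forall>j. (\<lambda>n. y n j) \<longlonglongrightarrow> x j" and i: "i < m"
    have Min: "(\<lambda>n. Min (y n ` A k)) \<longlonglongrightarrow> Min (x ` A k)" if k: "k < m" for k
    proof (rule LIMSEQ_I)
      fix e :: real assume e: "e > 0"
      have "\<forall>\<^sub>F n in sequentially. \<forall>j\<in>A k. \<bar>y n j - x j\<bar> < e"
        using A y e by (intro eventually_ball_finite ballI) (auto simp: tendsto_iff dist_real_def)
      then obtain N where N: "\<forall>n\<ge>N. \<forall>j\<in>A k. \<bar>y n j - x j\<bar> < e" by (auto simp: eventually_sequentially)
      have "norm (Min (y n ` A k) - Min (x ` A k)) < e" if n: "n \<ge> N" for n
      proof -
        have fin: "finite (y n ` A k)" "y n ` A k \<noteq> {}" "finite (x ` A k)" "x ` A k \<noteq> {}"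
          using A Aself[OF k] by auto
        obtain a where a: "a \<in> A k" "Min (y n ` A k) = y n a" using Min_in[OF fin(1,2)] by auto
        obtain b where b: "b \<in> A k" "Min (x ` A k) = x b" using Min_in[OF fin(3,4)] by auto
        have "y n a \<le> y n b" using a b Min_le[OF fin(1), of "y n b"] by auto
        moreover have "x b \<le> x a" using a b Min_le[OF fin(3), of "x a"] by auto
        moreover have "\<bar>y n a - x a\<bar> < e" "\<bar>y n b - x b\<bar> < e" using N n a b by auto
        ultimately show ?thesis using a b by (simp add: abs_less_iff)
      qed
      then show "\<exists>N. \<forall>n\<ge>N. norm (Min (y n ` A k) - Min (x ` A k)) < e" by blast
    qed
    have wc: "(\<lambda>n. w (y n) k) \<longlonglongrightarrow> w x k" if "k < m" for k
      unfolding w_def using y by (intro tendsto_intros Min[OF that]) auto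
    have "(\<lambda>n. \<pi> (y n) j) \<longlonglongrightarrow> \<pi> x j" if j: "j < m" for j
      using j wpos[OF j, of x] unfolding \<pi>_def by (auto intro!: tendsto_intros wc simp: A_def)
    then show "(\<lambda>n. c (\<pi> (y n)) i) \<longlonglongrightarrow> c (\<pi> x) i"
      using piS i by (intro cont) auto
  next
    fix x :: "nat \<Rightarrow> real" and i assume "i < m"
    then show "0 \<le> c (\<pi> x) i \<and> c (\<pi> x) i \<le> B" using bd[OF piS] by blast
  qed
  then obtain x where x: "\<forall>i<m. c (\<pi> x) i = x i" by blast
  have "c (\<pi> x) i \<le> c (\<pi> x) j + \<delta>" if ij: "i < m" "j < m" "grp i = grp j" "\<pi> x i > 0" for i j
  proof -
    have "w x i > 0"
    proof (rule ccontr)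
      assume "\<not> w x i > 0"
      then have "w x i = 0" by (simp add: w_def)
      then show False using ij by (simp add: \<pi>_def)
    qed
    then have "x i < Min (x ` A i) + \<delta>" by (auto simp: w_def less_max_iff_disj)
    also have "Min (x ` A i) \<le> x j" using ij A by (intro Min_le) (auto simp: A_def)
    finally show ?thesis using x ij by simp
  qed
  then show ?thesis using piS[of x] by blast
qed

section \<open>Compactness of the sublevel sets of the action\<close>

lemma abs_cont_on_subinterval:
  assumes "abs_cont_on a b f" "a \<le> s" "t \<le> b"
  shows "abs_cont_on s t f"
  unfolding abs_cont_on_def
proof (intro allI impI)
  fix \<epsilon> :: real assume "\<epsilon> > 0"
  then obtain \<delta> where \<delta>: "\<delta> > 0" and D: "\<forall>(k::nat) (s::nat \<Rightarrow> real) (e::nat \<Rightarrow> real).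
      (\<forall>i<k. a \<le> s i \<and> s i \<le> e i \<and> e i \<le> b) \<and>
      (\<forall>i<k. \<forall>j<k. i \<noteq> j \<longrightarrow> e i \<le> s j \<or> e j \<le> s i) \<and>
      (\<Sum>i<k. e i - s i) < \<delta> \<longrightarrow> (\<Sum>i<k. norm (f (e i) - f (s i))) < \<epsilon>"
    using assms(1) unfolding abs_cont_on_def by blast
  show "\<exists>\<delta>>0. \<forall>(k::nat) (sa::nat \<Rightarrow> real) (e::nat \<Rightarrow> real).
      (\<forall>i<k. s \<le> sa i \<and> sa i \<le> e i \<and> e i \<le> t) \<and>
      (\<forall>i<k. \<forall>j<k. i \<noteq> j \<longrightarrow> e i \<le> sa j \<or> e j \<le> sa i) \<and>
      (\<Sum>i<k. e i - sa i) < \<delta> \<longrightarrow> (\<Sum>i<k. norm (f (e i) - f (sa i))) < \<epsilon>"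
  proof (intro exI[of _ \<delta>] conjI \<delta> allI impI)
    fix k :: nat and u e :: "nat \<Rightarrow> real"
    assume *: "(\<forall>i<k. s \<le> u i \<and> u i \<le> e i \<and> e i \<le> t) \<and>
      (\<forall>i<k. \<forall>j<k. i \<noteq> j \<longrightarrow> e i \<le> u j \<or> e j \<le> u i) \<and> (\<Sum>i<k. e i - u i) < \<delta>"
    then have "\<forall>i<k. a \<le> u i \<and> u i \<le> e i \<and> e i \<le> b" using assms(2,3) by force
    then show "(\<Sum>i<k. norm (f (e i) - f (u i))) < \<epsilon>" using D * by blast
  qed
qed

text \<open>Takes the place of the Cauchy-Schwarz inequality: with \<eta> free it turns a bound on
  the integral of the squared speed into a modulus of continuity, and it is linear in the square, so
  it adds up over disjoint intervals.\<close>

lemma young_square: "\<eta> > 0 \<Longrightarrow> (x::real) \<le> \<eta> * x\<^sup>2 + 1 / (4 * \<eta>)"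
proof -
  assume \<eta>: "\<eta> > 0"
  have "0 \<le> (2 * \<eta> * x - 1)\<^sup>2 / (4 * \<eta>)" using \<eta> by simp
  also have "\<dots> = \<eta> * x\<^sup>2 + 1 / (4 * \<eta>) - x" using \<eta> by (simp add: power2_eq_square field_simps)
  finally show ?thesis by simp
qed

lemma set_integrable_const_interval:
  fixes c s t :: real
  shows "set_integrable lborel {s..t} (\<lambda>_. c)" "set_integrable lborel {s<..t} (\<lambda>_. c)"
proof -
  show I: "set_integrable lborel {s..t} (\<lambda>_. c)" by (rule borel_integrable_atLeastAtMost') simp
  show "set_integrable lborel {s<..t} (\<lambda>_. c)" by (rule set_integrable_subset[OF I]) auto
qed

lemma set_integral_const_interval:
  fixes c s t :: real
  assumes "s \<le> t"
  shows "(LINT x:{s..t}|lborel. c) = (t - s) * c" "(LINT x:{s<..t}|lborel. c) = (t - s) * c"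
  using assms by (simp_all add: set_lebesgue_integral_def)

lemma set_integral_mono_set_nonneg:
  fixes f :: "'a \<Rightarrow> real"
  assumes I: "set_integrable M B f" and A: "A \<in> sets M" "A \<subseteq> B" and f: "\<And>x. 0 \<le> f x"
  shows "(LINT x:A|M. f x) \<le> (LINT x:B|M. f x)"
  unfolding set_lebesgue_integral_def
proof (rule integral_mono)
  show "integrable M (\<lambda>x. indicator A x *\<^sub>R f x)"
    using set_integrable_subset[OF I A] by (simp add: set_integrable_def)
  show "integrable M (\<lambda>x. indicator B x *\<^sub>R f x)" using I by (simp add: set_integrable_def)
  show "indicator A x *\<^sub>R f x \<le> indicator B x *\<^sub>R f x" for x using A f[of x] by (auto simp: indicator_def)
qed

text \<open>Collects what the direct method uses. \<open>L_subgradient\<close> provides supporting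
  affine functions in the velocity variable at every point of the closed domain, the boundary
  included.\<close>

locale tonelli =
  fixes \<Omega> :: "(real^'n) set" and T :: real and L :: "real^'n \<Rightarrow> real^'n \<Rightarrow> real" and c1 c0 :: real
  assumes T_pos: "0 < T" and compact_closure: "compact (closure \<Omega>)"
    and L_cont: "continuous_on (closure \<Omega> \<times> UNIV) (\<lambda>(x,v). L x v)"
    and c1_pos: "0 < c1"
    and L_coercive: "\<And>x v. x \<in> closure \<Omega> \<Longrightarrow> c1 * (norm v)\<^sup>2 - c0 \<le> L x v"
    and L_convex: "\<And>x. x \<in> closure \<Omega> \<Longrightarrow> convex_on UNIV (L x)"
    and L_subgradient: "\<And>x v. x \<in> closure \<Omega> \<Longrightarrow> \<exists>p. \<forall>w. L x v + p \<bullet> (w - v) \<le> L x w"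
begin

definition vel :: "(real, real^'n) bcontfun \<Rightarrow> real \<Rightarrow> real^'n" where
  "vel \<gamma> t = vector_derivative (apply_bcontfun \<gamma>) (at t)"

text \<open>Adding \<open>c0\<close> makes the integrand nonnegative along curves in
  \<open>Gamma\<close>, so that the integral makes sense for every such curve and Fatou's lemma
  applies. \<open>Jcost_eq\<close> takes the constant \<open>c0 * T\<close> out again.\<close>

definition action :: "(real, real^'n) bcontfun \<Rightarrow> ennreal" where
  "action \<gamma> = (\<integral>\<^sup>+t\<in>{0..T}. ennreal (L (apply_bcontfun \<gamma> t) (vel \<gamma> t) + c0) \<partial>lborel)"

lemma Gamma_in_closure: "\<gamma> \<in> Gamma \<Omega> T \<Longrightarrow> apply_bcontfun \<gamma> t \<in> closure \<Omega>"
proof -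
  assume g: "\<gamma> \<in> Gamma \<Omega> T"
  have "apply_bcontfun \<gamma> t = apply_bcontfun \<gamma> (max 0 (min T t))" using g by (auto simp: Gamma_def)
  moreover have "max 0 (min T t) \<in> {0..T}" using T_pos by auto
  moreover have "\<forall>t\<in>{0..T}. apply_bcontfun \<gamma> t \<in> closure \<Omega>" using g unfolding Gamma_def by blast
  ultimately show ?thesis by metis
qed

lemma vel_borel [measurable]: "vel \<gamma> \<in> borel_measurable borel"
  unfolding vel_def by (rule borel_measurable_vector_derivative) simp

lemma bcontfun_borel [measurable]: "apply_bcontfun \<gamma> \<in> borel_measurable borel"
  for \<gamma> :: "(real, real^'n) bcontfun"
  by (rule borel_measurable_continuous_onI) simp

text \<open>\<open>L\<close> is continuous only on the closed set
  \<open>closure \<Omega> \<times> UNIV\<close>. Extended by 0 it is Borel on the whole space, and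
  curves in \<open>Gamma\<close> never leave that set.\<close>

lemma lagrangian_borel:
  assumes "\<gamma> \<in> Gamma \<Omega> T"
  shows "(\<lambda>t. L (apply_bcontfun \<gamma> t) (vel \<gamma> t)) \<in> borel_measurable borel"
proof -
  have "closed (closure \<Omega> \<times> (UNIV :: (real^'n) set))" by (intro closed_Times) auto
  then have "(\<lambda>z. indicator (closure \<Omega> \<times> UNIV) z *\<^sub>R (case z of (x,v) \<Rightarrow> L x v)) \<in> borel_measurable borel"
    by (intro borel_measurable_continuous_on_indicator L_cont borel_closed)
  then have "(\<lambda>t. indicator (closure \<Omega> \<times> UNIV) (apply_bcontfun \<gamma> t, vel \<gamma> t) *\<^sub>R
      (case (apply_bcontfun \<gamma> t, vel \<gamma> t) of (x,v) \<Rightarrow> L x v)) \<in> borel_measurable borel"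
    by (rule measurable_compose[rotated]) measurable
  then show ?thesis using Gamma_in_closure[OF assms] by (simp add: indicator_def)
qed

lemma L_plus_nonneg: "x \<in> closure \<Omega> \<Longrightarrow> 0 \<le> L x v + c0"
  using L_coercive[of x v] c1_pos by (smt (verit) mult_nonneg_nonneg zero_le_power2)

lemma action_finite_imp:
  assumes \<gamma>: "\<gamma> \<in> Gamma \<Omega> T" and M: "action \<gamma> \<le> ennreal M" "0 \<le> M"
  shows "set_integrable lborel {0..T} (\<lambda>t. L (apply_bcontfun \<gamma> t) (vel \<gamma> t) + c0)"
    "(LINT t:{0..T}|lborel. L (apply_bcontfun \<gamma> t) (vel \<gamma> t) + c0) \<le> M"
    "set_integrable lborel {0..T} (\<lambda>t. (norm (vel \<gamma> t))\<^sup>2)"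
    "(LINT t:{0..T}|lborel. (norm (vel \<gamma> t))\<^sup>2) \<le> M / c1"
proof -
  let ?l = "\<lambda>t. L (apply_bcontfun \<gamma> t) (vel \<gamma> t) + c0"
  have meas: "?l \<in> borel_measurable borel" using lagrangian_borel[OF \<gamma>] by simp
  have nn: "0 \<le> ?l t" for t using L_plus_nonneg[OF Gamma_in_closure[OF \<gamma>]] .
  have eq: "action \<gamma> = (\<integral>\<^sup>+t. ennreal (indicator {0..T} t *\<^sub>R ?l t) \<partial>lborel)"
    unfolding action_def by (intro nn_integral_cong) (auto simp: indicator_def)
  have fin: "action \<gamma> < \<infinity>" using M(1) by (simp add: le_less_trans)
  show I: "set_integrable lborel {0..T} ?l"
    unfolding set_integrable_def
  proof (rule integrableI_nonneg)
    show "(\<lambda>t. indicator {0..T} t *\<^sub>R ?l t) \<in> borel_measurable lborel" using meas by measurable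
    show "AE t in lborel. 0 \<le> indicator {0..T} t *\<^sub>R ?l t" using nn by simp
    show "(\<integral>\<^sup>+t. ennreal (indicator {0..T} t *\<^sub>R ?l t) \<partial>lborel) < \<infinity>" using fin eq by simp
  qed
  have "ennreal (LINT t:{0..T}|lborel. ?l t) = action \<gamma>"
    unfolding eq set_lebesgue_integral_def
    by (rule nn_integral_eq_integral[symmetric]) (use I nn in \<open>auto simp: set_integrable_def\<close>)
  then have "ennreal (LINT t:{0..T}|lborel. ?l t) \<le> ennreal M" using M(1) by simp
  then show B: "(LINT t:{0..T}|lborel. ?l t) \<le> M" unfolding ennreal_le_iff[OF M(2)] .
  have q: "c1 * (norm (vel \<gamma> t))\<^sup>2 \<le> ?l t" for t
    using L_coercive[OF Gamma_in_closure[OF \<gamma>], of "vel \<gamma> t" t] by simp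
  show I2: "set_integrable lborel {0..T} (\<lambda>t. (norm (vel \<gamma> t))\<^sup>2)"
    unfolding set_integrable_def
  proof (rule Bochner_Integration.integrable_bound)
    show "integrable lborel (\<lambda>t. indicator {0..T} t *\<^sub>R (?l t / c1))"
      using I c1_pos unfolding set_integrable_def by simp
    show "(\<lambda>t. indicator {0..T} t *\<^sub>R (norm (vel \<gamma> t))\<^sup>2) \<in> borel_measurable lborel" by measurable
    show "AE t in lborel. norm (indicator {0..T} t *\<^sub>R (norm (vel \<gamma> t))\<^sup>2) \<le> norm (indicator {0..T} t *\<^sub>R (?l t / c1))"
      using q nn c1_pos by (auto simp: indicator_def field_simps)
  qed
  have "c1 * (LINT t:{0..T}|lborel. (norm (vel \<gamma> t))\<^sup>2) = (LINT t:{0..T}|lborel. c1 * (norm (vel \<gamma> t))\<^sup>2)"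
    by simp
  also have "\<dots> \<le> (LINT t:{0..T}|lborel. ?l t)"
    by (rule set_integral_mono) (use I I2 q in auto)
  also have "\<dots> \<le> M" by (rule B)
  finally show "(LINT t:{0..T}|lborel. (norm (vel \<gamma> t))\<^sup>2) \<le> M / c1"
    using c1_pos by (simp add: field_simps)
qed

text \<open>The term \<open>T / 4\<close> comes from \<open>young_square\<close> with parameter 1,
  integrated over the time interval.\<close>

lemma speed_integrable:
  assumes \<gamma>: "\<gamma> \<in> Gamma \<Omega> T" and M: "action \<gamma> \<le> ennreal M" "0 \<le> M"
  shows "set_integrable lborel {0..T} (vel \<gamma>)" "set_integrable lborel {0..T} (\<lambda>t. norm (vel \<gamma> t))"
    "(LINT t:{0..T}|lborel. norm (vel \<gamma> t)) \<le> M / c1 + T / 4"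
proof -
  note I2 = action_finite_imp(3)[OF assms]
  have I3: "set_integrable lborel {0..T} (\<lambda>t. (norm (vel \<gamma> t))\<^sup>2 + 1/4)"
    by (rule set_integral_add(1)[OF I2 set_integrable_const_interval(1)])
  have y: "norm (vel \<gamma> t) \<le> (norm (vel \<gamma> t))\<^sup>2 + 1/4" for t using young_square[of 1 "norm (vel \<gamma> t)"] by simp
  show "set_integrable lborel {0..T} (vel \<gamma>)"
    unfolding set_integrable_def
    by (rule Bochner_Integration.integrable_bound[OF I3[unfolded set_integrable_def]])
       (use y in \<open>auto simp: indicator_def intro: order_trans\<close>)
  then show I1: "set_integrable lborel {0..T} (\<lambda>t. norm (vel \<gamma> t))"
    by (rule set_integrable_norm)
  have "(LINT t:{0..T}|lborel. norm (vel \<gamma> t)) \<le> (LINT t:{0..T}|lborel. (norm (vel \<gamma> t))\<^sup>2 + 1/4)"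
    by (rule set_integral_mono[OF I1 I3 y])
  also have "\<dots> = (LINT t:{0..T}|lborel. (norm (vel \<gamma> t))\<^sup>2) + T / 4"
    using T_pos unfolding set_integral_add(2)[OF I2 set_integrable_const_interval(1)]
    by (simp add: set_integral_const_interval)
  finally show "(LINT t:{0..T}|lborel. norm (vel \<gamma> t)) \<le> M / c1 + T / 4"
    using action_finite_imp(4)[OF assms] by linarith
qed

lemma increment_eq_integral:
  assumes \<gamma>: "\<gamma> \<in> Gamma \<Omega> T" and M: "action \<gamma> \<le> ennreal M" "0 \<le> M" and st: "0 \<le> s" "s \<le> t" "t \<le> T"
  shows "apply_bcontfun \<gamma> t - apply_bcontfun \<gamma> s = (LINT x:{s<..t}|lborel. vel \<gamma> x)"
    "set_integrable lborel {s<..t} (vel \<gamma>)"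
proof -
  show I: "set_integrable lborel {s<..t} (vel \<gamma>)"
    using speed_integrable(1)[OF \<gamma> M] st by (rule_tac set_integrable_subset) auto
  have I': "set_integrable lborel {s..t} (vel \<gamma>)"
    using speed_integrable(1)[OF \<gamma> M] st by (rule_tac set_integrable_subset) auto
  have "abs_cont_on s t (apply_bcontfun \<gamma>)"
    by (rule abs_cont_on_subinterval[of 0 T]) (use \<gamma> st in \<open>auto simp: Gamma_def\<close>)
  then have "(vel \<gamma> has_integral (apply_bcontfun \<gamma> t - apply_bcontfun \<gamma> s)) {s..t}"
    unfolding vel_def using st by (intro abs_cont_on_has_integral_vector_derivative)
  then have "apply_bcontfun \<gamma> t - apply_bcontfun \<gamma> s = (LINT x:{s..t}|lborel. vel \<gamma> x)"
    using set_borel_integral_eq_integral(2)[OF I'] by (simp add: integral_unique)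
  also have "\<dots> = (LINT x:{s<..t}|lborel. vel \<gamma> x)"
    unfolding set_lebesgue_integral_def
  proof (rule integral_cong_AE)
    show "AE x in lborel. indicator {s..t} x *\<^sub>R vel \<gamma> x = indicator {s<..t} x *\<^sub>R vel \<gamma> x"
      using AE_lborel_singleton[of s] by eventually_elim (auto simp: indicator_def)
  qed measurable
  finally show "apply_bcontfun \<gamma> t - apply_bcontfun \<gamma> s = (LINT x:{s<..t}|lborel. vel \<gamma> x)" .
qed

lemma increment_bound:
  assumes \<gamma>: "\<gamma> \<in> Gamma \<Omega> T" and M: "action \<gamma> \<le> ennreal M" "0 \<le> M" and st: "0 \<le> s" "s \<le> t" "t \<le> T" and \<eta>: "\<eta> > 0"
  shows "norm (apply_bcontfun \<gamma> t - apply_bcontfun \<gamma> s)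
    \<le> \<eta> * (LINT x:{s<..t}|lborel. (norm (vel \<gamma> x))\<^sup>2) + (t - s) / (4 * \<eta>)"
proof -
  have I: "set_integrable lborel {s<..t} (vel \<gamma>)" by (rule increment_eq_integral(2)[OF assms(1-6)])
  have I2: "set_integrable lborel {s<..t} (\<lambda>x. (norm (vel \<gamma> x))\<^sup>2)"
    using action_finite_imp(3)[OF \<gamma> M] st by (rule_tac set_integrable_subset) auto
  have I2': "set_integrable lborel {s<..t} (\<lambda>x. \<eta> * (norm (vel \<gamma> x))\<^sup>2)"
    using I2 by (rule set_integrable_mult_right)
  note add = set_integral_add[OF I2' set_integrable_const_interval(2)]
  have I3: "set_integrable lborel {s<..t} (\<lambda>x. \<eta> * (norm (vel \<gamma> x))\<^sup>2 + 1 / (4 * \<eta>))"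
    by (rule add(1))
  have "norm (apply_bcontfun \<gamma> t - apply_bcontfun \<gamma> s) = norm (LINT x:{s<..t}|lborel. vel \<gamma> x)"
    by (simp add: increment_eq_integral(1)[OF assms(1-6)])
  also have "\<dots> \<le> (LINT x:{s<..t}|lborel. norm (vel \<gamma> x))" using I by (rule set_integral_norm_bound)
  also have "\<dots> \<le> (LINT x:{s<..t}|lborel. \<eta> * (norm (vel \<gamma> x))\<^sup>2 + 1 / (4 * \<eta>))"
    by (rule set_integral_mono[OF set_integrable_norm[OF I] I3 young_square[OF \<eta>]])
  also have "\<dots> = \<eta> * (LINT x:{s<..t}|lborel. (norm (vel \<gamma> x))\<^sup>2) + (t - s) / (4 * \<eta>)"
    using st unfolding add(2) by (simp add: set_integral_const_interval)
  finally show ?thesis .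
qed

lemma equicontinuity_bound:
  assumes \<gamma>: "\<gamma> \<in> Gamma \<Omega> T" and M: "action \<gamma> \<le> ennreal M" "0 \<le> M" and \<eta>: "\<eta> > 0"
  shows "norm (apply_bcontfun \<gamma> t - apply_bcontfun \<gamma> s) \<le> \<eta> * (M / c1) + \<bar>t - s\<bar> / (4 * \<eta>)"
proof -
  have *: "norm (apply_bcontfun \<gamma> t - apply_bcontfun \<gamma> s) \<le> \<eta> * (M / c1) + (t - s) / (4 * \<eta>)"
    if st: "0 \<le> s" "s \<le> t" "t \<le> T" for s t
  proof -
    have "(LINT x:{s<..t}|lborel. (norm (vel \<gamma> x))\<^sup>2) \<le> (LINT x:{0..T}|lborel. (norm (vel \<gamma> x))\<^sup>2)"
      by (rule set_integral_mono_set_nonneg[OF action_finite_imp(3)[OF \<gamma> M]]) (use st in auto)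
    also have "\<dots> \<le> M / c1" by (rule action_finite_imp(4)[OF \<gamma> M])
    finally have "\<eta> * (LINT x:{s<..t}|lborel. (norm (vel \<gamma> x))\<^sup>2) \<le> \<eta> * (M / c1)"
      using \<eta> by (intro mult_left_mono) auto
    then show ?thesis using increment_bound[OF \<gamma> M st \<eta>] by linarith
  qed
  define s' t' where "s' = max 0 (min T s)" and "t' = max 0 (min T t)"
  have c: "apply_bcontfun \<gamma> t = apply_bcontfun \<gamma> t'" "apply_bcontfun \<gamma> s = apply_bcontfun \<gamma> s'"
    using \<gamma> unfolding s'_def t'_def Gamma_def by blast+
  have b: "0 \<le> s'" "s' \<le> T" "0 \<le> t'" "t' \<le> T" "\<bar>t' - s'\<bar> \<le> \<bar>t - s\<bar>" using T_pos by (auto simp: s'_def t'_def)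
  have "norm (apply_bcontfun \<gamma> t' - apply_bcontfun \<gamma> s') \<le> \<eta> * (M / c1) + \<bar>t' - s'\<bar> / (4 * \<eta>)"
  proof (cases "s' \<le> t'")
    case True
    then show ?thesis using *[of s' t'] b by simp
  next
    case False
    then show ?thesis using *[of t' s'] b by (simp add: norm_minus_commute)
  qed
  also have "\<bar>t' - s'\<bar> / (4 * \<eta>) \<le> \<bar>t - s\<bar> / (4 * \<eta>)" using b \<eta> by (intro divide_right_mono) auto
  finally show ?thesis using c by simp
qed

lemma uniform_equicontinuity:
  assumes "0 \<le> M" "\<epsilon> > 0"
  obtains \<delta> where "\<delta> > 0"
    "\<And>\<gamma> s t. \<gamma> \<in> Gamma \<Omega> T \<Longrightarrow> action \<gamma> \<le> ennreal M \<Longrightarrow> \<bar>t - s\<bar> < \<delta> \<Longrightarrow> norm (apply_bcontfun \<gamma> t - apply_bcontfun \<gamma> s) < \<epsilon>"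
proof -
  \<comment> \<open>The two terms of \<open>equicontinuity_bound\<close> get half of \<epsilon>
    each; the added 1 keeps the denominator positive when \<open>M = 0\<close>.\<close>
  define \<eta> where "\<eta> = \<epsilon> / (2 * (M / c1 + 1))"
  have Mc: "M / c1 + 1 > 0" using assms c1_pos by (simp add: add_nonneg_pos)
  have \<eta>: "\<eta> > 0" using Mc assms by (simp add: \<eta>_def)
  have "\<epsilon> / (2 * X) * X = \<epsilon> / 2" if "X > 0" for X using that by simp
  from this[OF Mc] have e1: "\<eta> * (M / c1 + 1) = \<epsilon> / 2" by (simp only: \<eta>_def)
  define \<delta> where "\<delta> = 2 * \<eta> * \<epsilon>"
  have "\<delta> > 0" using \<eta> assms by (simp add: \<delta>_def)
  moreover have "norm (apply_bcontfun \<gamma> t - apply_bcontfun \<gamma> s) < \<epsilon>"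
    if "\<gamma> \<in> Gamma \<Omega> T" "action \<gamma> \<le> ennreal M" "\<bar>t - s\<bar> < \<delta>" for \<gamma> s t
  proof -
    have "\<bar>t - s\<bar> / (4 * \<eta>) < \<delta> / (4 * \<eta>)" using that \<eta> by (intro divide_strict_right_mono) auto
    also have "\<dots> = \<epsilon> / 2" using \<eta> by (simp add: \<delta>_def)
    finally show ?thesis
      using equicontinuity_bound[OF that(1,2) assms(1) \<eta>, of t s] e1 \<eta> by (simp add: algebra_simps)
  qed
  ultimately show ?thesis using that by blast
qed

end

section \<open>Comparison of the action with its discretisation on uniform grids\<close>

lemma set_integral_partition:
  fixes f :: "real \<Rightarrow> 'a::{banach,second_countable_topology}"
  assumes "\<And>j. a j \<le> a (Suc j)" "set_integrable lborel {a 0<..a N} f"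
  shows "(\<Sum>j<N. LINT x:{a j<..a (Suc j)}|lborel. f x) = (LINT x:{a 0<..a N}|lborel. f x)"
  using assms(2)
proof (induction N)
  case 0
  then show ?case by (simp add: set_lebesgue_integral_def)
next
  case (Suc N)
  have m: "a 0 \<le> a N" using lift_Suc_mono_le[of a 0 N] assms(1) by simp
  have U: "{a 0<..a (Suc N)} = {a 0<..a N} \<union> {a N<..a (Suc N)}"
    using m assms(1)[of N] by auto
  have I: "set_integrable lborel {a 0<..a N} f" "set_integrable lborel {a N<..a (Suc N)} f"
    using Suc.prems unfolding U by (auto intro: set_integrable_subset)
  show ?case unfolding U using Suc.IH[OF I(1)] I by (simp add: set_integral_Un)
qed

context tonelli
begin

text \<open>A supporting function at \<open>y\<close> almost supports \<open>L x\<close> for nearby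
  \<open>x\<close>. Uniform continuity on a compact set shows this for velocities within distance 1
  of \<open>v0\<close>; convexity of \<open>L x\<close> extends it to all velocities at the cost of
  an error of linear growth, which is harmless because the speed is integrable.\<close>

lemma subgradient_perturbation:
  assumes R: "0 \<le> R" and \<epsilon>: "\<epsilon> > 0"
  shows "\<exists>\<delta>>0. \<forall>y\<in>closure \<Omega>. \<forall>v0. norm v0 \<le> R \<longrightarrow>
    (\<exists>p. \<forall>x\<in>closure \<Omega>. dist x y < \<delta> \<longrightarrow> (\<forall>v. L y v0 + p \<bullet> (v - v0) - 2 * \<epsilon> * (1 + norm (v - v0)) \<le> L x v))"
proof -
  have "compact (closure \<Omega> \<times> cball (0::real^'n) (R + 1))" by (intro compact_Times compact_closure) auto
  moreover have "continuous_on (closure \<Omega> \<times> cball (0::real^'n) (R + 1)) (\<lambda>(x,v). L x v)"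
    by (rule continuous_on_subset[OF L_cont]) auto
  ultimately have "uniformly_continuous_on (closure \<Omega> \<times> cball (0::real^'n) (R + 1)) (\<lambda>(x,v). L x v)"
    by (intro compact_uniformly_continuous)
  then obtain \<delta> where \<delta>: "\<delta> > 0" and D: "\<And>z z'. z \<in> closure \<Omega> \<times> cball (0::real^'n) (R + 1) \<Longrightarrow>
      z' \<in> closure \<Omega> \<times> cball (0::real^'n) (R + 1) \<Longrightarrow> dist z' z < \<delta> \<Longrightarrow>
      dist (case z' of (x,v) \<Rightarrow> L x v) (case z of (x,v) \<Rightarrow> L x v) < \<epsilon>"
    unfolding uniformly_continuous_on_def using \<epsilon> by metis
  have D': "\<bar>L x u - L y u\<bar> < \<epsilon>" if "x \<in> closure \<Omega>" "y \<in> closure \<Omega>" "dist x y < \<delta>" "norm u \<le> R + 1" for x y u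
    using D[of "(y,u)" "(x,u)"] that by (simp add: dist_Pair_Pair dist_real_def)
  have main: "L y v0 + p \<bullet> (v - v0) - 2 * \<epsilon> * (1 + norm (v - v0)) \<le> L x v"
    if xy: "x \<in> closure \<Omega>" "y \<in> closure \<Omega>" "dist x y < \<delta>" and v0: "norm v0 \<le> R"
      and p: "\<forall>w. L y v0 + p \<bullet> (w - v0) \<le> L y w" for x y v0 v p
  proof -
    define g where "g = (\<lambda>u. L x u - L y v0 - p \<bullet> (u - v0))"
    have g0: "g v0 \<le> \<epsilon>" using D'[OF xy, of v0] v0 by (simp add: g_def)
    have g1: "g u \<ge> - \<epsilon>" if "norm (u - v0) \<le> 1" for u
    proof -
      have "norm u \<le> R + 1" using that v0 norm_triangle_ineq[of "u - v0" v0] by simp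
      then show ?thesis using D'[OF xy, of u] p[rule_format, of u] by (simp add: g_def)
    qed
    have "- (2 * \<epsilon> * (1 + norm (v - v0))) \<le> g v"
    proof (cases "norm (v - v0) \<le> 1")
      case True
      have "2 * \<epsilon> * 1 \<le> 2 * \<epsilon> * (1 + norm (v - v0))" using \<epsilon> by (intro mult_left_mono) auto
      then show ?thesis using g1[OF True] \<epsilon> by linarith
    next
      case False
      define r where "r = norm (v - v0)"
      have r: "r > 1" using False by (simp add: r_def)
      \<comment> \<open>The point of the segment from \<open>v0\<close> to \<open>v\<close> at
        distance 1 from \<open>v0\<close>. There \<open>g\<close> is at least
        \<open>- \<epsilon>\<close>, at \<open>v0\<close> it is at most \<open>\<epsilon>\<close>,
        so convexity gives at least \<open>- 2 * \<epsilon> * r\<close> at \<open>v\<close>.\<close>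
      define u where "u = v0 + (1/r) *\<^sub>R (v - v0)"
      have "v \<noteq> v0" using r by (auto simp: r_def)
      then have "norm (u - v0) = 1" by (simp add: u_def r_def)
      then have gu: "- \<epsilon> \<le> g u" using g1 by simp
      have ueq: "u = (1 - 1/r) *\<^sub>R v0 + (1/r) *\<^sub>R v" by (simp add: u_def algebra_simps)
      have "L x u \<le> (1 - 1/r) * L x v0 + (1/r) * L x v"
        unfolding ueq using r by (intro convex_onD[OF L_convex[OF xy(1)]]) auto
      moreover have "p \<bullet> (u - v0) = (1/r) * (p \<bullet> (v - v0))" by (simp add: u_def)
      ultimately have "g u \<le> (1 - 1/r) * g v0 + (1/r) * g v" by (simp add: g_def algebra_simps)
      also have "(1 - 1/r) * g v0 \<le> 1 * \<epsilon>"
      proof -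
        have "(1 - 1/r) * g v0 \<le> (1 - 1/r) * \<epsilon>" using g0 r by (intro mult_left_mono) auto
        also have "\<dots> \<le> 1 * \<epsilon>" using \<epsilon> r by (intro mult_right_mono) auto
        finally show ?thesis .
      qed
      finally have "- 2 * \<epsilon> \<le> (1/r) * g v" using gu by simp
      then have "- 2 * \<epsilon> * r \<le> g v" using r by (simp add: field_simps)
      moreover have "2 * \<epsilon> * (1 + norm (v - v0)) \<ge> 2 * \<epsilon> * r" using \<epsilon> by (intro mult_left_mono) (auto simp: r_def)
      ultimately show ?thesis by simp
    qed
    then show ?thesis by (simp add: g_def algebra_simps)
  qed
  show ?thesis
  proof (intro exI[of _ \<delta>] conjI \<delta> ballI allI impI)
    fix y v0 :: "real^'n" assume y: "y \<in> closure \<Omega>" and v0: "norm v0 \<le> R"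
    obtain p where "\<forall>w. L y v0 + p \<bullet> (w - v0) \<le> L y w" using L_subgradient[OF y] by blast
    then show "\<exists>p. \<forall>x\<in>closure \<Omega>. dist x y < \<delta> \<longrightarrow> (\<forall>v. L y v0 + p \<bullet> (v - v0) - 2 * \<epsilon> * (1 + norm (v - v0)) \<le> L x v)"
      using main y v0 by blast
  qed
qed

text \<open>Jensen's inequality on one grid cell with the position frozen at the left end. As
  \<open>v0\<close> is the mean velocity, the linear term of the supporting function integrates to
  zero and only its value at \<open>v0\<close> and the error terms remain.\<close>

lemma cell_bound:
  assumes \<gamma>: "\<gamma> \<in> Gamma \<Omega> T" and M: "action \<gamma> \<le> ennreal M" "0 \<le> M" and st: "0 \<le> s" "s < t" "t \<le> T"
    and v0: "v0 = (1 / (t - s)) *\<^sub>R (apply_bcontfun \<gamma> t - apply_bcontfun \<gamma> s)" "norm v0 \<le> R" and \<epsilon>: "0 < \<epsilon>"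
    and p: "\<And>r v. r \<in> {s<..t} \<Longrightarrow> L (apply_bcontfun \<gamma> s) v0 + p \<bullet> (v - v0) - 2 * \<epsilon> * (1 + norm (v - v0)) \<le> L (apply_bcontfun \<gamma> r) v"
  shows "(t - s) * (L (apply_bcontfun \<gamma> s) v0 + c0)
    \<le> (LINT r:{s<..t}|lborel. L (apply_bcontfun \<gamma> r) (vel \<gamma> r) + c0)
      + 2 * \<epsilon> * ((t - s) * (1 + R) + (LINT r:{s<..t}|lborel. norm (vel \<gamma> r)))"
proof -
  let ?l = "\<lambda>r. L (apply_bcontfun \<gamma> r) (vel \<gamma> r) + c0"
  have st': "s \<le> t" using st by simp
  have sub: "{s<..t} \<subseteq> {0..T}" using st by auto
  have Iv: "set_integrable lborel {s<..t} (vel \<gamma>)" by (rule increment_eq_integral(2)[OF \<gamma> M st(1) st' st(3)])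
  have In: "set_integrable lborel {s<..t} (\<lambda>r. norm (vel \<gamma> r))" using Iv by (rule set_integrable_norm)
  have Il: "set_integrable lborel {s<..t} ?l"
    by (rule set_integrable_subset[OF action_finite_imp(1)[OF \<gamma> M]]) (use sub in auto)
  have Ic: "set_integrable lborel {s<..t} (\<lambda>r. c)" for c :: real by (rule set_integrable_const_interval)
  have Ip: "set_integrable lborel {s<..t} (\<lambda>r. p \<bullet> vel \<gamma> r)"
    using integrable_inner_right[OF Iv[unfolded set_integrable_def], of p] by (simp add: set_integrable_def)
  have intp: "(LINT r:{s<..t}|lborel. p \<bullet> vel \<gamma> r) = p \<bullet> (LINT r:{s<..t}|lborel. vel \<gamma> r)"
    unfolding set_lebesgue_integral_def
    using integral_inner_right[OF Iv[unfolded set_integrable_def], of p] by simp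
  have intc: "(LINT r:{s<..t}|lborel. c) = (t - s) * c" for c :: real
    using st' by (rule set_integral_const_interval)
  define A where "A = L (apply_bcontfun \<gamma> s) v0 + c0 - p \<bullet> v0"
  have "(LINT r:{s<..t}|lborel. A + p \<bullet> vel \<gamma> r)
      \<le> (LINT r:{s<..t}|lborel. ?l r + (2 * \<epsilon> * (1 + R) + 2 * \<epsilon> * norm (vel \<gamma> r)))"
  proof (rule set_integral_mono)
    show "set_integrable lborel {s<..t} (\<lambda>r. A + p \<bullet> vel \<gamma> r)" by (intro set_integral_add Ic Ip)
    show "set_integrable lborel {s<..t} (\<lambda>r. ?l r + (2 * \<epsilon> * (1 + R) + 2 * \<epsilon> * norm (vel \<gamma> r)))"
      by (intro set_integral_add Ic Il set_integrable_mult_right In impI)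
    fix r assume r: "r \<in> {s<..t}"
    have "norm (vel \<gamma> r - v0) \<le> norm (vel \<gamma> r) + R" using norm_triangle_ineq4[of "vel \<gamma> r" v0] v0(2) by linarith
    then have "2 * \<epsilon> * (1 + norm (vel \<gamma> r - v0)) \<le> 2 * \<epsilon> * (1 + (norm (vel \<gamma> r) + R))" using \<epsilon> by (intro mult_left_mono) auto
    then show "A + p \<bullet> vel \<gamma> r \<le> ?l r + (2 * \<epsilon> * (1 + R) + 2 * \<epsilon> * norm (vel \<gamma> r))"
      using p[OF r, of "vel \<gamma> r"] by (simp add: A_def algebra_simps)
  qed
  moreover have "(LINT r:{s<..t}|lborel. A + p \<bullet> vel \<gamma> r) = (t - s) * (L (apply_bcontfun \<gamma> s) v0 + c0)"
  proof -
    have "(LINT r:{s<..t}|lborel. A + p \<bullet> vel \<gamma> r) = (t - s) * A + p \<bullet> (apply_bcontfun \<gamma> t - apply_bcontfun \<gamma> s)"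
      using increment_eq_integral(1)[OF \<gamma> M st(1) st' st(3)] by (subst set_integral_add(2)[OF Ic Ip]) (simp add: intc intp)
    also have "apply_bcontfun \<gamma> t - apply_bcontfun \<gamma> s = (t - s) *\<^sub>R v0" using st v0 by simp
    finally show ?thesis by (simp add: A_def algebra_simps)
  qed
  moreover have "(LINT r:{s<..t}|lborel. ?l r + (2 * \<epsilon> * (1 + R) + 2 * \<epsilon> * norm (vel \<gamma> r)))
      = (LINT r:{s<..t}|lborel. ?l r) + 2 * \<epsilon> * ((t - s) * (1 + R) + (LINT r:{s<..t}|lborel. norm (vel \<gamma> r)))"
  proof -
    have In': "set_integrable lborel {s<..t} (\<lambda>r. 2 * \<epsilon> * norm (vel \<gamma> r))" using In by (rule set_integrable_mult_right)
    note a1 = set_integral_add[OF Ic[of "2 * \<epsilon> * (1 + R)"] In']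
    have "(LINT r:{s<..t}|lborel. ?l r + (2 * \<epsilon> * (1 + R) + 2 * \<epsilon> * norm (vel \<gamma> r)))
        = (LINT r:{s<..t}|lborel. ?l r) + ((t - s) * (2 * \<epsilon> * (1 + R)) + 2 * \<epsilon> * (LINT r:{s<..t}|lborel. norm (vel \<gamma> r)))"
      unfolding set_integral_add(2)[OF Il a1(1)] a1(2) intc by simp
    then show ?thesis by (simp add: algebra_simps)
  qed
  ultimately show ?thesis by simp
qed

text \<open>Equal to 1 up to norm \<open>R - 1\<close> and to 0 from norm \<open>R\<close> on. It
  restricts the slopes to a ball on which \<open>subgradient_perturbation\<close> is uniform, and is
  continuous so that the discrete action passes to limits.\<close>

definition cutoff :: "real \<Rightarrow> real^'n \<Rightarrow> real" where
  "cutoff R v = max 0 (min 1 (R - norm v))"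

definition slope :: "nat \<Rightarrow> nat \<Rightarrow> (real, real^'n) bcontfun \<Rightarrow> real^'n" where
  "slope N j \<gamma> = (real N / T) *\<^sub>R (apply_bcontfun \<gamma> (real (Suc j) * T / real N) - apply_bcontfun \<gamma> (real j * T / real N))"

text \<open>Depends on the curve only through two grid values, hence is continuous under uniform
  convergence, in contrast to the action itself.\<close>

definition cell_action :: "real \<Rightarrow> nat \<Rightarrow> nat \<Rightarrow> (real, real^'n) bcontfun \<Rightarrow> real" where
  "cell_action R N j \<gamma> = cutoff R (slope N j \<gamma>) * (L (apply_bcontfun \<gamma> (real j * T / real N)) (slope N j \<gamma>) + c0)"

text \<open>On a sublevel set the curves are uniformly equicontinuous, so a fine grid keeps each
  curve within the \<delta> of \<open>subgradient_perturbation\<close> on every cell. Summing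
  \<open>cell_bound\<close> gives one \<open>N0\<close> for the whole sublevel set; cells with a
  slope beyond \<open>R\<close> contribute 0.\<close>

lemma discrete_action_bound:
  assumes R: "0 \<le> R" and \<epsilon>: "\<epsilon> > 0" and M: "0 \<le> M"
  shows "\<exists>N0>0. \<forall>N\<ge>N0. \<forall>\<gamma>\<in>Gamma \<Omega> T. action \<gamma> \<le> ennreal M \<longrightarrow>
    (\<Sum>j<N. (T / real N) * cell_action R N j \<gamma>) \<le> M + 2 * \<epsilon> * (T * (1 + R) + (M / c1 + T / 4))"
proof -
  obtain \<delta> where \<delta>: "\<delta> > 0" and D: "\<forall>y\<in>closure \<Omega>. \<forall>v0. norm v0 \<le> R \<longrightarrow>
    (\<exists>p. \<forall>x\<in>closure \<Omega>. dist x y < \<delta> \<longrightarrow> (\<forall>v. L y v0 + p \<bullet> (v - v0) - 2 * \<epsilon> * (1 + norm (v - v0)) \<le> L x v))"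
    using subgradient_perturbation[OF R \<epsilon>] by blast
  obtain \<rho> where \<rho>: "\<rho> > 0" and eq: "\<And>\<gamma> s t. \<gamma> \<in> Gamma \<Omega> T \<Longrightarrow> action \<gamma> \<le> ennreal M \<Longrightarrow> \<bar>t - s\<bar> < \<rho> \<Longrightarrow>
      norm (apply_bcontfun \<gamma> t - apply_bcontfun \<gamma> s) < \<delta>"
    using uniform_equicontinuity[OF M \<delta>] by blast
  obtain N0 :: nat where N0: "real N0 > T / \<rho>" using reals_Archimedean2 by blast
  have "(\<Sum>j<N. (T / real N) * cell_action R N j \<gamma>) \<le> M + 2 * \<epsilon> * (T * (1 + R) + (M / c1 + T / 4))"
    if N: "N \<ge> Suc N0" and \<gamma>: "\<gamma> \<in> Gamma \<Omega> T" and act: "action \<gamma> \<le> ennreal M" for N \<gamma>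
  proof -
    have N': "real N > 0" "real N > T / \<rho>" using N N0 by auto
    then have h: "T / real N < \<rho>" using \<rho> by (simp add: field_simps)
    define a where "a = (\<lambda>j. real j * T / real N)"
    have a: "a (Suc j) - a j = T / real N" "a j \<le> a (Suc j)" for j
      using N' T_pos by (auto simp: a_def field_simps)
    have a0: "0 \<le> a j" for j using N' T_pos by (simp add: a_def)
    have aT: "a j \<le> T" if "j \<le> N" for j using that N' T_pos by (simp add: a_def field_simps)
    have aN: "a N = T" "a 0 = 0" using N' by (simp_all add: a_def)
    let ?l = "\<lambda>r. L (apply_bcontfun \<gamma> r) (vel \<gamma> r) + c0"
    have l0: "0 \<le> ?l r" for r using L_plus_nonneg[OF Gamma_in_closure[OF \<gamma>]] .
    have cell: "(T / real N) * cell_action R N j \<gamma> \<le> (LINT r:{a j<..a (Suc j)}|lborel. ?l r)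
        + 2 * \<epsilon> * ((T / real N) * (1 + R) + (LINT r:{a j<..a (Suc j)}|lborel. norm (vel \<gamma> r)))"
      if j: "j < N" for j
    proof (cases "norm (slope N j \<gamma>) \<le> R")
      case True
      have sl: "slope N j \<gamma> = (1 / (a (Suc j) - a j)) *\<^sub>R (apply_bcontfun \<gamma> (a (Suc j)) - apply_bcontfun \<gamma> (a j))"
        using a(1)[of j] by (simp add: slope_def a_def)
      obtain p where p: "\<forall>x\<in>closure \<Omega>. dist x (apply_bcontfun \<gamma> (a j)) < \<delta> \<longrightarrow> (\<forall>v. L (apply_bcontfun \<gamma> (a j)) (slope N j \<gamma>)
          + p \<bullet> (v - slope N j \<gamma>) - 2 * \<epsilon> * (1 + norm (v - slope N j \<gamma>)) \<le> L x v)"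
        using D Gamma_in_closure[OF \<gamma>, of "a j"] True by blast
      have "(a (Suc j) - a j) * (L (apply_bcontfun \<gamma> (a j)) (slope N j \<gamma>) + c0) \<le> (LINT r:{a j<..a (Suc j)}|lborel. ?l r)
          + 2 * \<epsilon> * ((a (Suc j) - a j) * (1 + R) + (LINT r:{a j<..a (Suc j)}|lborel. norm (vel \<gamma> r)))"
      proof (rule cell_bound[OF \<gamma> act M a0 _ _ sl True \<epsilon>])
        show "a j < a (Suc j)" using a(1)[of j] N' T_pos by (smt (verit) divide_pos_pos)
        show "a (Suc j) \<le> T" using aT j by simp
        fix r v assume r: "r \<in> {a j<..a (Suc j)}"
        then have "\<bar>r - a j\<bar> < \<rho>" using a(1)[of j] h by auto
        then have "dist (apply_bcontfun \<gamma> r) (apply_bcontfun \<gamma> (a j)) < \<delta>" using eq[OF \<gamma> act] by (simp add: dist_norm)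
        then show "L (apply_bcontfun \<gamma> (a j)) (slope N j \<gamma>) + p \<bullet> (v - slope N j \<gamma>) - 2 * \<epsilon> * (1 + norm (v - slope N j \<gamma>)) \<le> L (apply_bcontfun \<gamma> r) v"
          using p Gamma_in_closure[OF \<gamma>] by blast
      qed
      moreover have "cell_action R N j \<gamma> \<le> 1 * (L (apply_bcontfun \<gamma> (a j)) (slope N j \<gamma>) + c0)"
        unfolding cell_action_def a_def using L_plus_nonneg[OF Gamma_in_closure[OF \<gamma>]]
        by (intro mult_right_mono) (auto simp: cutoff_def)
      then have "(T / real N) * cell_action R N j \<gamma> \<le> (T / real N) * (L (apply_bcontfun \<gamma> (a j)) (slope N j \<gamma>) + c0)"
        using T_pos N' by (intro mult_left_mono) auto
      ultimately show ?thesis using a(1)[of j] by simp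
    next
      case False
      then have "cell_action R N j \<gamma> = 0" by (simp add: cell_action_def cutoff_def)
      moreover have "0 \<le> (LINT r:{a j<..a (Suc j)}|lborel. ?l r)" "0 \<le> (LINT r:{a j<..a (Suc j)}|lborel. norm (vel \<gamma> r))"
        unfolding set_lebesgue_integral_def using l0 by (auto intro!: Bochner_Integration.integral_nonneg simp: indicator_def)
      ultimately show ?thesis using R \<epsilon> T_pos by simp
    qed
    have sub: "{a 0<..a N} \<subseteq> {0..T}" using aN by auto
    have Il: "set_integrable lborel {a 0<..a N} ?l"
      by (rule set_integrable_subset[OF action_finite_imp(1)[OF \<gamma> act M]]) (use sub in auto)
    have In: "set_integrable lborel {a 0<..a N} (\<lambda>r. norm (vel \<gamma> r))"
      by (rule set_integrable_subset[OF speed_integrable(2)[OF \<gamma> act M]]) (use sub in auto)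
    have "(\<Sum>j<N. (T / real N) * cell_action R N j \<gamma>) \<le> (\<Sum>j<N. (LINT r:{a j<..a (Suc j)}|lborel. ?l r)
        + 2 * \<epsilon> * ((T / real N) * (1 + R) + (LINT r:{a j<..a (Suc j)}|lborel. norm (vel \<gamma> r))))"
      by (rule sum_mono) (use cell in auto)
    also have "\<dots> = (LINT r:{a 0<..a N}|lborel. ?l r) + 2 * \<epsilon> * (real N * ((T / real N) * (1 + R)) + (LINT r:{a 0<..a N}|lborel. norm (vel \<gamma> r)))"
      unfolding set_integral_partition[of a, OF a(2) Il, symmetric] set_integral_partition[of a, OF a(2) In, symmetric]
      by (simp add: sum.distrib sum_distrib_left distrib_left)
    also have "real N * ((T / real N) * (1 + R)) = T * (1 + R)" using N' by simp
    also have "(LINT r:{a 0<..a N}|lborel. ?l r) \<le> M"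
    proof -
      have "(LINT r:{a 0<..a N}|lborel. ?l r) \<le> (LINT r:{0..T}|lborel. ?l r)"
        using l0 sub by (intro set_integral_mono_set_nonneg[OF action_finite_imp(1)[OF \<gamma> act M]]) auto
      then show ?thesis using action_finite_imp(2)[OF \<gamma> act M] by linarith
    qed
    also have "(LINT r:{a 0<..a N}|lborel. norm (vel \<gamma> r)) \<le> M / c1 + T / 4"
    proof -
      have "(LINT r:{a 0<..a N}|lborel. norm (vel \<gamma> r)) \<le> (LINT r:{0..T}|lborel. norm (vel \<gamma> r))"
        using sub by (intro set_integral_mono_set_nonneg[OF speed_integrable(2)[OF \<gamma> act M]]) auto
      then show ?thesis using speed_integrable(3)[OF \<gamma> act M] by linarith
    qed
    finally show ?thesis using \<epsilon> by (simp add: mult_left_mono)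
  qed
  then show ?thesis by (intro exI[of _ "Suc N0"]) auto
qed

end

section \<open>Lower semicontinuity of the action and compactness of its sublevel sets\<close>

lemma bcontfun_tendsto_apply:
  fixes \<gamma> :: "('a::topological_space, 'b::metric_space) bcontfun"
  assumes "(f \<longlongrightarrow> \<gamma>) F"
  shows "((\<lambda>i. apply_bcontfun (f i) t) \<longlongrightarrow> apply_bcontfun \<gamma> t) F"
proof (rule tendstoI)
  fix e :: real assume "e > 0"
  then have "\<forall>\<^sub>F i in F. dist (f i) \<gamma> < e" using assms by (rule tendstoD[rotated])
  then show "\<forall>\<^sub>F i in F. dist (apply_bcontfun (f i) t) (apply_bcontfun \<gamma> t) < e"
    by eventually_elim (use dist_bounded le_less_trans in blast)
qed

context tonelli
begin

lemma L_tendsto: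
  assumes "(x \<longlongrightarrow> x0) F" "(v \<longlongrightarrow> v0) F" "\<forall>\<^sub>F i in F. x i \<in> closure \<Omega>" "x0 \<in> closure \<Omega>"
  shows "((\<lambda>i. L (x i) (v i)) \<longlongrightarrow> L x0 v0) F"
  using continuous_on_tendsto_compose[OF L_cont, of "\<lambda>i. (x i, v i)" "(x0, v0)" F] assms
  by (simp add: tendsto_Pair)

lemma cutoff_tendsto: "(v \<longlongrightarrow> v0) F \<Longrightarrow> ((\<lambda>i. cutoff R (v i)) \<longlongrightarrow> cutoff R v0) F"
  unfolding cutoff_def by (intro tendsto_intros)

lemma cell_action_nonneg: "\<gamma> \<in> Gamma \<Omega> T \<Longrightarrow> 0 \<le> cell_action R N j \<gamma>"
  unfolding cell_action_def using L_plus_nonneg[OF Gamma_in_closure] by (simp add: cutoff_def)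

lemma cell_action_tendsto:
  assumes "\<And>i. f i \<in> Gamma \<Omega> T" "\<gamma> \<in> Gamma \<Omega> T" "f \<longlonglongrightarrow> \<gamma>"
  shows "(\<lambda>i. cell_action R N j (f i)) \<longlonglongrightarrow> cell_action R N j \<gamma>"
proof -
  have "(\<lambda>i. slope N j (f i)) \<longlonglongrightarrow> slope N j \<gamma>"
    unfolding slope_def by (intro tendsto_intros bcontfun_tendsto_apply assms(3))
  then show ?thesis unfolding cell_action_def
    by (intro tendsto_intros cutoff_tendsto L_tendsto bcontfun_tendsto_apply assms(3)
        always_eventually allI Gamma_in_closure assms(1,2))
qed

text \<open>Over disjoint intervals \<open>increment_bound\<close> adds up to an estimate by the
  total length that is uniform along the sequence. Each sum involves finitely many values of the
  curve, so this modulus of absolute continuity survives the limit.\<close>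

lemma Gamma_limit:
  assumes f: "\<And>i. f i \<in> Gamma \<Omega> T" "\<And>i. action (f i) \<le> ennreal M" and M: "0 \<le> M" and lim: "f \<longlonglongrightarrow> \<gamma>"
  shows "\<gamma> \<in> Gamma \<Omega> T"
proof -
  note ap = bcontfun_tendsto_apply[OF lim]
  have "apply_bcontfun \<gamma> t = apply_bcontfun \<gamma> (max 0 (min T t))" for t
  proof -
    have "apply_bcontfun (f i) t = apply_bcontfun (f i) (max 0 (min T t))" for i
      using f(1)[of i] unfolding Gamma_def by blast
    then have "(\<lambda>i. apply_bcontfun (f i) t) \<longlonglongrightarrow> apply_bcontfun \<gamma> (max 0 (min T t))"
      using ap[of "max 0 (min T t)"] by simp
    then show ?thesis using ap[of t] LIMSEQ_unique by blast
  qed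
  moreover have "apply_bcontfun \<gamma> t \<in> closure \<Omega>" for t
    using closed_sequentially[OF closed_closure, of "\<lambda>i. apply_bcontfun (f i) t"] ap Gamma_in_closure[OF f(1)] by blast
  moreover have "abs_cont_on 0 T (apply_bcontfun \<gamma>)"
    unfolding abs_cont_on_def
  proof (intro allI impI)
    fix \<epsilon> :: real assume \<epsilon>: "\<epsilon> > 0"
    \<comment> \<open>Both terms of \<open>increment_bound\<close>, summed over the family, are at
      most \<epsilon> / 4. The total \<epsilon> / 2 leaves room for the loss of strictness in the
      limit.\<close>
    define \<eta> where "\<eta> = \<epsilon> / (4 * (M / c1 + 1))"
    have Mc: "M / c1 + 1 > 0" using M c1_pos by (simp add: add_nonneg_pos)
    have \<eta>: "\<eta> > 0" using Mc \<epsilon> by (simp add: \<eta>_def)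
    have "\<epsilon> / (4 * X) * X = \<epsilon> / 4" if "X > 0" for X using that by simp
    from this[OF Mc] have e1: "\<eta> * (M / c1 + 1) = \<epsilon> / 4" by (simp only: \<eta>_def)
    define \<delta> where "\<delta> = \<eta> * \<epsilon>"
    have \<delta>: "\<delta> > 0" using \<eta> \<epsilon> by (simp add: \<delta>_def)
    show "\<exists>\<delta>>0. \<forall>(k::nat) (s::nat \<Rightarrow> real) (e::nat \<Rightarrow> real).
      (\<forall>i<k. 0 \<le> s i \<and> s i \<le> e i \<and> e i \<le> T) \<and>
      (\<forall>i<k. \<forall>j<k. i \<noteq> j \<longrightarrow> e i \<le> s j \<or> e j \<le> s i) \<and>
      (\<Sum>i<k. e i - s i) < \<delta> \<longrightarrow> (\<Sum>i<k. norm (apply_bcontfun \<gamma> (e i) - apply_bcontfun \<gamma> (s i))) < \<epsilon>"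
    proof (intro exI[of _ \<delta>] conjI \<delta> allI impI)
      fix k :: nat and s e :: "nat \<Rightarrow> real"
      assume *: "(\<forall>i<k. 0 \<le> s i \<and> s i \<le> e i \<and> e i \<le> T) \<and>
        (\<forall>i<k. \<forall>j<k. i \<noteq> j \<longrightarrow> e i \<le> s j \<or> e j \<le> s i) \<and> (\<Sum>i<k. e i - s i) < \<delta>"
      have bound: "(\<Sum>i<k. norm (apply_bcontfun (f n) (e i) - apply_bcontfun (f n) (s i))) \<le> \<epsilon> / 2" for n
      proof -
        let ?q = "\<lambda>x. (norm (vel (f n) x))\<^sup>2"
        have I: "set_integrable lborel {0..T} ?q" by (rule action_finite_imp(3)[OF f M])
        have Ii: "set_integrable lborel {s i<..e i} ?q" if "i < k" for i
          by (rule set_integrable_subset[OF I]) (use * that in auto)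
        have "(\<Sum>i<k. norm (apply_bcontfun (f n) (e i) - apply_bcontfun (f n) (s i)))
            \<le> (\<Sum>i<k. \<eta> * (LINT x:{s i<..e i}|lborel. ?q x) + (e i - s i) / (4 * \<eta>))"
          by (rule sum_mono) (use * in \<open>auto intro!: increment_bound[OF f M] \<eta>\<close>)
        also have "\<dots> = \<eta> * (\<Sum>i<k. LINT x:{s i<..e i}|lborel. ?q x) + (\<Sum>i<k. e i - s i) / (4 * \<eta>)"
          by (simp add: sum.distrib sum_distrib_left sum_divide_distrib)
        also have "(\<Sum>i<k. LINT x:{s i<..e i}|lborel. ?q x) \<le> M / c1"
        proof -
          have "(\<Sum>i<k. LINT x:{s i<..e i}|lborel. ?q x) = (\<integral>x. (\<Sum>i<k. indicator {s i<..e i} x *\<^sub>R ?q x) \<partial>lborel)"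
            unfolding set_lebesgue_integral_def
            by (subst Bochner_Integration.integral_sum) (use Ii in \<open>auto simp: set_integrable_def\<close>)
          also have "\<dots> \<le> (LINT x:{0..T}|lborel. ?q x)"
            unfolding set_lebesgue_integral_def
          proof (rule integral_mono)
            show "integrable lborel (\<lambda>x. \<Sum>i<k. indicator {s i<..e i} x *\<^sub>R ?q x)"
              by (intro Bochner_Integration.integrable_sum) (use Ii in \<open>auto simp: set_integrable_def\<close>)
            show "integrable lborel (\<lambda>x. indicator {0..T} x *\<^sub>R ?q x)" using I by (simp add: set_integrable_def)
            fix x
            show "(\<Sum>i<k. indicator {s i<..e i} x *\<^sub>R ?q x) \<le> indicator {0..T} x *\<^sub>R ?q x"
            proof (cases "\<exists>i<k. x \<in> {s i<..e i}")
              case True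
              then obtain i where i: "i < k" "x \<in> {s i<..e i}" by blast
              have "indicator {s j<..e j} x *\<^sub>R ?q x = (if j = i then ?q x else 0)" if "j < k" for j
              proof (cases "j = i")
                case False
                then have "e j \<le> s i \<or> e i \<le> s j" using * that i by blast
                then show ?thesis using i False by (auto simp: indicator_def)
              qed (use i in auto)
              then have "(\<Sum>j<k. indicator {s j<..e j} x *\<^sub>R ?q x) = (\<Sum>j<k. if j = i then ?q x else 0)"
                by (intro sum.cong) auto
              also have "\<dots> = ?q x" using i by simp
              also have "x \<in> {0..T}" using * i by force
              then have "?q x = indicator {0..T} x *\<^sub>R ?q x" by simp
              finally show ?thesis by (rule eq_refl)
            next
              case False
              then have "(\<Sum>j<k. indicator {s j<..e j} x *\<^sub>R ?q x) = 0"
                by (intro sum.neutral) (auto simp: indicator_def)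
              also have "0 \<le> indicator {0..T} x *\<^sub>R ?q x" by (simp add: indicator_def)
              finally show ?thesis .
            qed
          qed
          also have "\<dots> \<le> M / c1" by (rule action_finite_imp(4)[OF f M])
          finally show ?thesis .
        qed
        also have "\<eta> * (M / c1) \<le> \<epsilon> / 4" using e1 \<eta> by (simp add: algebra_simps)
        also have "(\<Sum>i<k. e i - s i) / (4 * \<eta>) \<le> \<epsilon> / 4"
          using * \<eta> by (simp add: \<delta>_def field_simps)
        finally show ?thesis using \<eta> by (simp add: mult_left_mono)
      qed
      have "(\<Sum>i<k. norm (apply_bcontfun \<gamma> (e i) - apply_bcontfun \<gamma> (s i))) \<le> \<epsilon> / 2"
      proof (rule LIMSEQ_le_const2)
        show "(\<lambda>n. \<Sum>i<k. norm (apply_bcontfun (f n) (e i) - apply_bcontfun (f n) (s i)))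
            \<longlonglongrightarrow> (\<Sum>i<k. norm (apply_bcontfun \<gamma> (e i) - apply_bcontfun \<gamma> (s i)))"
          by (intro tendsto_intros ap)
      qed (use bound in blast)
      then show "(\<Sum>i<k. norm (apply_bcontfun \<gamma> (e i) - apply_bcontfun \<gamma> (s i))) < \<epsilon>" using \<epsilon> by simp
    qed
  qed
  ultimately show ?thesis unfolding Gamma_def by blast
qed

text \<open>The point \<open>t\<close> may sit anywhere in the shrinking cell: the distances of the
  two ends to \<open>t\<close> add up to the cell length, so the two errors of the linear
  approximation are together small relative to that length.\<close>

lemma slope_tendsto_vel:
  assumes d: "apply_bcontfun \<gamma> differentiable (at t)"
    and j: "\<And>n. real (j n) * T / real (Suc n) \<le> t" "\<And>n. t < real (Suc (j n)) * T / real (Suc n)"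
  shows "(\<lambda>n. slope (Suc n) (j n) \<gamma>) \<longlonglongrightarrow> vel \<gamma> t"
    and "(\<lambda>n. real (j n) * T / real (Suc n)) \<longlonglongrightarrow> t"
proof -
  define u where "u = (\<lambda>n. real (j n) * T / real (Suc n))"
  define w where "w = (\<lambda>n. real (Suc (j n)) * T / real (Suc n))"
  have uw: "u n \<le> t" "t < w n" for n using j by (auto simp: u_def w_def)
  have wu: "w n - u n = T / real (Suc n)" for n
    unfolding w_def u_def diff_divide_distrib[symmetric] left_diff_distrib[symmetric] by simp
  have sl: "slope (Suc n) (j n) \<gamma> = (1 / (w n - u n)) *\<^sub>R (apply_bcontfun \<gamma> (w n) - apply_bcontfun \<gamma> (u n))" for n
    unfolding wu by (simp add: slope_def u_def w_def)
  have h0: "(\<lambda>n. T / real (Suc n)) \<longlonglongrightarrow> 0"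
    using tendsto_mult_right_zero[OF LIMSEQ_inverse_real_of_nat, of T] by (simp add: divide_inverse)
  show "(\<lambda>n. real (j n) * T / real (Suc n)) \<longlonglongrightarrow> t"
  proof -
    have "(\<lambda>n. u n - t) \<longlonglongrightarrow> 0"
    proof (rule Lim_null_comparison[OF _ h0])
      have "norm (u n - t) \<le> T / real (Suc n)" for n using uw[of n] wu[of n] by auto
      then show "\<forall>\<^sub>F n in sequentially. norm (u n - t) \<le> T / real (Suc n)" by simp
    qed
    then have "u \<longlonglongrightarrow> t" by (rule LIM_zero_cancel)
    then show ?thesis by (simp only: u_def)
  qed
  show "(\<lambda>n. slope (Suc n) (j n) \<gamma>) \<longlonglongrightarrow> vel \<gamma> t"
  proof (rule LIMSEQ_I)
    fix e :: real assume e: "e > 0"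
    have "(apply_bcontfun \<gamma> has_vector_derivative vel \<gamma> t) (at t)"
      using d unfolding vel_def by (simp add: vector_derivative_works)
    then obtain d where d: "d > 0" and dd: "\<And>y. norm (y - t) < d \<Longrightarrow>
        norm (apply_bcontfun \<gamma> y - apply_bcontfun \<gamma> t - (y - t) *\<^sub>R vel \<gamma> t) \<le> (e/2) * norm (y - t)"
      unfolding has_vector_derivative_def has_derivative_at_alt using e by (meson half_gt_zero)
    obtain N where N: "\<And>n. n \<ge> N \<Longrightarrow> T / real (Suc n) < d"
      using order_tendstoD(2)[OF h0 d] by (auto simp: eventually_sequentially)
    have "norm (slope (Suc n) (j n) \<gamma> - vel \<gamma> t) < e" if n: "n \<ge> N" for n
    proof -
      have pos: "w n - u n > 0" using uw[of n] by simp
      have "norm (w n - t) < d" "norm (u n - t) < d" using N[OF n] wu[of n] uw[of n] by auto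
      note dw = dd[OF this(1)] and du = dd[OF this(2)]
      have "(w n - u n) *\<^sub>R (slope (Suc n) (j n) \<gamma> - vel \<gamma> t)
          = (apply_bcontfun \<gamma> (w n) - apply_bcontfun \<gamma> t - (w n - t) *\<^sub>R vel \<gamma> t)
          - (apply_bcontfun \<gamma> (u n) - apply_bcontfun \<gamma> t - (u n - t) *\<^sub>R vel \<gamma> t)"
        unfolding sl using pos by (simp add: scaleR_diff_right algebra_simps)
      then have "norm ((w n - u n) *\<^sub>R (slope (Suc n) (j n) \<gamma> - vel \<gamma> t)) \<le> (e/2) * norm (w n - t) + (e/2) * norm (u n - t)"
        using dw du norm_triangle_ineq4 by (smt (verit))
      also have "\<dots> = (w n - u n) * (e/2)"
      proof -
        have nn: "norm (w n - t) = w n - t" "norm (u n - t) = t - u n" using uw[of n] by auto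
        show ?thesis unfolding nn distrib_left[symmetric] by simp
      qed
      finally have "(w n - u n) * norm (slope (Suc n) (j n) \<gamma> - vel \<gamma> t) \<le> (w n - u n) * (e/2)" using pos by simp
      then show ?thesis using pos e by simp
    qed
    then show "\<exists>N. \<forall>n\<ge>N. norm (slope (Suc n) (j n) \<gamma> - vel \<gamma> t) < e" by blast
  qed
qed

text \<open>Fatou's lemma twice. For fixed \<open>R\<close> the step functions
  \<open>\<phi> R (Suc n)\<close> converge almost everywhere to the cut-off Lagrangian, because grid
  slopes tend to the velocity. Letting \<open>R\<close> run through the naturals then removes the
  cutoff.\<close>

lemma action_le_if_discrete:
  assumes \<gamma>: "\<gamma> \<in> Gamma \<Omega> T" and M: "0 \<le> M"
    and disc: "\<And>R e. 0 \<le> R \<Longrightarrow> 0 < e \<Longrightarrow> \<exists>N0. \<forall>N\<ge>N0. (\<Sum>j<N. (T / real N) * cell_action R N j \<gamma>) \<le> M + e"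
  shows "action \<gamma> \<le> ennreal M"
proof -
  let ?l = "\<lambda>t. L (apply_bcontfun \<gamma> t) (vel \<gamma> t) + c0"
  have meas: "?l \<in> borel_measurable borel" using lagrangian_borel[OF \<gamma>] by simp
  have l0: "0 \<le> ?l t" for t using L_plus_nonneg[OF Gamma_in_closure[OF \<gamma>]] .
  define a where "a = (\<lambda>(N::nat) (j::nat). real j * T / real N)"
  define \<phi> where "\<phi> = (\<lambda>R N t. \<Sum>j<N. indicator {a N j..<a N (Suc j)} t * cell_action R N j \<gamma>)"
  have \<phi>0: "0 \<le> \<phi> R N t" for R N t
    unfolding \<phi>_def using cell_action_nonneg[OF \<gamma>] by (intro sum_nonneg) auto
  have \<phi>m: "\<phi> R N \<in> borel_measurable borel" for R N unfolding \<phi>_def by measurable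
  have int\<phi>: "(\<integral>\<^sup>+t. ennreal (\<phi> R (Suc n) t) \<partial>lborel) = ennreal (\<Sum>j<Suc n. (T / real (Suc n)) * cell_action R (Suc n) j \<gamma>)" for R n
  proof -
    have aa: "a (Suc n) (Suc j) - a (Suc n) j = T / real (Suc n)" "a (Suc n) j \<le> a (Suc n) (Suc j)" for j
    proof -
      show d: "a (Suc n) (Suc j) - a (Suc n) j = T / real (Suc n)"
        unfolding a_def diff_divide_distrib[symmetric] left_diff_distrib[symmetric] by simp
      have "T / real (Suc n) > 0" using T_pos by simp
      then show "a (Suc n) j \<le> a (Suc n) (Suc j)" using d by linarith
    qed
    have I: "integrable lborel (\<lambda>t. indicator {a (Suc n) j..<a (Suc n) (Suc j)} t * cell_action R (Suc n) j \<gamma>)" for j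
      using aa(2)[of j] by (intro integrable_mult_left integrable_real_indicator) auto
    have "(\<integral>\<^sup>+t. ennreal (\<phi> R (Suc n) t) \<partial>lborel) = ennreal (\<integral>t. \<phi> R (Suc n) t \<partial>lborel)"
    proof (rule nn_integral_eq_integral)
      show "integrable lborel (\<phi> R (Suc n))" unfolding \<phi>_def by (intro Bochner_Integration.integrable_sum I)
    qed (use \<phi>0 in auto)
    also have "(\<integral>t. \<phi> R (Suc n) t \<partial>lborel) = (\<Sum>j<Suc n. \<integral>t. indicator {a (Suc n) j..<a (Suc n) (Suc j)} t * cell_action R (Suc n) j \<gamma> \<partial>lborel)"
      unfolding \<phi>_def by (rule Bochner_Integration.integral_sum) (rule I)
    also have "\<dots> = (\<Sum>j<Suc n. (T / real (Suc n)) * cell_action R (Suc n) j \<gamma>)"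
      using aa by (intro sum.cong refl) simp
    finally show ?thesis .
  qed
  have conv: "(\<lambda>n. \<phi> R (Suc n) t) \<longlonglongrightarrow> cutoff R (vel \<gamma> t) * ?l t"
    if t: "t \<in> {0<..<T}" and d: "apply_bcontfun \<gamma> differentiable (at t)" for R t
  proof -
    \<comment> \<open>The index of the grid cell containing \<open>t\<close>. The cells are half
      open, so exactly one term of \<open>\<phi>\<close> survives.\<close>
    define j where "j = (\<lambda>n. nat \<lfloor>t * real (Suc n) / T\<rfloor>)"
    have jr: "real (j n) \<le> t * real (Suc n) / T" "t * real (Suc n) / T < real (j n) + 1" for n
    proof -
      have "0 \<le> t * real (Suc n) / T" using t by simp
      then show "real (j n) \<le> t * real (Suc n) / T" "t * real (Suc n) / T < real (j n) + 1"
        unfolding j_def by (auto simp: of_nat_floor)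
    qed
    have j1: "real (j n) * T / real (Suc n) \<le> t" for n
      using jr(1)[of n] T_pos by (simp add: field_simps)
    have j2: "t < real (Suc (j n)) * T / real (Suc n)" for n
      using jr(2)[of n] T_pos by (simp add: field_simps)
    have jlt: "j n < Suc n" for n
    proof -
      have "t * real (Suc n) / T < real (Suc n)" using t T_pos by (simp add: divide_less_eq mult.commute)
      then show ?thesis using jr(1)[of n] by linarith
    qed
    have eq: "\<phi> R (Suc n) t = cell_action R (Suc n) (j n) \<gamma>" for n
    proof -
      have "indicator {a (Suc n) i..<a (Suc n) (Suc i)} t * cell_action R (Suc n) i \<gamma> = (if i = j n then cell_action R (Suc n) (j n) \<gamma> else 0)" for i
      proof (cases "i = j n")
        case True
        then show ?thesis using j1[of n] j2[of n] by (simp add: a_def)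
      next
        case False
        have "t \<notin> {a (Suc n) i..<a (Suc n) (Suc i)}"
        proof
          assume "t \<in> {a (Suc n) i..<a (Suc n) (Suc i)}"
          then have "real i \<le> t * real (Suc n) / T" "t * real (Suc n) / T < real i + 1"
            using T_pos by (auto simp: a_def field_simps)
          then have "real i < real (j n) + 1" "real (j n) < real i + 1" using jr[of n] by linarith+
          then show False using False by linarith
        qed
        then show ?thesis using False by simp
      qed
      then show ?thesis unfolding \<phi>_def using jlt[of n] by simp
    qed
    note sv = slope_tendsto_vel[OF d j1 j2]
    have "isCont (apply_bcontfun \<gamma>) t" 
      by (metis UNIV_I continuous_on_apply_bcontfun continuous_on_eq_continuous_at open_UNIV)
    then have "(\<lambda>n. apply_bcontfun \<gamma> (real (j n) * T / real (Suc n))) \<longlonglongrightarrow> apply_bcontfun \<gamma> t"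
      by (rule isCont_tendsto_compose[OF _ sv(2)])
    then have "(\<lambda>n. cell_action R (Suc n) (j n) \<gamma>) \<longlonglongrightarrow> cutoff R (vel \<gamma> t) * ?l t"
      unfolding cell_action_def using sv(1)
      by (intro tendsto_intros cutoff_tendsto L_tendsto always_eventually allI Gamma_in_closure[OF \<gamma>])
    then show ?thesis unfolding eq .
  qed
  have AEd: "AE t in lborel. t \<in> {0<..<T} \<longrightarrow> apply_bcontfun \<gamma> differentiable (at t)"
    using \<gamma> by (intro abs_cont_on_AE_differentiable) (auto simp: Gamma_def)
  have step: "(\<integral>\<^sup>+t. ennreal (indicator {0..T} t * (cutoff R (vel \<gamma> t) * ?l t)) \<partial>lborel) \<le> ennreal M" if R: "0 \<le> R" for R
  proof (rule ennreal_le_epsilon)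
    fix e :: real assume e: "0 < e"
    obtain N0 where N0: "\<forall>N\<ge>N0. (\<Sum>j<N. (T / real N) * cell_action R N j \<gamma>) \<le> M + e" using disc[OF R e] by blast
    have "(\<integral>\<^sup>+t. ennreal (indicator {0..T} t * (cutoff R (vel \<gamma> t) * ?l t)) \<partial>lborel)
        \<le> (\<integral>\<^sup>+t. liminf (\<lambda>n. ennreal (\<phi> R (Suc n) t)) \<partial>lborel)"
    proof (rule nn_integral_mono_AE)
      show "AE t in lborel. ennreal (indicator {0..T} t * (cutoff R (vel \<gamma> t) * ?l t)) \<le> liminf (\<lambda>n. ennreal (\<phi> R (Suc n) t))"
        using AEd AE_lborel_singleton[of 0] AE_lborel_singleton[of T]
      proof eventually_elim
        case (elim t)
        show ?case
        proof (cases "t \<in> {0<..<T}")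
          case True
          then have "(\<lambda>n. ennreal (\<phi> R (Suc n) t)) \<longlonglongrightarrow> ennreal (cutoff R (vel \<gamma> t) * ?l t)"
            using conv elim by (intro tendsto_ennrealI) auto
          then have "liminf (\<lambda>n. ennreal (\<phi> R (Suc n) t)) = ennreal (cutoff R (vel \<gamma> t) * ?l t)"
            by (intro lim_imp_Liminf) auto
          then show ?thesis using True by simp
        next
          case False
          then have "t \<notin> {0..T}" using elim by auto
          then show ?thesis by simp
        qed
      qed
    qed
    also have "\<dots> \<le> liminf (\<lambda>n. \<integral>\<^sup>+t. ennreal (\<phi> R (Suc n) t) \<partial>lborel)"
      by (rule nn_integral_liminf) (use \<phi>m in simp)
    also have "\<dots> \<le> liminf (\<lambda>n. ennreal (M + e))"
    proof (rule Liminf_mono)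
      show "\<forall>\<^sub>F n in sequentially. (\<integral>\<^sup>+t. ennreal (\<phi> R (Suc n) t) \<partial>lborel) \<le> ennreal (M + e)"
        using eventually_ge_at_top[of N0]
      proof eventually_elim
        case (elim n)
        then show ?case unfolding int\<phi> using N0 by (intro ennreal_leI) (auto simp del: sum.lessThan_Suc of_nat_Suc)
      qed
    qed
    also have "\<dots> = ennreal M + ennreal e" using M e by (simp add: Liminf_const ennreal_plus)
    finally show "(\<integral>\<^sup>+t. ennreal (indicator {0..T} t * (cutoff R (vel \<gamma> t) * ?l t)) \<partial>lborel) \<le> ennreal M + ennreal e" .
  qed
  have cm: "(\<lambda>t. cutoff R (vel \<gamma> t)) \<in> borel_measurable borel" for R unfolding cutoff_def by measurable
  have "action \<gamma> = (\<integral>\<^sup>+t. liminf (\<lambda>n. ennreal (indicator {0..T} t * (cutoff (real n) (vel \<gamma> t) * ?l t))) \<partial>lborel)"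
    unfolding action_def
  proof (rule nn_integral_cong)
    fix t
    obtain n0 :: nat where n0: "real n0 > norm (vel \<gamma> t) + 1" using reals_Archimedean2 by blast
    have "\<forall>\<^sub>F n in sequentially. ennreal (indicator {0..T} t * ?l t) = ennreal (indicator {0..T} t * (cutoff (real n) (vel \<gamma> t) * ?l t))"
      using eventually_ge_at_top[of n0]
    proof eventually_elim
      case (elim n)
      have "cutoff (real n) (vel \<gamma> t) = 1" using elim n0 by (simp add: cutoff_def)
      then show ?case by simp
    qed
    then have "(\<lambda>n. ennreal (indicator {0..T} t * (cutoff (real n) (vel \<gamma> t) * ?l t))) \<longlonglongrightarrow> ennreal (indicator {0..T} t * ?l t)"
      by (rule Lim_transform_eventually[OF tendsto_const])
    then have "liminf (\<lambda>n. ennreal (indicator {0..T} t * (cutoff (real n) (vel \<gamma> t) * ?l t))) = ennreal (indicator {0..T} t * ?l t)"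
      by (intro lim_imp_Liminf) auto
    then show "ennreal (?l t) * indicator {0..T} t = liminf (\<lambda>n. ennreal (indicator {0..T} t * (cutoff (real n) (vel \<gamma> t) * ?l t)))"
      by (simp add: indicator_def)
  qed
  also have "\<dots> \<le> liminf (\<lambda>n. \<integral>\<^sup>+t. ennreal (indicator {0..T} t * (cutoff (real n) (vel \<gamma> t) * ?l t)) \<partial>lborel)"
    by (rule nn_integral_liminf) (use cm meas in measurable)
  also have "\<dots> \<le> liminf (\<lambda>n. ennreal M)"
    by (rule Liminf_mono) (use step in auto)
  finally show ?thesis by (simp add: Liminf_const)
qed

text \<open>Two limits in the right order: for fixed \<open>N\<close> the discrete action converges
  along the sequence, and \<open>discrete_action_bound\<close> holds for all its members with the
  same \<open>N0\<close>. The limit curve inherits the bound for all large \<open>N\<close>, and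
  \<open>action_le_if_discrete\<close> turns it into a bound on the action.\<close>

lemma action_limit:
  assumes f: "\<And>i. f i \<in> Gamma \<Omega> T" "\<And>i. action (f i) \<le> ennreal M" and M: "0 \<le> M" and lim: "f \<longlonglongrightarrow> \<gamma>"
  shows "action \<gamma> \<le> ennreal M"
proof (rule action_le_if_discrete[OF Gamma_limit[OF assms] M])
  fix R e :: real assume R: "0 \<le> R" and e: "0 < e"
  define C where "C = T * (1 + R) + (M / c1 + T / 4)"
  have C: "C > 0" using R M T_pos c1_pos unfolding C_def by (intro add_pos_nonneg) auto
  obtain N0 where "N0 > 0" and N0: "\<forall>N\<ge>N0. \<forall>\<gamma>\<in>Gamma \<Omega> T. action \<gamma> \<le> ennreal M \<longrightarrow>
    (\<Sum>j<N. (T / real N) * cell_action R N j \<gamma>) \<le> M + 2 * (e / (2 * C)) * C"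
    using discrete_action_bound[OF R _ M, of "e / (2 * C)"] e C unfolding C_def by auto
  have "(\<Sum>j<N. (T / real N) * cell_action R N j \<gamma>) \<le> M + e" if "N \<ge> N0" for N
  proof (rule LIMSEQ_le_const2)
    show "(\<lambda>i. \<Sum>j<N. (T / real N) * cell_action R N j (f i)) \<longlonglongrightarrow> (\<Sum>j<N. (T / real N) * cell_action R N j \<gamma>)"
      by (intro tendsto_intros cell_action_tendsto f lim Gamma_limit[OF assms])
    have "(\<Sum>j<N. (T / real N) * cell_action R N j (f i)) \<le> M + 2 * (e / (2 * C)) * C" for i using N0 that f by blast
    moreover have "2 * (e / (2 * C)) * C = e" using C by simp
    ultimately show "\<exists>k. \<forall>i\<ge>k. (\<Sum>j<N. (T / real N) * cell_action R N j (f i)) \<le> M + e" by simp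
  qed
  then show "\<exists>N0. \<forall>N\<ge>N0. (\<Sum>j<N. (T / real N) * cell_action R N j \<gamma>) \<le> M + e" by blast
qed

text \<open>Arzela-Ascoli on the interval, where finite action gives equicontinuity. The limit is
  extended constantly, which makes convergence on the interval convergence in the metric of
  \<open>bcontfun\<close>; the two preceding limit lemmas show that it stays in the set.\<close>

lemma compact_action_sublevel:
  assumes M: "0 \<le> M"
  shows "compact {\<gamma> \<in> Gamma \<Omega> T. action \<gamma> \<le> ennreal M}"
  unfolding compact_eq_seq_compact_metric seq_compact_def
proof (intro allI impI)
  fix f :: "nat \<Rightarrow> (real, real^'n) bcontfun"
  assume "\<forall>n. f n \<in> {\<gamma> \<in> Gamma \<Omega> T. action \<gamma> \<le> ennreal M}"
  then have f: "\<And>n. f n \<in> Gamma \<Omega> T" "\<And>n. action (f n) \<le> ennreal M" by auto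
  obtain B where B: "\<And>x. x \<in> closure \<Omega> \<Longrightarrow> norm x \<le> B"
    using compact_imp_bounded[OF compact_closure] unfolding bounded_iff by blast
  obtain g k where g: "continuous_on {0..T} g" "strict_mono (k :: nat \<Rightarrow> nat)"
      "\<And>e. 0 < e \<Longrightarrow> \<exists>N. \<forall>n x. n \<ge> N \<and> x \<in> {0..T} \<longrightarrow> norm (apply_bcontfun (f (k n)) x - g x) < e"
  proof (rule Arzela_Ascoli[of "{0..T}" "\<lambda>n. apply_bcontfun (f n)" B])
    show "norm (apply_bcontfun (f n) x) \<le> B" for n x using B Gamma_in_closure[OF f(1)] by blast
    fix x e :: real assume "0 < e"
    then obtain \<delta> where "\<delta> > 0" "\<And>\<gamma> s t. \<gamma> \<in> Gamma \<Omega> T \<Longrightarrow> action \<gamma> \<le> ennreal M \<Longrightarrow> \<bar>t - s\<bar> < \<delta> \<Longrightarrow>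
        norm (apply_bcontfun \<gamma> t - apply_bcontfun \<gamma> s) < e"
      using uniform_equicontinuity[OF M] by blast
    then show "\<exists>d>0. \<forall>n y. y \<in> {0..T} \<and> norm (x - y) < d \<longrightarrow> norm (apply_bcontfun (f n) x - apply_bcontfun (f n) y) < e"
      using f by (intro exI[of _ \<delta>]) auto
  qed auto
  define G where "G = (\<lambda>t. g (max 0 (min T t)))"
  have cl: "max 0 (min T t) \<in> {0..T}" for t using T_pos by auto
  have "continuous_on UNIV G" unfolding G_def
    by (rule continuous_on_compose2[OF g(1)]) (use T_pos in \<open>auto intro!: continuous_intros\<close>)
  moreover have "bounded (range G)"
  proof (rule bounded_subset)
    show "bounded (g ` {0..T})" using g(1) by (intro compact_imp_bounded compact_continuous_image) auto
    show "range G \<subseteq> g ` {0..T}" using cl unfolding G_def by blast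
  qed
  ultimately have "G \<in> bcontfun" by (simp add: bcontfun_def)
  then obtain \<gamma> where \<gamma>: "apply_bcontfun \<gamma> = G" by (metis Bcontfun_inverse)
  have lim: "(\<lambda>n. f (k n)) \<longlonglongrightarrow> \<gamma>"
  proof (rule metric_LIMSEQ_I)
    fix r :: real assume "r > 0"
    then obtain N where N: "\<forall>n x. n \<ge> N \<and> x \<in> {0..T} \<longrightarrow> norm (apply_bcontfun (f (k n)) x - g x) < r/2"
      using g(3)[of "r/2"] by auto
    have "dist (f (k n)) \<gamma> < r" if "n \<ge> N" for n
    proof -
      have "dist (f (k n)) \<gamma> \<le> r/2"
      proof (rule dist_bound)
        fix t
        have "apply_bcontfun (f (k n)) t = apply_bcontfun (f (k n)) (max 0 (min T t))"
          using f(1)[of "k n"] unfolding Gamma_def by blast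
        moreover have "norm (apply_bcontfun (f (k n)) (max 0 (min T t)) - g (max 0 (min T t))) < r/2"
          using N that cl[of t] by blast
        ultimately show "dist (apply_bcontfun (f (k n)) t) (apply_bcontfun \<gamma> t) \<le> r/2"
          by (simp add: \<gamma> G_def dist_norm)
      qed
      then show ?thesis using \<open>r > 0\<close> by simp
    qed
    then show "\<exists>N. \<forall>n\<ge>N. dist (f (k n)) \<gamma> < r" by blast
  qed
  have "\<gamma> \<in> {\<gamma> \<in> Gamma \<Omega> T. action \<gamma> \<le> ennreal M}"
    using Gamma_limit[OF f M lim] action_limit[OF f M lim] by simp
  then show "\<exists>l\<in>{\<gamma> \<in> Gamma \<Omega> T. action \<gamma> \<le> ennreal M}. \<exists>r. strict_mono r \<and> (f \<circ> r) \<longlonglongrightarrow> l"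
    using g(2) lim by (auto simp: o_def)
qed

end

section \<open>Perturbation of the starting point\<close>

text \<open>The maximum with the default value of \<open>vector_derivative\<close> covers the times
  without a derivative, so that a Lipschitz bridge gets a bound at every interior time.\<close>

lemma norm_vector_derivative_le_local_lipschitz:
  fixes f :: "real \<Rightarrow> 'a::real_normed_vector"
  assumes "d > 0" "\<And>y. \<bar>y - t\<bar> < d \<Longrightarrow> norm (f y - f t) \<le> \<bar>y - t\<bar>"
  shows "norm (vector_derivative f (at t)) \<le> max 1 (norm (SOME y::'a. False))"
proof (cases "f differentiable (at t)")
  case True
  define D where "D = vector_derivative f (at t)"
  have D: "(f has_vector_derivative D) (at t)" using True unfolding D_def by (simp add: vector_derivative_works)
  have "norm D \<le> 1 + e" if e: "e > 0" for e
  proof -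
    obtain k where k: "k > 0" "\<And>y. norm (y - t) < k \<Longrightarrow> norm (f y - f t - (y - t) *\<^sub>R D) \<le> e * norm (y - t)"
      using D e unfolding has_vector_derivative_def has_derivative_at_alt by meson
    define h where "h = min d k / 2"
    have h: "h > 0" "h < d" "h < k" using assms(1) k(1) by (auto simp: h_def min_def)
    have "norm (h *\<^sub>R D) \<le> norm (f (t + h) - f t) + norm (f (t + h) - f t - h *\<^sub>R D)"
      using norm_triangle_ineq4[of "f (t + h) - f t" "f (t + h) - f t - h *\<^sub>R D"] by simp
    also have "\<dots> \<le> h + e * h" using assms(2)[of "t + h"] k(2)[of "t + h"] h by simp
    finally have "h * norm D \<le> h * (1 + e)" using h by (simp add: algebra_simps)
    then show ?thesis using h by simp
  qed
  then have "norm D \<le> 1" by (rule field_le_epsilon)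
  then show ?thesis by (simp add: D_def)
next
  case False
  then have "(\<lambda>D. (f has_vector_derivative D) (at t)) = (\<lambda>D. False)"
    using differentiableI_vector by blast
  then show ?thesis unfolding vector_derivative_def by simp
qed

text \<open>The predicates inside the choice operator agree, so the equation also holds where
  neither function is differentiable.\<close>

lemma vector_derivative_shift:
  fixes f g :: "real \<Rightarrow> 'a::real_normed_vector"
  assumes S: "open S" "t \<in> S" and eq: "\<And>s. s \<in> S \<Longrightarrow> g s = f (s - \<tau>)"
  shows "vector_derivative g (at t) = vector_derivative f (at (t - \<tau>))"
proof -
  have "(g has_vector_derivative D) (at t) \<longleftrightarrow> (f has_vector_derivative D) (at (t - \<tau>))" for D
  proof
    assume "(g has_vector_derivative D) (at t)"
    then have "((\<lambda>s. f (s - \<tau>)) has_vector_derivative D) (at t)"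
      by (rule has_vector_derivative_transform_within_open[OF _ S]) (rule eq)
    moreover have "((\<lambda>s. s + \<tau>) has_vector_derivative 1) (at (t - \<tau>))"
      by (auto intro!: derivative_eq_intros simp: has_vector_derivative_def)
    ultimately have "((\<lambda>s. f (s - \<tau>)) \<circ> (\<lambda>s. s + \<tau>) has_vector_derivative 1 *\<^sub>R D) (at (t - \<tau>))"
      by (intro vector_diff_chain_at) auto
    then show "(f has_vector_derivative D) (at (t - \<tau>))" by (simp add: o_def)
  next
    assume "(f has_vector_derivative D) (at (t - \<tau>))"
    moreover have "((\<lambda>s. s - \<tau>) has_vector_derivative 1) (at t)"
      by (auto intro!: derivative_eq_intros simp: has_vector_derivative_def)
    ultimately have "(f \<circ> (\<lambda>s. s - \<tau>) has_vector_derivative 1 *\<^sub>R D) (at t)"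
      by (intro vector_diff_chain_at) auto
    then have "((\<lambda>s. f (s - \<tau>)) has_vector_derivative D) (at t)" by (simp add: o_def)
    then show "(g has_vector_derivative D) (at t)"
      by (rule has_vector_derivative_transform_within_open[OF _ S]) (simp add: eq)
  qed
  then show ?thesis unfolding vector_derivative_def by simp
qed

context tonelli
begin

text \<open>A passage from \<open>y\<close> to \<open>x\<close> inside the closed domain in time
  \<tau> at speed at most one. Lipschitz continuity is required on the whole line, so that
  compositions with clamped times need no side conditions; the domain constraint concerns the
  passage time only.\<close>

definition bridge :: "real \<Rightarrow> real^'n \<Rightarrow> real^'n \<Rightarrow> (real \<Rightarrow> real^'n) \<Rightarrow> bool" where
  "bridge \<tau> y x \<beta> \<longleftrightarrow> 1-lipschitz_on UNIV \<beta> \<and> \<beta> 0 = y \<and> \<beta> \<tau> = x \<and> (\<forall>t\<in>{0..\<tau>}. \<beta> t \<in> closure \<Omega>)"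

text \<open>Written as a sum to avoid a case distinction: before \<tau> the second summand is frozen
  at \<open>x\<close>, after \<tau> the first one is, and subtracting \<open>x\<close> leaves the
  moving part. The last stretch of \<sigma> of length \<tau> is cut off.\<close>

lemma prepend_bridge:
  assumes \<sigma>: "\<sigma> \<in> Gamma_at \<Omega> T x" and \<tau>: "0 \<le> \<tau>" "\<tau> < T" and \<beta>: "bridge \<tau> y x \<beta>"
  obtains \<sigma>' where "\<sigma>' \<in> Gamma_at \<Omega> T y"
    "\<And>t. apply_bcontfun \<sigma>' t = \<beta> (min (max 0 (min T t)) \<tau>) + apply_bcontfun \<sigma> (max (max 0 (min T t)) \<tau> - \<tau>) - x"
proof -
  have \<sigma>G: "\<sigma> \<in> Gamma \<Omega> T" and \<sigma>0: "apply_bcontfun \<sigma> 0 = x" using \<sigma> by (auto simp: Gamma_at_def)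
  have lip: "norm (\<beta> a - \<beta> b) \<le> \<bar>a - b\<bar>" for a b
    using lipschitz_onD[of 1 UNIV \<beta> a b] \<beta> by (simp add: bridge_def dist_norm)
  have \<beta>0: "\<beta> 0 = y" "\<beta> \<tau> = x" "\<And>t. t \<in> {0..\<tau>} \<Longrightarrow> \<beta> t \<in> closure \<Omega>" using \<beta> by (auto simp: bridge_def)
  define P where "P = (\<lambda>t. \<beta> (min t \<tau>) + apply_bcontfun \<sigma> (max t \<tau> - \<tau>) - x)"
  define G where "G = (\<lambda>t. P (max 0 (min T t)))"
  have P1: "P t = \<beta> t" if "t \<le> \<tau>" for t using that \<sigma>0 by (simp add: P_def max_def)
  have P2: "P t = apply_bcontfun \<sigma> (t - \<tau>)" if "\<tau> \<le> t" for t using that \<beta>0(2) by (simp add: P_def max_def min_def)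
  have Pcl: "P t \<in> closure \<Omega>" if "0 \<le> t" for t
    using P1[of t] P2[of t] that \<beta>0(3)[of t] Gamma_in_closure[OF \<sigma>G, of "t - \<tau>"] by (cases "t \<le> \<tau>") auto
  have c\<beta>: "continuous_on UNIV \<beta>" using \<beta> by (auto simp: bridge_def intro: lipschitz_on_continuous_on)
  have "continuous_on UNIV G"
    unfolding G_def P_def
    by (intro continuous_intros continuous_on_compose2[OF c\<beta>] continuous_on_compose2[OF continuous_on_apply_bcontfun[of UNIV \<sigma>]]) auto
  moreover have "bounded (range G)"
    by (rule bounded_subset[OF compact_imp_bounded[OF compact_closure]]) (auto simp: G_def intro!: Pcl)
  ultimately have "G \<in> bcontfun" by (simp add: bcontfun_def)
  then obtain \<sigma>' where \<sigma>': "apply_bcontfun \<sigma>' = G" by (metis Bcontfun_inverse)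
  have "\<sigma>' \<in> Gamma \<Omega> T"
  proof -
    have "G t = G (max 0 (min T t))" for t using T_pos by (simp add: G_def)
    moreover have "G t \<in> closure \<Omega>" for t unfolding G_def by (rule Pcl) simp
    moreover have "abs_cont_on 0 T G"
      unfolding abs_cont_on_def
    proof (intro allI impI)
      fix \<epsilon> :: real assume \<epsilon>: "\<epsilon> > 0"
      then have "\<epsilon> / 2 > 0" by simp
      moreover have "abs_cont_on 0 T (apply_bcontfun \<sigma>)" using \<sigma>G by (simp add: Gamma_def)
      ultimately obtain \<delta> where \<delta>: "\<delta> > 0" and D: "\<forall>(k::nat) (s::nat \<Rightarrow> real) (e::nat \<Rightarrow> real).
        (\<forall>i<k. 0 \<le> s i \<and> s i \<le> e i \<and> e i \<le> T) \<and>
        (\<forall>i<k. \<forall>j<k. i \<noteq> j \<longrightarrow> e i \<le> s j \<or> e j \<le> s i) \<and>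
        (\<Sum>i<k. e i - s i) < \<delta> \<longrightarrow> (\<Sum>i<k. norm (apply_bcontfun \<sigma> (e i) - apply_bcontfun \<sigma> (s i))) < \<epsilon> / 2"
        unfolding abs_cont_on_def by blast
      show "\<exists>\<delta>>0. \<forall>(k::nat) (s::nat \<Rightarrow> real) (e::nat \<Rightarrow> real).
        (\<forall>i<k. 0 \<le> s i \<and> s i \<le> e i \<and> e i \<le> T) \<and>
        (\<forall>i<k. \<forall>j<k. i \<noteq> j \<longrightarrow> e i \<le> s j \<or> e j \<le> s i) \<and>
        (\<Sum>i<k. e i - s i) < \<delta> \<longrightarrow> (\<Sum>i<k. norm (G (e i) - G (s i))) < \<epsilon>"
      proof (intro exI[of _ "min \<delta> (\<epsilon>/2)"] conjI allI impI)
        show "min \<delta> (\<epsilon>/2) > 0" using \<delta> \<epsilon> by simp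
        fix k :: nat and s e :: "nat \<Rightarrow> real"
        assume *: "(\<forall>i<k. 0 \<le> s i \<and> s i \<le> e i \<and> e i \<le> T) \<and>
          (\<forall>i<k. \<forall>j<k. i \<noteq> j \<longrightarrow> e i \<le> s j \<or> e j \<le> s i) \<and> (\<Sum>i<k. e i - s i) < min \<delta> (\<epsilon>/2)"
        \<comment> \<open>The delay maps the given intervals to intervals that are no longer and
          still ordered, possibly degenerate; absolute continuity of \<sigma> bounds the increments
          over them. The bridge, being 1-Lipschitz, contributes at most the total length.\<close>
        define s' where "s' = (\<lambda>i. max (s i) \<tau> - \<tau>)"
        define e' where "e' = (\<lambda>i. max (e i) \<tau> - \<tau>)"
        have "(\<Sum>i<k. norm (apply_bcontfun \<sigma> (e' i) - apply_bcontfun \<sigma> (s' i))) < \<epsilon> / 2"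
        proof (rule D[rule_format], intro conjI allI impI)
          fix i j assume "i < k" "j < k" "i \<noteq> j"
          then have "e i \<le> s j \<or> e j \<le> s i" using * by blast
          then show "e' i \<le> s' j \<or> e' j \<le> s' i" by (auto simp: s'_def e'_def)
        next
          have "(\<Sum>i<k. e' i - s' i) \<le> (\<Sum>i<k. e i - s i)"
            by (rule sum_mono) (use * in \<open>auto simp: s'_def e'_def\<close>)
          then show "(\<Sum>i<k. e' i - s' i) < \<delta>" using * by linarith
        qed (use * \<tau> in \<open>auto simp: s'_def e'_def\<close>)
        moreover have "(\<Sum>i<k. norm (\<beta> (min (e i) \<tau>) - \<beta> (min (s i) \<tau>))) \<le> (\<Sum>i<k. e i - s i)"
          by (rule sum_mono) (use * in \<open>auto intro!: order_trans[OF lip]\<close>)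
        moreover have "(\<Sum>i<k. norm (G (e i) - G (s i)))
            \<le> (\<Sum>i<k. norm (\<beta> (min (e i) \<tau>) - \<beta> (min (s i) \<tau>)) + norm (apply_bcontfun \<sigma> (e' i) - apply_bcontfun \<sigma> (s' i)))"
        proof (rule sum_mono)
          fix i assume "i \<in> {..<k}"
          then have i: "0 \<le> s i" "s i \<le> e i" "e i \<le> T" using * by auto
          then have "G (e i) - G (s i) = (\<beta> (min (e i) \<tau>) - \<beta> (min (s i) \<tau>)) + (apply_bcontfun \<sigma> (e' i) - apply_bcontfun \<sigma> (s' i))"
            by (simp add: G_def P_def s'_def e'_def)
          then show "norm (G (e i) - G (s i)) \<le> norm (\<beta> (min (e i) \<tau>) - \<beta> (min (s i) \<tau>)) + norm (apply_bcontfun \<sigma> (e' i) - apply_bcontfun \<sigma> (s' i))"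
            by (metis norm_triangle_ineq)
        qed
        moreover have "(\<Sum>i<k. e i - s i) < \<epsilon> / 2" using * by simp
        ultimately show "(\<Sum>i<k. norm (G (e i) - G (s i))) < \<epsilon>" by (simp add: sum.distrib)
      qed
    qed
    ultimately have "(\<forall>t. G t = G (max 0 (min T t))) \<and> abs_cont_on 0 T G \<and> (\<forall>t\<in>{0..T}. G t \<in> closure \<Omega>)" by blast
    then show ?thesis unfolding Gamma_def mem_Collect_eq \<sigma>' .
  qed
  moreover have "apply_bcontfun \<sigma>' 0 = y" using \<tau> \<beta>0 T_pos by (simp add: \<sigma>' G_def P1)
  ultimately show ?thesis using that[of \<sigma>'] by (simp add: Gamma_at_def \<sigma>' G_def P_def)
qed

text \<open>Run a short bridge at speed at most one, then follow the given curve with a time delay.\<close>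
lemma recovery:
  assumes \<sigma>: "\<sigma> \<in> Gamma_at \<Omega> T x" and e: "e > 0"
    and br: "\<exists>\<rho>>0. \<exists>\<Lambda>>0. \<forall>y\<in>closure \<Omega>. dist y x < \<rho> \<longrightarrow> (\<exists>\<beta>. bridge (\<Lambda> * dist y x) y x \<beta>)"
  shows "\<exists>r>0. \<forall>y\<in>closure \<Omega>. dist y x < r \<longrightarrow>
    (\<exists>\<sigma>'\<in>Gamma_at \<Omega> T y. dist \<sigma>' \<sigma> < e \<and> action \<sigma>' \<le> action \<sigma> + ennreal e)"
proof -
  have \<sigma>G: "\<sigma> \<in> Gamma \<Omega> T" and \<sigma>0: "apply_bcontfun \<sigma> 0 = x" using \<sigma> by (auto simp: Gamma_at_def)
  obtain \<rho> \<Lambda> where \<rho>: "\<rho> > 0" and \<Lambda>: "\<Lambda> > 0"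
    and br: "\<And>y. y \<in> closure \<Omega> \<Longrightarrow> dist y x < \<rho> \<Longrightarrow> \<exists>\<beta>. bridge (\<Lambda> * dist y x) y x \<beta>" using br by blast
  define Q where "Q = max 1 (norm (SOME y::real^'n. False))"
  have "compact ((\<lambda>(x,v). L x v) ` (closure \<Omega> \<times> cball (0::real^'n) Q))"
    by (intro compact_continuous_image continuous_on_subset[OF L_cont] compact_Times compact_closure) auto
  then have "bounded ((\<lambda>(x,v). L x v) ` (closure \<Omega> \<times> cball (0::real^'n) Q))" by (rule compact_imp_bounded)
  then obtain B0 where B0: "\<forall>z\<in>(\<lambda>(x,v). L x v) ` (closure \<Omega> \<times> cball (0::real^'n) Q). norm z \<le> B0"
    unfolding bounded_iff by blast
  define B where "B = max 1 (B0 + c0)"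
  have B: "L z v + c0 \<le> B" if "z \<in> closure \<Omega>" "norm v \<le> Q" for z v
  proof -
    have "L z v \<in> (\<lambda>(x,v). L x v) ` (closure \<Omega> \<times> cball (0::real^'n) Q)"
      using that by (intro image_eqI[of _ _ "(z, v)"]) auto
    then have "norm (L z v) \<le> B0" using B0 by blast
    then show ?thesis by (simp add: B_def)
  qed
  have B1: "B \<ge> 1" by (simp add: B_def)
  have "uniformly_continuous_on {0..T} (apply_bcontfun \<sigma>)"
    by (rule compact_uniformly_continuous) auto
  then obtain \<delta> where \<delta>: "\<delta> > 0" and D: "\<And>s t. s \<in> {0..T} \<Longrightarrow> t \<in> {0..T} \<Longrightarrow> dist t s < \<delta> \<Longrightarrow>
      dist (apply_bcontfun \<sigma> t) (apply_bcontfun \<sigma> s) < e/4"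
    unfolding uniformly_continuous_on_def using e by (metis zero_less_divide_iff zero_less_numeral)
  \<comment> \<open>\<open>\<delta>\<close> bounds the change of \<sigma> under the delay,
    \<open>e/4\<close> the displacement along the bridge, \<open>e / B\<close> the cost of the
    bridge, and \<open>T\<close> leaves time after the bridge.\<close>
  define \<tau>0 where "\<tau>0 = min (min \<delta> (e/4)) (min (e / B) T)"
  have \<tau>0: "\<tau>0 > 0" "\<tau>0 \<le> \<delta>" "\<tau>0 \<le> e/4" "\<tau>0 \<le> e / B" "\<tau>0 \<le> T"
  proof -
    have "\<tau>0 \<le> min \<delta> (e/4)" "\<tau>0 \<le> min (e / B) T" unfolding \<tau>0_def by (rule min.cobounded1 min.cobounded2)+
    then show "\<tau>0 \<le> \<delta>" "\<tau>0 \<le> e/4" "\<tau>0 \<le> e / B" "\<tau>0 \<le> T" by (simp_all only: min.bounded_iff)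
    show "\<tau>0 > 0" using \<delta> e B1 T_pos by (simp add: \<tau>0_def)
  qed
  have "\<exists>\<sigma>'\<in>Gamma_at \<Omega> T y. dist \<sigma>' \<sigma> < e \<and> action \<sigma>' \<le> action \<sigma> + ennreal e"
    if y: "y \<in> closure \<Omega>" "dist y x < min \<rho> (\<tau>0 / \<Lambda>)" for y
  proof -
    define \<tau> where "\<tau> = \<Lambda> * dist y x"
    have \<tau>: "0 \<le> \<tau>" "\<tau> < \<tau>0" using y \<Lambda> by (auto simp: \<tau>_def field_simps)
    obtain \<beta> where \<beta>: "bridge \<tau> y x \<beta>" using br y unfolding \<tau>_def by auto
    have \<tau>T: "\<tau> < T" using \<tau> \<tau>0 by simp
    obtain \<sigma>' where s1: "\<sigma>' \<in> Gamma_at \<Omega> T y" and s2: "\<And>t. apply_bcontfun \<sigma>' t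
        = \<beta> (min (max 0 (min T t)) \<tau>) + apply_bcontfun \<sigma> (max (max 0 (min T t)) \<tau> - \<tau>) - x"
      using prepend_bridge[OF \<sigma> \<tau>(1) \<tau>T \<beta>] by blast
    have sG: "\<sigma>' \<in> Gamma \<Omega> T" using s1 by (simp add: Gamma_at_def)
    have lip: "norm (\<beta> a - \<beta> b) \<le> \<bar>a - b\<bar>" for a b
      using lipschitz_onD[of 1 UNIV \<beta> a b] \<beta> by (simp add: bridge_def dist_norm)
    have \<beta>\<tau>: "\<beta> \<tau> = x" using \<beta> by (simp add: bridge_def)
    have S1: "apply_bcontfun \<sigma>' t = \<beta> t" if "0 \<le> t" "t \<le> \<tau>" for t
      using that \<tau>T \<sigma>0 by (simp add: s2 max_def min_def)
    have S2: "apply_bcontfun \<sigma>' t = apply_bcontfun \<sigma> (t - \<tau>)" if "\<tau> \<le> t" "t \<le> T" for t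
      using that \<tau> \<beta>\<tau> by (simp add: s2 max_def min_def)
    have "dist \<sigma>' \<sigma> \<le> e/2"
    proof (rule dist_bound)
      fix t
      define t' where "t' = max 0 (min T t)"
      have t': "0 \<le> t'" "t' \<le> T" using T_pos by (auto simp: t'_def)
      have cl: "apply_bcontfun \<sigma>' t = apply_bcontfun \<sigma>' t'" "apply_bcontfun \<sigma> t = apply_bcontfun \<sigma> t'"
        using sG \<sigma>G unfolding Gamma_def t'_def by blast+
      have "dist (apply_bcontfun \<sigma>' t') (apply_bcontfun \<sigma> t') \<le> e/2"
      proof (cases "t' \<le> \<tau>")
        case True
        have "dist (\<beta> t') x \<le> \<tau>" using lip[of t' \<tau>] \<beta>\<tau> t' True by (simp add: dist_norm)
        moreover have "dist x (apply_bcontfun \<sigma> t') < e/4" using D[of t' 0] t' True \<tau> \<tau>0 \<sigma>0 T_pos by auto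
        ultimately show ?thesis using S1[of t'] t' True dist_triangle[of "\<beta> t'" "apply_bcontfun \<sigma> t'" x] \<tau> \<tau>0 by simp
      next
        case False
        have "dist (apply_bcontfun \<sigma> (t' - \<tau>)) (apply_bcontfun \<sigma> t') < e/4"
          using t' False \<tau> \<tau>0 by (intro D) (auto simp: dist_real_def)
        then show ?thesis using S2[of t'] t' False e by simp
      qed
      then show "dist (apply_bcontfun \<sigma>' t) (apply_bcontfun \<sigma> t) \<le> e/2" using cl by simp
    qed
    then have "dist \<sigma>' \<sigma> < e" using e by simp
    moreover have "action \<sigma>' \<le> action \<sigma> + ennreal e"
    proof -
      let ?l = "\<lambda>t. L (apply_bcontfun \<sigma> t) (vel \<sigma> t) + c0"
      have meas: "?l \<in> borel_measurable borel" using lagrangian_borel[OF \<sigma>G] by simp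
      have v1: "norm (vel \<sigma>' t) \<le> Q" if t: "t \<in> {0<..<\<tau>}" for t
        unfolding vel_def Q_def
      proof (rule norm_vector_derivative_le_local_lipschitz)
        show "min t (\<tau> - t) > 0" using t by auto
        fix s assume "\<bar>s - t\<bar> < min t (\<tau> - t)"
        then have "0 \<le> s" "s \<le> \<tau>" by auto
        then show "norm (apply_bcontfun \<sigma>' s - apply_bcontfun \<sigma>' t) \<le> \<bar>s - t\<bar>" using S1 t lip by simp
      qed
      have v2: "vel \<sigma>' t = vel \<sigma> (t - \<tau>)" if t: "t \<in> {\<tau><..<T}" for t
        unfolding vel_def by (rule vector_derivative_shift[of "{\<tau><..<T}"]) (use t S2 in auto)
      have "action \<sigma>' \<le> (\<integral>\<^sup>+t. (ennreal B * indicator {0..\<tau>} t + ennreal (?l (t - \<tau>)) * indicator {0..T} (t - \<tau>)) \<partial>lborel)"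
        unfolding action_def
      proof (rule nn_integral_mono_AE)
        \<comment> \<open>At 0, at the junction \<tau> and at \<open>T\<close> a two-sided
          derivative sees different pieces of the curve; these three times form a null set.\<close>
        show "AE t in lborel. ennreal (L (apply_bcontfun \<sigma>' t) (vel \<sigma>' t) + c0) * indicator {0..T} t
            \<le> ennreal B * indicator {0..\<tau>} t + ennreal (?l (t - \<tau>)) * indicator {0..T} (t - \<tau>)"
          using AE_lborel_singleton[of 0] AE_lborel_singleton[of \<tau>] AE_lborel_singleton[of T]
        proof eventually_elim
          case (elim t)
          consider "t \<in> {0<..<\<tau>}" | "t \<in> {\<tau><..<T}" | "t \<notin> {0..T}" using elim \<tau> by force
          then show ?case
          proof cases
            case 1
            then have "ennreal (L (apply_bcontfun \<sigma>' t) (vel \<sigma>' t) + c0) \<le> ennreal B"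
              using B[OF Gamma_in_closure[OF sG] v1[OF 1]] by (intro ennreal_leI)
            then show ?thesis using 1 \<tau>T by (simp add: add_increasing2)
          next
            case 2
            then show ?thesis using v2[OF 2] S2[of t] \<tau> by simp
          next
            case 3
            then show ?thesis by simp
          qed
        qed
      qed
      also have "\<dots> = (\<integral>\<^sup>+t. ennreal B * indicator {0..\<tau>} t \<partial>lborel) + (\<integral>\<^sup>+t. ennreal (?l (t - \<tau>)) * indicator {0..T} (t - \<tau>) \<partial>lborel)"
      proof (rule nn_integral_add)
        have "(\<lambda>u. ennreal (?l u) * indicator {0..T} u) \<in> borel_measurable borel" using meas by measurable
        then show "(\<lambda>t. ennreal (?l (t - \<tau>)) * indicator {0..T} (t - \<tau>)) \<in> borel_measurable lborel"
          using measurable_compose[of "\<lambda>t. t - \<tau>" borel borel "\<lambda>u. ennreal (?l u) * indicator {0..T} u" borel] by simp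
      qed simp
      also have "(\<integral>\<^sup>+t. ennreal B * indicator {0..\<tau>} t \<partial>lborel) = ennreal (B * \<tau>)"
        using \<tau> B1 by (simp add: nn_integral_cmult_indicator ennreal_mult)
      also have "(\<integral>\<^sup>+t. ennreal (?l (t - \<tau>)) * indicator {0..T} (t - \<tau>) \<partial>lborel) = action \<sigma>"
      proof -
        have "(\<lambda>u. ennreal (?l u) * indicator {0..T} u) \<in> borel_measurable borel" using meas by measurable
        then have "(\<lambda>t. ennreal (?l (t - \<tau>)) * indicator {0..T} (t - \<tau>)) \<in> borel_measurable borel"
          using measurable_compose[of "\<lambda>t. t - \<tau>" borel borel "\<lambda>u. ennreal (?l u) * indicator {0..T} u" borel] by simp
        from nn_integral_real_affine[OF this, of 1 \<tau>] show ?thesis by (simp add: action_def)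
      qed
      also have "ennreal (B * \<tau>) \<le> ennreal e"
      proof (rule ennreal_leI)
        have "B * \<tau> \<le> B * (e / B)" using \<tau> \<tau>0 B1 by (intro mult_left_mono) auto
        then show "B * \<tau> \<le> e" using B1 by simp
      qed
      finally show ?thesis by (simp add: add.commute)
    qed
    ultimately show ?thesis using s1 by blast
  qed
  then show ?thesis using \<rho> \<tau>0(1) \<Lambda> by (intro exI[of _ "min \<rho> (\<tau>0 / \<Lambda>)"]) auto
qed

end

text \<open>At interior points the tangent of the convex function along the line from
  \<open>v\<close> to \<open>w\<close> lies below it. The derivative is given only in the open set,
  so boundary points are reached by continuity of \<open>L\<close> and \<open>DvL\<close>.\<close>

lemma subgradient_of_derivative:
  fixes L :: "real^'n \<Rightarrow> real^'n \<Rightarrow> real"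
  assumes cont: "continuous_on (closure \<Omega> \<times> UNIV) (\<lambda>(x, v). L x v)"
    and deriv: "\<And>x v. x \<in> \<Omega> \<Longrightarrow>
        ((\<lambda>(y, w). L y w) has_derivative (\<lambda>(h, k). DxL x v \<bullet> h + DvL x v \<bullet> k)) (at (x, v))"
    and Dcont: "continuous_on (closure \<Omega> \<times> UNIV) (\<lambda>(x, v). DvL x v)"
    and conv: "\<And>x. x \<in> closure \<Omega> \<Longrightarrow> convex_on UNIV (L x)"
    and x: "x \<in> closure \<Omega>"
  shows "L x v + DvL x v \<bullet> (w - v) \<le> L x w"
proof -
  have inner: "L x v + DvL x v \<bullet> (w - v) \<le> L x w" if x: "x \<in> \<Omega>" for x
  proof -
    define \<phi> where "\<phi> = (\<lambda>s. L x (v + s *\<^sub>R (w - v)))"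
    have "((\<lambda>s. (x, v + s *\<^sub>R (w - v))) has_derivative (\<lambda>s. (0, s *\<^sub>R (w - v)))) (at 0)"
      by (auto intro!: derivative_eq_intros)
    moreover have "((\<lambda>(y, w). L y w) has_derivative (\<lambda>(h, k). DxL x v \<bullet> h + DvL x v \<bullet> k)) (at (x, v + 0 *\<^sub>R (w - v)))"
      using deriv[OF x, of v] by simp
    ultimately have "((\<lambda>(y, w). L y w) \<circ> (\<lambda>s. (x, v + s *\<^sub>R (w - v))) has_derivative
        (\<lambda>(h, k). DxL x v \<bullet> h + DvL x v \<bullet> k) \<circ> (\<lambda>s. (0, s *\<^sub>R (w - v)))) (at 0)"
      by (rule diff_chain_at)
    then have "(\<phi> has_derivative (\<lambda>s. s * (DvL x v \<bullet> (w - v)))) (at 0)"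
      by (simp add: \<phi>_def o_def)
    then have D: "(\<phi> has_field_derivative (DvL x v \<bullet> (w - v))) (at 0)"
      by (simp add: has_field_derivative_def mult_commute_abs)
    have xc: "x \<in> closure \<Omega>" using x closure_subset by blast
    have "convex_on UNIV \<phi>"
    proof (rule convex_onI)
      fix t a b :: real assume t: "0 < t" "t < 1"
      have eq: "v + ((1 - t) * a + t * b) *\<^sub>R (w - v) = (1 - t) *\<^sub>R (v + a *\<^sub>R (w - v)) + t *\<^sub>R (v + b *\<^sub>R (w - v))"
        by (simp add: algebra_simps)
      show "\<phi> ((1 - t) *\<^sub>R a + t *\<^sub>R b) \<le> (1 - t) * \<phi> a + t * \<phi> b"
        using convex_onD[OF conv[OF xc], of t "v + a *\<^sub>R (w - v)" "v + b *\<^sub>R (w - v)"] t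
        unfolding \<phi>_def real_scaleR_def eq by simp
    qed simp
    from convex_on_imp_above_tangent[OF this, of 0 1 "DvL x v \<bullet> (w - v)"] D
    show ?thesis by (simp add: \<phi>_def)
  qed
  obtain y where y: "\<And>n. y n \<in> \<Omega>" "y \<longlonglongrightarrow> x" using x unfolding closure_sequential by blast
  have yc: "y n \<in> closure \<Omega>" for n using y closure_subset by blast
  have l1: "(\<lambda>n. L (y n) u) \<longlonglongrightarrow> L x u" for u
    using continuous_on_tendsto_compose[OF cont, of "\<lambda>n. (y n, u)" "(x, u)" sequentially] y x yc
    by (simp add: tendsto_Pair)
  have l2: "(\<lambda>n. DvL (y n) v) \<longlonglongrightarrow> DvL x v"
    using continuous_on_tendsto_compose[OF Dcont, of "\<lambda>n. (y n, v)" "(x, v)" sequentially] y x yc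
    by (simp add: tendsto_Pair)
  show ?thesis
  proof (rule LIMSEQ_le)
    show "(\<lambda>n. L (y n) v + DvL (y n) v \<bullet> (w - v)) \<longlonglongrightarrow> L x v + DvL x v \<bullet> (w - v)"
      by (intro tendsto_intros l1 l2)
    show "(\<lambda>n. L (y n) w) \<longlonglongrightarrow> L x w" by (rule l1)
  qed (use inner y in blast)
qed

section \<open>Bridges in a domain with C2 boundary\<close>

lemma mean_value_inner:
  fixes psi :: "real^'n \<Rightarrow> real" and g :: "real^'n \<Rightarrow> real^'n"
  assumes d: "\<And>z. z \<in> S \<Longrightarrow> (psi has_derivative (\<lambda>h. g z \<bullet> h)) (at z)" and S: "convex S" "p \<in> S" "q \<in> S"
  shows "\<exists>z\<in>S. psi q - psi p = g z \<bullet> (q - p)"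
proof -
  have inS: "p + s *\<^sub>R (q - p) \<in> S" if "s \<in> {0..1}" for s
    using convexD_alt[OF S, of s] that by (simp add: algebra_simps)
  have "\<exists>s\<in>{0<..<1}. psi (p + 1 *\<^sub>R (q - p)) - psi (p + 0 *\<^sub>R (q - p)) = g (p + s *\<^sub>R (q - p)) \<bullet> ((1 - 0) *\<^sub>R (q - p))"
  proof (rule mvt_simple)
    fix s :: real assume s: "0 \<le> s" "s \<le> 1"
    have "((\<lambda>s. p + s *\<^sub>R (q - p)) has_derivative (\<lambda>h. h *\<^sub>R (q - p))) (at s within {0..1})"
      by (auto intro!: derivative_eq_intros)
    moreover have "(psi has_derivative (\<lambda>h. g (p + s *\<^sub>R (q - p)) \<bullet> h)) (at (p + s *\<^sub>R (q - p)) within (\<lambda>s. p + s *\<^sub>R (q - p)) ` {0..1})"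
      using s by (intro has_derivative_at_withinI[OF d] inS) auto
    ultimately have "(psi \<circ> (\<lambda>s. p + s *\<^sub>R (q - p)) has_derivative (\<lambda>h. g (p + s *\<^sub>R (q - p)) \<bullet> h) \<circ> (\<lambda>h. h *\<^sub>R (q - p))) (at s within {0..1})"
      by (rule diff_chain_within)
    then show "((\<lambda>s. psi (p + s *\<^sub>R (q - p))) has_derivative (\<lambda>h. g (p + s *\<^sub>R (q - p)) \<bullet> (h *\<^sub>R (q - p)))) (at s within {0..1})"
      by (simp add: o_def)
  qed simp
  then show ?thesis using inS by force
qed

text \<open>Near a boundary point the inward direction \<open>\<nu>\<close> at \<open>x\<close> strictly decreases the defining function; so
  does the direction from \<open>y\<close> to \<open>x + 2 d \<nu>\<close> with \<open>d = dist y x\<close>. The path therefore runs from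
  \<open>y\<close> to \<open>x + 2 d \<nu>\<close> in time \<open>3 d\<close> and on to \<open>x\<close> in time \<open>2 d\<close>.\<close>
lemma C2_boundary_bridge:
  fixes \<Omega> :: "(real^'n) set"
  assumes op: "open \<Omega>" and C2: "C2_boundary \<Omega>" and x: "x \<in> closure \<Omega>"
  shows "\<exists>\<rho>>0. \<exists>\<Lambda>>0. \<forall>y\<in>closure \<Omega>. dist y x < \<rho> \<longrightarrow> (\<exists>\<beta>. 1-lipschitz_on UNIV \<beta> \<and> \<beta> 0 = y \<and>
    \<beta> (\<Lambda> * dist y x) = x \<and> (\<forall>t\<in>{0..\<Lambda> * dist y x}. \<beta> t \<in> closure \<Omega>))"
proof (cases "x \<in> \<Omega>")
  case True
  then obtain \<rho> where \<rho>: "\<rho> > 0" "ball x \<rho> \<subseteq> \<Omega>" using op open_contains_ball by blast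
  show ?thesis
  proof (rule exI[of _ \<rho>], rule conjI[OF \<rho>(1)], rule exI[of _ 1], rule conjI[OF zero_less_one], intro ballI impI)
    fix y assume y: "y \<in> closure \<Omega>" "dist y x < \<rho>"
    define d where "d = dist y x"
    define u where "u = (1 / d) *\<^sub>R (x - y)"
    have u1: "norm u \<le> 1" by (simp add: u_def d_def dist_norm norm_minus_commute)
    have du: "d *\<^sub>R u = x - y" by (cases "d = 0") (auto simp: u_def d_def)
    define \<beta> where "\<beta> = (\<lambda>t. y + t *\<^sub>R u)"
    show "\<exists>\<beta>. 1-lipschitz_on UNIV \<beta> \<and> \<beta> 0 = y \<and> \<beta> (1 * dist y x) = x \<and> (\<forall>t\<in>{0..1 * dist y x}. \<beta> t \<in> closure \<Omega>)"
    proof (intro exI[of _ \<beta>] conjI ballI)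
      show "1-lipschitz_on UNIV \<beta>"
      proof (rule lipschitz_onI)
        fix s t
        have "dist (\<beta> s) (\<beta> t) = \<bar>s - t\<bar> * norm u"
          by (simp add: \<beta>_def dist_norm scaleR_left_diff_distrib[symmetric])
        also have "\<dots> \<le> \<bar>s - t\<bar> * 1" using u1 by (intro mult_left_mono) auto
        finally show "dist (\<beta> s) (\<beta> t) \<le> 1 * dist s t" by (simp add: dist_real_def)
      qed simp
      show "\<beta> 0 = y" by (simp add: \<beta>_def)
      show bd: "\<beta> (1 * dist y x) = x" using du by (simp add: \<beta>_def d_def)
      fix t assume t: "t \<in> {0..1 * dist y x}"
      have "dist x (\<beta> t) \<le> d"
      proof -
        have "x - \<beta> t = (d - t) *\<^sub>R u" using du by (simp add: \<beta>_def algebra_simps)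
        then have "dist x (\<beta> t) = \<bar>d - t\<bar> * norm u" by (simp add: dist_norm)
        also have "\<dots> \<le> \<bar>d - t\<bar> * 1" using u1 by (intro mult_left_mono) auto
        finally show ?thesis using t by (simp add: d_def)
      qed
      then have "\<beta> t \<in> ball x \<rho>" using y by (simp add: d_def)
      then show "\<beta> t \<in> closure \<Omega>" using \<rho> closure_subset by blast
    qed
  qed
next
  case False
  then have "x \<in> frontier \<Omega>" using x op by (simp add: frontier_def interior_open)
  then obtain U psi and g :: "real^'n \<Rightarrow> real^'n" and H :: "real^'n \<Rightarrow> real^'n^'n" where U: "open U" "x \<in> U"
    and dpsi0: "\<forall>z\<in>U. (psi has_derivative (\<lambda>h. g z \<bullet> h)) (at z)"
    and dg0: "\<forall>z\<in>U. (g has_derivative (\<lambda>h. H z *v h)) (at z)"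
    and g0: "g x \<noteq> 0" and \<Omega>U: "\<Omega> \<inter> U = {z\<in>U. psi z < 0}"
    using C2[unfolded C2_boundary_def, rule_format, of x] by blast
  note dpsi = bspec[OF dpsi0] and dg = bspec[OF dg0]
  \<comment> \<open>If \<open>g\<close> varies by at most \<kappa> on the ball, then
    \<open>g z \<bullet> \<nu>\<close> is at most \<open>- (3 * \<kappa>)\<close> and
    \<open>norm (g z)\<close> at most \<open>5 * \<kappa>\<close> there.\<close>
  define \<kappa> where "\<kappa> = norm (g x) / 4"
  have \<kappa>: "\<kappa> > 0" "norm (g x) = 4 * \<kappa>" using g0 by (auto simp: \<kappa>_def)
  define \<nu> where "\<nu> = - (1 / norm (g x)) *\<^sub>R g x"
  have \<nu>1: "norm \<nu> = 1" using g0 by (simp add: \<nu>_def)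
  have g\<nu>: "g x \<bullet> \<nu> = - (4 * \<kappa>)" using g0 \<kappa>(2) by (simp add: \<nu>_def dot_square_norm power2_eq_square)
  have "isCont g x" using dg[OF U(2)] by (rule has_derivative_continuous)
  then obtain r0 where r0: "r0 > 0" "\<And>z. dist z x < r0 \<Longrightarrow> dist (g z) (g x) < \<kappa>"
    using \<kappa>(1) unfolding continuous_at_eps_delta by blast
  obtain r1 where r1: "r1 > 0" "ball x r1 \<subseteq> U" using U open_contains_ball by blast
  define r where "r = min r0 r1"
  have r: "r > 0" "ball x r \<subseteq> U" using r0 r1 by (auto simp: r_def)
  have gz: "norm (g z - g x) \<le> \<kappa>" if "z \<in> ball x r" for z
    using r0(2)[of z] that by (simp add: r_def dist_norm dist_commute less_imp_le norm_minus_commute)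
  have gz\<nu>: "g z \<bullet> \<nu> \<le> - (3 * \<kappa>)" if "z \<in> ball x r" for z
  proof -
    have "(g z - g x) \<bullet> \<nu> \<le> norm (g z - g x) * norm \<nu>" by (rule norm_cauchy_schwarz)
    then show ?thesis using gz[OF that] g\<nu> \<nu>1 by (simp add: inner_diff_left)
  qed
  have gzn: "norm (g z) \<le> 5 * \<kappa>" if "z \<in> ball x r" for z
    using norm_triangle_ineq[of "g x" "g z - g x"] gz[OF that] \<kappa>(2) by simp
  have neg: "z \<in> \<Omega>" if "z \<in> ball x r" "psi z < 0" for z using that r(2) \<Omega>U by blast
  have clneg: "psi z \<le> 0" if z: "z \<in> closure \<Omega>" "z \<in> U" for z
  proof (rule ccontr)
    assume "\<not> psi z \<le> 0"
    have cont: "isCont psi z" using dpsi[OF z(2)] by (rule has_derivative_continuous)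
    obtain s where s: "s > 0" "\<And>z'. dist z' z < s \<Longrightarrow> dist (psi z') (psi z) < psi z"
      using cont \<open>\<not> psi z \<le> 0\<close> unfolding continuous_at_eps_delta by (metis not_le)
    obtain s' where s': "s' > 0" "ball z s' \<subseteq> U" using U(1) z(2) open_contains_ball by blast
    obtain z' where z': "z' \<in> \<Omega>" "dist z' z < min s s'"
      using z(1) s(1) s'(1) unfolding closure_approachable by (metis min_less_iff_conj)
    have "z' \<in> \<Omega> \<inter> U" using z' s' by (auto simp: dist_commute subset_iff)
    then have "psi z' < 0" using \<Omega>U by blast
    moreover have "dist (psi z') (psi z) < psi z" using s z' by simp
    ultimately show False by (simp add: dist_real_def abs_if split: if_splits)
  qed
  have cvx: "convex (ball x r)" by simp
  have dball: "(psi has_derivative (\<lambda>h. g z \<bullet> h)) (at z)" if "z \<in> ball x r" for z using dpsi r(2) that by blast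
  show ?thesis
  proof (rule exI[of _ "r / 4"], rule conjI, use r in simp, rule exI[of _ 5], rule conjI, simp, intro ballI impI)
    fix y assume y: "y \<in> closure \<Omega>" "dist y x < r / 4"
    define d where "d = dist y x"
    have d4: "4 * d < r" "0 \<le> d" using y by (auto simp: d_def)
    show "\<exists>\<beta>. 1-lipschitz_on UNIV \<beta> \<and> \<beta> 0 = y \<and> \<beta> (5 * dist y x) = x \<and> (\<forall>t\<in>{0..5 * dist y x}. \<beta> t \<in> closure \<Omega>)"
    proof (cases "d = 0")
      case True
      then have "y = x" by (simp add: d_def)
      then show ?thesis using x by (intro exI[of _ "\<lambda>_. x"]) (auto intro: lipschitz_onI)
    next
      case False
      then have dpos: "d > 0" using d4 by simp
      \<comment> \<open>The factor 2 outweighs the displacement from \<open>y\<close> to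
        \<open>x\<close>: along \<open>w - y\<close> the derivative of \<open>psi\<close> is at most
        \<open>5 * \<kappa> * d - 6 * \<kappa> * d\<close>. As \<open>4 * d < r\<close>, the ends of
        both segments lie in the ball, which is convex.\<close>
      define w where "w = x + (2 * d) *\<^sub>R \<nu>"
      have wx: "dist w x = 2 * d" using \<nu>1 dpos by (simp add: w_def dist_norm)
      have wy: "norm (w - y) \<le> 3 * d"
        using dist_triangle[of w y x] wx by (simp add: d_def dist_norm dist_commute norm_minus_commute)
      have dr: "d < r" "2 * d < r" using d4 dpos by linarith+
      have yb: "y \<in> ball x r" using dr by (simp add: d_def dist_commute)
      have wb: "w \<in> ball x r" using dr wx by (simp add: dist_commute)
      have seg1: "y + l *\<^sub>R (w - y) \<in> closure \<Omega>" if l: "0 \<le> l" "l \<le> 1" for l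
      proof (cases "l = 0")
        case True
        then show ?thesis using y by simp
      next
        case False
        define q where "q = y + l *\<^sub>R (w - y)"
        have qb: "q \<in> ball x r" using convexD_alt[OF cvx yb wb l] by (simp add: q_def algebra_simps)
        obtain z where z: "z \<in> ball x r" "psi q - psi y = g z \<bullet> (q - y)"
          using mean_value_inner[OF dball cvx yb qb] by blast
        have "g z \<bullet> (w - y) \<le> - (\<kappa> * d)"
        proof -
          have wy': "w - y = (x - y) + (2 * d) *\<^sub>R \<nu>" by (simp add: w_def)
          have "g z \<bullet> (w - y) = g z \<bullet> (x - y) + 2 * d * (g z \<bullet> \<nu>)"
            by (simp only: wy' inner_add_right inner_scaleR_right)
          moreover have "g z \<bullet> (x - y) \<le> norm (g z) * norm (x - y)" by (rule norm_cauchy_schwarz)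
          moreover have "norm (g z) * norm (x - y) \<le> 5 * \<kappa> * d"
            using gzn[OF z(1)] dpos \<kappa> by (intro mult_mono) (auto simp: d_def dist_norm norm_minus_commute)
          moreover have "2 * d * (g z \<bullet> \<nu>) \<le> 2 * d * (- (3 * \<kappa>))" using gz\<nu>[OF z(1)] dpos by (intro mult_left_mono) auto
          ultimately show ?thesis by simp
        qed
        then have "l * (g z \<bullet> (w - y)) \<le> l * (- (\<kappa> * d))" using l by (intro mult_left_mono) auto
        moreover have "l * (\<kappa> * d) > 0" using l False \<kappa> dpos by simp
        moreover have "g z \<bullet> (q - y) = l * (g z \<bullet> (w - y))" by (simp add: q_def)
        ultimately have "psi q - psi y < 0" unfolding z(2) by linarith
        moreover have "psi y \<le> 0" using clneg[OF y(1)] yb r(2) by blast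
        ultimately have "q \<in> \<Omega>" using neg[OF qb] by simp
        then show ?thesis using closure_subset by (auto simp: q_def)
      qed
      have seg2: "x + s *\<^sub>R \<nu> \<in> closure \<Omega>" if s: "0 \<le> s" "s \<le> 2 * d" for s
      proof (cases "s = 0")
        case True
        then show ?thesis using x by simp
      next
        case False
        define q where "q = x + s *\<^sub>R \<nu>"
        have qb: "q \<in> ball x r" using s d4 \<nu>1 by (simp add: q_def dist_norm)
        have xb: "x \<in> ball x r" using r by simp
        obtain z where z: "z \<in> ball x r" "psi q - psi x = g z \<bullet> (q - x)"
          using mean_value_inner[OF dball cvx xb qb] by blast
        have "s * (g z \<bullet> \<nu>) \<le> s * (- (3 * \<kappa>))" using gz\<nu>[OF z(1)] s by (intro mult_left_mono) auto
        moreover have "s * (3 * \<kappa>) > 0" using s False \<kappa> by simp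
        moreover have "g z \<bullet> (q - x) = s * (g z \<bullet> \<nu>)" by (simp add: q_def)
        ultimately have "psi q - psi x < 0" unfolding z(2) by linarith
        moreover have "psi x \<le> 0" using clneg[OF x U(2)] .
        ultimately have "q \<in> \<Omega>" using neg[OF qb] by simp
        then show ?thesis using closure_subset by (auto simp: q_def)
      qed
      \<comment> \<open>With \<open>min\<close> and \<open>max\<close> only one term moves at a
        time, and the increments of the two clamped times add up to the elapsed time; this yields
        the Lipschitz constant 1 on the whole line without cases.\<close>
      define \<beta> where "\<beta> = (\<lambda>t. y + (min t (3 * d) / (3 * d)) *\<^sub>R (w - y) - (max t (3 * d) - 3 * d) *\<^sub>R \<nu>)"
      show ?thesis
      proof (intro exI[of _ \<beta>] conjI ballI)
        show "1-lipschitz_on UNIV \<beta>"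
        proof (rule lipschitz_onI)
          fix s t
          have "\<beta> s - \<beta> t = ((min s (3 * d) - min t (3 * d)) / (3 * d)) *\<^sub>R (w - y) - (max s (3 * d) - max t (3 * d)) *\<^sub>R \<nu>"
            by (simp add: \<beta>_def algebra_simps diff_divide_distrib)
          then have "norm (\<beta> s - \<beta> t) \<le> norm (((min s (3 * d) - min t (3 * d)) / (3 * d)) *\<^sub>R (w - y)) + norm ((max s (3 * d) - max t (3 * d)) *\<^sub>R \<nu>)"
            by (metis norm_triangle_ineq4)
          also have "\<dots> = (\<bar>min s (3 * d) - min t (3 * d)\<bar> / (3 * d)) * norm (w - y) + \<bar>max s (3 * d) - max t (3 * d)\<bar>"
            using \<nu>1 dpos by simp
          also have "(\<bar>min s (3 * d) - min t (3 * d)\<bar> / (3 * d)) * norm (w - y) \<le> (\<bar>min s (3 * d) - min t (3 * d)\<bar> / (3 * d)) * (3 * d)"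
            using wy dpos by (intro mult_left_mono) auto
          also have "\<dots> = \<bar>min s (3 * d) - min t (3 * d)\<bar>" using dpos by simp
          finally have "norm (\<beta> s - \<beta> t) \<le> \<bar>min s (3 * d) - min t (3 * d)\<bar> + \<bar>max s (3 * d) - max t (3 * d)\<bar>" by simp
          also have "\<dots> = \<bar>s - t\<bar>" by (auto simp: min_def max_def)
          finally show "dist (\<beta> s) (\<beta> t) \<le> 1 * dist s t" by (simp add: dist_norm)
        qed simp
        show "\<beta> 0 = y" using dpos by (simp add: \<beta>_def)
        show "\<beta> (5 * dist y x) = x" using dpos by (simp add: \<beta>_def d_def[symmetric] w_def)
        fix t assume t: "t \<in> {0..5 * dist y x}"
        show "\<beta> t \<in> closure \<Omega>"
        proof (cases "t \<le> 3 * d")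
          case True
          then have "\<beta> t = y + (t / (3 * d)) *\<^sub>R (w - y)" by (simp add: \<beta>_def)
          then show ?thesis using seg1[of "t / (3 * d)"] t True dpos by simp
        next
          case False
          have "(2 * d) *\<^sub>R \<nu> - (t - 3 * d) *\<^sub>R \<nu> = (5 * d - t) *\<^sub>R \<nu>"
            unfolding scaleR_left_diff_distrib[symmetric] by simp
          then have "\<beta> t = x + (5 * d - t) *\<^sub>R \<nu>" using dpos False by (simp add: \<beta>_def w_def add_diff_eq[symmetric])
          then show ?thesis using seg2[of "5 * d - t"] t False by (simp add: d_def)
        qed
      qed
    qed
  qed
qed

text \<open>The function \<open>v\<close> need not be continuous; it will be the action. Points are
  therefore sorted both by a nearby centre and by the integer part of \<open>v x / e\<close>, and
  one representative is kept for each of the finitely many pairs that occur.\<close>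

lemma finite_net_with_values:
  fixes K :: "'a::metric_space set" and v :: "'a \<Rightarrow> real"
  assumes K: "compact K" and A: "A \<subseteq> K" and v: "\<And>x. x \<in> A \<Longrightarrow> 0 \<le> v x \<and> v x \<le> B" and e: "e > 0"
  shows "\<exists>S. finite S \<and> S \<subseteq> A \<and> (\<forall>x\<in>A. \<exists>s\<in>S. dist s x < e \<and> v s \<le> v x + e)"
proof -
  have "\<exists>C. finite C \<and> C \<subseteq> K \<and> K \<subseteq> (\<Union>x\<in>C. ball x (e/2))"
    using seq_compact_imp_totally_bounded[OF compact_imp_seq_compact[OF K]] e by simp
  then obtain C where C: "finite C" "K \<subseteq> (\<Union>x\<in>C. ball x (e/2))" by blast
  define ctr where "ctr = (\<lambda>x. SOME c. c \<in> C \<and> x \<in> ball c (e/2))"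
  have ctr: "ctr x \<in> C \<and> x \<in> ball (ctr x) (e/2)" if "x \<in> A" for x
    unfolding ctr_def by (rule someI_ex) (use that A C(2) in blast)
  define key where "key = (\<lambda>x. (ctr x, nat \<lfloor>v x / e\<rfloor>))"
  have "key ` A \<subseteq> C \<times> {..nat \<lfloor>B / e\<rfloor>}"
  proof
    fix k assume "k \<in> key ` A"
    then obtain x where x: "x \<in> A" "k = key x" by blast
    have "v x / e \<le> B / e" using v[OF x(1)] e by (intro divide_right_mono) auto
    then have "nat \<lfloor>v x / e\<rfloor> \<le> nat \<lfloor>B / e\<rfloor>" by (intro nat_mono floor_mono)
    then show "k \<in> C \<times> {..nat \<lfloor>B / e\<rfloor>}" using ctr[OF x(1)] x(2) by (simp add: key_def)
  qed
  then have fin: "finite (key ` A)" using C(1) finite_subset by blast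
  define rep where "rep = (\<lambda>k. SOME x. x \<in> A \<and> key x = k)"
  have rep: "rep (key x) \<in> A \<and> key (rep (key x)) = key x" if "x \<in> A" for x
    unfolding rep_def by (rule someI[of _ x]) (use that in simp)
  have "\<exists>s\<in>rep ` key ` A. dist s x < e \<and> v s \<le> v x + e" if x: "x \<in> A" for x
  proof (intro bexI[of _ "rep (key x)"] conjI)
    define s where "s = rep (key x)"
    have s: "s \<in> A" "ctr s = ctr x" "nat \<lfloor>v s / e\<rfloor> = nat \<lfloor>v x / e\<rfloor>"
      using rep[OF x] by (auto simp: s_def key_def)
    have "dist (ctr x) x < e/2" "dist (ctr x) s < e/2" using ctr[OF x] ctr[OF s(1)] s(2) by auto
    then show "dist (rep (key x)) x < e"
      using dist_triangle3[of s x "ctr x"] unfolding s_def[symmetric] by linarith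
    have "0 \<le> v s / e" "0 \<le> v x / e" using v s(1) x e by auto
    then have "\<lfloor>v s / e\<rfloor> = \<lfloor>v x / e\<rfloor>" using s(3) by (simp add: eq_nat_nat_iff)
    then have "v s / e \<le> v x / e + 1" by linarith
    then have "v s \<le> v x + e" using e by (simp add: field_simps)
    then show "v (rep (key x)) \<le> v x + e" by (simp add: s_def)
  qed (use x in blast)
  moreover have "rep ` key ` A \<subseteq> A" using rep by blast
  ultimately show ?thesis using fin by (intro exI[of _ "rep ` key ` A"]) blast
qed

section \<open>Continuity of the coupling\<close>

lemma lipschitz_tent: "1-lipschitz_on UNIV (\<lambda>z::'a::metric_space. max 0 (e - dist z a))"
proof (rule lipschitz_onI)
  fix x y :: 'a
  show "dist (max 0 (e - dist x a)) (max 0 (e - dist y a)) \<le> 1 * dist x y"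
    using dist_triangle[of x a y] dist_triangle[of y a x] by (auto simp: dist_real_def dist_commute max_def)
qed simp

section \<open>Measures on the closed domain and the Kantorovich-Rubinstein distance\<close>

lemma Pmeas_prob_space: "m \<in> Pmeas \<Omega> \<Longrightarrow> prob_space m" by (simp add: Pmeas_def)

lemma Pmeas_space: "m \<in> Pmeas \<Omega> \<Longrightarrow> space m = closure \<Omega>"
  using sets_eq_imp_space_eq[of m "restrict_space borel (closure \<Omega>)"] by (simp add: Pmeas_def space_restrict_space)

lemma Pmeas_measurable:
  assumes "m \<in> Pmeas \<Omega>" "f \<in> measurable borel N"
  shows "f \<in> measurable m N"
proof -
  have "f \<in> measurable (restrict_space borel (closure \<Omega>)) N" using assms(2) by (rule measurable_restrict_space1)
  moreover have "sets m = sets (restrict_space borel (closure \<Omega>))" using assms by (simp add: Pmeas_def)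
  ultimately show ?thesis using measurable_cong_sets by blast
qed

lemma lipschitz_borel: "1-lipschitz_on UNIV f \<Longrightarrow> f \<in> borel_measurable borel"
  for f :: "'a::metric_space \<Rightarrow> real"
  by (intro borel_measurable_continuous_onI lipschitz_on_continuous_on)

text \<open>Later arguments need only upper bounds for \<open>d1\<close>, and these follow from the
  least upper bound property of the nonempty set of differences.\<close>

lemma d1_le:
  assumes "\<And>f :: real^'n \<Rightarrow> real. 1-lipschitz_on UNIV f \<Longrightarrow> (\<integral>x. f x \<partial>M) - (\<integral>x. f x \<partial>N) \<le> e"
  shows "d1 M N \<le> e"
  unfolding d1_def
proof (rule cSup_least)
  have "1-lipschitz_on UNIV (\<lambda>_::real^'n. 0::real)" by (rule lipschitz_onI) auto
  then show "{(\<integral>x. f x \<partial>M) - (\<integral>x. f x \<partial>N) | f :: real^'n \<Rightarrow> real. 1-lipschitz_on UNIV f} \<noteq> {}" by blast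
qed (use assms in blast)

text \<open>Indicators of closed sets are monotone limits of Lipschitz functions.\<close>
lemma Pmeas_eqI_lipschitz:
  fixes \<Omega> :: "(real^'n) set"
  assumes m: "m \<in> Pmeas \<Omega>" and m': "m' \<in> Pmeas \<Omega>"
    and eq: "\<And>f :: real^'n \<Rightarrow> real. 1-lipschitz_on UNIV f \<Longrightarrow> (\<integral>x. f x \<partial>m) = (\<integral>x. f x \<partial>m')"
  shows "m = m'"
proof -
  interpret M: prob_space m using m by (rule Pmeas_prob_space)
  interpret M': prob_space m' using m' by (rule Pmeas_prob_space)
  have closed_eq: "measure m (C \<inter> closure \<Omega>) = measure m' (C \<inter> closure \<Omega>)" if C: "closed C" for C
  proof (cases "C = {}")
    case False
    define f where "f = (\<lambda>(k::nat) x. max 0 (1 / real (Suc k) - infdist x C))"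
    have lip: "1-lipschitz_on UNIV (f k)" for k
    proof (rule lipschitz_onI)
      fix x y :: "real^'n"
      have "\<bar>infdist x C - infdist y C\<bar> \<le> dist x y" using infdist_triangle_abs .
      then show "dist (f k x) (f k y) \<le> 1 * dist x y" by (auto simp: f_def dist_real_def max_def)
    qed simp
    \<comment> \<open>Multiplied by \<open>Suc k\<close>, the functions \<open>f k\<close> equal 1
      on \<open>C\<close>, take values between 0 and 1, and are eventually 0 at each point off
      \<open>C\<close>, since a closed set has positive distance from such a point.\<close>
    have ind: "(\<lambda>k. \<integral>x. real (Suc k) * f k x \<partial>M) \<longlonglongrightarrow> measure M (C \<inter> closure \<Omega>)" if M: "M \<in> Pmeas \<Omega>" for M
    proof -
      interpret prob_space M using M by (rule Pmeas_prob_space)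
      have fm: "f k \<in> borel_measurable M" for k using M lipschitz_borel[OF lip] by (rule Pmeas_measurable)
      have Cm: "C \<inter> closure \<Omega> \<in> sets M" using C M by (auto simp: Pmeas_def sets_restrict_space)
      have "(\<lambda>k. \<integral>x. real (Suc k) * f k x \<partial>M) \<longlonglongrightarrow> (\<integral>x. indicator (C \<inter> closure \<Omega>) x \<partial>M)"
      proof (rule integral_dominated_convergence[where w = "\<lambda>_. 1"])
        show "AE x in M. (\<lambda>k. real (Suc k) * f k x) \<longlonglongrightarrow> indicator (C \<inter> closure \<Omega>) x"
        proof (rule AE_I2)
          fix x assume "x \<in> space M"
          then have xc: "x \<in> closure \<Omega>" using Pmeas_space[OF M] by simp
          show "(\<lambda>k. real (Suc k) * f k x) \<longlonglongrightarrow> indicator (C \<inter> closure \<Omega>) x"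
          proof (cases "x \<in> C")
            case True
            then have "real (Suc k) * f k x = 1" for k by (simp add: f_def)
            then show ?thesis using True xc by simp
          next
            case F: False
            then have "infdist x C > 0" using C False by (simp add: infdist_pos_not_in_closed)
            then obtain K :: nat where K: "1 / real (Suc K) < infdist x C" by (metis nat_approx_posE)
            have "\<forall>\<^sub>F k in sequentially. real (Suc k) * f k x = 0"
              using eventually_ge_at_top[of K]
            proof eventually_elim
              case (elim k)
              then have "1 / real (Suc k) \<le> 1 / real (Suc K)" by (simp add: frac_le)
              then show ?case using K by (simp add: f_def)
            qed
            then show ?thesis using F by (simp add: tendsto_eventually)
          qed
        qed
        show "AE x in M. norm (real (Suc k) * f k x) \<le> 1" for k
        proof (rule AE_I2)
          fix x
          have "f k x \<le> 1 / real (Suc k)" "0 \<le> f k x" using infdist_nonneg[of x C] by (auto simp: f_def)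
          then have "real (Suc k) * f k x \<le> real (Suc k) * (1 / real (Suc k))" by (intro mult_left_mono) auto
          then show "norm (real (Suc k) * f k x) \<le> 1" using \<open>0 \<le> f k x\<close> by simp
        qed
      qed (use fm Cm in auto)
      moreover have "(\<integral>x. indicator (C \<inter> closure \<Omega>) x \<partial>M) = measure M (C \<inter> closure \<Omega>)"
        using Cm sets.sets_into_space[OF Cm] by (simp add: Int_absorb2)
      ultimately show ?thesis by simp
    qed
    have "(\<integral>x. real (Suc k) * f k x \<partial>m) = (\<integral>x. real (Suc k) * f k x \<partial>m')" for k
      using eq[OF lip[of k]] by simp
    then show ?thesis using ind[OF m] ind[OF m'] LIMSEQ_unique by fastforce
  qed simp
  have gen: "sets (restrict_space borel (closure \<Omega>)) = sigma_sets (closure \<Omega>) ((\<inter>) (closure \<Omega>) ` Collect closed)"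
  proof -
    have b: "sets (borel :: (real^'n) measure) = sigma_sets UNIV (Collect closed)" by (simp add: borel_eq_closed)
    show ?thesis unfolding sets_restrict_space b
      by (rule sigma_sets_Int) (auto intro: sigma_sets.Basic)
  qed
  show ?thesis
  proof (rule measure_eqI_generator_eq)
    show "Int_stable ((\<inter>) (closure \<Omega>) ` Collect closed)"
    proof (rule Int_stableI)
      fix a b assume "a \<in> (\<inter>) (closure \<Omega>) ` Collect closed" "b \<in> (\<inter>) (closure \<Omega>) ` Collect closed"
      then obtain A B where "closed A" "closed B" "a = closure \<Omega> \<inter> A" "b = closure \<Omega> \<inter> B" by auto
      then show "a \<inter> b \<in> (\<inter>) (closure \<Omega>) ` Collect closed"
        by (intro image_eqI[of _ _ "A \<inter> B"]) auto
    qed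
    show "(\<inter>) (closure \<Omega>) ` Collect closed \<subseteq> Pow (closure \<Omega>)" by auto
    show "sets m = sigma_sets (closure \<Omega>) ((\<inter>) (closure \<Omega>) ` Collect closed)" using m gen by (simp add: Pmeas_def)
    show "sets m' = sigma_sets (closure \<Omega>) ((\<inter>) (closure \<Omega>) ` Collect closed)" using m' gen by (simp add: Pmeas_def)
    show "range (\<lambda>_::nat. closure \<Omega>) \<subseteq> (\<inter>) (closure \<Omega>) ` Collect closed"
      by (auto intro!: image_eqI[of _ _ UNIV])
    show "emeasure m X = emeasure m' X" if "X \<in> (\<inter>) (closure \<Omega>) ` Collect closed" for X
      using that closed_eq by (auto simp: M.emeasure_eq_measure M'.emeasure_eq_measure Int_commute)
  qed (auto simp: M.emeasure_eq_measure)
qed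

definition d1conv :: "(nat \<Rightarrow> (real^'n) measure) \<Rightarrow> (real^'n) measure \<Rightarrow> bool" where
  "d1conv M N \<longleftrightarrow> (\<forall>e>0. \<forall>\<^sub>F n in sequentially. d1 (M n) N < e)"

lemma d1conv_compose: "d1conv M N \<Longrightarrow> filterlim r at_top sequentially \<Longrightarrow> d1conv (\<lambda>n. M (r n)) N"
  unfolding d1conv_def filterlim_iff by blast

lemma cont_xP_tendsto:
  assumes F: "cont_xP \<Omega> F" and x: "\<And>n. x n \<in> closure \<Omega>" "x \<longlonglongrightarrow> x0" "x0 \<in> closure \<Omega>"
    and m: "\<And>n. m n \<in> Pmeas \<Omega>" "m' \<in> Pmeas \<Omega>" "d1conv m m'"
  shows "(\<lambda>n. F (x n) (m n)) \<longlonglongrightarrow> F x0 m'"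
proof (rule tendstoI)
  fix e :: real assume "e > 0"
  then obtain \<delta> where \<delta>: "\<delta> > 0" "\<forall>y\<in>closure \<Omega>. \<forall>m''\<in>Pmeas \<Omega>. dist y x0 < \<delta> \<and> d1 m'' m' < \<delta> \<longrightarrow> \<bar>F y m'' - F x0 m'\<bar> < e"
    using F x(3) m(2) unfolding cont_xP_def by blast
  have "\<forall>\<^sub>F n in sequentially. dist (x n) x0 < \<delta>" using x(2) \<delta>(1) by (rule tendstoD)
  moreover have "\<forall>\<^sub>F n in sequentially. d1 (m n) m' < \<delta>" using m(3) \<delta>(1) unfolding d1conv_def by blast
  ultimately show "\<forall>\<^sub>F n in sequentially. dist (F (x n) (m n)) (F x0 m') < e"
  proof eventually_elim
    case (elim n)
    then show ?case using \<delta>(2) x(1)[of n] m(1)[of n] by (simp add: dist_real_def)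
  qed
qed

text \<open>\<open>Pmeas \<Omega>\<close> is sequentially compact for \<open>d1\<close>, by
  \<open>compact_laws_subsequence\<close> with the identity as random variable. Along arguments
  where \<open>F\<close> exceeds \<open>n\<close> in modulus, a subsequence of points and laws would
  converge, and with it the values of \<open>F\<close>.\<close>

lemma cont_xP_bounded:
  fixes \<Omega> :: "(real^'n) set"
  assumes K: "compact (closure \<Omega>)" and F: "cont_xP \<Omega> F"
  shows "\<exists>B\<ge>0. \<forall>x\<in>closure \<Omega>. \<forall>m\<in>Pmeas \<Omega>. \<bar>F x m\<bar> \<le> B"
proof (rule ccontr)
  assume neg: "\<not> ?thesis"
  have "\<exists>z. fst z \<in> closure \<Omega> \<and> snd z \<in> Pmeas \<Omega> \<and> \<bar>F (fst z) (snd z)\<bar> > real n" for n :: nat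
  proof -
    have "\<not> (\<forall>x\<in>closure \<Omega>. \<forall>m\<in>Pmeas \<Omega>. \<bar>F x m\<bar> \<le> real n)" using neg by (metis of_nat_0_le_iff)
    then obtain x m where "x \<in> closure \<Omega>" "m \<in> Pmeas \<Omega>" "\<not> \<bar>F x m\<bar> \<le> real n" by blast
    then show ?thesis by (intro exI[of _ "(x, m)"]) auto
  qed
  then obtain z where z: "\<And>n::nat. fst (z n) \<in> closure \<Omega>" "\<And>n. snd (z n) \<in> Pmeas \<Omega>" "\<And>n. \<bar>F (fst (z n)) (snd (z n))\<bar> > real n"
    by metis
  define x where "x = (\<lambda>n. fst (z n))"
  define m where "m = (\<lambda>n. snd (z n))"
  obtain x0 r1 where x0: "x0 \<in> closure \<Omega>" and r1: "strict_mono (r1::nat\<Rightarrow>nat)" "(x \<circ> r1) \<longlonglongrightarrow> x0"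
    using K z(1) unfolding compact_eq_seq_compact_metric seq_compact_def x_def by metis
  have "\<exists>r Y. strict_mono (r::nat \<Rightarrow> nat) \<and> Y \<in> borel_measurable borel \<and> (\<forall>u. Y u \<in> closure \<Omega>) \<and>
    (\<forall>e>0. \<exists>N. \<forall>n\<ge>N. \<forall>f::(real^'n) \<Rightarrow> real. 1-lipschitz_on UNIV f \<longrightarrow>
      \<bar>(\<integral>x. f x \<partial>m (r1 (r n))) - (\<integral>u. f (Y u) \<partial>restrict_space lborel {0..<1::real})\<bar> \<le> e)"
  proof (rule compact_laws_subsequence[OF K, of "\<lambda>n. m (r1 n)" "\<lambda>n x. x"])
    show "prob_space (m (r1 n))" for n unfolding m_def by (rule Pmeas_prob_space[OF z(2)])
    show "(\<lambda>x. x) \<in> borel_measurable (m (r1 n))" for n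
      unfolding m_def by (rule Pmeas_measurable[OF z(2)]) simp
    show "x \<in> closure \<Omega>" if "x \<in> space (m (r1 n))" for n x
      using that Pmeas_space[of "m (r1 n)" \<Omega>] z(2) by (simp add: m_def)
  qed
  then obtain r Y where r: "strict_mono (r::nat \<Rightarrow> nat)" and Y: "Y \<in> borel_measurable borel" "\<And>u. Y u \<in> closure \<Omega>"
    and conv: "\<And>e. e > 0 \<Longrightarrow> \<exists>N. \<forall>n\<ge>N. \<forall>f::(real^'n) \<Rightarrow> real. 1-lipschitz_on UNIV f \<longrightarrow>
      \<bar>(\<integral>x. f x \<partial>m (r1 (r n))) - (\<integral>u. f (Y u) \<partial>restrict_space lborel {0..<1::real})\<bar> \<le> e" by blast
  let ?U = "restrict_space lborel {0..<1::real}"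
  have Ym: "Y \<in> measurable ?U (restrict_space borel (closure \<Omega>))"
    using Y by (intro measurable_restrict_space2 measurable_restrict_space1) (auto simp: measurable_lborel1)
  define m' where "m' = distr ?U (restrict_space borel (closure \<Omega>)) Y"
  have m': "m' \<in> Pmeas \<Omega>"
    using prob_space.prob_space_distr[OF prob_space_unit_interval Ym] by (simp add: Pmeas_def m'_def)
  have int: "(\<integral>x. f x \<partial>m') = (\<integral>u. f (Y u) \<partial>?U)" if "1-lipschitz_on UNIV f" for f :: "real^'n \<Rightarrow> real"
    unfolding m'_def by (rule integral_distr[OF Ym]) (intro measurable_restrict_space1 lipschitz_borel that)
  have "d1conv (\<lambda>n. m (r1 (r n))) m'"
    unfolding d1conv_def
  proof (intro allI impI)
    fix e :: real assume e: "e > 0"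
    obtain N where N: "\<forall>n\<ge>N. \<forall>f::(real^'n) \<Rightarrow> real. 1-lipschitz_on UNIV f \<longrightarrow>
      \<bar>(\<integral>x. f x \<partial>m (r1 (r n))) - (\<integral>u. f (Y u) \<partial>?U)\<bar> \<le> e/2" using conv[of "e/2"] e by auto
    have "d1 (m (r1 (r n))) m' < e" if "n \<ge> N" for n
    proof -
      have "d1 (m (r1 (r n))) m' \<le> e/2"
      proof (rule d1_le)
        fix f :: "real^'n \<Rightarrow> real" assume f: "1-lipschitz_on UNIV f"
        then have "\<bar>(\<integral>x. f x \<partial>m (r1 (r n))) - (\<integral>u. f (Y u) \<partial>?U)\<bar> \<le> e/2" using N that by blast
        then show "(\<integral>x. f x \<partial>m (r1 (r n))) - (\<integral>x. f x \<partial>m') \<le> e/2" unfolding int[OF f] by linarith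
      qed
      then show ?thesis using e by simp
    qed
    then show "\<forall>\<^sub>F n in sequentially. d1 (m (r1 (r n))) m' < e" by (auto simp: eventually_sequentially)
  qed
  then have "(\<lambda>n. F (x (r1 (r n))) (m (r1 (r n)))) \<longlonglongrightarrow> F x0 m'"
    using LIMSEQ_subseq_LIMSEQ[OF r1(2) r] z(1,2) by (intro cont_xP_tendsto[OF F] x0 m') (auto simp: x_def m_def o_def)
  then have "Bseq (\<lambda>n. F (x (r1 (r n))) (m (r1 (r n))))" using convergentI convergent_imp_Bseq by blast
  then obtain C where C: "\<And>n. \<bar>F (x (r1 (r n))) (m (r1 (r n)))\<bar> \<le> C" unfolding Bseq_def by auto
  obtain n :: nat where n: "C < real n" using reals_Archimedean2 by blast
  have "n \<le> r1 (r n)" using seq_suble[OF r1(1), of "r n"] seq_suble[OF r, of n] by linarith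
  then show False using z(3)[of "r1 (r n)"] C[of n] n unfolding x_def m_def by linarith
qed

section \<open>Time marginals of laws on curves\<close>

lemma eval_lipschitz:
  "1-lipschitz_on UNIV (\<lambda>\<gamma>::('a::topological_space, 'b::metric_space) bcontfun. apply_bcontfun \<gamma> t)"
  by (rule lipschitz_onI) (auto simp: dist_bounded)

lemma eval_borel [measurable]: "(\<lambda>\<gamma>::(real, real^'n) bcontfun. apply_bcontfun \<gamma> t) \<in> borel_measurable borel"
  by (intro borel_measurable_continuous_onI lipschitz_on_continuous_on[OF eval_lipschitz])

lemma lipschitz_compose_eval:
  assumes "1-lipschitz_on UNIV f"
  shows "1-lipschitz_on UNIV (\<lambda>\<gamma>::('a::topological_space, 'b::metric_space) bcontfun. f (apply_bcontfun \<gamma> t) :: real)"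
proof (rule lipschitz_onI)
  fix \<gamma> \<gamma>' :: "('a, 'b) bcontfun"
  have "dist (f (apply_bcontfun \<gamma> t)) (f (apply_bcontfun \<gamma>' t)) \<le> dist (apply_bcontfun \<gamma> t) (apply_bcontfun \<gamma>' t)"
    using lipschitz_onD[OF assms, of "apply_bcontfun \<gamma> t" "apply_bcontfun \<gamma>' t"] by simp
  also have "\<dots> \<le> dist \<gamma> \<gamma>'" by (rule dist_bounded)
  finally show "dist (f (apply_bcontfun \<gamma> t)) (f (apply_bcontfun \<gamma>' t)) \<le> 1 * dist \<gamma> \<gamma>'" by simp
qed simp

lemma PGamma_prob_space: "\<eta> \<in> PGamma \<Omega> T \<Longrightarrow> prob_space \<eta>" by (simp add: PGamma_def)

lemma PGamma_space: "\<eta> \<in> PGamma \<Omega> T \<Longrightarrow> space \<eta> = Gamma \<Omega> T"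
  using sets_eq_imp_space_eq[of \<eta> "restrict_space borel (Gamma \<Omega> T)"] by (simp add: PGamma_def space_restrict_space)

lemma PGamma_measurable:
  assumes "\<eta> \<in> PGamma \<Omega> T" "f \<in> measurable borel N"
  shows "f \<in> measurable \<eta> N"
proof -
  have "f \<in> measurable (restrict_space borel (Gamma \<Omega> T)) N" using assms(2) by (rule measurable_restrict_space1)
  moreover have "sets \<eta> = sets (restrict_space borel (Gamma \<Omega> T))" using assms by (simp add: PGamma_def)
  ultimately show ?thesis using measurable_cong_sets by blast
qed

text \<open>The geometry of the boundary enters through \<open>bridges\<close>, in the form in which
  \<open>recovery\<close> uses it.\<close>

locale mfg = tonelli \<Omega> T L c1 c0
  for \<Omega> :: "(real^'n) set" and T :: real and L :: "real^'n \<Rightarrow> real^'n \<Rightarrow> real" and c1 c0 :: real +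
  fixes F G :: "real^'n \<Rightarrow> (real^'n) measure \<Rightarrow> real" and m0 :: "(real^'n) measure"
  assumes F_cont: "cont_xP \<Omega> F" and G_cont: "cont_xP \<Omega> G" and m0: "m0 \<in> Pmeas \<Omega>"
    and bridges: "\<And>x. x \<in> closure \<Omega> \<Longrightarrow>
      \<exists>\<rho>>0. \<exists>\<Lambda>>0. \<forall>y\<in>closure \<Omega>. dist y x < \<rho> \<longrightarrow> (\<exists>\<beta>. bridge (\<Lambda> * dist y x) y x \<beta>)"
begin

lemma eval_measurable:
  assumes \<eta>: "\<eta> \<in> PGamma \<Omega> T"
  shows "(\<lambda>\<gamma>. apply_bcontfun \<gamma> t) \<in> measurable \<eta> (restrict_space borel (closure \<Omega>))"
  using PGamma_measurable[OF \<eta> eval_borel] Gamma_in_closure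
  by (intro measurable_restrict_space2) (auto simp: PGamma_space[OF \<eta>])

lemma push_e_Pmeas: "\<eta> \<in> PGamma \<Omega> T \<Longrightarrow> push_e \<Omega> t \<eta> \<in> Pmeas \<Omega>"
  unfolding push_e_def Pmeas_def
  using prob_space.prob_space_distr[OF PGamma_prob_space eval_measurable] by auto

lemma integral_push_e:
  assumes \<eta>: "\<eta> \<in> PGamma \<Omega> T" and f: "f \<in> borel_measurable borel"
  shows "(\<integral>x. f x \<partial>push_e \<Omega> t \<eta>) = (\<integral>\<gamma>. f (apply_bcontfun \<gamma> t) \<partial>\<eta> :: real)"
  unfolding push_e_def by (rule integral_distr[OF eval_measurable[OF \<eta>]]) (rule measurable_restrict_space1[OF f])

text \<open>The times vary with \<open>n\<close> so that continuity in time, with a constant law,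
  and convergence of laws, at a constant time, are both instances. A one-sided bound on the
  integrals suffices, as \<open>d1\<close> is a supremum of signed differences.\<close>

lemma d1conv_push_e:
  assumes \<eta>: "\<And>n. \<eta> n \<in> PGamma \<Omega> T" and \<eta>': "\<eta>' \<in> PGamma \<Omega> T"
    and conv: "\<And>e. e > 0 \<Longrightarrow> \<exists>N. \<forall>n\<ge>N. \<forall>f::real^'n \<Rightarrow> real. 1-lipschitz_on UNIV f \<longrightarrow>
       (\<integral>\<gamma>. f (apply_bcontfun \<gamma> (s n)) \<partial>\<eta> n) - (\<integral>\<gamma>. f (apply_bcontfun \<gamma> t) \<partial>\<eta>') \<le> e"
  shows "d1conv (\<lambda>n. push_e \<Omega> (s n) (\<eta> n)) (push_e \<Omega> t \<eta>')"
  unfolding d1conv_def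
proof (intro allI impI)
  fix e :: real assume e: "e > 0"
  obtain N where N: "\<forall>n\<ge>N. \<forall>f::real^'n \<Rightarrow> real. 1-lipschitz_on UNIV f \<longrightarrow>
       (\<integral>\<gamma>. f (apply_bcontfun \<gamma> (s n)) \<partial>\<eta> n) - (\<integral>\<gamma>. f (apply_bcontfun \<gamma> t) \<partial>\<eta>') \<le> e/2"
    using conv[of "e/2"] e by auto
  have half: "d1 (push_e \<Omega> (s n) (\<eta> n)) (push_e \<Omega> t \<eta>') \<le> e/2" if "n \<ge> N" for n
    by (rule d1_le) (use N that in \<open>simp add: integral_push_e[OF \<eta>] integral_push_e[OF \<eta>'] lipschitz_borel\<close>)
  have "d1 (push_e \<Omega> (s n) (\<eta> n)) (push_e \<Omega> t \<eta>') < e" if "n \<ge> N" for n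
    using half[OF that] e by linarith
  then show "\<forall>\<^sub>F n in sequentially. d1 (push_e \<Omega> (s n) (\<eta> n)) (push_e \<Omega> t \<eta>') < e"
    by (auto simp: eventually_sequentially)
qed

lemma closure_norm_bound: "\<exists>B\<ge>0. \<forall>x\<in>closure \<Omega>. norm x \<le> B"
  using compact_imp_bounded[OF compact_closure] unfolding bounded_iff
  by (metis norm_ge_zero order_trans order_refl linear)

text \<open>For 1-Lipschitz test functions the integrals differ by at most the mean displacement
  between the two times, uniformly in the test function. Dominated convergence sends it to 0, the
  curves being continuous and the domain bounded.\<close>

lemma push_e_time_continuous:
  assumes \<eta>: "\<eta> \<in> PGamma \<Omega> T" and s: "s \<longlonglongrightarrow> t"
  shows "d1conv (\<lambda>n. push_e \<Omega> (s n) \<eta>) (push_e \<Omega> t \<eta>)"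
proof (rule d1conv_push_e[OF \<eta> \<eta>])
  fix e :: real assume e: "e > 0"
  interpret prob_space \<eta> using \<eta> by (rule PGamma_prob_space)
  obtain B where B: "B \<ge> 0" "\<And>x. x \<in> closure \<Omega> \<Longrightarrow> norm x \<le> B" using closure_norm_bound by blast
  have em: "(\<lambda>\<gamma>. apply_bcontfun \<gamma> r) \<in> borel_measurable \<eta>" for r by (rule PGamma_measurable[OF \<eta> eval_borel])
  have nb: "norm (apply_bcontfun \<gamma> r - apply_bcontfun \<gamma> r') \<le> 2 * B" if "\<gamma> \<in> space \<eta>" for \<gamma> r r'
    using norm_triangle_ineq4[of "apply_bcontfun \<gamma> r" "apply_bcontfun \<gamma> r'"]
      B(2)[OF Gamma_in_closure[of \<gamma> r]] B(2)[OF Gamma_in_closure[of \<gamma> r']] that by (simp add: PGamma_space[OF \<eta>])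
  have "(\<lambda>n. \<integral>\<gamma>. norm (apply_bcontfun \<gamma> (s n) - apply_bcontfun \<gamma> t) \<partial>\<eta>) \<longlonglongrightarrow> (\<integral>\<gamma>. 0 \<partial>\<eta>)"
  proof (rule integral_dominated_convergence[where w = "\<lambda>_. 2 * B"])
    show "AE \<gamma> in \<eta>. (\<lambda>n. norm (apply_bcontfun \<gamma> (s n) - apply_bcontfun \<gamma> t)) \<longlonglongrightarrow> 0"
    proof (rule AE_I2)
      fix \<gamma> :: "(real, real^'n) bcontfun"
      have "isCont (apply_bcontfun \<gamma>) t"
        by (metis UNIV_I continuous_on_apply_bcontfun continuous_on_eq_continuous_at open_UNIV)
      then have "(\<lambda>n. apply_bcontfun \<gamma> (s n)) \<longlonglongrightarrow> apply_bcontfun \<gamma> t" using s by (rule isCont_tendsto_compose)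
      then show "(\<lambda>n. norm (apply_bcontfun \<gamma> (s n) - apply_bcontfun \<gamma> t)) \<longlonglongrightarrow> 0"
        by (simp add: LIM_zero tendsto_norm_zero)
    qed
  qed (use em nb in auto)
  then have "\<forall>\<^sub>F n in sequentially. (\<integral>\<gamma>. norm (apply_bcontfun \<gamma> (s n) - apply_bcontfun \<gamma> t) \<partial>\<eta>) < e"
    using e by (intro order_tendstoD(2)) auto
  then obtain N where N: "\<And>n. n \<ge> N \<Longrightarrow> (\<integral>\<gamma>. norm (apply_bcontfun \<gamma> (s n) - apply_bcontfun \<gamma> t) \<partial>\<eta>) < e"
    by (auto simp: eventually_sequentially)
  have "(\<integral>\<gamma>. f (apply_bcontfun \<gamma> (s n)) \<partial>\<eta>) - (\<integral>\<gamma>. f (apply_bcontfun \<gamma> t) \<partial>\<eta>) \<le> e"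
    if n: "n \<ge> N" and f: "1-lipschitz_on UNIV f" for n and f :: "real^'n \<Rightarrow> real"
  proof -
    have lf: "\<bar>f x - f y\<bar> \<le> norm (x - y)" for x y using lipschitz_onD[OF f, of x y] by (simp add: dist_norm)
    have fi: "integrable \<eta> (\<lambda>\<gamma>. f (apply_bcontfun \<gamma> r))" for r
    proof (rule integrable_const_bound[where B = "\<bar>f 0\<bar> + B"])
      show "(\<lambda>\<gamma>. f (apply_bcontfun \<gamma> r)) \<in> borel_measurable \<eta>" using em lipschitz_borel[OF f] by (rule measurable_compose)
      show "AE \<gamma> in \<eta>. norm (f (apply_bcontfun \<gamma> r)) \<le> \<bar>f 0\<bar> + B"
      proof (rule AE_I2)
        fix \<gamma> assume "\<gamma> \<in> space \<eta>"
        then have "norm (apply_bcontfun \<gamma> r) \<le> B" using B(2) Gamma_in_closure by (simp add: PGamma_space[OF \<eta>])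
        then show "norm (f (apply_bcontfun \<gamma> r)) \<le> \<bar>f 0\<bar> + B" using lf[of "apply_bcontfun \<gamma> r" 0] by simp
      qed
    qed
    have ni: "integrable \<eta> (\<lambda>\<gamma>. norm (apply_bcontfun \<gamma> (s n) - apply_bcontfun \<gamma> t))"
      using em nb by (intro integrable_const_bound[where B = "2 * B"]) auto
    have "(\<integral>\<gamma>. f (apply_bcontfun \<gamma> (s n)) \<partial>\<eta>) - (\<integral>\<gamma>. f (apply_bcontfun \<gamma> t) \<partial>\<eta>) = (\<integral>\<gamma>. f (apply_bcontfun \<gamma> (s n)) - f (apply_bcontfun \<gamma> t) \<partial>\<eta>)"
      using fi by simp
    also have "\<dots> \<le> (\<integral>\<gamma>. norm (apply_bcontfun \<gamma> (s n) - apply_bcontfun \<gamma> t) \<partial>\<eta>)"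
      using fi ni lf by (intro integral_mono) (auto simp: abs_le_iff)
    finally show ?thesis using N[OF n] by linarith
  qed
  then show "\<exists>N. \<forall>n\<ge>N. \<forall>f::real^'n \<Rightarrow> real. 1-lipschitz_on UNIV f \<longrightarrow>
       (\<integral>\<gamma>. f (apply_bcontfun \<gamma> (s n)) \<partial>\<eta>) - (\<integral>\<gamma>. f (apply_bcontfun \<gamma> t) \<partial>\<eta>) \<le> e" by blast
qed

text \<open>The part of the cost that depends on the law. It is bounded and jointly continuous in
  law and curve, whereas the action is independent of the law and only lower semicontinuous.\<close>

definition coupling :: "(real, real^'n) bcontfun measure \<Rightarrow> (real, real^'n) bcontfun \<Rightarrow> real" where
  "coupling \<eta> \<gamma> = (LINT t:{0..T}|lborel. F (apply_bcontfun \<gamma> t) (push_e \<Omega> t \<eta>)) + G (apply_bcontfun \<gamma> T) (push_e \<Omega> T \<eta>)"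

lemma F_along_continuous:
  assumes \<gamma>: "\<gamma> \<in> Gamma \<Omega> T" and \<eta>: "\<eta> \<in> PGamma \<Omega> T"
  shows "continuous_on UNIV (\<lambda>t. F (apply_bcontfun \<gamma> t) (push_e \<Omega> t \<eta>))"
proof -
  have "isCont (\<lambda>t. F (apply_bcontfun \<gamma> t) (push_e \<Omega> t \<eta>)) t" for t
    unfolding continuous_at_sequentially
  proof (intro allI impI)
    fix s assume s: "s \<longlonglongrightarrow> t"
    have "isCont (apply_bcontfun \<gamma>) t"
      by (metis UNIV_I continuous_on_apply_bcontfun continuous_on_eq_continuous_at open_UNIV)
    then have "(\<lambda>n. apply_bcontfun \<gamma> (s n)) \<longlonglongrightarrow> apply_bcontfun \<gamma> t" using s by (rule isCont_tendsto_compose)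
    then have "(\<lambda>n. F (apply_bcontfun \<gamma> (s n)) (push_e \<Omega> (s n) \<eta>)) \<longlonglongrightarrow> F (apply_bcontfun \<gamma> t) (push_e \<Omega> t \<eta>)"
      using push_e_time_continuous[OF \<eta> s] by (intro cont_xP_tendsto[OF F_cont] Gamma_in_closure[OF \<gamma>] push_e_Pmeas[OF \<eta>])
    then show "((\<lambda>t. F (apply_bcontfun \<gamma> t) (push_e \<Omega> t \<eta>)) \<circ> s) \<longlonglongrightarrow> F (apply_bcontfun \<gamma> t) (push_e \<Omega> t \<eta>)" by (simp add: o_def)
  qed
  then show ?thesis by (simp add: continuous_on_eq_continuous_at)
qed

lemma F_along_integrable:
  assumes "\<gamma> \<in> Gamma \<Omega> T" "\<eta> \<in> PGamma \<Omega> T"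
  shows "set_integrable lborel {0..T} (\<lambda>t. F (apply_bcontfun \<gamma> t) (push_e \<Omega> t \<eta>))"
  by (rule borel_integrable_atLeastAtMost'[OF continuous_on_subset[OF F_along_continuous[OF assms]]]) simp

lemma coupling_bounded: "\<exists>B\<ge>0. \<forall>\<eta>\<in>PGamma \<Omega> T. \<forall>\<gamma>\<in>Gamma \<Omega> T. \<bar>coupling \<eta> \<gamma>\<bar> \<le> B"
proof -
  obtain BF where BF: "BF \<ge> 0" "\<forall>x\<in>closure \<Omega>. \<forall>m\<in>Pmeas \<Omega>. \<bar>F x m\<bar> \<le> BF" using cont_xP_bounded[OF compact_closure F_cont] by blast
  obtain BG where BG: "BG \<ge> 0" "\<forall>x\<in>closure \<Omega>. \<forall>m\<in>Pmeas \<Omega>. \<bar>G x m\<bar> \<le> BG" using cont_xP_bounded[OF compact_closure G_cont] by blast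
  have "\<bar>coupling \<eta> \<gamma>\<bar> \<le> T * BF + BG" if \<eta>: "\<eta> \<in> PGamma \<Omega> T" and \<gamma>: "\<gamma> \<in> Gamma \<Omega> T" for \<eta> \<gamma>
  proof -
    let ?f = "\<lambda>t. F (apply_bcontfun \<gamma> t) (push_e \<Omega> t \<eta>)"
    have I: "set_integrable lborel {0..T} ?f" by (rule F_along_integrable[OF \<gamma> \<eta>])
    have b: "\<bar>?f t\<bar> \<le> BF" for t using BF(2) Gamma_in_closure[OF \<gamma>] push_e_Pmeas[OF \<eta>] by blast
    have "\<bar>LINT t:{0..T}|lborel. ?f t\<bar> \<le> (LINT t:{0..T}|lborel. \<bar>?f t\<bar>)"
      using set_integral_norm_bound[OF I] by simp
    also have "\<dots> \<le> (LINT t:{0..T}|lborel. BF)"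
      by (rule set_integral_mono) (use I b set_integrable_const_interval in \<open>auto intro: set_integrable_abs\<close>)
    also have "\<dots> = T * BF" using set_integral_const_interval(1)[of 0 T BF] T_pos by simp
    finally have "\<bar>LINT t:{0..T}|lborel. ?f t\<bar> \<le> T * BF" .
    moreover have "\<bar>G (apply_bcontfun \<gamma> T) (push_e \<Omega> T \<eta>)\<bar> \<le> BG" using BG(2) Gamma_in_closure[OF \<gamma>] push_e_Pmeas[OF \<eta>] by blast
    ultimately show ?thesis unfolding coupling_def by linarith
  qed
  then show ?thesis using BF(1) BG(1) T_pos by (intro exI[of _ "T * BF + BG"]) auto
qed

text \<open>Convergence of the marginals at each single time is enough: the integrand converges
  pointwise and is dominated by the bound \<open>BF\<close> of \<open>F\<close>.\<close>

lemma coupling_tendsto: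
  assumes z: "\<And>n. z n \<in> Gamma \<Omega> T" "z \<longlonglongrightarrow> \<gamma>" "\<gamma> \<in> Gamma \<Omega> T"
    and \<eta>: "\<And>n. \<eta> n \<in> PGamma \<Omega> T" "\<eta>' \<in> PGamma \<Omega> T" and conv: "\<And>t. d1conv (\<lambda>n. push_e \<Omega> t (\<eta> n)) (push_e \<Omega> t \<eta>')"
  shows "(\<lambda>n. coupling (\<eta> n) (z n)) \<longlonglongrightarrow> coupling \<eta>' \<gamma>"
proof -
  obtain BF where BF: "BF \<ge> 0" "\<forall>x\<in>closure \<Omega>. \<forall>m\<in>Pmeas \<Omega>. \<bar>F x m\<bar> \<le> BF" using cont_xP_bounded[OF compact_closure F_cont] by blast
  have lim: "(\<lambda>n. H (apply_bcontfun (z n) t) (push_e \<Omega> t (\<eta> n))) \<longlonglongrightarrow> H (apply_bcontfun \<gamma> t) (push_e \<Omega> t \<eta>')"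
    if "cont_xP \<Omega> H" for H t
    by (rule cont_xP_tendsto[OF that Gamma_in_closure[OF z(1)] bcontfun_tendsto_apply[OF z(2)]
        Gamma_in_closure[OF z(3)] push_e_Pmeas[OF \<eta>(1)] push_e_Pmeas[OF \<eta>(2)] conv])
  have "(\<lambda>n. LINT t:{0..T}|lborel. F (apply_bcontfun (z n) t) (push_e \<Omega> t (\<eta> n)))
      \<longlonglongrightarrow> (LINT t:{0..T}|lborel. F (apply_bcontfun \<gamma> t) (push_e \<Omega> t \<eta>'))"
    unfolding set_lebesgue_integral_def
  proof (rule integral_dominated_convergence[where w = "\<lambda>t. indicator {0..T} t *\<^sub>R BF"])
    show "integrable lborel (\<lambda>t. indicator {0..T} t *\<^sub>R BF)"
      using set_integrable_const_interval(1)[of 0 T BF] by (simp add: set_integrable_def)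
    show "AE t in lborel. (\<lambda>n. indicator {0..T} t *\<^sub>R F (apply_bcontfun (z n) t) (push_e \<Omega> t (\<eta> n)))
        \<longlonglongrightarrow> indicator {0..T} t *\<^sub>R F (apply_bcontfun \<gamma> t) (push_e \<Omega> t \<eta>')"
      by (intro AE_I2 tendsto_intros lim F_cont)
    show "(\<lambda>t. indicator {0..T} t *\<^sub>R F (apply_bcontfun \<gamma> t) (push_e \<Omega> t \<eta>')) \<in> borel_measurable lborel"
      using F_along_integrable[OF z(3) \<eta>(2)] by (auto simp: set_integrable_def)
    show "(\<lambda>t. indicator {0..T} t *\<^sub>R F (apply_bcontfun (z n) t) (push_e \<Omega> t (\<eta> n))) \<in> borel_measurable lborel" for n
      using F_along_integrable[OF z(1) \<eta>(1)] by (auto simp: set_integrable_def)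
    show "AE t in lborel. norm (indicator {0..T} t *\<^sub>R F (apply_bcontfun (z n) t) (push_e \<Omega> t (\<eta> n))) \<le> indicator {0..T} t *\<^sub>R BF" for n
    proof (rule AE_I2)
      fix t
      have "\<bar>F (apply_bcontfun (z n) t) (push_e \<Omega> t (\<eta> n))\<bar> \<le> BF"
        using BF(2) Gamma_in_closure[OF z(1)] push_e_Pmeas[OF \<eta>(1)] by blast
      then show "norm (indicator {0..T} t *\<^sub>R F (apply_bcontfun (z n) t) (push_e \<Omega> t (\<eta> n))) \<le> indicator {0..T} t *\<^sub>R BF"
        by (simp add: indicator_def)
    qed
  qed
  then show ?thesis unfolding coupling_def by (intro tendsto_intros lim G_cont)
qed

text \<open>Along a curve the term with \<open>F\<close> is integrable on the interval, so the whole
  integrand is integrable exactly when the action is finite. Optimality becomes a comparison of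
  action plus coupling, in which \<open>c0 * T\<close> drops out.\<close>

lemma Jcost_eq:
  assumes \<gamma>: "\<gamma> \<in> Gamma \<Omega> T" and \<eta>: "\<eta> \<in> PGamma \<Omega> T"
  shows "Jcost \<Omega> T L F G \<eta> \<gamma> = (if action \<gamma> = \<infinity> then \<infinity> else ereal (enn2real (action \<gamma>) - c0 * T + coupling \<eta> \<gamma>))"
proof -
  let ?L = "\<lambda>t. L (apply_bcontfun \<gamma> t) (vel \<gamma> t)"
  let ?F = "\<lambda>t. F (apply_bcontfun \<gamma> t) (push_e \<Omega> t \<eta>)"
  have IF: "set_integrable lborel {0..T} ?F" by (rule F_along_integrable[OF \<gamma> \<eta>])
  have Ic: "set_integrable lborel {0..T} (\<lambda>_. c0)" by (rule set_integrable_const_interval)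
  have meas: "?L \<in> borel_measurable borel" by (rule lagrangian_borel[OF \<gamma>])
  have nn: "0 \<le> ?L t + c0" for t using L_plus_nonneg[OF Gamma_in_closure[OF \<gamma>]] .
  have eq: "action \<gamma> = (\<integral>\<^sup>+t. ennreal (indicator {0..T} t *\<^sub>R (?L t + c0)) \<partial>lborel)"
    unfolding action_def by (intro nn_integral_cong) (auto simp: indicator_def)
  have J: "Jcost \<Omega> T L F G \<eta> \<gamma> = (if set_integrable lborel {0..T} (\<lambda>t. ?L t + ?F t)
      then ereal (LINT t:{0..T}|lborel. ?L t + ?F t) else \<infinity>) + ereal (G (apply_bcontfun \<gamma> T) (push_e \<Omega> T \<eta>))"
    unfolding Jcost_def Let_def vel_def ..
  show ?thesis
  proof (cases "action \<gamma> = \<infinity>")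
    case True
    have "\<not> set_integrable lborel {0..T} (\<lambda>t. ?L t + ?F t)"
    proof
      assume "set_integrable lborel {0..T} (\<lambda>t. ?L t + ?F t)"
      then have "set_integrable lborel {0..T} (\<lambda>t. (?L t + ?F t) - ?F t)" using IF by (rule set_integral_diff(1))
      then have "set_integrable lborel {0..T} ?L" by simp
      then have I: "set_integrable lborel {0..T} (\<lambda>t. ?L t + c0)" using Ic by (rule set_integral_add(1))
      have "(\<integral>\<^sup>+t. ennreal (indicator {0..T} t *\<^sub>R (?L t + c0)) \<partial>lborel) = ennreal (\<integral>t. indicator {0..T} t *\<^sub>R (?L t + c0) \<partial>lborel)"
        by (rule nn_integral_eq_integral) (use I nn in \<open>auto simp: set_integrable_def\<close>)
      then show False using True eq by simp
    qed
    then show ?thesis using True J by simp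
  next
    case False
    define M where "M = enn2real (action \<gamma>)"
    have M: "action \<gamma> = ennreal M" "0 \<le> M" using False by (auto simp: M_def less_top)
    have I: "set_integrable lborel {0..T} (\<lambda>t. ?L t + c0)" using action_finite_imp(1)[OF \<gamma>, of M] M by simp
    have "ennreal (LINT t:{0..T}|lborel. ?L t + c0) = ennreal M"
      unfolding M(1)[symmetric] eq set_lebesgue_integral_def
      by (rule nn_integral_eq_integral[symmetric]) (use I nn in \<open>auto simp: set_integrable_def\<close>)
    moreover have "0 \<le> (LINT t:{0..T}|lborel. ?L t + c0)"
      unfolding set_lebesgue_integral_def using nn by (intro Bochner_Integration.integral_nonneg) (auto simp: indicator_def)
    ultimately have LM: "(LINT t:{0..T}|lborel. ?L t + c0) = M" using M(2) by simp
    have "set_integrable lborel {0..T} (\<lambda>t. (?L t + c0) - c0)" using I Ic by (rule set_integral_diff(1))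
    then have IL: "set_integrable lborel {0..T} ?L" by simp
    have "(LINT t:{0..T}|lborel. ?L t) + (LINT t:{0..T}|lborel. c0) = M"
      using set_integral_add(2)[OF IL Ic] LM by simp
    then have "(LINT t:{0..T}|lborel. ?L t) = M - c0 * T"
      using set_integral_const_interval(1)[of 0 T c0] T_pos by (simp add: mult.commute)
    then have "(LINT t:{0..T}|lborel. ?L t + ?F t) = M - c0 * T + (LINT t:{0..T}|lborel. ?F t)"
      using set_integral_add(2)[OF IL IF] by simp
    moreover have "set_integrable lborel {0..T} (\<lambda>t. ?L t + ?F t)" using IL IF by (rule set_integral_add(1))
    ultimately show ?thesis using False J by (simp add: coupling_def M_def)
  qed
qed

section \<open>Existence of equilibria\<close>

text \<open>The law on curves induced by a mixed profile. The mass sits on indices and is pushed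
  forward by \<open>Z\<close>, so equal curves with different indices simply add up.\<close>

definition finite_law :: "nat \<Rightarrow> (nat \<Rightarrow> real) \<Rightarrow> (nat \<Rightarrow> (real, real^'n) bcontfun) \<Rightarrow> (real, real^'n) bcontfun measure" where
  "finite_law k \<pi> Z = distr (point_measure {..<k} (\<lambda>j. ennreal (\<pi> j))) (restrict_space borel (Gamma \<Omega> T)) Z"

context
  fixes k :: nat and \<pi> :: "nat \<Rightarrow> real" and Z :: "nat \<Rightarrow> (real, real^'n) bcontfun"
  assumes \<pi>: "\<And>j. j < k \<Longrightarrow> 0 \<le> \<pi> j" "(\<Sum>j<k. \<pi> j) = 1" and Z: "\<And>j. j < k \<Longrightarrow> Z j \<in> Gamma \<Omega> T"
begin

lemma finite_law_measurable:
  "Z \<in> measurable (point_measure {..<k} (\<lambda>j. ennreal (\<pi> j))) (restrict_space borel (Gamma \<Omega> T))"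
  using Z by (auto simp: measurable_point_measure_eq1 space_restrict_space)

lemma finite_law_PGamma: "finite_law k \<pi> Z \<in> PGamma \<Omega> T"
proof -
  have "emeasure (point_measure {..<k} (\<lambda>j. ennreal (\<pi> j))) {..<k} = (\<Sum>j<k. ennreal (\<pi> j))"
    by (rule emeasure_point_measure_finite) auto
  also have "\<dots> = ennreal (\<Sum>j<k. \<pi> j)" using \<pi>(1) by (intro sum_ennreal) auto
  finally have "prob_space (point_measure {..<k} (\<lambda>j. ennreal (\<pi> j)))"
    using \<pi>(2) by (intro prob_spaceI) (simp add: space_point_measure)
  then show ?thesis unfolding finite_law_def PGamma_def
    using prob_space.prob_space_distr[OF _ finite_law_measurable] by simp
qed

lemma integral_finite_law:
  assumes f: "f \<in> borel_measurable borel"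
  shows "(\<integral>\<gamma>. f \<gamma> \<partial>finite_law k \<pi> Z) = (\<Sum>j<k. \<pi> j * (f (Z j) :: real))"
proof -
  have "(\<integral>\<gamma>. f \<gamma> \<partial>finite_law k \<pi> Z) = (\<integral>j. f (Z j) \<partial>point_measure {..<k} (\<lambda>j. ennreal (\<pi> j)))"
    unfolding finite_law_def by (rule integral_distr[OF finite_law_measurable measurable_restrict_space1[OF f]])
  also have "\<dots> = (\<Sum>j<k. \<pi> j *\<^sub>R f (Z j))"
    by (rule lebesgue_integral_point_measure_finite) (use \<pi> in auto)
  finally show ?thesis by simp
qed

lemma AE_finite_law: "AE \<gamma> in finite_law k \<pi> Z. \<gamma> \<in> Z ` {j. j < k \<and> 0 < \<pi> j}"
proof -
  let ?A = "Z ` {j. j < k \<and> 0 < \<pi> j}"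
  have "finite ?A" by simp
  then have "closed ?A" by (rule finite_imp_closed)
  then have m: "{\<gamma> \<in> space (restrict_space borel (Gamma \<Omega> T)). \<gamma> \<in> ?A} \<in> sets (restrict_space borel (Gamma \<Omega> T))"
    by (auto simp: sets_restrict_space space_restrict_space intro!: image_eqI[of _ _ ?A])
  show ?thesis unfolding finite_law_def AE_distr_iff[OF finite_law_measurable m]
    by (subst AE_point_measure) auto
qed

end

text \<open>Standing still respects the state constraint and costs at most \<open>T\<close> times a
  bound for \<open>L x 0 + c0\<close> on the compact domain.\<close>

lemma const_curve: "\<exists>C\<ge>0. \<forall>x\<in>closure \<Omega>. \<exists>\<gamma>\<in>Gamma_at \<Omega> T x. action \<gamma> \<le> ennreal C"
proof -
  have "compact ((\<lambda>x. L x 0) ` closure \<Omega>)"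
  proof (intro compact_continuous_image compact_closure)
    show "continuous_on (closure \<Omega>) (\<lambda>x. L x 0)"
    proof -
      have "continuous_on (closure \<Omega>) (\<lambda>x. (x, 0::real^'n))" by (intro continuous_intros)
      from continuous_on_compose2[OF L_cont this] show ?thesis by auto
    qed
  qed
  then have "bounded ((\<lambda>x. L x 0) ` closure \<Omega>)" by (rule compact_imp_bounded)
  then obtain B where B: "\<forall>z\<in>(\<lambda>x. L x 0) ` closure \<Omega>. norm z \<le> B" unfolding bounded_iff by blast
  define D where "D = max 0 (B + c0)"
  have D: "L x 0 + c0 \<le> D" if "x \<in> closure \<Omega>" for x
  proof -
    have "norm (L x 0) \<le> B" using B that by blast
    then show ?thesis by (simp add: D_def)
  qed
  have "\<exists>\<gamma>\<in>Gamma_at \<Omega> T x. action \<gamma> \<le> ennreal (D * T)" if x: "x \<in> closure \<Omega>" for x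
  proof -
    obtain \<gamma> :: "(real, real^'n) bcontfun" where \<gamma>: "\<And>t. apply_bcontfun \<gamma> t = x"
      using const_bcontfun.rep_eq by metis
    then have f: "apply_bcontfun \<gamma> = (\<lambda>_. x)" by auto
    have "\<gamma> \<in> Gamma_at \<Omega> T x" unfolding Gamma_at_def Gamma_def abs_cont_on_def
      using x by (auto simp: \<gamma> intro: exI[of _ 1] zero_less_one)
    moreover have "action \<gamma> \<le> (\<integral>\<^sup>+t. ennreal D * indicator {0..T} t \<partial>lborel)"
      unfolding action_def by (intro nn_integral_mono mult_right_mono ennreal_leI) (simp_all add: vel_def f D[OF x])
    moreover have "(\<integral>\<^sup>+t. ennreal D * indicator {0..T} t \<partial>lborel) = ennreal (D * T)"
      using T_pos by (simp add: nn_integral_cmult_indicator D_def ennreal_mult)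
    ultimately show ?thesis by auto
  qed
  moreover have "D * T \<ge> 0" using T_pos by (simp add: D_def)
  ultimately show ?thesis by blast
qed

abbreviation (input) act :: "(real, real^'n) bcontfun \<Rightarrow> real" where "act \<gamma> \<equiv> enn2real (action \<gamma>)"

text \<open>Each start index \<open>i\<close> is a population of mass \<open>W i\<close> whose
  strategies form a net \<open>S i\<close> of curves of action at most \<open>M2\<close>;
  \<open>A\<close> consists of the curves played with positive mass. The last conclusion joins two
  approximations: a competitor \<sigma> is replaced by a net element \<open>s\<close> close to it
  and not much more expensive, and no played curve gains more than \<epsilon> by switching to
  \<open>s\<close>.\<close>

lemma approx_equilibrium:
  assumes \<epsilon>: "\<epsilon> > 0" and M2: "0 \<le> M2" and start: "\<And>x. x \<in> closure \<Omega> \<Longrightarrow> \<exists>\<gamma>\<in>Gamma_at \<Omega> T x. action \<gamma> \<le> ennreal M2"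
  shows "\<exists>\<eta> A. \<eta> \<in> PGamma \<Omega> T \<and> finite A \<and> A \<subseteq> {\<gamma> \<in> Gamma \<Omega> T. action \<gamma> \<le> ennreal M2} \<and> (AE \<gamma> in \<eta>. \<gamma> \<in> A) \<and>
    (\<forall>f::real^'n \<Rightarrow> real. 1-lipschitz_on UNIV f \<longrightarrow> \<bar>(\<integral>\<gamma>. f (apply_bcontfun \<gamma> 0) \<partial>\<eta>) - (\<integral>x. f x \<partial>m0)\<bar> \<le> \<epsilon>) \<and>
    (\<forall>\<gamma>\<in>A. \<forall>\<sigma>\<in>Gamma_at \<Omega> T (apply_bcontfun \<gamma> 0). action \<sigma> \<le> ennreal M2 \<longrightarrow>
      (\<exists>s\<in>Gamma_at \<Omega> T (apply_bcontfun \<gamma> 0). action s \<le> ennreal M2 \<and> dist s \<sigma> < \<epsilon> \<and> act s \<le> act \<sigma> + \<epsilon> \<and>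
        act \<gamma> + coupling \<eta> \<gamma> \<le> act s + coupling \<eta> s + \<epsilon>))"
proof -
  interpret m0: prob_space m0 using m0 by (rule Pmeas_prob_space)
  obtain B where B: "B \<ge> 0" "\<And>x. x \<in> closure \<Omega> \<Longrightarrow> norm x \<le> B" using closure_norm_bound by blast
  obtain B\<Phi> where B\<Phi>: "B\<Phi> \<ge> 0" "\<forall>\<eta>\<in>PGamma \<Omega> T. \<forall>\<gamma>\<in>Gamma \<Omega> T. \<bar>coupling \<eta> \<gamma>\<bar> \<le> B\<Phi>" using coupling_bounded by blast
  have "\<exists>C. finite C \<and> C \<subseteq> closure \<Omega> \<and> closure \<Omega> \<subseteq> (\<Union>x\<in>C. ball x \<epsilon>)"
    using seq_compact_imp_totally_bounded[OF compact_imp_seq_compact[OF compact_closure]] \<epsilon> by simp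
  then obtain C where C: "finite C" "C \<subseteq> closure \<Omega>" "closure \<Omega> \<subseteq> (\<Union>x\<in>C. ball x \<epsilon>)" by blast
  obtain xs where xs: "set xs = C" using C(1) finite_list by blast
  define n where "n = length xs"
  define p where "p = (\<lambda>i. xs ! i)"
  have pcl: "p i \<in> closure \<Omega>" if "i < n" for i using that C(2) xs by (auto simp: p_def n_def)
  \<comment> \<open>The mass of \<open>m0\<close> is moved to the first net point within distance
    \<epsilon>, which changes integrals of 1-Lipschitz functions by at most \<epsilon>.\<close>
  define E where "E = (\<lambda>i. closure \<Omega> \<inter> (ball (p i) \<epsilon> - (\<Union>j<i. ball (p j) \<epsilon>)))"
  have Em: "E i \<in> sets m0" for i
  proof -
    have "ball (p i) \<epsilon> - (\<Union>j<i. ball (p j) \<epsilon>) \<in> sets borel" by (intro sets.Diff sets.finite_UN) auto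
    then show ?thesis using m0 by (auto simp: Pmeas_def sets_restrict_space E_def)
  qed
  have Ecov: "\<exists>i\<in>{..<n}. x \<in> E i" if "x \<in> space m0" for x
  proof -
    have x: "x \<in> closure \<Omega>" using that Pmeas_space[OF m0] by simp
    then obtain c where "c \<in> set xs" "x \<in> ball c \<epsilon>" using C(3) xs by blast
    then obtain i where i: "i < n" "x \<in> ball (p i) \<epsilon>" unfolding in_set_conv_nth n_def p_def by blast
    define l where "l = (LEAST i. x \<in> ball (p i) \<epsilon>)"
    have "x \<in> ball (p l) \<epsilon>" unfolding l_def using i(2) by (rule LeastI)
    moreover have "l \<le> i" unfolding l_def using i(2) by (rule Least_le)
    moreover have "x \<notin> ball (p j) \<epsilon>" if "j < l" for j using not_less_Least[of j "\<lambda>i. x \<in> ball (p i) \<epsilon>"] that by (simp add: l_def)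
    ultimately have "x \<in> E l" "l < n" using i x by (auto simp: E_def)
    then show ?thesis by blast
  qed
  have Edis: "E i \<inter> E j = {}" if "i \<noteq> j" for i j
  proof -
    have "E i \<inter> E j = {}" if "i < j" for i j using that by (auto simp: E_def)
    from this[of i j] this[of j i] show ?thesis using that by (cases "i < j") (auto simp: Int_commute)
  qed
  define W where "W = (\<lambda>i. measure m0 (E i))"
  have W0: "0 \<le> W i" for i by (simp add: W_def)
  have W1: "(\<Sum>i<n. W i) = 1"
  proof -
    have "\<bar>(\<integral>x. 1 \<partial>m0) - (\<Sum>i\<in>{..<n}. 1 * measure m0 (E i))\<bar> \<le> (0::real)"
      by (rule prob_space_abs_integral_minus_simple[OF m0.prob_space_axioms]) (use Em Ecov Edis in auto)
    then show ?thesis by (simp add: W_def m0.prob_space)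
  qed
  have Wf: "\<bar>(\<integral>x. f x \<partial>m0) - (\<Sum>i<n. f (p i) * W i)\<bar> \<le> \<epsilon>" if f: "1-lipschitz_on UNIV f" for f :: "real^'n \<Rightarrow> real"
    unfolding W_def
  proof (rule prob_space_abs_integral_minus_simple[OF m0.prob_space_axioms])
    have lf: "\<bar>f x - f y\<bar> \<le> dist x y" for x y using lipschitz_onD[OF f, of x y] by (simp add: dist_real_def)
    show "integrable m0 f"
    proof (rule m0.integrable_const_bound[where B = "\<bar>f 0\<bar> + B"])
      show "AE x in m0. norm (f x) \<le> \<bar>f 0\<bar> + B"
      proof (rule AE_I2)
        fix x assume "x \<in> space m0"
        then have "norm x \<le> B" using B(2) Pmeas_space[OF m0] by simp
        then show "norm (f x) \<le> \<bar>f 0\<bar> + B" using lf[of x 0] by (simp add: dist_norm)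
      qed
    qed (rule Pmeas_measurable[OF m0 lipschitz_borel[OF f]])
    fix i x assume "x \<in> E i"
    then have "dist x (p i) < \<epsilon>" by (simp add: E_def dist_commute)
    then show "\<bar>f x - f (p i)\<bar> \<le> \<epsilon>" using lf[of x "p i"] by linarith
  qed (use Em Ecov Edis in auto)
  define Av where "Av = (\<lambda>i. {\<sigma> \<in> Gamma_at \<Omega> T (p i). action \<sigma> \<le> ennreal M2})"
  have act: "0 \<le> act \<sigma> \<and> act \<sigma> \<le> M2" if "action \<sigma> \<le> ennreal M2" for \<sigma>
    using enn2real_mono[OF that] M2 by simp
  have "\<exists>S. finite S \<and> S \<subseteq> Av i \<and> (\<forall>\<sigma>\<in>Av i. \<exists>s\<in>S. dist s \<sigma> < \<epsilon> \<and> act s \<le> act \<sigma> + \<epsilon>)" for i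
  proof (rule finite_net_with_values[OF compact_action_sublevel[OF M2] _ _ \<epsilon>])
    show "Av i \<subseteq> {\<gamma> \<in> Gamma \<Omega> T. action \<gamma> \<le> ennreal M2}" by (auto simp: Av_def Gamma_at_def)
    show "0 \<le> act \<sigma> \<and> act \<sigma> \<le> M2" if "\<sigma> \<in> Av i" for \<sigma> using that act by (simp add: Av_def)
  qed
  then obtain S where S: "\<And>i. finite (S i)" "\<And>i. S i \<subseteq> Av i" "\<And>i \<sigma>. \<sigma> \<in> Av i \<Longrightarrow> \<exists>s\<in>S i. dist s \<sigma> < \<epsilon> \<and> act s \<le> act \<sigma> + \<epsilon>"
    by metis
  have Sne: "S i \<noteq> {}" if i: "i < n" for i
  proof -
    obtain \<gamma> where "\<gamma> \<in> Gamma_at \<Omega> T (p i)" "action \<gamma> \<le> ennreal M2" using start[OF pcl[OF i]] by blast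
    then have "\<gamma> \<in> Av i" by (simp add: Av_def)
    then show ?thesis using S(3) by blast
  qed
  \<comment> \<open>Strategies are pairs of a start index and a curve: the list \<open>xs\<close>
    may repeat a point, and pairs keep the corresponding groups apart.\<close>
  define St where "St = Sigma {..<n} S"
  have finSt: "finite St" unfolding St_def using S(1) by (intro finite_SigmaI) auto
  define k where "k = card St"
  obtain h where h: "bij_betw h {..<k} St"
    using ex_bij_betw_nat_finite[OF finSt] unfolding k_def by (auto simp: lessThan_atLeast0)
  define grp where "grp = (\<lambda>j. fst (h j))"
  define Z where "Z = (\<lambda>j. snd (h j))"
  have hj: "grp j < n" "Z j \<in> S (grp j)" if "j < k" for j
  proof -
    have "h j \<in> St" using h that by (auto simp: bij_betw_def)
    then show "grp j < n" "Z j \<in> S (grp j)" by (auto simp: St_def grp_def Z_def)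
  qed
  have hex: "\<exists>j<k. grp j = i \<and> Z j = s" if "i < n" "s \<in> S i" for i s
  proof -
    have "(i, s) \<in> h ` {..<k}" using h that by (auto simp: bij_betw_def St_def)
    then obtain j where "j < k" "h j = (i, s)" by auto
    then show ?thesis by (intro exI[of _ j]) (simp add: grp_def Z_def)
  qed
  have ZA: "Z j \<in> Gamma \<Omega> T" "action (Z j) \<le> ennreal M2" "apply_bcontfun (Z j) 0 = p (grp j)" if "j < k" for j
    using hj(2)[OF that] S(2)[of "grp j"] by (auto simp: Av_def Gamma_at_def)
  let ?S = "{\<pi>. (\<forall>i<k. 0 \<le> \<pi> i) \<and> (\<forall>i<k. (\<Sum>j\<in>{j. j < k \<and> grp j = grp i}. \<pi> j) = W (grp i))}"
  have grpsum: "(\<Sum>j<k. \<pi> j * g (grp j)) = (\<Sum>i<n. W i * g i)" if \<pi>: "\<pi> \<in> ?S" for \<pi> and g :: "nat \<Rightarrow> real"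
  proof -
    have "(\<Sum>j<k. \<pi> j * g (grp j)) = (\<Sum>i<n. \<Sum>j\<in>{j\<in>{..<k}. grp j = i}. \<pi> j * g (grp j))"
      by (rule sum.group[symmetric]) (use hj in auto)
    also have "\<dots> = (\<Sum>i<n. W i * g i)"
    proof (rule sum.cong[OF refl])
      fix i assume "i \<in> {..<n}"
      then have i: "i < n" by simp
      then obtain s where "s \<in> S i" using Sne by blast
      then obtain j0 where j0: "j0 < k" "grp j0 = i" using hex i by blast
      have "(\<Sum>j\<in>{j\<in>{..<k}. grp j = i}. \<pi> j * g (grp j)) = (\<Sum>j\<in>{j. j < k \<and> grp j = grp j0}. \<pi> j * g i)"
        using j0 by (intro sum.cong) auto
      also have "\<dots> = (\<Sum>j\<in>{j. j < k \<and> grp j = grp j0}. \<pi> j) * g i" by (rule sum_distrib_right[symmetric])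
      also have "(\<Sum>j\<in>{j. j < k \<and> grp j = grp j0}. \<pi> j) = W (grp j0)" using \<pi> j0(1) by blast
      also have "W (grp j0) * g i = W i * g i" using j0 by simp
      finally show "(\<Sum>j\<in>{j\<in>{..<k}. grp j = i}. \<pi> j * g (grp j)) = W i * g i" .
    qed
    finally show ?thesis .
  qed
  have \<pi>1: "(\<Sum>j<k. \<pi> j) = 1" if "\<pi> \<in> ?S" for \<pi> using grpsum[OF that, of "\<lambda>_. 1"] W1 by simp
  have \<pi>0: "0 \<le> \<pi> j" if "\<pi> \<in> ?S" "j < k" for \<pi> j using that by simp
  have law: "finite_law k \<pi> Z \<in> PGamma \<Omega> T" if "\<pi> \<in> ?S" for \<pi>
    by (rule finite_law_PGamma[OF \<pi>0[OF that] \<pi>1[OF that] ZA(1)])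
  have int: "(\<integral>\<gamma>. f \<gamma> \<partial>finite_law k \<pi> Z) = (\<Sum>j<k. \<pi> j * f (Z j))"
    if "\<pi> \<in> ?S" "f \<in> borel_measurable borel" for \<pi> and f :: "_ \<Rightarrow> real"
    by (rule integral_finite_law[OF \<pi>0[OF that(1)] \<pi>1[OF that(1)] ZA(1) that(2)])
  \<comment> \<open>The shift by \<open>B\<Phi>\<close> makes the costs nonnegative, as the game
    lemma requires, and leaves comparisons unchanged.\<close>
  define c where "c = (\<lambda>\<pi> j. act (Z j) + coupling (finite_law k \<pi> Z) (Z j) + B\<Phi>)"
  have "\<exists>\<pi>\<in>?S. \<forall>i<k. \<forall>j<k. grp i = grp j \<longrightarrow> \<pi> i > 0 \<longrightarrow> c \<pi> i \<le> c \<pi> j + \<epsilon>"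
  proof (rule finite_game_approx_equilibrium[where B = "M2 + 2 * B\<Phi> + 1", OF _ \<epsilon> W0])
    show "M2 + 2 * B\<Phi> + 1 > 0" using M2 B\<Phi>(1) by simp
    show "0 \<le> c \<pi> i \<and> c \<pi> i \<le> M2 + 2 * B\<Phi> + 1" if "\<pi> \<in> ?S" "i < k" for \<pi> i
    proof -
      have "\<bar>coupling (finite_law k \<pi> Z) (Z i)\<bar> \<le> B\<Phi>" using B\<Phi>(2) law[OF that(1)] ZA(1)[OF that(2)] by blast
      then show ?thesis using act[OF ZA(2)[OF that(2)]] unfolding c_def by linarith
    qed
    fix \<pi> :: "nat \<Rightarrow> nat \<Rightarrow> real" and \<rho> :: "nat \<Rightarrow> real" and i
    assume \<pi>: "\<And>l. \<pi> l \<in> ?S" and \<rho>: "\<rho> \<in> ?S" and lim: "\<And>j. j < k \<Longrightarrow> (\<lambda>l. \<pi> l j) \<longlonglongrightarrow> \<rho> j" and i: "i < k"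
    \<comment> \<open>Only finitely many weights move. Subtracting \<open>f 0\<close>, which is
      harmless because the weights sum to 1, gives a bound that is uniform in the 1-Lipschitz
      \<open>f\<close>.\<close>
    have "d1conv (\<lambda>l. push_e \<Omega> t (finite_law k (\<pi> l) Z)) (push_e \<Omega> t (finite_law k \<rho> Z))" for t
    proof (rule d1conv_push_e[OF law[OF \<pi>] law[OF \<rho>]])
      fix e :: real assume e: "e > 0"
      have "(\<lambda>l. B * (\<Sum>j<k. \<bar>\<pi> l j - \<rho> j\<bar>)) \<longlonglongrightarrow> B * (\<Sum>j<k. \<bar>\<rho> j - \<rho> j\<bar>)"
        by (intro tendsto_intros lim) auto
      then have "\<forall>\<^sub>F l in sequentially. B * (\<Sum>j<k. \<bar>\<pi> l j - \<rho> j\<bar>) < e" using e by (intro order_tendstoD(2)) auto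
      then obtain N where N: "\<And>l. l \<ge> N \<Longrightarrow> B * (\<Sum>j<k. \<bar>\<pi> l j - \<rho> j\<bar>) < e" by (auto simp: eventually_sequentially)
      have "(\<integral>\<gamma>. f (apply_bcontfun \<gamma> t) \<partial>finite_law k (\<pi> l) Z) - (\<integral>\<gamma>. f (apply_bcontfun \<gamma> t) \<partial>finite_law k \<rho> Z) \<le> e"
        if l: "l \<ge> N" and f: "1-lipschitz_on UNIV f" for l and f :: "real^'n \<Rightarrow> real"
      proof -
        have fm: "(\<lambda>\<gamma>::(real, real^'n) bcontfun. f (apply_bcontfun \<gamma> t)) \<in> borel_measurable borel"
          by (rule lipschitz_borel[OF lipschitz_compose_eval[OF f]])
        have lf: "\<bar>f x - f y\<bar> \<le> dist x y" for x y using lipschitz_onD[OF f, of x y] by (simp add: dist_real_def)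
        have "(\<Sum>j<k. \<pi> l j * f (apply_bcontfun (Z j) t)) - (\<Sum>j<k. \<rho> j * f (apply_bcontfun (Z j) t))
            = (\<Sum>j<k. (\<pi> l j - \<rho> j) * (f (apply_bcontfun (Z j) t) - f 0)) + f 0 * ((\<Sum>j<k. \<pi> l j) - (\<Sum>j<k. \<rho> j))"
          by (simp add: algebra_simps sum.distrib sum_subtractf sum_distrib_left)
        also have "\<dots> = (\<Sum>j<k. (\<pi> l j - \<rho> j) * (f (apply_bcontfun (Z j) t) - f 0))" using \<pi>1[OF \<pi>] \<pi>1[OF \<rho>] by simp
        also have "\<dots> \<le> (\<Sum>j<k. \<bar>\<pi> l j - \<rho> j\<bar> * B)"
        proof (rule sum_mono)
          fix j assume "j \<in> {..<k}"
          then have "norm (apply_bcontfun (Z j) t) \<le> B" using B(2)[OF Gamma_in_closure[OF ZA(1)]] by simp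
          then have "\<bar>f (apply_bcontfun (Z j) t) - f 0\<bar> \<le> B" using lf[of "apply_bcontfun (Z j) t" 0] by (simp add: dist_norm)
          then have "\<bar>\<pi> l j - \<rho> j\<bar> * \<bar>f (apply_bcontfun (Z j) t) - f 0\<bar> \<le> \<bar>\<pi> l j - \<rho> j\<bar> * B" by (intro mult_left_mono) auto
          then show "(\<pi> l j - \<rho> j) * (f (apply_bcontfun (Z j) t) - f 0) \<le> \<bar>\<pi> l j - \<rho> j\<bar> * B"
            using abs_ge_self[of "(\<pi> l j - \<rho> j) * (f (apply_bcontfun (Z j) t) - f 0)"] by (simp add: abs_mult)
        qed
        also have "\<dots> = B * (\<Sum>j<k. \<bar>\<pi> l j - \<rho> j\<bar>)" by (simp add: sum_distrib_left mult.commute)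
        finally show ?thesis using N[OF l] unfolding int[OF \<pi> fm] int[OF \<rho> fm] by linarith
      qed
      then show "\<exists>N. \<forall>l\<ge>N. \<forall>f::real^'n \<Rightarrow> real. 1-lipschitz_on UNIV f \<longrightarrow>
        (\<integral>\<gamma>. f (apply_bcontfun \<gamma> t) \<partial>finite_law k (\<pi> l) Z) - (\<integral>\<gamma>. f (apply_bcontfun \<gamma> t) \<partial>finite_law k \<rho> Z) \<le> e" by blast
    qed
    then have "(\<lambda>l. coupling (finite_law k (\<pi> l) Z) (Z i)) \<longlonglongrightarrow> coupling (finite_law k \<rho> Z) (Z i)"
      using ZA(1)[OF i] law[OF \<pi>] law[OF \<rho>] by (intro coupling_tendsto) auto
    then show "(\<lambda>l. c (\<pi> l) i) \<longlonglongrightarrow> c \<rho> i" unfolding c_def by (intro tendsto_intros)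
  qed
  then obtain \<pi> where \<pi>: "\<pi> \<in> ?S" and opt: "\<And>i j. i < k \<Longrightarrow> j < k \<Longrightarrow> grp i = grp j \<Longrightarrow> \<pi> i > 0 \<Longrightarrow> c \<pi> i \<le> c \<pi> j + \<epsilon>"
    by blast
  define \<eta> where "\<eta> = finite_law k \<pi> Z"
  define A where "A = Z ` {j. j < k \<and> 0 < \<pi> j}"
  have F1: "\<eta> \<in> PGamma \<Omega> T" unfolding \<eta>_def by (rule law[OF \<pi>])
  have F2: "finite A" by (simp add: A_def)
  have F3: "A \<subseteq> {\<gamma> \<in> Gamma \<Omega> T. action \<gamma> \<le> ennreal M2}" using ZA by (auto simp: A_def)
  have F4: "AE \<gamma> in \<eta>. \<gamma> \<in> A" unfolding \<eta>_def A_def by (rule AE_finite_law[OF \<pi>0[OF \<pi>] \<pi>1[OF \<pi>] ZA(1)])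
  have F5: "\<bar>(\<integral>\<gamma>. f (apply_bcontfun \<gamma> 0) \<partial>\<eta>) - (\<integral>x. f x \<partial>m0)\<bar> \<le> \<epsilon>" if f: "1-lipschitz_on UNIV f" for f :: "real^'n \<Rightarrow> real"
  proof -
    have "(\<integral>\<gamma>. f (apply_bcontfun \<gamma> 0) \<partial>\<eta>) = (\<Sum>j<k. \<pi> j * f (apply_bcontfun (Z j) 0))"
      unfolding \<eta>_def by (rule int[OF \<pi> lipschitz_borel[OF lipschitz_compose_eval[OF f]]])
    also have "\<dots> = (\<Sum>j<k. \<pi> j * f (p (grp j)))" using ZA(3) by (intro sum.cong) auto
    also have "\<dots> = (\<Sum>i<n. W i * f (p i))" by (rule grpsum[OF \<pi>])
    finally show ?thesis using Wf[OF f] by (simp add: mult.commute abs_minus_commute)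
  qed
  have F6: "\<exists>s\<in>Gamma_at \<Omega> T (apply_bcontfun \<gamma> 0). action s \<le> ennreal M2 \<and> dist s \<sigma> < \<epsilon> \<and> act s \<le> act \<sigma> + \<epsilon> \<and>
        act \<gamma> + coupling \<eta> \<gamma> \<le> act s + coupling \<eta> s + \<epsilon>"
    if \<gamma>: "\<gamma> \<in> A" and \<sigma>: "\<sigma> \<in> Gamma_at \<Omega> T (apply_bcontfun \<gamma> 0)" "action \<sigma> \<le> ennreal M2" for \<gamma> \<sigma>
  proof -
    obtain j where j: "j < k" "0 < \<pi> j" "\<gamma> = Z j" using \<gamma> by (auto simp: A_def)
    have \<gamma>0: "apply_bcontfun \<gamma> 0 = p (grp j)" using ZA(3) j by simp
    have "\<sigma> \<in> Av (grp j)" using \<sigma> \<gamma>0 by (simp add: Av_def)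
    then obtain s where s: "s \<in> S (grp j)" "dist s \<sigma> < \<epsilon>" "act s \<le> act \<sigma> + \<epsilon>" using S(3) by blast
    obtain i where i: "i < k" "grp i = grp j" "Z i = s" using hex[OF hj(1)[OF j(1)] s(1)] by blast
    have "c \<pi> j \<le> c \<pi> i + \<epsilon>" using opt j i by simp
    moreover have "s \<in> Gamma_at \<Omega> T (apply_bcontfun \<gamma> 0)" "action s \<le> ennreal M2" using S(2) s(1) \<gamma>0 by (auto simp: Av_def)
    ultimately show ?thesis using s i j by (intro bexI[of _ s]) (auto simp: c_def \<eta>_def)
  qed
  show ?thesis
    by (rule exI[of _ \<eta>], rule exI[of _ A], intro conjI allI ballI impI F1 F2 F3 F4)
       (rule F5 F6; assumption)+
qed

lemma equilibrium_exists: "\<exists>\<eta>. constrained_MFG_equilibrium \<Omega> T L F G m0 \<eta>"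
proof -
  obtain C where C: "C \<ge> 0" "\<And>x. x \<in> closure \<Omega> \<Longrightarrow> \<exists>\<gamma>\<in>Gamma_at \<Omega> T x. action \<gamma> \<le> ennreal C" using const_curve by blast
  obtain B where B: "B \<ge> 0" "\<forall>\<eta>\<in>PGamma \<Omega> T. \<forall>\<gamma>\<in>Gamma \<Omega> T. \<bar>coupling \<eta> \<gamma>\<bar> \<le> B" using coupling_bounded by blast
  \<comment> \<open>Bounds the action of a played curve by comparison with a constant curve:
    \<open>C\<close> for its action, \<open>2 * B\<close> for the two couplings, and 1 each for the
    net error and the equilibrium error.\<close>
  define M1 where "M1 = C + 2 * B + 2"
  \<comment> \<open>Leaves room for every competitor that is not beaten outright, that is, of action
    at most \<open>M1 + 2 * B\<close>, after \<open>recovery\<close> has added at most 1.\<close>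
  define M2 where "M2 = M1 + 2 * B + 1"
  have M: "0 \<le> M1" "0 \<le> M2" "C \<le> M2" using C(1) B(1) by (auto simp: M1_def M2_def)
  have start: "\<exists>\<gamma>\<in>Gamma_at \<Omega> T x. action \<gamma> \<le> ennreal M2" if "x \<in> closure \<Omega>" for x
    using C(2)[OF that] order_trans[OF _ ennreal_leI[OF M(3)]] by blast
  have fin: "action \<gamma> = ennreal (act \<gamma>)" if "action \<gamma> \<le> ennreal m" for \<gamma> m
    using that by (simp add: le_less_trans less_top)
  have act_le: "act \<gamma> \<le> m" if "action \<gamma> \<le> ennreal m" "0 \<le> m" for \<gamma> m
    using enn2real_mono[OF that(1)] that(2) by simp
  define Q where "Q = (\<lambda>(n::nat) (\<eta>, A). \<eta> \<in> PGamma \<Omega> T \<and> finite (A) \<and> A \<subseteq> {\<gamma> \<in> Gamma \<Omega> T. action \<gamma> \<le> ennreal M2} \<and>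
    (AE \<gamma> in \<eta>. \<gamma> \<in> A) \<and>
    (\<forall>f::real^'n \<Rightarrow> real. 1-lipschitz_on UNIV f \<longrightarrow> \<bar>(\<integral>\<gamma>. f (apply_bcontfun \<gamma> 0) \<partial>\<eta>) - (\<integral>x. f x \<partial>m0)\<bar> \<le> 1 / real (Suc n)) \<and>
    (\<forall>\<gamma>\<in>A. \<forall>\<sigma>\<in>Gamma_at \<Omega> T (apply_bcontfun \<gamma> 0). action \<sigma> \<le> ennreal M2 \<longrightarrow>
      (\<exists>s\<in>Gamma_at \<Omega> T (apply_bcontfun \<gamma> 0). action s \<le> ennreal M2 \<and> dist s \<sigma> < 1 / real (Suc n) \<and> act s \<le> act \<sigma> + 1 / real (Suc n) \<and>
        act \<gamma> + coupling (\<eta>) \<gamma> \<le> act s + coupling (\<eta>) s + 1 / real (Suc n))))"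
  have "\<exists>t. Q n t" for n
  proof -
    have "0 < 1 / real (Suc n)" by simp
    from approx_equilibrium[OF this M(2) start] obtain \<eta> A where "Q n (\<eta>, A)" unfolding Q_def prod.case by blast
    then show ?thesis ..
  qed
  then obtain t where t: "\<And>n. Q n (t n)" using choice[of Q] by blast
  define \<eta>s where "\<eta>s = (\<lambda>n. fst (t n))"
  define A where "A = (\<lambda>n. snd (t n))"
  have \<eta>s: "\<eta>s n \<in> PGamma \<Omega> T" and A2: "A n \<subseteq> {\<gamma> \<in> Gamma \<Omega> T. action \<gamma> \<le> ennreal M2}" and AEA: "AE \<gamma> in \<eta>s n. \<gamma> \<in> A n" for n
    using t[of n] unfolding Q_def case_prod_beta \<eta>s_def A_def by blast+
  have init: "\<bar>(\<integral>\<gamma>. f (apply_bcontfun \<gamma> 0) \<partial>\<eta>s n) - (\<integral>x. f x \<partial>m0)\<bar> \<le> 1 / real (Suc n)"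
    if "1-lipschitz_on UNIV f" for n and f :: "real^'n \<Rightarrow> real"
    using t[of n] that unfolding Q_def case_prod_beta \<eta>s_def by blast
  have nash: "\<exists>s\<in>Gamma_at \<Omega> T (apply_bcontfun \<gamma> 0). action s \<le> ennreal M2 \<and> dist s \<sigma> < 1 / real (Suc n) \<and> act s \<le> act \<sigma> + 1 / real (Suc n) \<and>
        act \<gamma> + coupling (\<eta>s n) \<gamma> \<le> act s + coupling (\<eta>s n) s + 1 / real (Suc n)"
    if "\<gamma> \<in> A n" "\<sigma> \<in> Gamma_at \<Omega> T (apply_bcontfun \<gamma> 0)" "action \<sigma> \<le> ennreal M2" for n \<gamma> \<sigma>
    using t[of n] that unfolding Q_def case_prod_beta \<eta>s_def A_def by blast
  define K where "K = {\<gamma> \<in> Gamma \<Omega> T. action \<gamma> \<le> ennreal M1}"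
  have K: "compact K" unfolding K_def by (rule compact_action_sublevel[OF M(1)])
  have AK: "A n \<subseteq> K" for n
  proof
    fix \<gamma> assume \<gamma>: "\<gamma> \<in> A n"
    then have \<gamma>G: "\<gamma> \<in> Gamma \<Omega> T" "action \<gamma> \<le> ennreal M2" using A2 by auto
    obtain \<sigma> where \<sigma>: "\<sigma> \<in> Gamma_at \<Omega> T (apply_bcontfun \<gamma> 0)" "action \<sigma> \<le> ennreal C" using C(2)[OF Gamma_in_closure[OF \<gamma>G(1)]] by blast
    have "action \<sigma> \<le> ennreal M2" using \<sigma>(2) order_trans[OF _ ennreal_leI[OF M(3)]] by blast
    then obtain s where s: "s \<in> Gamma_at \<Omega> T (apply_bcontfun \<gamma> 0)" "act s \<le> act \<sigma> + 1 / real (Suc n)"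
        "act \<gamma> + coupling (\<eta>s n) \<gamma> \<le> act s + coupling (\<eta>s n) s + 1 / real (Suc n)" using nash[OF \<gamma> \<sigma>(1)] by blast
    have "\<bar>coupling (\<eta>s n) \<gamma>\<bar> \<le> B" "\<bar>coupling (\<eta>s n) s\<bar> \<le> B" using B(2) \<eta>s \<gamma>G s(1) by (auto simp: Gamma_at_def)
    moreover have "1 / real (Suc n) \<le> 1" by simp
    moreover have "act \<sigma> \<le> C" by (rule act_le[OF \<sigma>(2) C(1)])
    ultimately have "act \<gamma> \<le> M1" using s(2,3) unfolding M1_def by linarith
    then show "\<gamma> \<in> K" using \<gamma>G fin[OF \<gamma>G(2)] unfolding K_def by (metis (no_types, lifting) ennreal_leI mem_Collect_eq)
  qed
  obtain x0 where x0: "x0 \<in> closure \<Omega>" using prob_space.not_empty[OF Pmeas_prob_space[OF m0]] Pmeas_space[OF m0] by blast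
  obtain \<gamma>0 where \<gamma>0: "\<gamma>0 \<in> K"
  proof -
    obtain \<gamma> where "\<gamma> \<in> Gamma_at \<Omega> T x0" "action \<gamma> \<le> ennreal C" using C(2)[OF x0] by blast
    moreover have "C \<le> M1" using B(1) by (simp add: M1_def)
    ultimately have "\<gamma> \<in> K" unfolding K_def Gamma_at_def using order_trans[OF _ ennreal_leI] by blast
    then show ?thesis using that by blast
  qed
  \<comment> \<open>The identity, changed on a null set of every \<open>\<eta>s n\<close>, since
    \<open>compact_laws_subsequence\<close> asks for values in \<open>K\<close> at every point of
    the space.\<close>
  define X where "X = (\<lambda>\<gamma>. if \<gamma> \<in> K then \<gamma> else \<gamma>0)"
  have Xm: "X \<in> borel_measurable borel"
    unfolding X_def using borel_closed[OF compact_imp_closed[OF K]] by (intro measurable_If_set) auto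
  have XK: "X \<gamma> \<in> K" for \<gamma> using \<gamma>0 by (simp add: X_def)
  have intX: "(\<integral>\<gamma>. f (X \<gamma>) \<partial>\<eta>s n) = (\<integral>\<gamma>. f \<gamma> \<partial>\<eta>s n)" if f: "f \<in> borel_measurable borel" for f :: "_ \<Rightarrow> real" and n
  proof (rule integral_cong_AE)
    show "AE \<gamma> in \<eta>s n. f (X \<gamma>) = f \<gamma>" using AEA[of n] by eventually_elim (use AK[of n] in \<open>auto simp: X_def\<close>)
    show "(\<lambda>\<gamma>. f (X \<gamma>)) \<in> borel_measurable (\<eta>s n)" by (rule PGamma_measurable[OF \<eta>s measurable_compose[OF Xm f]])
    show "f \<in> borel_measurable (\<eta>s n)" by (rule PGamma_measurable[OF \<eta>s f])
  qed
  let ?U = "restrict_space lborel {0..<1::real}"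
  have "\<exists>r Y. strict_mono (r::nat \<Rightarrow> nat) \<and> Y \<in> borel_measurable borel \<and> (\<forall>u. Y u \<in> K) \<and>
    (\<forall>e>0. \<exists>N. \<forall>n\<ge>N. \<forall>f::(real, real^'n) bcontfun \<Rightarrow> real. 1-lipschitz_on UNIV f \<longrightarrow>
      \<bar>(\<integral>\<gamma>. f (X \<gamma>) \<partial>\<eta>s (r n)) - (\<integral>u. f (Y u) \<partial>?U)\<bar> \<le> e)"
    by (rule compact_laws_subsequence[OF K PGamma_prob_space[OF \<eta>s] PGamma_measurable[OF \<eta>s Xm] XK])
  then obtain r Y where r: "strict_mono (r::nat \<Rightarrow> nat)" and Y: "Y \<in> borel_measurable borel" "\<And>u. Y u \<in> K"
    and conv0: "\<forall>e>0. \<exists>N. \<forall>n\<ge>N. \<forall>f::(real, real^'n) bcontfun \<Rightarrow> real. 1-lipschitz_on UNIV f \<longrightarrow>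
      \<bar>(\<integral>\<gamma>. f (X \<gamma>) \<partial>\<eta>s (r n)) - (\<integral>u. f (Y u) \<partial>?U)\<bar> \<le> e" by blast
  have YG: "Y u \<in> Gamma \<Omega> T" for u using Y(2)[of u] by (simp add: K_def)
  have Ym: "Y \<in> measurable ?U (restrict_space borel (Gamma \<Omega> T))"
    using Y(1) YG by (intro measurable_restrict_space2 measurable_restrict_space1) (auto simp: measurable_lborel1)
  define \<eta> where "\<eta> = distr ?U (restrict_space borel (Gamma \<Omega> T)) Y"
  have \<eta>: "\<eta> \<in> PGamma \<Omega> T"
    using prob_space.prob_space_distr[OF prob_space_unit_interval Ym] by (simp add: PGamma_def \<eta>_def)
  interpret \<eta>: prob_space \<eta> using \<eta> by (rule PGamma_prob_space)
  have int\<eta>: "(\<integral>\<gamma>. f \<gamma> \<partial>\<eta>) = (\<integral>u. f (Y u) \<partial>?U)" if "f \<in> borel_measurable borel" for f :: "_ \<Rightarrow> real"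
    unfolding \<eta>_def by (rule integral_distr[OF Ym measurable_restrict_space1[OF that]])
  have conv: "\<exists>N. \<forall>n\<ge>N. \<forall>f::(real, real^'n) bcontfun \<Rightarrow> real. 1-lipschitz_on UNIV f \<longrightarrow>
      \<bar>(\<integral>\<gamma>. f \<gamma> \<partial>\<eta>s (r n)) - (\<integral>\<gamma>. f \<gamma> \<partial>\<eta>)\<bar> \<le> e" if e: "e > 0" for e
  proof -
    obtain N where "\<forall>n\<ge>N. \<forall>f::(real, real^'n) bcontfun \<Rightarrow> real. 1-lipschitz_on UNIV f \<longrightarrow>
      \<bar>(\<integral>\<gamma>. f (X \<gamma>) \<partial>\<eta>s (r n)) - (\<integral>u. f (Y u) \<partial>?U)\<bar> \<le> e" using conv0 e by blast
    then show ?thesis by (intro exI[of _ N]) (simp add: intX int\<eta> lipschitz_borel)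
  qed
  have d1c: "d1conv (\<lambda>n. push_e \<Omega> s (\<eta>s (r n))) (push_e \<Omega> s \<eta>)" for s
  proof (rule d1conv_push_e[OF \<eta>s \<eta>])
    fix e :: real assume "e > 0"
    then obtain N where N: "\<forall>n\<ge>N. \<forall>f::(real, real^'n) bcontfun \<Rightarrow> real. 1-lipschitz_on UNIV f \<longrightarrow>
      \<bar>(\<integral>\<gamma>. f \<gamma> \<partial>\<eta>s (r n)) - (\<integral>\<gamma>. f \<gamma> \<partial>\<eta>)\<bar> \<le> e" using conv by blast
    have "(\<integral>\<gamma>. f (apply_bcontfun \<gamma> s) \<partial>\<eta>s (r n)) - (\<integral>\<gamma>. f (apply_bcontfun \<gamma> s) \<partial>\<eta>) \<le> e"
      if "n \<ge> N" "1-lipschitz_on UNIV f" for n and f :: "real^'n \<Rightarrow> real"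
      using N[rule_format, OF that(1) lipschitz_compose_eval[OF that(2), of s]] by linarith
    then show "\<exists>N. \<forall>n\<ge>N. \<forall>f::real^'n \<Rightarrow> real. 1-lipschitz_on UNIV f \<longrightarrow>
       (\<integral>\<gamma>. f (apply_bcontfun \<gamma> s) \<partial>\<eta>s (r n)) - (\<integral>\<gamma>. f (apply_bcontfun \<gamma> s) \<partial>\<eta>) \<le> e" by blast
  qed
  have "push_e \<Omega> 0 \<eta> = m0"
  proof (rule Pmeas_eqI_lipschitz[OF push_e_Pmeas[OF \<eta>] m0])
    fix f :: "real^'n \<Rightarrow> real" assume f: "1-lipschitz_on UNIV f"
    have "\<bar>(\<integral>\<gamma>. f (apply_bcontfun \<gamma> 0) \<partial>\<eta>) - (\<integral>x. f x \<partial>m0)\<bar> \<le> 0 + e" if e: "e > 0" for e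
    proof -
      obtain N where N: "\<forall>n\<ge>N. \<forall>f::(real, real^'n) bcontfun \<Rightarrow> real. 1-lipschitz_on UNIV f \<longrightarrow>
        \<bar>(\<integral>\<gamma>. f \<gamma> \<partial>\<eta>s (r n)) - (\<integral>\<gamma>. f \<gamma> \<partial>\<eta>)\<bar> \<le> e/2" using conv[of "e/2"] e by auto
      obtain k :: nat where k: "1 / real (Suc k) < e/2" using nat_approx_posE[of "e/2"] e by auto
      define n where "n = max N k"
      have "1 / real (Suc (r n)) \<le> 1 / real (Suc k)"
        using seq_suble[OF r, of n] by (intro divide_left_mono) (auto simp: n_def)
      moreover have "\<bar>(\<integral>\<gamma>. f (apply_bcontfun \<gamma> 0) \<partial>\<eta>s (r n)) - (\<integral>\<gamma>. f (apply_bcontfun \<gamma> 0) \<partial>\<eta>)\<bar> \<le> e/2"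
        by (rule N[rule_format, OF _ lipschitz_compose_eval[OF f]]) (simp add: n_def)
      ultimately show ?thesis using init[OF f, of "r n"] k by linarith
    qed
    then have "\<bar>(\<integral>\<gamma>. f (apply_bcontfun \<gamma> 0) \<partial>\<eta>) - (\<integral>x. f x \<partial>m0)\<bar> \<le> 0" by (rule field_le_epsilon)
    then show "(\<integral>x. f x \<partial>push_e \<Omega> 0 \<eta>) = (\<integral>x. f x \<partial>m0)" using integral_push_e[OF \<eta> lipschitz_borel[OF f]] by simp
  qed
  then have "\<eta> \<in> PGamma_m0 \<Omega> T m0" using \<eta> by (simp add: PGamma_m0_def)
  moreover have "\<gamma> \<in> (\<Union>x\<in>closure \<Omega>. Gamma_opt \<Omega> T L F G \<eta> x)" if \<gamma>: "\<gamma> \<in> msupp \<eta>" for \<gamma>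
  proof -
    have \<gamma>G: "\<gamma> \<in> Gamma \<Omega> T" and supp: "\<And>V. open V \<Longrightarrow> \<gamma> \<in> V \<Longrightarrow> emeasure \<eta> (V \<inter> space \<eta>) > 0"
      using \<gamma> PGamma_space[OF \<eta>] by (auto simp: msupp_def)
    have opm: "V \<inter> space \<eta> \<in> sets \<eta>" if "open V" for V
      using \<eta> that unfolding PGamma_space[OF \<eta>] by (auto simp: PGamma_def sets_restrict_space)
    \<comment> \<open>The complement of \<open>K\<close> is open and a null set of
      \<open>\<eta>\<close>, as \<open>Y\<close> takes values in \<open>K\<close>; so it cannot meet
      the support.\<close>
    have \<gamma>K: "\<gamma> \<in> K"
    proof (rule ccontr)
      assume "\<gamma> \<notin> K"
      then have "emeasure \<eta> (- K \<inter> space \<eta>) > 0" using compact_imp_closed[OF K] by (intro supp) auto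
      moreover have "emeasure \<eta> (- K \<inter> space \<eta>) = emeasure ?U (Y -` (- K \<inter> space \<eta>) \<inter> space ?U)"
        using opm[of "- K"] compact_imp_closed[OF K] Ym unfolding \<eta>_def by (subst emeasure_distr) auto
      moreover have "Y -` (- K \<inter> space \<eta>) \<inter> space ?U = {}" using Y(2) by auto
      ultimately show False by simp
    qed
    \<comment> \<open>The tent around \<gamma> is 1-Lipschitz and has positive integral under
      \<open>\<eta>\<close>, hence eventually also under the approximating laws; these live on the
      sets \<open>A (r n)\<close>, which must therefore meet the ball.\<close>
    have near: "\<exists>N. \<forall>n\<ge>N. \<exists>z\<in>A (r n). dist z \<gamma> < e" if e: "e > 0" for e
    proof -
      define f where "f = (\<lambda>z. max 0 (e - dist z \<gamma>))"
      have lip: "1-lipschitz_on UNIV f" unfolding f_def by (rule lipschitz_tent)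
      have fm: "f \<in> borel_measurable \<eta>" by (rule PGamma_measurable[OF \<eta> lipschitz_borel[OF lip]])
      have f0: "0 \<le> f z" "f z \<le> e" for z using e by (auto simp: f_def)
      have fi: "integrable \<eta> f" using fm f0 by (intro \<eta>.integrable_const_bound[where B = e]) auto
      have "(\<integral>z. f z \<partial>\<eta>) \<noteq> 0"
      proof
        assume "(\<integral>z. f z \<partial>\<eta>) = 0"
        then have "AE z in \<eta>. f z = 0" using integral_nonneg_eq_0_iff_AE[OF fi] f0 by simp
        then have "AE z in \<eta>. z \<notin> ball \<gamma> e" by eventually_elim (auto simp: f_def dist_commute max_def split: if_splits)
        then have "emeasure \<eta> (ball \<gamma> e \<inter> space \<eta>) = 0"
          using opm[of "ball \<gamma> e"] by (subst (asm) AE_iff_measurable[of "ball \<gamma> e \<inter> space \<eta>"]) auto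
        then show False using supp[of "ball \<gamma> e"] e by simp
      qed
      moreover have "(\<integral>z. f z \<partial>\<eta>) \<ge> 0" using f0 by (intro Bochner_Integration.integral_nonneg) auto
      ultimately have pos: "(\<integral>z. f z \<partial>\<eta>) > 0" by simp
      then have half: "(\<integral>z. f z \<partial>\<eta>) / 2 > 0" by simp
      from conv[OF half] obtain N where N: "\<forall>n\<ge>N. \<forall>g::(real, real^'n) bcontfun \<Rightarrow> real. 1-lipschitz_on UNIV g \<longrightarrow>
        \<bar>(\<integral>\<gamma>. g \<gamma> \<partial>\<eta>s (r n)) - (\<integral>\<gamma>. g \<gamma> \<partial>\<eta>)\<bar> \<le> (\<integral>z. f z \<partial>\<eta>) / 2" by blast
      have "\<exists>z\<in>A (r n). dist z \<gamma> < e" if n: "n \<ge> N" for n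
      proof (rule ccontr)
        assume "\<not> ?thesis"
        then have fz: "f z = 0" if "z \<in> A (r n)" for z using that by (auto simp: f_def)
        have "AE z in \<eta>s (r n). f z = 0" using AEA[of "r n"] by eventually_elim (rule fz)
        then have "(\<integral>z. f z \<partial>\<eta>s (r n)) = 0" by (rule integral_eq_zero_AE)
        moreover have "\<bar>(\<integral>z. f z \<partial>\<eta>s (r n)) - (\<integral>z. f z \<partial>\<eta>)\<bar> \<le> (\<integral>z. f z \<partial>\<eta>) / 2" using N n lip by blast
        ultimately show False using pos by simp
      qed
      then show ?thesis by blast
    qed
    define x where "x = apply_bcontfun \<gamma> 0"
    have xcl: "x \<in> closure \<Omega>" unfolding x_def by (rule Gamma_in_closure[OF \<gamma>G])
    have \<gamma>x: "\<gamma> \<in> Gamma_at \<Omega> T x" using \<gamma>G by (simp add: Gamma_at_def x_def)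
    have \<gamma>M: "action \<gamma> \<le> ennreal M1" using \<gamma>K by (simp add: K_def)
    have "Jcost \<Omega> T L F G \<eta> \<gamma> \<le> Jcost \<Omega> T L F G \<eta> \<sigma>" if \<sigma>: "\<sigma> \<in> Gamma_at \<Omega> T x" for \<sigma>
    proof (cases "action \<sigma> = \<infinity>")
      case True
      then show ?thesis using Jcost_eq[of \<sigma> \<eta>] \<sigma> \<eta> by (simp add: Gamma_at_def)
    next
      case False
      have \<sigma>G: "\<sigma> \<in> Gamma \<Omega> T" using \<sigma> by (simp add: Gamma_at_def)
      have \<sigma>a: "action \<sigma> = ennreal (act \<sigma>)" using False by (simp add: less_top)
      have "act \<gamma> + coupling \<eta> \<gamma> \<le> act \<sigma> + coupling \<eta> \<sigma>"
      \<comment> \<open>A competitor of larger action loses outright, because \<gamma> has action at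
        most \<open>M1\<close> and the couplings differ by at most \<open>2 * B\<close>. The others
        can be transferred to nearby starting points without leaving the strategy sets.\<close>
      proof (cases "act \<sigma> \<le> M1 + 2 * B")
        case F: False
        have "\<bar>coupling \<eta> \<gamma>\<bar> \<le> B" "\<bar>coupling \<eta> \<sigma>\<bar> \<le> B" using B(2) \<eta> \<gamma>G \<sigma>G by auto
        then show ?thesis using act_le[OF \<gamma>M M(1)] F by linarith
      next
        case True
        \<comment> \<open>The triple consists of an index, a played curve near \<gamma> and a curve
          near \<sigma> of hardly larger action; the last conjunct is the approximate equilibrium
          inequality between the two.\<close>
        define R where "R = (\<lambda>(k::nat) (w :: nat \<times> (real, real^'n) bcontfun \<times> (real, real^'n) bcontfun).
          fst w \<ge> k \<and> fst (snd w) \<in> A (r (fst w)) \<and> dist (fst (snd w)) \<gamma> < 1 / real (Suc k) \<and>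
          snd (snd w) \<in> Gamma \<Omega> T \<and> dist (snd (snd w)) \<sigma> < 1 / real (Suc k) \<and> act (snd (snd w)) \<le> act \<sigma> + 1 / real (Suc k) \<and>
          act (fst (snd w)) + coupling (\<eta>s (r (fst w))) (fst (snd w)) \<le> act (snd (snd w)) + coupling (\<eta>s (r (fst w))) (snd (snd w)) + 1 / real (Suc k))"
        have "\<exists>w. R k w" for k
        proof -
          define e where "e = 1 / (2 * real (Suc k))"
          have e: "e > 0" "e + e = 1 / real (Suc k)" "e \<le> 1" by (auto simp: e_def field_simps)
          obtain \<rho> where \<rho>: "\<rho> > 0" "\<forall>y\<in>closure \<Omega>. dist y x < \<rho> \<longrightarrow>
              (\<exists>\<sigma>'\<in>Gamma_at \<Omega> T y. dist \<sigma>' \<sigma> < e \<and> action \<sigma>' \<le> action \<sigma> + ennreal e)"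
            using recovery[OF \<sigma> e(1) bridges[OF xcl]] by blast
          obtain N where N: "\<forall>n\<ge>N. \<exists>z\<in>A (r n). dist z \<gamma> < min \<rho> e" using near[of "min \<rho> e"] \<rho>(1) e(1) by auto
          \<comment> \<open>The bound \<open>2 * k + 2\<close> makes the game error
            \<open>1 / Suc (r n)\<close> at most \<open>e\<close>; together with the recovery error
            \<open>e\<close> this gives \<open>1 / Suc k\<close>.\<close>
          define n where "n = max N (2 * k + 2)"
          obtain z where z: "z \<in> A (r n)" "dist z \<gamma> < \<rho>" "dist z \<gamma> < e"
            using N[rule_format, of n] by (auto simp: n_def)
          have zG: "z \<in> Gamma \<Omega> T" using z(1) A2 by blast
          have "dist (apply_bcontfun z 0) x < \<rho>" using dist_bounded[of z 0 \<gamma>] z(2) by (simp add: x_def)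
          then obtain \<sigma>' where \<sigma>': "\<sigma>' \<in> Gamma_at \<Omega> T (apply_bcontfun z 0)" "dist \<sigma>' \<sigma> < e" "action \<sigma>' \<le> action \<sigma> + ennreal e"
            using \<rho>(2) Gamma_in_closure[OF zG] by blast
          have le: "action \<sigma>' \<le> ennreal (act \<sigma> + e)" using \<sigma>'(3) \<sigma>a e(1) by (simp add: ennreal_plus)
          have "ennreal (act \<sigma> + e) \<le> ennreal M2" using True e B(1) by (intro ennreal_leI) (simp add: M2_def)
          then have "action \<sigma>' \<le> ennreal M2" using le by (rule order_trans[rotated])
          then obtain s where s: "s \<in> Gamma_at \<Omega> T (apply_bcontfun z 0)" "dist s \<sigma>' < 1 / real (Suc (r n))"
            "act s \<le> act \<sigma>' + 1 / real (Suc (r n))"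
            "act z + coupling (\<eta>s (r n)) z \<le> act s + coupling (\<eta>s (r n)) s + 1 / real (Suc (r n))"
            using nash[OF z(1) \<sigma>'(1)] by blast
          have rn: "1 / real (Suc (r n)) \<le> e"
          proof -
            have "2 * k + 2 \<le> r n" using seq_suble[OF r, of n] by (simp add: n_def)
            then have "2 * real (Suc k) \<le> real (Suc (r n))" by simp
            then show ?thesis unfolding e_def by (intro divide_left_mono) auto
          qed
          have "act \<sigma>' \<le> act \<sigma> + e" using act_le[OF le] e(1) by simp
          then have "act s \<le> act \<sigma> + 1 / real (Suc k)" using s(3) rn e(2) by linarith
          moreover have "dist s \<sigma> < 1 / real (Suc k)" using dist_triangle[of s \<sigma> \<sigma>'] s(2) \<sigma>'(2) rn e(2) by linarith
          moreover have "dist z \<gamma> < 1 / real (Suc k)" using z(3) e(1,2) by linarith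
          moreover have "act z + coupling (\<eta>s (r n)) z \<le> act s + coupling (\<eta>s (r n)) s + 1 / real (Suc k)"
            using s(4) rn e(1,2) by linarith
          moreover have "n \<ge> k" by (simp add: n_def)
          ultimately have "R k (n, z, s)" using z(1) s(1) by (simp add: R_def Gamma_at_def)
          then show ?thesis ..
        qed
        then obtain w where w: "\<And>k. R k (w k)" using choice[of R] by blast
        define n where "n = (\<lambda>k. fst (w k))"
        define z where "z = (\<lambda>k. fst (snd (w k)))"
        define s where "s = (\<lambda>k. snd (snd (w k)))"
        have nk: "n k \<ge> k" and zA: "z k \<in> A (r (n k))" and zd: "dist (z k) \<gamma> < 1 / real (Suc k)"
          and sG: "s k \<in> Gamma \<Omega> T" and sd: "dist (s k) \<sigma> < 1 / real (Suc k)" and sa: "act (s k) \<le> act \<sigma> + 1 / real (Suc k)"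
          and zs: "act (z k) + coupling (\<eta>s (r (n k))) (z k) \<le> act (s k) + coupling (\<eta>s (r (n k))) (s k) + 1 / real (Suc k)" for k
          using w[of k] unfolding R_def n_def z_def s_def by blast+
        have inv: "(\<lambda>k. 1 / real (Suc k)) \<longlonglongrightarrow> 0" using LIMSEQ_inverse_real_of_nat by (simp add: inverse_eq_divide)
        have zG: "z k \<in> Gamma \<Omega> T" and zM: "action (z k) \<le> ennreal M1" for k using zA[of k] AK by (auto simp: K_def)
        have "(\<lambda>k. dist (z k) \<gamma>) \<longlonglongrightarrow> 0"
          by (rule Lim_null_comparison[OF _ inv]) (use zd in \<open>auto intro!: always_eventually less_imp_le\<close>)
        moreover have "(\<lambda>k. dist (s k) \<sigma>) \<longlonglongrightarrow> 0"
          by (rule Lim_null_comparison[OF _ inv]) (use sd in \<open>auto intro!: always_eventually less_imp_le\<close>)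
        ultimately have zl: "z \<longlonglongrightarrow> \<gamma>" and sl: "s \<longlonglongrightarrow> \<sigma>" by (simp_all only: tendsto_dist_iff[symmetric])
        have nf: "filterlim n at_top sequentially"
          by (rule filterlim_at_top_mono[OF filterlim_ident]) (use nk in auto)
        have dk: "d1conv (\<lambda>k. push_e \<Omega> t (\<eta>s (r (n k)))) (push_e \<Omega> t \<eta>)" for t
          using d1conv_compose[OF d1c nf] .
        have cz: "(\<lambda>k. coupling (\<eta>s (r (n k))) (z k)) \<longlonglongrightarrow> coupling \<eta> \<gamma>"
          by (rule coupling_tendsto[OF zG zl \<gamma>G \<eta>s \<eta> dk])
        have cs: "(\<lambda>k. coupling (\<eta>s (r (n k))) (s k)) \<longlonglongrightarrow> coupling \<eta> \<sigma>"
          by (rule coupling_tendsto[OF sG sl \<sigma>G \<eta>s \<eta> dk])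
        \<comment> \<open>The equilibrium inequality bounds \<open>act (z k)\<close> by quantities
          converging to \<open>V\<close>, as the couplings converge on both sides. After the first
          \<open>k0\<close> terms are dropped, \<open>action_limit\<close> transfers the bound
          \<open>V + e\<close> to \<gamma>.\<close>
        define V where "V = act \<sigma> + coupling \<eta> \<sigma> - coupling \<eta> \<gamma>"
        have "act \<gamma> \<le> V + e" if e: "e > 0" for e
        proof -
          have "(\<lambda>k. act \<sigma> + 1 / real (Suc k) + coupling (\<eta>s (r (n k))) (s k) + 1 / real (Suc k) - coupling (\<eta>s (r (n k))) (z k))
              \<longlonglongrightarrow> act \<sigma> + 0 + coupling \<eta> \<sigma> + 0 - coupling \<eta> \<gamma>"
            by (intro tendsto_intros inv cz cs)
          then have "\<forall>\<^sub>F k in sequentially. act \<sigma> + 1 / real (Suc k) + coupling (\<eta>s (r (n k))) (s k) + 1 / real (Suc k) - coupling (\<eta>s (r (n k))) (z k) < V + e"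
            using e by (intro order_tendstoD(2)) (auto simp: V_def)
          then obtain k0 where k0: "\<And>k. k \<ge> k0 \<Longrightarrow> act \<sigma> + 1 / real (Suc k) + coupling (\<eta>s (r (n k))) (s k) + 1 / real (Suc k) - coupling (\<eta>s (r (n k))) (z k) < V + e"
            unfolding eventually_sequentially by blast
          have az: "act (z (k + k0)) \<le> V + e" for k
            using k0[of "k + k0"] zs[of "k + k0"] sa[of "k + k0"] by linarith
          have pos: "0 \<le> V + e" using az[of 0] by (rule order_trans[rotated]) simp
          have "action \<gamma> \<le> ennreal (V + e)"
          proof (rule action_limit[of "\<lambda>k. z (k + k0)"])
            show "action (z (k + k0)) \<le> ennreal (V + e)" for k
              using ennreal_leI[OF az[of k]] fin[OF zM[of "k + k0"]] by simp
            show "(\<lambda>k. z (k + k0)) \<longlonglongrightarrow> \<gamma>" using zl by (rule LIMSEQ_ignore_initial_segment)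
          qed (use zG pos in auto)
          then show ?thesis using act_le pos by blast
        qed
        then have "act \<gamma> \<le> V" by (rule field_le_epsilon)
        then show ?thesis by (simp add: V_def)
      qed
      moreover have "action \<gamma> \<noteq> \<infinity>" using \<gamma>M by (auto simp: top_unique)
      ultimately show ?thesis using Jcost_eq[OF \<gamma>G \<eta>] Jcost_eq[OF \<sigma>G \<eta>] False by simp
    qed
    then have "\<gamma> \<in> Gamma_opt \<Omega> T L F G \<eta> x" using \<gamma>x by (simp add: Gamma_opt_def)
    then show ?thesis using xcl by blast
  qed
  ultimately have "constrained_MFG_equilibrium \<Omega> T L F G m0 \<eta>"
    unfolding constrained_MFG_equilibrium_def by blast
  then show ?thesis by blast
qed

end

theorem theorem3p1:
  fixes \<Omega> :: "(real^'n) set" and T :: real and m0 :: "(real^'n) measure"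
    and L :: "real^'n \<Rightarrow> real^'n \<Rightarrow> real"
    and DxL DvL :: "real^'n \<Rightarrow> real^'n \<Rightarrow> real^'n"
    and F G :: "real^'n \<Rightarrow> (real^'n) measure \<Rightarrow> real"
  assumes T_pos: "T > 0"
    and \<Omega>_open: "open \<Omega>" and \<Omega>_bounded: "bounded \<Omega>" and \<Omega>_C2: "C2_boundary \<Omega>"
    and m0: "m0 \<in> Pmeas \<Omega>"
    and L1_cont: "continuous_on (closure \<Omega> \<times> UNIV) (\<lambda>(x, v). L x v)"
    and L1_deriv: "\<And>x v. x \<in> \<Omega> \<Longrightarrow>
        ((\<lambda>(y, w). L y w) has_derivative (\<lambda>(h, k). DxL x v \<bullet> h + DvL x v \<bullet> k)) (at (x, v))"
    and L1_Dcont: "continuous_on (closure \<Omega> \<times> UNIV) (\<lambda>(x, v). DxL x v)"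
                  "continuous_on (closure \<Omega> \<times> UNIV) (\<lambda>(x, v). DvL x v)"
    and L1_bounds: "\<exists>C>0. \<forall>x\<in>closure \<Omega>. \<forall>v.
        norm (DxL x v) \<le> C * (1 + (norm v)\<^sup>2) \<and> norm (DvL x v) \<le> C * (1 + norm v)"
    and L2: "\<exists>c1>0. \<exists>c0>0. \<forall>x\<in>closure \<Omega>. \<forall>v. L x v \<ge> c1 * (norm v)\<^sup>2 - c0"
    and L3: "\<And>x. x \<in> closure \<Omega> \<Longrightarrow> convex_on UNIV (L x)"
    and F_cont: "cont_xP \<Omega> F" and G_cont: "cont_xP \<Omega> G"
  shows "\<exists>\<eta>. constrained_MFG_equilibrium \<Omega> T L F G m0 \<eta>"
proof -
  obtain c1 c0 where c: "c1 > 0" "\<forall>x\<in>closure \<Omega>. \<forall>v. L x v \<ge> c1 * (norm v)\<^sup>2 - c0" using L2 by blast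
  interpret tonelli \<Omega> T L c1 c0
  proof
    show "compact (closure \<Omega>)" using \<Omega>_bounded by (simp add: compact_closure)
    show "\<exists>p. \<forall>w. L x v + p \<bullet> (w - v) \<le> L x w" if "x \<in> closure \<Omega>" for x v
      using subgradient_of_derivative[OF L1_cont L1_deriv L1_Dcont(2) L3 that] by blast
  qed (use T_pos L1_cont c L3 in auto)
  interpret mfg \<Omega> T L c1 c0 F G m0
  proof
    show "\<exists>\<rho>>0. \<exists>\<Lambda>>0. \<forall>y\<in>closure \<Omega>. dist y x < \<rho> \<longrightarrow> (\<exists>\<beta>. bridge (\<Lambda> * dist y x) y x \<beta>)"
      if "x \<in> closure \<Omega>" for x
      unfolding bridge_def by (rule C2_boundary_bridge[OF \<Omega>_open \<Omega>_C2 that])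
  qed (use F_cont G_cont m0 in auto)
  show ?thesis by (rule equilibrium_exists)
qed

end
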